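(* There exists $\varepsilon>0$ such that for every pair of coprime positive integers $p,q$ with $\frac{p}{q}\in\left(\frac12,\frac{\sqrt2}{2}\right)$ and $\frac{\sqrt2}{2}-\frac pq<\varepsilon$, the minimal torus $\widetilde O_{p/q}$ in $\mathbb S^4$ (the bipolar surface to the Otsuki torus $O_{p/q}$) satisfies $$6q+8p-3\le \operatorname{Ind}\widetilde O_{p/q}\le 10q+4p-5\quad\text{if $q$ is odd},$$ $$3q+4p-3\le \operatorname{Ind}\widetilde O_{p/q}\le 5q+2p-5\quad\text{if $q$ is even},$$ and in both cases $$9\le \operatorname{Nul}\widetilde O_{p/q}\le 13 .$$
   Context: **The surfaces.** For $b\in(-\frac\pi2,0)$ put $t(\phi)=\int_b^\phi \frac{2\pi\cos^3\psi\,d\psi}{\sqrt{\cos^4\psi-\cos^4 b}}$ for $\phi\in[b,-b]$ (increasing, integrable singularities), $T=t(-b)$. Let $\phi(t)$ on $[0,T]$ be the inverse function of $t(\phi)$, extended to a smooth function on $\mathbb R$ by $\phi(t+T)=-\phi(t)$. It satisfies $\phi(0)=b$, $\dot\phi(0)=0$, $\phi(T-t)=-\phi(t)$, $\dot\phi^2=\frac{\cos^4\phi-\cos^4b}{4\pi^2\cos^6\phi}$. Let $\theta(t)$ be defined by $\dot\theta=\frac{\cos^2b}{2\pi\cos^4\phi(t)}$, $\theta(0)=0$. The map $$u_b(\alpha,t)=(\cos\alpha\cos\phi\sin\theta,\ \sin\alpha\cos\phi\sin\theta,\ \cos\alpha\cos\phi\cos\theta,\ \sin\alpha\cos\phi\cos\theta,\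 \sin\phi)\in\mathbb R^5$$ is a minimal immersion of $(\mathbb R/2\pi\mathbb Z)\times\mathbb R$ into the unit sphere $\mathbb S^4$. Put $\Xi(b)=\int_b^{-b}\frac{\cos^2b\,d\phi}{\cos\phi\sqrt{\cos^4\phi-\cos^4b}}$. For each rational $p/q\in(1/2,\sqrt2/2)$ with $\gcd(p,q)=1$ there is a (unique) $b$ with $\Xi(b)=(p/q)\pi$; then $u_b$ is periodic in $t$ with period $t_0=2qT$. Fix this $b$. Let $\widehat O_{p/q}$ be the torus $(\mathbb R/2\pi\mathbb Z)\times(\mathbb R/t_0\mathbb Z)$ immersed in $\mathbb S^4$ by $u_b$, with the induced metric. If $q$ is even, $u_b$ is invariant under the translation $(\alpha,t)\mapsto(\alpha+\pi,t+\frac{t_0}2)$. The surface $\widetilde O_{p/q}$ (the image of $u_b$) is $\widehat O_{p/q}$ itself if $q$ is odd, and the quotient torus of $\widehat O_{p/q}$ by this translation, immersed in $\mathbb S^4$ by the induced map, if $q$ is even. **Index and nullity.** For an oriented minimal surface $\Sigma$ in $\mathbb S^4$ with normal bundle $N\Sigma$ (in $\mathbb S^4$), normal connection $\nabla^\bot$, tangential connection $\nabla^\top$, second fundamental form $B(X,Y)=(\nabla_XY)^\bot$ and a local orthonormal tangent frame $e_1,e_2$, put $b_{ij}=B(e_i,e_j)$ and define, for sections $X$ of $N\Sigma$, $$\Delta^\bot X=\sum_{i=1}^2\left(\nabla^\bot_{\nabla^\top_{e_i}e_i}X-\nabla^\bot_{e_i}\nabla^\bot_{e_i}X\right),\quad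 \mathcal B(X)=\sum_{i,j=1}^2\langle b_{ij},X\rangle b_{ij},\quad L=\Delta^\bot-2-\mathcal B .$$ For closed $\Sigma$, $L$ has discrete spectrum bounded below; $\operatorname{Ind}\Sigma$ and $\operatorname{Nul}\Sigma$ are the numbers of negative and zero eigenvalues of $L$ respectively, counted with multiplicity. *)

theory Defs
  imports "HOL-Analysis.Analysis" "HOL-Library.Function_Algebras" "HOL-Library.Extended_Nat"
begin

section \<open>Dimension of spaces of vector-valued functions\<close>

instantiation "fun" :: (type, real_vector) real_vector
begin

definition scaleR_fun :: "real \<Rightarrow> ('a \<Rightarrow> 'b) \<Rightarrow> 'a \<Rightarrow> 'b"
  where "scaleR_fun c f = (\<lambda>x. c *\<^sub>R f x)"

instance
  by standard (simp_all add: scaleR_fun_def plus_fun_def fun_eq_iff algebra_simps)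

end

text \<open>Unlike \<^const>\<open>dim\<close>, which is \<open>0\<close> on infinite-dimensional spaces, this takes the value
  \<open>\<infinity>\<close> there.\<close>

definition edim :: "'a::real_vector set \<Rightarrow> enat"
  where "edim V = (SUP S\<in>{S. finite S \<and> S \<subseteq> V \<and> independent S}. enat (card S))"

text \<open>\<open>Ck k f\<close>: \<open>f\<close> is of class \<open>C\<^sup>k\<close> on the whole (finite-dimensional) space.\<close>

primrec Ck :: "nat \<Rightarrow> ('a::real_normed_vector \<Rightarrow> 'b::real_normed_vector) \<Rightarrow> bool" where
  "Ck 0 f \<longleftrightarrow> continuous_on UNIV f"
| "Ck (Suc k) f \<longleftrightarrow> (\<forall>x. f differentiable (at x)) \<and>
     (\<forall>v. Ck k (\<lambda>x. frechet_derivative f (at x) v))"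

definition smooth :: "('a::real_normed_vector \<Rightarrow> 'b::real_normed_vector) \<Rightarrow> bool"
  where "smooth f \<longleftrightarrow> (\<forall>k. Ck k f)"

section \<open>The Jacobi operator of an immersed surface in the unit 4-sphere\<close>

text \<open>A closed immersed surface in \<open>\<S>\<^sup>4 \<subset> \<real>\<^sup>5\<close>, where the surface is a quotient of the
  plane by a lattice of translations, is given by its lift \<open>u\<close> to the plane. Tangent vector
  fields of the surface are represented by their components, as maps from the plane to itself,
  and sections of the normal bundle by maps from the plane to \<open>\<real>\<^sup>5\<close>.\<close>

type_synonym plane = "real \<times> real"
type_synonym R5 = "real ^ 5"

definition deriv_along :: "(plane \<Rightarrow> plane) \<Rightarrow> (plane \<Rightarrow> R5) \<Rightarrow> plane \<Rightarrow> R5"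
  where "deriv_along v X z = frechet_derivative X (at z) (v z)"

text \<open>The orthonormal tangent frame \<open>e\<^sub>1, e\<^sub>2\<close> (indices 1 and 2) obtained from the coordinate
  frame by the Gram--Schmidt process with respect to the induced metric.\<close>

definition tangent_frame :: "(plane \<Rightarrow> R5) \<Rightarrow> nat \<Rightarrow> plane \<Rightarrow> plane"
  where "tangent_frame u i z =
    (let u1 = frechet_derivative u (at z) (1, 0);
         u2 = frechet_derivative u (at z) (0, 1);
         c = (u2 \<bullet> u1) / (u1 \<bullet> u1)
     in if i = 1 then (1 / norm u1) *\<^sub>R (1, 0)
        else (1 / norm (u2 - c *\<^sub>R u1)) *\<^sub>R (- c, 1))"

definition pushed_frame :: "(plane \<Rightarrow> R5) \<Rightarrow> nat \<Rightarrow> plane \<Rightarrow> R5"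
  where "pushed_frame u i = deriv_along (tangent_frame u i) u"

lemma pushed_frame_orthonormal:
  assumes "u differentiable (at z)" and inj: "inj (frechet_derivative u (at z))"
    and "i \<in> {1, 2}" and "j \<in> {1, 2}"
  shows "pushed_frame u i z \<bullet> pushed_frame u j z = (if i = j then 1 else 0)"
proof -
  define D where "D = frechet_derivative u (at z)"
  define c where "c = (D (0, 1) \<bullet> D (1, 0)) / (D (1, 0) \<bullet> D (1, 0))"
  define w where "w = D (0, 1) - c *\<^sub>R D (1, 0)"
  have lin: "linear D"
    unfolding D_def using assms(1) by (rule linear_frechet_derivative)
  have D0: "D v = 0 \<longleftrightarrow> v = 0" for v
    using inj lin linear_0[OF lin] unfolding D_def[symmetric] by (metis injD)
  have "D (1, 0) \<noteq> 0" by (simp add: D0 zero_prod_def)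
  have "w = D (- c, 1)"
    using linear_diff[OF lin, of "(0, 1)" "c *\<^sub>R (1, 0)"] linear_scale[OF lin, of c "(1, 0)"]
    by (simp add: w_def)
  then have "w \<noteq> 0" by (simp add: D0 zero_prod_def)
  have orth: "D (1, 0) \<bullet> w = 0"
    using \<open>D (1, 0) \<noteq> 0\<close> by (simp add: w_def c_def inner_diff_right inner_commute)
  have f1: "pushed_frame u 1 z = (1 / norm (D (1, 0))) *\<^sub>R D (1, 0)"
    unfolding pushed_frame_def deriv_along_def tangent_frame_def Let_def D_def[symmetric]
      if_P[OF refl] by (rule linear_scale[OF lin])
  have "pushed_frame u 2 z = (1 / norm w) *\<^sub>R D (- c, 1)"
    unfolding pushed_frame_def deriv_along_def tangent_frame_def Let_def D_def[symmetric]
      c_def[symmetric] w_def[symmetric]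
    by (subst if_not_P) (simp, rule linear_scale[OF lin])
  then have f2: "pushed_frame u 2 z = (1 / norm w) *\<^sub>R w"
    using \<open>w = D (- c, 1)\<close> by metis
  have sq: "v \<noteq> 0 \<Longrightarrow> ((1 / norm v) *\<^sub>R v) \<bullet> ((1 / norm v) *\<^sub>R v) = 1" for v :: R5
    by (simp add: dot_square_norm power2_eq_square)
  have orth': "w \<bullet> D (1, 0) = 0"
    using orth by (simp only: inner_commute)
  consider "i = 1" "j = 1" | "i = 1" "j = 2" | "i = 2" "j = 1" | "i = 2" "j = 2"
    using assms(3,4) by blast
  then show ?thesis
  proof cases
    case 1
    then show ?thesis using sq[OF \<open>D (1, 0) \<noteq> 0\<close>] f1 by (simp only: refl if_True)
  next
    case 2
    then show ?thesis using orth orth' f1 f2 by simp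
  next
    case 3
    then show ?thesis using orth orth' f1 f2 by simp
  next
    case 4
    then show ?thesis using sq[OF \<open>w \<noteq> 0\<close>] f2 by (simp only: refl if_True)
  qed
qed

definition normal_part :: "(plane \<Rightarrow> R5) \<Rightarrow> plane \<Rightarrow> R5 \<Rightarrow> R5"
  where "normal_part u z w = w - (w \<bullet> u z) *\<^sub>R u z
     - (\<Sum>k\<in>{1, 2}. (w \<bullet> pushed_frame u k z) *\<^sub>R pushed_frame u k z)"

definition nabla_tangent :: "(plane \<Rightarrow> R5) \<Rightarrow> (plane \<Rightarrow> plane) \<Rightarrow> (plane \<Rightarrow> plane) \<Rightarrow> plane \<Rightarrow> plane"
  where "nabla_tangent u v w z =
    (\<Sum>k\<in>{1, 2}. (deriv_along v (deriv_along w u) z \<bullet> pushed_frame u k z) *\<^sub>R tangent_frame u k z)"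

definition nabla_normal :: "(plane \<Rightarrow> R5) \<Rightarrow> (plane \<Rightarrow> plane) \<Rightarrow> (plane \<Rightarrow> R5) \<Rightarrow> plane \<Rightarrow> R5"
  where "nabla_normal u v X z = normal_part u z (deriv_along v X z)"

definition second_ff :: "(plane \<Rightarrow> R5) \<Rightarrow> (plane \<Rightarrow> plane) \<Rightarrow> (plane \<Rightarrow> plane) \<Rightarrow> plane \<Rightarrow> R5"
  where "second_ff u v w z = normal_part u z (deriv_along v (deriv_along w u) z)"

definition normal_laplacian :: "(plane \<Rightarrow> R5) \<Rightarrow> (plane \<Rightarrow> R5) \<Rightarrow> plane \<Rightarrow> R5"
  where "normal_laplacian u X z =
    (\<Sum>i\<in>{1, 2}. let e = tangent_frame u i in
       nabla_normal u (nabla_tangent u e e) X z - nabla_normal u e (nabla_normal u e X) z)"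

definition simons_op :: "(plane \<Rightarrow> R5) \<Rightarrow> (plane \<Rightarrow> R5) \<Rightarrow> plane \<Rightarrow> R5"
  where "simons_op u X z =
    (\<Sum>i\<in>{1, 2}. \<Sum>j\<in>{1, 2}. let b = second_ff u (tangent_frame u i) (tangent_frame u j) z
       in (b \<bullet> X z) *\<^sub>R b)"

definition jacobi_op :: "(plane \<Rightarrow> R5) \<Rightarrow> (plane \<Rightarrow> R5) \<Rightarrow> plane \<Rightarrow> R5"
  where "jacobi_op u X z = normal_laplacian u X z - 2 *\<^sub>R X z - simons_op u X z"

section \<open>Index and nullity\<close>

text \<open>Here \<open>G\<close> is a set of translation vectors generating the lattice. A section over the quotient
  surface is a section over the plane that is invariant under these translations.\<close>

definition normal_section :: "(plane \<Rightarrow> R5) \<Rightarrow> plane set \<Rightarrow> (plane \<Rightarrow> R5) \<Rightarrow> bool"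
  where "normal_section u G X \<longleftrightarrow> smooth X
     \<and> (\<forall>z. X z \<bullet> u z = 0)
     \<and> (\<forall>z v. X z \<bullet> frechet_derivative u (at z) v = 0)
     \<and> (\<forall>z. \<forall>g\<in>G. X (z + g) = X z)"

definition jacobi_eigenspace :: "(plane \<Rightarrow> R5) \<Rightarrow> plane set \<Rightarrow> real \<Rightarrow> (plane \<Rightarrow> R5) set"
  where "jacobi_eigenspace u G l =
    {X. normal_section u G X \<and> (\<forall>z. jacobi_op u X z = l *\<^sub>R X z)}"

text \<open>The number of eigenvalues in \<open>A\<close> counted with multiplicity: the sum of the multiplicities
  over all of \<open>A\<close>, as the supremum of its finite partial sums (a non-eigenvalue contributes 0).\<close>

definition eigenvalue_count :: "(plane \<Rightarrow> R5) \<Rightarrow> plane set \<Rightarrow> real set \<Rightarrow> enat"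
  where "eigenvalue_count u G A =
    (SUP F\<in>{F. finite F \<and> F \<subseteq> A}. \<Sum>l\<in>F. edim (jacobi_eigenspace u G l))"

definition surface_index :: "(plane \<Rightarrow> R5) \<Rightarrow> plane set \<Rightarrow> enat"
  where "surface_index u G = eigenvalue_count u G {..<0}"

definition surface_nullity :: "(plane \<Rightarrow> R5) \<Rightarrow> plane set \<Rightarrow> enat"
  where "surface_nullity u G = eigenvalue_count u G {0}"

section \<open>The bipolar surfaces to the Otsuki tori\<close>

text \<open>Gauge integrals: the singularities of the integrands at \<open>b\<close> and \<open>-b\<close> are integrable.\<close>

definition time_of :: "real \<Rightarrow> real \<Rightarrow> real"
  where "time_of b x = integral {b..x} (\<lambda>s. 2 * pi * cos s ^ 3 / sqrt (cos s ^ 4 - cos b ^ 4))"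

definition half_period :: "real \<Rightarrow> real"
  where "half_period b = time_of b (- b)"

text \<open>With \<open>n = \<lfloor>t / T\<rfloor>\<close>, the point \<open>t - n T\<close> lies in \<open>[0, T)\<close>; the sign realizes
  \<open>\<phi>(t + T) = - \<phi>(t)\<close>.\<close>

definition phi :: "real \<Rightarrow> real \<Rightarrow> real"
  where "phi b t = (let T = half_period b; n = \<lfloor>t / T\<rfloor>
     in (if even n then 1 else - 1) * inv_into {b..- b} (time_of b) (t - of_int n * T))"

definition theta :: "real \<Rightarrow> real \<Rightarrow> real"
  where "theta b = (THE f. f 0 = 0 \<and>
     (\<forall>t. (f has_real_derivative cos b ^ 2 / (2 * pi * cos (phi b t) ^ 4)) (at t)))"

definition otsuki_bipolar :: "real \<Rightarrow> plane \<Rightarrow> R5"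
  where "otsuki_bipolar b = (\<lambda>(a, t). vector
     [cos a * cos (phi b t) * sin (theta b t), sin a * cos (phi b t) * sin (theta b t),
      cos a * cos (phi b t) * cos (theta b t), sin a * cos (phi b t) * cos (theta b t),
      sin (phi b t)])"

definition Xi :: "real \<Rightarrow> real"
  where "Xi b = integral {b..- b} (\<lambda>s. cos b ^ 2 / (cos s * sqrt (cos s ^ 4 - cos b ^ 4)))"

text \<open>The period in the second variable is \<open>t\<^sub>0 = 2 q T\<close>; for even \<open>q\<close> there is the additional
  translation by \<open>(\<pi>, t\<^sub>0 / 2)\<close>.\<close>

definition otsuki_translations :: "nat \<Rightarrow> real \<Rightarrow> plane set"
  where "otsuki_translations q b =
    (let t0 = 2 * real q * half_period b
     in {(2 * pi, 0), (0, t0)} \<union> (if even q then {(pi, t0 / 2)} else {}))"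

end

theory Submission
  imports Defs "HOL-Complex_Analysis.Great_Picard"
begin

text \<open>In a frame adapted to the rotational symmetry, a Jacobi field decomposes into Fourier modes in
  \<open>\<alpha>\<close>, and the mode of frequency \<open>l\<close> satisfies a linear Sturm--Liouville system of two equations in the
  profile variable. As \<open>p / q\<close> tends to \<open>\<surd>2 / 2\<close> the amplitude of the profile tends to zero, so the system
  becomes close to a decoupled one with constant coefficients \<open>l\<^sup>2 - 4\<close> and \<open>l\<^sup>2 - 2\<close>. Hence \<open>l \<ge> 3\<close>
  contributes nothing to index and nullity, and for \<open>l = 2\<close> the operator factors through an explicit
  null solution, so it is nonnegative. For \<open>l \<le> 1\<close> the number of negative eigenvalues is asymptotic to a
  multiple of \<open>q\<close>, with a constant strictly between those of the two bounds: it is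
  bounded below by trial functions and above by Wirtinger's inequality on equispaced nodes. Since
  \<open>p / q\<close> is close to an irrational number, \<open>q\<close> is large and absorbs the rounding errors. The nullity is
  bounded below by explicit solutions coming from ambient rotations, and above by the
  dimension of the space of Cauchy data, reduced for \<open>l = 0\<close> by a nonperiodic explicit solution.\<close>

text \<open>At amplitude zero \<open>DD\<close> is sqrt 2, and the equations for null solutions
  become 2 X'' = (l^2 - 4) X and 2 Y'' = (l^2 - 2) Y over a length of pi times \<open>nn\<close>. An
  operator - 2 X'' - c X has about \<open>nn\<close> sqrt (c / 2) negative modes, and each positive
  l occurs with two phases. The total is about (1 + 2 sqrt 2 + sqrt 6) \<open>nn\<close>, that is
  6.278 \<open>nn\<close>, while the two bounds are near 5.828 \<open>nn\<close> and 6.414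
  \<open>nn\<close>; the numerical constants live in these gaps. For l = 2 the limiting X-equation
  has a constant null solution, so no perturbation estimate decides its sign, and an exact
  factorisation is used. The nine explicit null solutions are the normal parts of the
  ten-dimensional algebra of rotations of R^5, in which only the rotation in \<alpha> is tangential.
  Index and nullity count eigensections directly. A lower bound must therefore produce
  eigenfunctions, which is done by minimising the form in one variable; an upper bound needs
  finitely many linear functionals whose common kernel contains no nonzero sum of
  eigensections.\<close>

lemma common_kernel_vector:
  fixes g :: "'i \<Rightarrow> nat \<Rightarrow> real"
  assumes "finite I" and "card I > N"
  shows "\<exists>c. (\<exists>i\<in>I. c i \<noteq> 0) \<and> (\<forall>j<N. (\<Sum>i\<in>I. c i * g i j) = 0)"
  using assms
proof (induction N arbitrary: I g)
  case 0
  then show ?case by (intro exI[of _ "\<lambda>_. 1"]) (auto simp: card_gt_0_iff)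
next
  case (Suc N)
  show ?case
  proof (cases "\<forall>i\<in>I. g i N = 0")
    case True
    obtain c where "\<exists>i\<in>I. c i \<noteq> 0" "\<forall>j<N. (\<Sum>i\<in>I. c i * g i j) = 0"
      using Suc.IH[of I g] Suc.prems by auto
    with True show ?thesis by (intro exI[of _ c]) (auto simp: less_Suc_eq)
  next
    case False
    then obtain i0 where i0: "i0 \<in> I" "g i0 N \<noteq> 0" by auto
    define J where "J = I - {i0}"
    \<comment> \<open>Gaussian elimination with pivot row \<open>i0\<close>: the rows
      \<open>h i\<close> vanish in column \<open>N\<close>, so a relation among them in the first
      \<open>N\<close> columns extends to that column.\<close>
    define h where "h i j = g i j - g i N / g i0 N * g i0 j" for i j
    have J: "finite J" "card J > N" "i0 \<notin> J" "I = insert i0 J"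
      using Suc.prems i0 by (auto simp: J_def)
    obtain c where c: "\<exists>i\<in>J. c i \<noteq> 0" "\<And>j. j < N \<Longrightarrow> (\<Sum>i\<in>J. c i * h i j) = 0"
      using Suc.IH[of J h] J by auto
    \<comment> \<open>The coefficient of the pivot row is forced by column \<open>N\<close>; with it
      the combination of the rows \<open>g\<close> agrees with that of the rows \<open>h\<close> in
      every column.\<close>
    define d where "d = c(i0 := - (\<Sum>i\<in>J. c i * g i N) / g i0 N)"
    have split: "(\<Sum>i\<in>I. d i * g i j) = (\<Sum>i\<in>J. c i * h i j)" for j
    proof -
      have "(\<Sum>i\<in>I. d i * g i j) = d i0 * g i0 j + (\<Sum>i\<in>J. d i * g i j)"
        using J by simp
      also have "(\<Sum>i\<in>J. d i * g i j) = (\<Sum>i\<in>J. c i * g i j)"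
        using J by (intro sum.cong) (auto simp: d_def)
      also have "d i0 * g i0 j = (\<Sum>i\<in>J. - (c i * (g i N / g i0 N * g i0 j)))"
        by (simp add: d_def sum_negf sum_distrib_right sum_divide_distrib flip: times_divide_eq_left)
           (simp add: mult.assoc)
      finally show ?thesis
        by (simp add: h_def right_diff_distrib sum_subtractf sum_negf)
    qed
    have "(\<Sum>i\<in>J. c i * h i N) = 0" using i0 by (simp add: h_def)
    with c split have "\<forall>j<Suc N. (\<Sum>i\<in>I. d i * g i j) = 0" by (auto simp: less_Suc_eq)
    moreover have "\<exists>i\<in>I. d i \<noteq> 0" using c(1) J by (auto simp: d_def)
    ultimately show ?thesis by blast
  qed
qed

lemma ex_antiderivative:
  fixes f :: "real \<Rightarrow> 'a::euclidean_space"
  assumes "continuous_on UNIV f"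
  obtains F where "\<And>x. (F has_vector_derivative f x) (at x)"
proof -
  \<comment> \<open>The base point must lie to the left of both \<open>x\<close> and 0, since
    integrals over reversed intervals are 0. Subtracting the integral up to 0 makes the value
    independent of the base point.\<close>
  define F where "F x = integral {-\<bar>x\<bar>-1..x} f - integral {-\<bar>x\<bar>-1..0} f" for x
  have cont: "continuous_on A f" for A
    using assms continuous_on_subset by blast
  have int: "f integrable_on {p..r}" for p r
    using cont by (rule integrable_continuous_interval)
  have F: "F x = integral {m..x} f - integral {m..0} f" if "m \<le> x" "m \<le> 0" for m x
  proof -
    define n where "n = min m (-\<bar>x\<bar>-1)"
    have *: "integral {k..x} f - integral {k..0} f = integral {n..x} f - integral {n..0} f"
      if "n \<le> k" "k \<le> x" "k \<le> 0" for k
      using Henstock_Kurzweil_Integration.integral_combine[of n k x f]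
        Henstock_Kurzweil_Integration.integral_combine[of n k 0 f] that int
      by (metis (no_types, lifting) add_diff_cancel_left)
    show ?thesis
      unfolding F_def using *[of m] *[of "-\<bar>x\<bar>-1"] that by (auto simp: n_def)
  qed
  have "(F has_vector_derivative f x) (at x)" for x
  proof -
    define m where "m = -\<bar>x\<bar> - 1"
    have "((\<lambda>u. integral {m..u} f) has_vector_derivative f x) (at x within {m..x+1})"
      by (rule integral_has_vector_derivative[OF cont]) (auto simp: m_def)
    then have "((\<lambda>u. integral {m..u} f - integral {m..0} f) has_vector_derivative f x) (at x within {m..x+1})"
      by (auto intro!: derivative_eq_intros)
    then have "((\<lambda>u. integral {m..u} f - integral {m..0} f) has_vector_derivative f x) (at x)"
      using at_within_interior[of x "{m..x+1}"] by (simp add: m_def)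
    moreover have "eventually (\<lambda>u. u \<in> {m<..}) (nhds x)"
      by (intro eventually_nhds_in_open) (auto simp: m_def)
    then have "eventually (\<lambda>u. integral {m..u} f - integral {m..0} f = F u) (nhds x)"
      by eventually_elim (rule F[symmetric], auto simp: m_def)
    ultimately show ?thesis
      by (subst (asm) has_vector_derivative_cong_ev[where g = F])
         (auto dest: eventually_nhds_x_imp_x elim!: eventually_mono)
  qed
  then show ?thesis using that by blast
qed

section \<open>Smooth maps\<close>

lemma Ck_SucI:
  assumes "\<And>x. (f has_derivative f' x) (at x)" and "\<And>v. Ck k (\<lambda>x. f' x v)"
  shows "Ck (Suc k) f"
  using assms frechet_derivative_at[OF assms(1)] unfolding Ck.simps
  by (auto simp: differentiable_def)

lemma Ck_SucD:
  assumes "Ck (Suc k) f"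
  shows "(f has_derivative frechet_derivative f (at x)) (at x)"
    and "Ck k (\<lambda>x. frechet_derivative f (at x) v)"
  using assms by (auto simp: frechet_derivative_works)

lemma Ck_continuous: "Ck k f \<Longrightarrow> continuous_on UNIV f"
  by (cases k) (auto intro!: differentiable_imp_continuous_on
      simp: differentiable_on_def differentiable_at_withinI)

lemma Ck_pred: "Ck (Suc k) f \<Longrightarrow> Ck k f"
proof (induction k arbitrary: f)
  case 0
  then show ?case using Ck_continuous[OF 0] by (simp only: Ck.simps(1))
next
  case (Suc k)
  show ?case
    by (rule Ck_SucI[OF Ck_SucD(1)[OF Suc.prems]]) (rule Suc.IH[OF Ck_SucD(2)[OF Suc.prems]])
qed

lemma Ck_const [simp]: "Ck k (\<lambda>_. c)"
proof (induction k arbitrary: c)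
  case (Suc k)
  then show ?case by (intro Ck_SucI[where f' = "\<lambda>_ _. 0"]) auto
qed auto

lemma Ck_bounded_linear:
  assumes "bounded_linear h" and "Ck k f"
  shows "Ck k (\<lambda>x. h (f x))"
  using assms(2)
proof (induction k arbitrary: f)
  case 0
  then show ?case
    using assms(1) by (auto intro: bounded_linear.continuous_on)
next
  case (Suc k)
  show ?case
    by (rule Ck_SucI[OF bounded_linear.has_derivative[OF assms(1) Ck_SucD(1)[OF Suc.prems]]])
       (auto intro!: Suc.IH Ck_SucD(2)[OF Suc.prems])
qed

lemma Ck_add: "Ck k f \<Longrightarrow> Ck k g \<Longrightarrow> Ck k (\<lambda>x. f x + g x)"
proof (induction k arbitrary: f g)
  case 0
  then show ?case by (auto intro: continuous_intros)
next
  case (Suc k)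
  show ?case
    by (rule Ck_SucI[OF has_derivative_add[OF Ck_SucD(1)[OF Suc.prems(1)] Ck_SucD(1)[OF Suc.prems(2)]]])
       (auto intro!: Suc.IH Ck_SucD(2)[OF Suc.prems(1)] Ck_SucD(2)[OF Suc.prems(2)])
qed

lemma Ck_bilinear:
  assumes "bounded_bilinear h"
  shows "Ck k f \<Longrightarrow> Ck k g \<Longrightarrow> Ck k (\<lambda>x. h (f x) (g x))"
proof (induction k arbitrary: f g)
  case 0
  then show ?case using assms by (auto intro: bounded_bilinear.continuous_on)
next
  case (Suc k)
  show ?case
    by (rule Ck_SucI[OF bounded_bilinear.FDERIV[OF assms Ck_SucD(1)[OF Suc.prems(1)] Ck_SucD(1)[OF Suc.prems(2)]]])
       (intro Ck_add Suc.IH Ck_SucD(2)[OF Suc.prems(1)] Ck_SucD(2)[OF Suc.prems(2)]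
         Ck_pred[OF Suc.prems(1)] Ck_pred[OF Suc.prems(2)])
qed

lemma Ck_linear: "bounded_linear h \<Longrightarrow> Ck k h"
  by (cases k) (auto intro!: Ck_SucI[where f' = "\<lambda>_. h"] bounded_linear_imp_has_derivative
      linear_continuous_on simp del: Ck.simps(2))

lemma Ck_Suc_real:
  fixes f :: "real \<Rightarrow> 'a::real_normed_vector"
  assumes "\<And>x. (f has_vector_derivative f' x) (at x)" and "Ck k f'"
  shows "Ck (Suc k) f"
  by (rule Ck_SucI[OF assms(1)[unfolded has_vector_derivative_def]])
     (auto intro: Ck_bounded_linear assms(2) bounded_linear_scaleR_right)

text \<open>Restricting the outer function to one real variable reduces the chain rule to a scalar
  factor times \<open>f'\<close>, so bilinearity and the induction hypothesis suffice.\<close>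

lemma Ck_compose:
  fixes f :: "real \<Rightarrow> 'b::real_normed_vector" and g :: "'a::real_normed_vector \<Rightarrow> real"
  shows "Ck k f \<Longrightarrow> Ck k g \<Longrightarrow> Ck k (\<lambda>x. f (g x))"
proof (induction k arbitrary: f g)
  case 0
  then show ?case by (auto intro: continuous_on_compose2)
next
  case (Suc k)
  define f' where "f' x = frechet_derivative f (at x) 1" for x
  have f': "Ck k f'" unfolding f'_def using Ck_SucD(2)[OF Suc.prems(1)] .
  have "(f has_derivative (\<lambda>h. h *\<^sub>R f' x)) (at x)" for x
  proof -
    have d: "(f has_derivative frechet_derivative f (at x)) (at x)"
      by (rule Ck_SucD(1)[OF Suc.prems(1)])
    have "frechet_derivative f (at x) = (\<lambda>h. h *\<^sub>R f' x)"
    proof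
      fix h :: real
      show "frechet_derivative f (at x) h = h *\<^sub>R f' x"
        using linear_scale[OF has_derivative_linear[OF d], of h 1] by (simp add: f'_def)
    qed
    with d show ?thesis by simp
  qed
  from has_derivative_compose[OF Ck_SucD(1)[OF Suc.prems(2)] this]
  have "((\<lambda>x. f (g x)) has_derivative (\<lambda>h. frechet_derivative g (at x) h *\<^sub>R f' (g x))) (at x)" for x .
  then show ?case
    by (rule Ck_SucI)
       (intro Ck_bilinear[OF bounded_bilinear_scaleR] Suc.IH Ck_pred[OF Suc.prems(2)] f' Ck_SucD(2)[OF Suc.prems(2)])
qed

text \<open>The derivative is again a product of \<open>inverse f\<close> with derivatives of
  \<open>f\<close>, so the induction closes; \<open>Ck_sqrt\<close> works in the same way.\<close>

lemma Ck_inverse: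
  fixes f :: "'a::real_normed_vector \<Rightarrow> real"
  assumes "\<And>x. f x \<noteq> 0"
  shows "Ck k f \<Longrightarrow> Ck k (\<lambda>x. inverse (f x))"
proof (induction k)
  case 0
  then show ?case using assms by (auto intro: continuous_intros)
next
  case (Suc k)
  note [intro!] = Ck_bilinear[OF bounded_bilinear_mult]
  show ?case
    by (rule Ck_SucI[OF Deriv.has_derivative_inverse[OF assms Ck_SucD(1)[OF Suc.prems]]])
       (auto intro!: Ck_bounded_linear[OF bounded_linear_minus[OF bounded_linear_ident]]
         Suc.IH Ck_pred[OF Suc.prems] Ck_SucD(2)[OF Suc.prems])
qed

lemma Ck_sqrt:
  fixes f :: "'a::real_normed_vector \<Rightarrow> real"
  assumes "\<And>x. f x > 0"
  shows "Ck k f \<Longrightarrow> Ck k (\<lambda>x. sqrt (f x))"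
proof (induction k)
  case 0
  then show ?case by (auto intro: continuous_intros)
next
  case (Suc k)
  have "((\<lambda>x. sqrt (f x)) has_derivative
      (\<lambda>v. frechet_derivative f (at x) v * (inverse (sqrt (f x)) * (1/2)))) (at x)" for x
    using assms[of x]
    by (auto intro!: derivative_eq_intros Ck_SucD(1)[OF Suc.prems] simp: divide_simps)
  then show ?case
    by (rule Ck_SucI)
       (intro Ck_bilinear[OF bounded_bilinear_mult] Ck_inverse Suc.IH Ck_pred[OF Suc.prems]
         Ck_SucD(2)[OF Suc.prems] Ck_const, use assms in \<open>simp add: less_imp_neq[symmetric]\<close>)
qed

lemma smooth_Ck: "smooth f \<Longrightarrow> Ck k f"
  by (simp add: smooth_def)

lemma smooth_const [simp]: "smooth (\<lambda>_. c)"
  by (simp add: smooth_def)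

lemma smooth_linear: "bounded_linear h \<Longrightarrow> smooth h"
  by (simp add: smooth_def Ck_linear)

lemma smooth_add: "smooth f \<Longrightarrow> smooth g \<Longrightarrow> smooth (\<lambda>x. f x + g x)"
  by (simp add: smooth_def Ck_add)

lemma smooth_bounded_linear: "bounded_linear h \<Longrightarrow> smooth f \<Longrightarrow> smooth (\<lambda>x. h (f x))"
  by (simp add: smooth_def Ck_bounded_linear)

lemma smooth_minus: "smooth f \<Longrightarrow> smooth (\<lambda>x. - f x)"
  by (intro smooth_bounded_linear[OF bounded_linear_minus[OF bounded_linear_ident]])

lemma smooth_diff: "smooth f \<Longrightarrow> smooth g \<Longrightarrow> smooth (\<lambda>x. f x - g x)"
  using smooth_add[of f "\<lambda>x. - g x"] smooth_minus[of g] by simp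

lemma smooth_scaleR: "smooth f \<Longrightarrow> smooth g \<Longrightarrow> smooth (\<lambda>x. f x *\<^sub>R g x)"
  by (simp add: smooth_def Ck_bilinear[OF bounded_bilinear_scaleR])

lemma smooth_mult: "smooth f \<Longrightarrow> smooth g \<Longrightarrow> smooth (\<lambda>x. f x * g x :: real)"
  by (simp add: smooth_def Ck_bilinear[OF bounded_bilinear_mult])

lemma smooth_inner: "smooth f \<Longrightarrow> smooth g \<Longrightarrow> smooth (\<lambda>x. f x \<bullet> g x)"
  by (simp add: smooth_def Ck_bilinear[OF bounded_bilinear_inner])

lemma smooth_power: "smooth f \<Longrightarrow> smooth (\<lambda>x. f x ^ n :: real)"
  by (induction n) (auto intro: smooth_mult)

lemma smooth_compose:
  fixes f :: "real \<Rightarrow> 'b::real_normed_vector"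
  shows "smooth f \<Longrightarrow> smooth g \<Longrightarrow> smooth (\<lambda>x. f (g x))"
  by (simp add: smooth_def Ck_compose)

lemma smooth_divide:
  fixes g :: "'a::real_normed_vector \<Rightarrow> real"
  shows "smooth f \<Longrightarrow> smooth g \<Longrightarrow> (\<And>x. g x \<noteq> 0) \<Longrightarrow> smooth (\<lambda>x. f x / g x)"
  unfolding divide_inverse by (intro smooth_mult) (auto simp: smooth_def Ck_inverse)

lemma smooth_sqrt:
  fixes f :: "'a::real_normed_vector \<Rightarrow> real"
  shows "smooth f \<Longrightarrow> (\<And>x. f x > 0) \<Longrightarrow> smooth (\<lambda>x. sqrt (f x))"
  by (simp add: smooth_def Ck_sqrt)

lemma smooth_real:
  fixes f :: "real \<Rightarrow> 'a::real_normed_vector"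
  assumes "\<And>x. (f has_vector_derivative f' x) (at x)" and "smooth f'"
  shows "smooth f"
  unfolding smooth_def
proof
  fix k
  have "Ck (Suc k) f" by (rule Ck_Suc_real[OF assms(1) smooth_Ck[OF assms(2)]])
  then show "Ck k f" by (rule Ck_pred)
qed

text \<open>Bootstrapping: if \<open>y\<close> is of class \<open>Ck k\<close>, so is its derivative
  \<open>G (y x)\<close>, which puts \<open>y\<close> in the next class. This gives the smoothness
  of the inverse function \<open>Psi\<close> below.\<close>

lemma smooth_ode:
  fixes y :: "real \<Rightarrow> real"
  assumes "\<And>x. (y has_vector_derivative G (y x)) (at x)" and "smooth G"
  shows "smooth y"
proof -
  have "Ck k y" for k
  proof (induction k)
    case 0
    have "continuous (at x) y" for x
      using assms(1) has_vector_derivative_continuous by blast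
    then show ?case by (simp add: continuous_at_imp_continuous_on)
  next
    case (Suc k)
    show ?case
      by (rule Ck_Suc_real[OF assms(1)]) (rule Ck_compose[OF smooth_Ck[OF assms(2)] Suc])
  qed
  then show ?thesis by (simp add: smooth_def)
qed

lemma smooth_sin_cos: "smooth (sin :: real \<Rightarrow> real)" "smooth (cos :: real \<Rightarrow> real)"
proof -
  have "Ck k (sin :: real \<Rightarrow> real) \<and> Ck k (cos :: real \<Rightarrow> real)" for k
  proof (induction k)
    case 0
    then show ?case by (auto intro: continuous_intros)
  next
    case (Suc k)
    have "Ck k (\<lambda>x. - sin x :: real)"
      using Suc by (intro Ck_bounded_linear[OF bounded_linear_minus[OF bounded_linear_ident]]) auto
    then show ?case
      using Suc
      by (auto intro!: Ck_Suc_real[of sin cos] Ck_Suc_real[of cos "\<lambda>x. - sin x"] derivative_eq_intros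
          simp flip: has_real_derivative_iff_has_vector_derivative simp del: Ck.simps)
  qed
  then show "smooth (sin :: real \<Rightarrow> real)" "smooth (cos :: real \<Rightarrow> real)"
    by (auto simp: smooth_def)
qed

lemma smooth_continuous: "smooth f \<Longrightarrow> continuous_on UNIV f"
  using Ck_continuous smooth_Ck by blast

lemma smooth_frechet_derivative:
  assumes "smooth f"
  shows "smooth (\<lambda>x. frechet_derivative f (at x) v)"
    and "(f has_derivative frechet_derivative f (at x)) (at x)"
proof -
  have S: "Ck (Suc k) f" for k using assms by (rule smooth_Ck)
  show "smooth (\<lambda>x. frechet_derivative f (at x) v)"
    unfolding smooth_def using Ck_SucD(2)[OF S] by blast
  show "(f has_derivative frechet_derivative f (at x)) (at x)"
    by (rule Ck_SucD(1)[OF S])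
qed

section \<open>Periodic functions and Fourier coefficients\<close>

text \<open>The increment of an antiderivative over one period has derivative zero, so it does not
  depend on the starting point.\<close>

lemma integral_period_shift:
  fixes f :: "real \<Rightarrow> 'a::euclidean_space"
  assumes "continuous_on UNIV f" and "\<And>x. f (x + P) = f x" and "P \<ge> 0"
  shows "integral {c..c+P} f = integral {0..P} f"
proof -
  obtain F where F: "\<And>x. (F has_vector_derivative f x) (at x)"
    using ex_antiderivative[OF assms(1)] by blast
  have int: "integral {u..u+P} f = F (u + P) - F u" for u
    using assms(3) F
    by (intro integral_unique fundamental_theorem_of_calculus) (auto intro: has_vector_derivative_at_within)
  have "((\<lambda>x. F (x + P) - F x) has_vector_derivative 0) (at x)" for x
  proof -
    have "((\<lambda>x. F (x + P)) has_vector_derivative f (x + P)) (at x)"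
      using vector_diff_chain_at[of "\<lambda>x. x + P" 1 x F "f (x + P)"] F[of "x + P"]
      by (simp add: o_def has_vector_derivative_add_const[of "\<lambda>x. x", simplified] has_vector_derivative_id)
    from has_vector_derivative_diff[OF this F[of x]] show ?thesis by (simp add: assms(2))
  qed
  then obtain k where "\<And>x. x \<in> UNIV \<Longrightarrow> F (x + P) - F x = k"
    by (rule has_vector_derivative_zero_constant[OF convex_UNIV]) blast
  from this[of c] this[of 0] int[of c] int[of 0] show ?thesis by simp
qed

text \<open>The product formulas turn one more factor 1 + cos (x - x0) into a combination of the
  frequencies k - 1, k and k + 1. Integer frequencies let the induction pass below zero.\<close>

lemma trigonometric_kernel_orthogonal:
  fixes f :: "real \<Rightarrow> real"
  defines "Z \<equiv> \<lambda>h. ((\<lambda>x. f x * h x) has_integral 0) {0..2*pi}"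
  assumes "\<And>k::int. Z (\<lambda>x. cos (k * x))" "\<And>k::int. Z (\<lambda>x. sin (k * x))"
  shows "Z (\<lambda>x. (1 + cos (x - x0)) ^ n * cos (of_int k * x)) \<and>
         Z (\<lambda>x. (1 + cos (x - x0)) ^ n * sin (of_int k * x))"
proof (induction n arbitrary: k)
  case 0
  then show ?case using assms(2,3) by simp
next
  case (Suc n)
  have lin: "Z (\<lambda>x. K x * (u1 x + a / 2 * (u2 x + u3 x) + b / 2 * (u4 x - u5 x)))"
    if "Z (\<lambda>x. K x * u1 x)" "Z (\<lambda>x. K x * u2 x)" "Z (\<lambda>x. K x * u3 x)" "Z (\<lambda>x. K x * u4 x)" "Z (\<lambda>x. K x * u5 x)"
    for K u1 u2 u3 u4 u5 :: "real \<Rightarrow> real" and a b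
  proof -
    have "((\<lambda>x. f x * (K x * u1 x) + (a / 2) * (f x * (K x * u2 x) + f x * (K x * u3 x)) +
       (b/2) * (f x * (K x * u4 x) - f x * (K x * u5 x))) has_integral
       0 + (a / 2) * (0 + 0) + (b / 2) * (0 - 0)) {0..2*pi}"
      using that unfolding Z_def by (intro has_integral_add has_integral_diff has_integral_mult_right)
    then show ?thesis
      unfolding Z_def by (simp add: algebra_simps add_divide_distrib diff_divide_distrib)
  qed
  define K where "K x = (1 + cos (x - x0)) ^ n" for x
  have "(1 + cos (x - x0)) ^ Suc n * cos (of_int k * x) = K x * (cos (of_int k * x)
      + cos x0 / 2 * (cos (of_int (k + 1) * x) + cos (of_int (k - 1) * x))
      + sin x0 / 2 * (sin (of_int (k + 1) * x) - sin (of_int (k - 1) * x)))" for x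
    by (simp add: K_def distrib_right left_diff_distrib cos_add cos_diff sin_add sin_diff) (simp add: algebra_simps)
  moreover have "(1 + cos (x - x0)) ^ Suc n * sin (of_int k * x) = K x * (sin (of_int k * x)
      + cos x0 / 2 * (sin (of_int (k + 1) * x) + sin (of_int (k - 1) * x))
      + sin x0 / 2 * (cos (of_int (k - 1) * x) - cos (of_int (k + 1) * x)))" for x
    by (simp add: K_def distrib_right left_diff_distrib cos_add cos_diff sin_add sin_diff) (simp add: algebra_simps)
  ultimately show ?case
    using lin Suc unfolding K_def by presburger
qed

text \<open>If \<open>f\<close> were positive at \<open>x0\<close>, its integrals against high
  powers of (1 + cos (x - x0)) / 2, which concentrate at \<open>x0\<close>, would be positive; by
  orthogonality they all vanish.\<close>

lemma fourier_coefficients_zero_imp_nonpos: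
  fixes f :: "real \<Rightarrow> real"
  assumes cont: "continuous_on UNIV f" and per: "\<And>x. f (x + 2 * pi) = f x"
    and c: "\<And>l::nat. integral {0..2*pi} (\<lambda>x. f x * cos (l * x)) = 0"
    and s: "\<And>l::nat. integral {0..2*pi} (\<lambda>x. f x * sin (l * x)) = 0"
  shows "f x0 \<le> 0"
proof (rule ccontr)
  assume neg: "\<not> f x0 \<le> 0"
  have cont': "continuous_on A f" for A using cont continuous_on_subset by blast
  note [continuous_intros] = cont'
  have int0: "(g has_integral 0) {0..2*pi}"
    if "integral {0..2*pi} g = 0" "continuous_on {0..2*pi} g" for g :: "real \<Rightarrow> real"
    using integrable_integral[OF integrable_continuous_interval[OF that(2)]] that(1) by simp
  have abs_cases: "of_int k = real (nat \<bar>k\<bar>) \<or> of_int k = - real (nat \<bar>k\<bar>)" for k :: int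
    by (auto simp: abs_if)
  have c': "((\<lambda>x. f x * cos (of_int k * x)) has_integral 0) {0..2*pi}" for k :: int
  proof -
    have eq: "cos (of_int k * x) = cos (real (nat \<bar>k\<bar>) * x)" for x :: real
      by (cases "k \<ge> 0") auto
    show ?thesis unfolding eq by (rule int0[OF c]) (intro continuous_intros)
  qed
  have s': "((\<lambda>x. f x * sin (of_int k * x)) has_integral 0) {0..2*pi}" for k :: int
  proof -
    have eq: "sin (of_int k * x) = (if k \<ge> 0 then 1 else -1) * sin (real (nat \<bar>k\<bar>) * x)" for x :: real
      by (cases "k \<ge> 0") auto
    have "((\<lambda>x. f x * sin (real (nat \<bar>k\<bar>) * x)) has_integral 0) {0..2*pi}"
      by (rule int0[OF s]) (intro continuous_intros)
    from has_integral_mult_right[OF this, of "if k \<ge> 0 then 1 else -1"] show ?thesis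
      unfolding eq mult.left_commute[of "f _"] by simp
  qed
  define K where "K x = (1 + cos (x - x0)) / 2" for x
  have contK: "continuous_on A (\<lambda>x. f x * K x ^ n)" for A n
    unfolding K_def by (intro continuous_intros) auto
  have "integral {0..2*pi} (\<lambda>x. f x * K x ^ n) = 0" for n
  proof -
    have "((\<lambda>x. f x * ((1 + cos (x - x0)) ^ n * cos (of_int 0 * x))) has_integral 0) {0..2*pi}"
      using trigonometric_kernel_orthogonal[of f x0 n 0] c' s' by blast
    from has_integral_mult_right[OF this, of "1 / 2 ^ n"]
    show ?thesis by (intro integral_unique) (simp add: K_def power_divide mult.commute mult.left_commute)
  qed
  moreover have "K (x + 2 * pi) = K x" for x
    using cos_periodic[of "x - x0"] by (simp add: K_def algebra_simps)
  \<comment> \<open>On the period centred at \<open>x0\<close> the kernel is a decreasing function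
    of the distance to \<open>x0\<close>.\<close>
  ultimately have int: "integral {x0 - pi..x0 + pi} (\<lambda>x. f x * K x ^ n) = 0" for n
    using integral_period_shift[of "\<lambda>x. f x * K x ^ n" "2*pi" "x0 - pi"] contK per
    by (simp add: algebra_simps)
  obtain M where M: "\<And>x. x \<in> {x0 - pi..x0 + pi} \<Longrightarrow> \<bar>f x\<bar> \<le> M"
    using compact_imp_bounded[OF compact_continuous_image[OF cont' compact_Icc]]
    unfolding bounded_iff by (metis imageI real_norm_def)
  have M0: "M \<ge> 0" using M[of x0] by (auto simp: abs_le_iff)
  have "isCont f x0" using cont by (simp add: continuous_on_eq_continuous_at)
  then obtain d0 where d0: "d0 > 0" "\<And>x. \<bar>x - x0\<bar> < d0 \<Longrightarrow> \<bar>f x - f x0\<bar> < f x0 / 2"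
    using neg unfolding continuous_at_eps_delta by (metis half_gt_zero not_le real_norm_def dist_real_def)
  define d where "d = min (d0 / 2) 1"
  have d: "0 < d" "d \<le> 1" "d < d0" using d0 by (auto simp: d_def min_def)
  have dpi: "d < pi" using d pi_gt3 by linarith
  define m where "m = f x0 / 2"
  have m: "m > 0" using neg by (simp add: m_def)
  have fm: "f x \<ge> m" if "\<bar>x - x0\<bar> \<le> d" for x
    using d0(2)[of x] that d by (auto simp: m_def abs_if split: if_splits)
  \<comment> \<open>\<open>r\<close> bounds the kernel from above outside the
    \<open>d\<close>-neighbourhood of \<open>x0\<close>, and \<open>\<rho>\<close> bounds it from
    below on the \<open>d/2\<close>-neighbourhood. The gap between them gives exponential dominance
    of the part near \<open>x0\<close>.\<close>
  define r \<rho> where "r = (1 + cos d) / 2" and "\<rho> = (1 + cos (d/2)) / 2"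
  have r: "0 \<le> r" "r < \<rho>"
  proof -
    have "cos d < cos (d / 2)" using d dpi by (intro cos_monotone_0_pi) auto
    moreover have "0 \<le> 1 + cos d" using cos_ge_minus_one[of d] by linarith
    ultimately have "0 \<le> r \<and> r < \<rho>" by (simp add: r_def \<rho>_def)
    then show "0 \<le> r" "r < \<rho>" by auto
  qed
  have K0: "0 \<le> K x" for x using cos_ge_minus_one[of "x - x0"] unfolding K_def by (smt (verit) divide_nonneg_pos)
  have cosabs: "cos (x - x0) = cos \<bar>x - x0\<bar>" for x by (simp add: abs_if cos_diff mult.commute)
  have Kr: "K x \<le> r" if "d \<le> \<bar>x - x0\<bar>" "\<bar>x - x0\<bar> \<le> pi" for x
    using cos_monotone_0_pi_le[of d "\<bar>x - x0\<bar>"] that d unfolding K_def r_def cosabs by simp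
  have K\<rho>: "\<rho> \<le> K x" if "\<bar>x - x0\<bar> \<le> d / 2" for x
    using cos_monotone_0_pi_le[of "\<bar>x - x0\<bar>" "d/2"] that d dpi unfolding K_def \<rho>_def cosabs by simp
  have key: "d * (m * \<rho> ^ n) \<le> 2 * pi * (M * r ^ n)" for n
  proof -
    \<comment> \<open>Adding the constant \<open>M * r ^ n\<close> makes the integrand nonnegative
      on the whole period, so its integral is at least the part near \<open>x0\<close>; the total is
      just the integral of that constant.\<close>
    define h where "h x = f x * K x ^ n + M * r ^ n" for x
    have conth: "continuous_on A h" for A unfolding h_def by (intro continuous_intros contK)
    have h0: "h x \<ge> 0" if "x \<in> {x0 - pi..x0 + pi}" for x
    proof (cases "\<bar>x - x0\<bar> \<le> d")
      case True
      then show ?thesis using fm[of x] m K0[of x] M0 r by (simp add: h_def)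
    next
      case False
      then have "K x ^ n \<le> r ^ n" using that Kr[of x] K0[of x] by (intro power_mono) (auto simp: abs_le_iff)
      then have "\<bar>f x * K x ^ n\<bar> \<le> M * r ^ n"
        using M[OF that] K0[of x] M0 by (auto simp: abs_mult intro!: mult_mono)
      then show ?thesis by (simp add: h_def)
    qed
    have "d * (m * \<rho> ^ n) = integral {x0 - d/2..x0 + d/2} (\<lambda>x. m * \<rho> ^ n)" using d by simp
    also have "\<dots> \<le> integral {x0 - d/2..x0 + d/2} h"
    proof (rule integral_le)
      fix x assume "x \<in> {x0 - d/2..x0 + d/2}"
      then have x: "\<bar>x - x0\<bar> \<le> d / 2" unfolding abs_le_iff by auto
      then have "m * \<rho> ^ n \<le> f x * K x ^ n"
        using K\<rho>[OF x] fm[of x] m r d by (intro mult_mono power_mono) auto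
      then show "m * \<rho> ^ n \<le> h x" using M0 r by (simp add: h_def add_increasing2)
    qed (auto intro: integrable_continuous_interval conth)
    also have "\<dots> \<le> integral {x0 - pi..x0 + pi} h"
      using h0 dpi d by (intro integral_subset_le integrable_continuous_interval conth) auto
    also have "\<dots> = 2 * pi * (M * r ^ n)"
      unfolding h_def by (subst Henstock_Kurzweil_Integration.integral_add)
        (auto intro: integrable_continuous_interval contK simp: int)
    finally show ?thesis .
  qed
  have \<rho>0: "\<rho> > 0" using r by simp
  have "d * m \<le> 2 * pi * M * (r / \<rho>) ^ n" for n
    using key[of n] \<rho>0 by (simp add: power_divide field_simps)
  moreover have "(\<lambda>n. 2 * pi * M * (r / \<rho>) ^ n) \<longlonglongrightarrow> 2 * pi * M * 0"
    using r \<rho>0 by (intro tendsto_intros LIMSEQ_realpow_zero) auto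
  ultimately have "d * m \<le> 2 * pi * M * 0"
    by (intro LIMSEQ_le_const) auto
  then show False using d m by (simp add: mult_le_0_iff)
qed

lemma fourier_coefficients_zero_imp_zero:
  fixes f :: "real \<Rightarrow> real"
  assumes "continuous_on UNIV f" and "\<And>x. f (x + 2 * pi) = f x"
    and "\<And>l::nat. integral {0..2*pi} (\<lambda>x. f x * cos (l * x)) = 0"
    and "\<And>l::nat. integral {0..2*pi} (\<lambda>x. f x * sin (l * x)) = 0"
  shows "f x = 0"
  using fourier_coefficients_zero_imp_nonpos[of f x]
    fourier_coefficients_zero_imp_nonpos[of "\<lambda>x. - f x" x] assms
  by (force intro: continuous_on_minus)

section \<open>Periodic Sturm--Liouville systems\<close>

definition dd :: "(real \<Rightarrow> 'a::euclidean_space) \<Rightarrow> real \<Rightarrow> 'a"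
  where "dd f x = vector_derivative f (at x)"

definition qd :: "(real \<Rightarrow> real) \<Rightarrow> (real \<Rightarrow> 'a::euclidean_space) \<Rightarrow> real \<Rightarrow> 'a"
  where "qd D f x = vector_derivative (\<lambda>y. D y *\<^sub>R dd f y) (at x)"

text \<open>Regularity is asked of the flux \<open>D f'\<close>, the quantity that occurs in the
  equation and in integration by parts; \<open>D\<close> is then only assumed continuous.\<close>

definition C2D :: "(real \<Rightarrow> real) \<Rightarrow> (real \<Rightarrow> 'a::euclidean_space) \<Rightarrow> bool"
  where "C2D D f \<longleftrightarrow> (\<forall>x. (f has_vector_derivative dd f x) (at x)) \<and>
    (\<forall>x. ((\<lambda>y. D y *\<^sub>R dd f y) has_vector_derivative qd D f x) (at x)) \<and> continuous_on UNIV (qd D f)"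

lemma C2DI:
  assumes "\<And>x. (f has_vector_derivative f1 x) (at x)"
    and "\<And>x. ((\<lambda>y. D y *\<^sub>R f1 y) has_vector_derivative f2 x) (at x)"
    and "continuous_on UNIV f2"
  shows "C2D D f" "dd f = f1" "qd D f = f2"
proof -
  show 1: "dd f = f1" using assms(1) by (auto simp: dd_def vector_derivative_at)
  then show 2: "qd D f = f2" using assms(2) by (auto simp: qd_def vector_derivative_at fun_eq_iff)
  show "C2D D f" using assms unfolding C2D_def 1 2 by blast
qed

lemma C2D_D:
  assumes "C2D D f"
  shows "(f has_vector_derivative dd f x) (at x)"
    and "((\<lambda>y. D y *\<^sub>R dd f y) has_vector_derivative qd D f x) (at x)"
    and "continuous_on A (qd D f)"
    and "continuous_on A f" and "continuous_on A (\<lambda>y. D y *\<^sub>R dd f y)"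
proof -
  show 1: "(f has_vector_derivative dd f x) (at x)"
    and 2: "((\<lambda>y. D y *\<^sub>R dd f y) has_vector_derivative qd D f x) (at x)" for x
    using assms by (auto simp: C2D_def)
  show "continuous_on A (qd D f)" using assms continuous_on_subset by (auto simp: C2D_def)
  show "continuous_on A f" "continuous_on A (\<lambda>y. D y *\<^sub>R dd f y)"
    by (auto intro!: continuous_at_imp_continuous_on has_vector_derivative_continuous[OF 1]
        has_vector_derivative_continuous[OF 2])
qed

lemma C2D_lin:
  assumes "C2D D f" "C2D D g"
  shows "C2D D (\<lambda>x. a *\<^sub>R f x + b *\<^sub>R g x)"
    and "dd (\<lambda>x. a *\<^sub>R f x + b *\<^sub>R g x) = (\<lambda>x. a *\<^sub>R dd f x + b *\<^sub>R dd g x)"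
    and "qd D (\<lambda>x. a *\<^sub>R f x + b *\<^sub>R g x) = (\<lambda>x. a *\<^sub>R qd D f x + b *\<^sub>R qd D g x)"
proof -
  note df = C2D_D[OF assms(1)] and dg = C2D_D[OF assms(2)]
  have 1: "((\<lambda>x. a *\<^sub>R f x + b *\<^sub>R g x) has_vector_derivative a *\<^sub>R dd f x + b *\<^sub>R dd g x) (at x)" for x
    using df(1) dg(1) by (auto intro!: derivative_eq_intros)
  have "((\<lambda>y. a *\<^sub>R (D y *\<^sub>R dd f y) + b *\<^sub>R (D y *\<^sub>R dd g y)) has_vector_derivative
      a *\<^sub>R qd D f x + b *\<^sub>R qd D g x) (at x)" for x
    by (intro has_vector_derivative_add bounded_linear.has_vector_derivative[OF bounded_linear_scaleR_right] df(2) dg(2))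
  then have 2: "((\<lambda>y. D y *\<^sub>R (a *\<^sub>R dd f y + b *\<^sub>R dd g y)) has_vector_derivative
      a *\<^sub>R qd D f x + b *\<^sub>R qd D g x) (at x)" for x
    by (simp add: scaleR_right_distrib mult.commute)
  have 3: "continuous_on UNIV (\<lambda>x. a *\<^sub>R qd D f x + b *\<^sub>R qd D g x)"
    by (intro continuous_intros df dg)
  show "C2D D (\<lambda>x. a *\<^sub>R f x + b *\<^sub>R g x)"
    "dd (\<lambda>x. a *\<^sub>R f x + b *\<^sub>R g x) = (\<lambda>x. a *\<^sub>R dd f x + b *\<^sub>R dd g x)"
    "qd D (\<lambda>x. a *\<^sub>R f x + b *\<^sub>R g x) = (\<lambda>x. a *\<^sub>R qd D f x + b *\<^sub>R qd D g x)"
    using C2DI[OF 1 2 3] by auto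
qed

lemma C2D_zero: "C2D D (\<lambda>_. 0)" "dd (\<lambda>_. 0) = (\<lambda>_. 0)" "qd D (\<lambda>_. 0) = (\<lambda>_. 0)"
  using C2DI[of "\<lambda>_. 0" "\<lambda>_. 0" D "\<lambda>_. 0"] by auto

lemma C2D_sum:
  assumes "finite I" "\<And>i. i \<in> I \<Longrightarrow> C2D D (f i)"
  shows "C2D D (\<lambda>x. \<Sum>i\<in>I. c i *\<^sub>R f i x) \<and>
    dd (\<lambda>x. \<Sum>i\<in>I. c i *\<^sub>R f i x) = (\<lambda>x. \<Sum>i\<in>I. c i *\<^sub>R dd (f i) x) \<and>
    qd D (\<lambda>x. \<Sum>i\<in>I. c i *\<^sub>R f i x) = (\<lambda>x. \<Sum>i\<in>I. c i *\<^sub>R qd D (f i) x)"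
  using assms
proof (induction I)
  case empty
  then show ?case by (simp add: C2D_zero)
next
  case (insert i I)
  then show ?case
    using C2D_lin[of D "f i" "\<lambda>x. \<Sum>i\<in>I. c i *\<^sub>R f i x" "c i" 1] by simp
qed

text \<open>The self-adjoint system (D f')' = V f - l w f on an interval of length \<open>P\<close>.
  The sign \<open>\<sigma>\<close> selects periodic or antiperiodic functions; the latter arise from
  odd frequencies in \<alpha> on the quotient torus for even q.\<close>

locale sturm_liouville =
  fixes D w :: "real \<Rightarrow> real" and V :: "real \<Rightarrow> 'a::euclidean_space \<Rightarrow> 'a" and P \<sigma> :: real
  assumes D_pos: "D x > 0" and D_cont: "continuous_on UNIV D"
    and w_pos: "w x > 0" and w_cont: "continuous_on UNIV w"
    and V_linear: "linear (V x)" and V_sym: "V x u \<bullet> v = V x v \<bullet> u"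
    and V_cont: "\<And>f. continuous_on UNIV f \<Longrightarrow> continuous_on UNIV (\<lambda>x. V x (f x))"
    and V_bound: "\<exists>K. \<forall>x u. norm (V x u) \<le> K * norm u"
    and D_per: "D (x + P) = D x" and w_per: "w (x + P) = w x" and V_per: "V (x + P) = V x"
    and P_pos: "P > 0" and sign: "\<sigma> = 1 \<or> \<sigma> = -1"
begin

lemma cont_D [continuous_intros]: "continuous_on A D"
  and cont_w [continuous_intros]: "continuous_on A w"
  using D_cont w_cont continuous_on_subset by blast+

lemma cont_V: "continuous_on UNIV f \<Longrightarrow> continuous_on A (\<lambda>x. V x (f x))"
  using V_cont continuous_on_subset by blast

lemma V_lin: "V x (a *\<^sub>R u + b *\<^sub>R v) = a *\<^sub>R V x u + b *\<^sub>R V x v"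
  using V_linear[of x] by (simp add: linear_add linear_scale)

lemma cont_dd: assumes "C2D D f" shows "continuous_on A (dd f)"
proof -
  have "continuous_on A (\<lambda>y. inverse (D y) *\<^sub>R (D y *\<^sub>R dd f y))"
    using D_pos by (intro continuous_intros C2D_D[OF assms]) (simp add: less_imp_neq[symmetric])
  then show ?thesis using D_pos by (simp add: less_imp_neq[symmetric])
qed

definition adm :: "(real \<Rightarrow> 'a) \<Rightarrow> bool"
  where "adm f \<longleftrightarrow> C2D D f \<and> (\<forall>x. f (x + P) = \<sigma> *\<^sub>R f x)"

definition ip :: "(real \<Rightarrow> 'a) \<Rightarrow> (real \<Rightarrow> 'a) \<Rightarrow> real"
  where "ip f g = integral {0..P} (\<lambda>x. w x * (f x \<bullet> g x))"

definition form :: "(real \<Rightarrow> 'a) \<Rightarrow> (real \<Rightarrow> 'a) \<Rightarrow> real"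
  where "form f g = integral {0..P} (\<lambda>x. D x * (dd f x \<bullet> dd g x) + V x (f x) \<bullet> g x)"

definition sol :: "real \<Rightarrow> (real \<Rightarrow> 'a) \<Rightarrow> bool"
  where "sol l f \<longleftrightarrow> adm f \<and> (\<forall>x. qd D f x = V x (f x) - (l * w x) *\<^sub>R f x)"

lemma adm_C2D: "adm f \<Longrightarrow> C2D D f" by (simp add: adm_def)

lemma dd_shift:
  assumes "C2D D f" "\<And>x. f (x + P) = \<sigma> *\<^sub>R f x"
  shows "dd f (x + P) = \<sigma> *\<^sub>R dd f x"
proof -
  have "((\<lambda>x. f (x + P)) has_vector_derivative dd f (x + P)) (at x)"
    using vector_diff_chain_at[of "\<lambda>x. x + P" 1 x f "dd f (x + P)"] C2D_D(1)[OF assms(1), of "x + P"]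
    by (simp add: o_def has_vector_derivative_add_const[of "\<lambda>x. x", simplified] has_vector_derivative_id)
  moreover have "((\<lambda>x. f (x + P)) has_vector_derivative \<sigma> *\<^sub>R dd f x) (at x)"
    unfolding assms(2) by (auto intro!: derivative_eq_intros C2D_D[OF assms(1)])
  ultimately show ?thesis by (rule vector_derivative_unique_at)
qed

lemma adm_lin: "adm f \<Longrightarrow> adm g \<Longrightarrow> adm (\<lambda>x. a *\<^sub>R f x + b *\<^sub>R g x)"
  by (simp add: adm_def C2D_lin scaleR_right_distrib mult.commute)

lemma adm_sum:
  assumes "finite I" "\<And>i. i \<in> I \<Longrightarrow> adm (f i)"
  shows "adm (\<lambda>x. \<Sum>i\<in>I. c i *\<^sub>R f i x)"
  using assms C2D_sum[of I D f c] by (simp add: adm_def scaleR_sum_right mult.commute)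

lemma int_ip: "adm f \<Longrightarrow> adm g \<Longrightarrow> (\<lambda>x. w x * (f x \<bullet> g x)) integrable_on {c..d}"
  by (intro integrable_continuous_interval continuous_intros C2D_D(4)[where D = D]) (auto simp: adm_C2D)

lemma int_form: "adm f \<Longrightarrow> adm g \<Longrightarrow>
    (\<lambda>x. D x * (dd f x \<bullet> dd g x) + V x (f x) \<bullet> g x) integrable_on {c..d}"
  by (intro integrable_continuous_interval continuous_intros cont_dd cont_V C2D_D(4)[where D = D])
     (auto simp: adm_C2D)

lemma ip_sym: "ip f g = ip g f" by (simp add: ip_def inner_commute)

lemma form_sym: "form f g = form g f"
  unfolding form_def using V_sym by (simp add: inner_commute)

lemma ip_lin: "adm f \<Longrightarrow> adm g \<Longrightarrow> adm h \<Longrightarrow> ip (\<lambda>x. a *\<^sub>R f x + b *\<^sub>R g x) h = a * ip f h + b * ip g h"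
  unfolding ip_def
  by (subst integral_mult_right[symmetric], subst integral_mult_right[symmetric],
      subst Henstock_Kurzweil_Integration.integral_add[symmetric])
     (auto intro!: integrable_on_mult_right int_ip integral_cong simp: inner_left_distrib algebra_simps)

lemma form_lin:
  assumes "adm f" "adm g" "adm h"
  shows "form (\<lambda>x. a *\<^sub>R f x + b *\<^sub>R g x) h = a * form f h + b * form g h"
proof -
  have "form (\<lambda>x. a *\<^sub>R f x + b *\<^sub>R g x) h = integral {0..P} (\<lambda>x.
      a * (D x * (dd f x \<bullet> dd h x) + V x (f x) \<bullet> h x) + b * (D x * (dd g x \<bullet> dd h x) + V x (g x) \<bullet> h x))"
    unfolding form_def C2D_lin(2)[OF adm_C2D[OF assms(1)] adm_C2D[OF assms(2)]]
    by (intro integral_cong) (simp add: V_lin inner_left_distrib algebra_simps)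
  also have "\<dots> = a * form f h + b * form g h"
    unfolding form_def
    by (subst Henstock_Kurzweil_Integration.integral_add)
       (auto intro!: integrable_on_cmult_left[where 'b = real, simplified] int_form assms)
  finally show ?thesis .
qed

lemma form_sum:
  assumes "finite I" "\<And>i. i \<in> I \<Longrightarrow> adm (f i)" "adm h"
  shows "form (\<lambda>x. \<Sum>i\<in>I. c i *\<^sub>R f i x) h = (\<Sum>i\<in>I. c i * form (f i) h)"
    and "ip (\<lambda>x. \<Sum>i\<in>I. c i *\<^sub>R f i x) h = (\<Sum>i\<in>I. c i * ip (f i) h)"
proof -
  have z: "V x 0 = 0" for x using V_linear linear_0 by blast
  have "form (\<lambda>x. \<Sum>i\<in>I. c i *\<^sub>R f i x) h = (\<Sum>i\<in>I. c i * form (f i) h) \<and>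
     ip (\<lambda>x. \<Sum>i\<in>I. c i *\<^sub>R f i x) h = (\<Sum>i\<in>I. c i * ip (f i) h)"
    using assms(1,2)
  proof (induction I)
    case empty
    then show ?case by (simp add: form_def ip_def C2D_zero z)
  next
    case (insert i I)
    then show ?case
      using form_lin[of "f i" "\<lambda>x. \<Sum>i\<in>I. c i *\<^sub>R f i x" h "c i" 1]
        ip_lin[of "f i" "\<lambda>x. \<Sum>i\<in>I. c i *\<^sub>R f i x" h "c i" 1] adm_sum[of I f c] assms(3) by simp
  qed
  then show "form (\<lambda>x. \<Sum>i\<in>I. c i *\<^sub>R f i x) h = (\<Sum>i\<in>I. c i * form (f i) h)"
    "ip (\<lambda>x. \<Sum>i\<in>I. c i *\<^sub>R f i x) h = (\<Sum>i\<in>I. c i * ip (f i) h)" by auto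
qed

lemma ip_nonneg: "adm f \<Longrightarrow> ip f f \<ge> 0"
  unfolding ip_def using w_pos by (intro integral_nonneg int_ip) (auto simp: less_imp_le)

lemma adm_eq_zero:
  assumes "adm f" "\<And>x. x \<in> {0..P} \<Longrightarrow> f x = 0"
  shows "f x = 0"
proof -
  have step: "f (y + P) = 0 \<longleftrightarrow> f y = 0" for y using assms(1) sign by (auto simp: adm_def)
  have "f (y + of_int m * P) = 0 \<longleftrightarrow> f y = 0" for y and m :: int
  proof (induction m rule: int_induct[where k = 0])
    case (step1 i)
    then show ?case using step[of "y + of_int i * P"] by (simp add: algebra_simps)
  next
    case (step2 i)
    then show ?case using step[of "y + of_int (i - 1) * P"] by (simp add: algebra_simps)
  qed auto
  from this[of "x - of_int \<lfloor>x / P\<rfloor> * P" "\<lfloor>x / P\<rfloor>"] show ?thesis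
    using assms(2)[of "x - of_int \<lfloor>x / P\<rfloor> * P"] P_pos floor_divide_lower[of P x] floor_divide_upper[of P x]
    by (simp add: algebra_simps)
qed

lemma ip_zero_imp: assumes "adm f" "ip f f \<le> 0" shows "f x = 0"
proof (rule adm_eq_zero[OF assms(1)])
  have "ip f f = 0" using assms ip_nonneg by (simp add: antisym)
  moreover have "continuous_on {0..P} (\<lambda>x. w x * (f x \<bullet> f x))"
    using assms by (intro continuous_intros C2D_D(4)[where D = D]) (auto simp: adm_C2D)
  moreover fix x assume "x \<in> {0..P}"
  ultimately have "w x * (f x \<bullet> f x) = 0"
    using integral_eq_0_iff[of 0 P "\<lambda>x. w x * (f x \<bullet> f x)"] P_pos w_pos less_imp_le[OF w_pos]
    by (auto simp: ip_def)
  then show "f x = 0" using w_pos[of x] by simp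
qed

text \<open>The boundary terms at 0 and \<open>P\<close> cancel, because both factors acquire
  \<open>\<sigma>\<close> and its square is 1.\<close>

lemma green:
  assumes "adm f" "adm g"
  shows "((\<lambda>x. D x * (dd f x \<bullet> dd g x) + f x \<bullet> qd D g x) has_integral 0) {0..P}"
proof -
  have "((\<lambda>x. f x \<bullet> (D x *\<^sub>R dd g x)) has_vector_derivative (D x * (dd f x \<bullet> dd g x) + f x \<bullet> qd D g x)) (at x)" for x
    using bounded_bilinear.has_vector_derivative[OF bounded_bilinear_inner
        C2D_D(1)[OF adm_C2D[OF assms(1)]] C2D_D(2)[OF adm_C2D[OF assms(2)]], of x]
    by (simp add: algebra_simps)
  then have "((\<lambda>x. D x * (dd f x \<bullet> dd g x) + f x \<bullet> qd D g x) has_integral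
     f P \<bullet> (D P *\<^sub>R dd g P) - f 0 \<bullet> (D 0 *\<^sub>R dd g 0)) {0..P}"
    using P_pos by (intro fundamental_theorem_of_calculus) (auto intro: has_vector_derivative_at_within)
  moreover have "f P = \<sigma> *\<^sub>R f 0" "dd g P = \<sigma> *\<^sub>R dd g 0" "D P = D 0"
    using assms dd_shift[of g 0] D_per[of 0] unfolding adm_def by (metis add_0)+
  ultimately show ?thesis using sign by auto
qed

lemma form_sol:
  assumes "adm f" "sol l g"
  shows "form f g = l * ip f g"
proof -
  have g: "adm g" "\<And>x. qd D g x = V x (g x) - (l * w x) *\<^sub>R g x" using assms(2) by (auto simp: sol_def)
  have "form f g - l * ip f g = integral {0..P} (\<lambda>x. (D x * (dd f x \<bullet> dd g x) + V x (f x) \<bullet> g x) - l * (w x * (f x \<bullet> g x)))"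
    unfolding form_def ip_def
    by (subst integral_mult_right[symmetric],
      rule Henstock_Kurzweil_Integration.integral_diff[symmetric])
      (auto intro!: int_form int_ip integrable_on_mult_right assms g)
  also have "\<dots> = integral {0..P} (\<lambda>x. D x * (dd f x \<bullet> dd g x) + f x \<bullet> qd D g x)"
    by (intro integral_cong) (simp add: g(2) inner_diff_right V_sym[of _ "f _" "g _"] inner_commute[of "f _" "V _ (g _)"])
  also have "\<dots> = 0" using green[OF assms(1) g(1)] by (rule integral_unique)
  finally show ?thesis by simp
qed

lemma sol_orthogonal:
  assumes "sol l f" "sol m g" "l \<noteq> m"
  shows "ip f g = 0"
proof -
  have "form f g = m * ip f g" "form g f = l * ip g f"
    using form_sol assms by (auto simp: sol_def)
  then have "(m - l) * ip f g = 0" by (simp add: form_sym[of g] ip_sym[of g] algebra_simps)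
  then show ?thesis using assms(3) by simp
qed

lemma form_sum_sols:
  assumes "finite F" "\<And>l. l \<in> F \<Longrightarrow> sol l (f l)"
  shows "form (\<lambda>x. \<Sum>l\<in>F. f l x) (\<lambda>x. \<Sum>l\<in>F. f l x) = (\<Sum>l\<in>F. l * ip (f l) (f l))"
proof -
  have a: "adm (f l)" if "l \<in> F" for l using assms(2)[OF that] by (simp add: sol_def)
  have A: "adm (\<lambda>x. \<Sum>l\<in>F. f l x)" using adm_sum[of F f "\<lambda>_. 1"] assms(1) a by simp
  have "form (\<lambda>x. \<Sum>l\<in>F. f l x) (\<lambda>x. \<Sum>l\<in>F. f l x) = (\<Sum>l\<in>F. form (\<lambda>x. \<Sum>l\<in>F. f l x) (f l))"
    using form_sum(1)[of F f "\<lambda>x. \<Sum>l\<in>F. f l x" "\<lambda>_. 1"] assms(1) a A by (simp add: form_sym)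
  also have "\<dots> = (\<Sum>l\<in>F. l * ip (f l) (f l))"
  proof (rule sum.cong[OF refl])
    fix l assume l: "l \<in> F"
    have "form (\<lambda>x. \<Sum>l\<in>F. f l x) (f l) = l * ip (\<lambda>x. \<Sum>l\<in>F. f l x) (f l)"
      by (rule form_sol[OF A assms(2)[OF l]])
    also have "ip (\<lambda>x. \<Sum>l\<in>F. f l x) (f l) = (\<Sum>m\<in>F. ip (f m) (f l))"
      using form_sum(2)[of F f "f l" "\<lambda>_. 1"] assms(1) a l by simp
    also have "\<dots> = (\<Sum>m\<in>F. if m = l then ip (f l) (f l) else 0)"
      using sol_orthogonal[OF assms(2) assms(2)[OF l]] by (intro sum.cong) auto
    finally show "form (\<lambda>x. \<Sum>l\<in>F. f l x) (f l) = l * ip (f l) (f l)" using assms(1) l by simp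
  qed
  finally show ?thesis .
qed

text \<open>By orthogonality the form of the sum is the sum of the terms
  \<open>l * ip (f l) (f l)\<close>, all nonpositive, so nonnegativity makes each of them zero. This
  converts a sign of the form into an upper bound on the number of negative eigenvalues.\<close>

lemma negative_sols_vanish:
  assumes "finite F" "\<And>l. l \<in> F \<Longrightarrow> sol l (f l)" "\<And>l. l \<in> F \<Longrightarrow> l < 0"
    and "form (\<lambda>x. \<Sum>l\<in>F. f l x) (\<lambda>x. \<Sum>l\<in>F. f l x) \<ge> 0" and "l \<in> F"
  shows "f l x = 0"
proof -
  have a: "adm (f l)" if "l \<in> F" for l using assms(2)[OF that] by (simp add: sol_def)
  have "0 \<le> (\<Sum>l\<in>F. l * ip (f l) (f l))" using form_sum_sols[OF assms(1,2)] assms(4) by simp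
  moreover have "l * ip (f l) (f l) \<le> 0" if "l \<in> F" for l
    using assms(3)[OF that] ip_nonneg[OF a[OF that]] by (simp add: mult_le_0_iff)
  ultimately have "(\<Sum>l\<in>F. - (l * ip (f l) (f l))) = 0"
    using sum_nonpos[of F "\<lambda>l. l * ip (f l) (f l)"] by (simp add: sum_negf)
  then have "- (l * ip (f l) (f l)) = 0"
    using sum_nonneg_eq_0_iff[of F "\<lambda>l. - (l * ip (f l) (f l))"] assms(1,5)
      \<open>\<And>l. l \<in> F \<Longrightarrow> l * ip (f l) (f l) \<le> 0\<close> by simp
  then have "ip (f l) (f l) = 0" using assms(3)[OF assms(5)] by simp
  then show ?thesis using ip_zero_imp a[OF assms(5)] by simp
qed

end

section \<open>Reduction to one period, and existence of eigenfunctions by minimisation\<close>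

lemma periodic_int:
  fixes h :: "real \<Rightarrow> 'a"
  assumes "\<And>x. h (x + P) = h x"
  shows "h (x + of_int m * P) = h x"
proof (induction m rule: int_induct[where k = 0])
  case (step1 i)
  then show ?case using assms[of "x + of_int i * P"] by (simp add: algebra_simps)
next
  case (step2 i)
  then show ?case using assms[of "x + of_int (i - 1) * P"] by (simp add: algebra_simps)
qed auto

lemma reduce_period:
  fixes x P :: real
  assumes "P > 0"
  obtains m :: int where "x + of_int m * P \<in> {0..P}"
proof
  show "x + of_int (- \<lfloor>x / P\<rfloor>) * P \<in> {0..P}"
    using floor_divide_lower[OF assms, of x] floor_divide_upper[OF assms, of x]
    by (simp add: algebra_simps)
qed

lemma positive_periodic_bounds:
  fixes h :: "real \<Rightarrow> real"
  assumes "continuous_on UNIV h" "\<And>x. h (x + P) = h x" "P > 0" "\<And>x. h x > 0"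
  obtains d M where "d > 0" "\<And>x. d \<le> h x" "\<And>x. h x \<le> M"
proof -
  have c: "continuous_on {0..P} h" using assms(1) continuous_on_subset by blast
  obtain x0 where x0: "\<forall>x\<in>{0..P}. h x0 \<le> h x"
    using continuous_attains_inf[OF compact_Icc _ c] assms(3) by auto
  obtain x1 where x1: "\<forall>x\<in>{0..P}. h x \<le> h x1"
    using continuous_attains_sup[OF compact_Icc _ c] assms(3) by auto
  have "h x0 \<le> h x \<and> h x \<le> h x1" for x
  proof -
    obtain m :: int where "x + of_int m * P \<in> {0..P}" using reduce_period[OF assms(3)] .
    then show ?thesis using x0 x1 periodic_int[of h P x m] assms(2) by metis
  qed
  then show ?thesis using that[of "h x0" "h x1"] assms(4) by blast
qed

context sturm_liouville
begin

text \<open>Any antiderivative satisfies H0 (x + P) = \<sigma> H0 x + k with a constant k. In the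
  periodic case k is the integral of \<open>F\<close> and vanishes; in the antiperiodic case
  subtracting k / 2 removes it.\<close>

lemma twisted_antiderivative:
  assumes F: "continuous_on UNIV F" "\<And>x. F (x + P) = \<sigma> *\<^sub>R F x"
    and "\<sigma> = 1 \<Longrightarrow> integral {0..P} F = 0"
  obtains H where "\<And>x. (H has_vector_derivative F x) (at x)" "\<And>x. H (x + P) = \<sigma> *\<^sub>R (H x :: 'a)"
proof -
  obtain H0 where H0: "\<And>x. (H0 has_vector_derivative F x) (at x)"
    using ex_antiderivative[OF F(1)] by blast
  have "((\<lambda>x. H0 (x + P) - \<sigma> *\<^sub>R H0 x) has_vector_derivative 0) (at x)" for x
  proof -
    have "((\<lambda>x. H0 (x + P)) has_vector_derivative F (x + P)) (at x)"
      using vector_diff_chain_at[of "\<lambda>x. x + P" 1 x H0 "F (x + P)"] H0[of "x + P"]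
      by (simp add: o_def has_vector_derivative_add_const[of "\<lambda>x. x", simplified] has_vector_derivative_id)
    then have "((\<lambda>x. H0 (x + P) - \<sigma> *\<^sub>R H0 x) has_vector_derivative F (x + P) - \<sigma> *\<^sub>R F x) (at x)"
      by (intro has_vector_derivative_diff bounded_linear.has_vector_derivative[OF bounded_linear_scaleR_right] H0)
    then show ?thesis by (simp add: F(2))
  qed
  then obtain k where "\<And>x. x \<in> UNIV \<Longrightarrow> H0 (x + P) - \<sigma> *\<^sub>R H0 x = k"
    by (rule has_vector_derivative_zero_constant[OF convex_UNIV]) blast
  then have k: "H0 (x + P) = \<sigma> *\<^sub>R H0 x + k" for x by (metis add.commute diff_add_cancel UNIV_I)
  have int: "integral {0..P} F = H0 P - H0 0"
    using P_pos H0
    by (intro integral_unique fundamental_theorem_of_calculus) (auto intro: has_vector_derivative_at_within)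
  define H where "H x = H0 x - (if \<sigma> = 1 then 0 else (1/2) *\<^sub>R k)" for x
  have "(H has_vector_derivative F x) (at x)" for x
    unfolding H_def using has_vector_derivative_diff[OF H0[of x] has_vector_derivative_const] by simp
  moreover have "H (x + P) = \<sigma> *\<^sub>R H x" for x
  proof (cases "\<sigma> = 1")
    case True
    then have "k = 0" using k[of 0] int assms(3) by simp
    then show ?thesis using True k by (simp add: H_def)
  next
    case False
    then have "\<sigma> = -1" using sign by auto
    moreover have "k - (1/2) *\<^sub>R k = (1/2) *\<^sub>R k" using scaleR_left_diff_distrib[of 1 "1/2" k] by simp
    ultimately show ?thesis using k[of x] by (simp add: H_def)
  qed
  ultimately show ?thesis using that by blast
qed

lemma solve_quasi_derivative:
  assumes F: "continuous_on UNIV F" "\<And>x. F (x + P) = \<sigma> *\<^sub>R F x"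
    and "\<sigma> = 1 \<Longrightarrow> integral {0..P} F = 0"
  obtains Z where "adm Z" "qd D Z = F"
proof -
  obtain H0 where H0: "\<And>x. (H0 has_vector_derivative F x) (at x)" "\<And>x. H0 (x + P) = \<sigma> *\<^sub>R H0 x"
    using twisted_antiderivative[OF F assms(3)] by blast
  have H0c: "continuous_on A H0" for A
    by (auto intro!: continuous_at_imp_continuous_on has_vector_derivative_continuous[OF H0(1)])
  have Dn: "D x \<noteq> 0" for x using D_pos[of x] by simp
  have Dint: "integral {0..P} (\<lambda>x. inverse (D x)) > 0"
  proof -
    have ci: "continuous_on {0..P} (\<lambda>x. inverse (D x))" by (intro continuous_intros) (use Dn in auto)
    have "integral {0..P} (\<lambda>x. inverse (D x)) \<noteq> 0"
      using integral_eq_0_iff[OF ci] P_pos D_pos less_imp_le[OF D_pos] Dn by auto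
    moreover have "integral {0..P} (\<lambda>x. inverse (D x)) \<ge> 0"
      using D_pos by (intro integral_nonneg integrable_continuous_interval ci) (auto simp: less_imp_le)
    ultimately show ?thesis by simp
  qed
  \<comment> \<open>In the periodic case the second integration also requires mean zero; the free
    constant of the first integration is chosen so that \<open>G\<close> has it.\<close>
  define h where "h = (if \<sigma> = 1 then - (inverse (integral {0..P} (\<lambda>x. inverse (D x)))) *\<^sub>R
      integral {0..P} (\<lambda>x. inverse (D x) *\<^sub>R H0 x) else 0)"
  define H where "H x = H0 x + h" for x
  have H: "(H has_vector_derivative F x) (at x)" "H (x + P) = \<sigma> *\<^sub>R H x" for x
  proof -
    show "(H has_vector_derivative F x) (at x)"
      using has_vector_derivative_add[OF H0(1)[of x] has_vector_derivative_const[of h]]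
      by (simp add: H_def[abs_def])
    show "H (x + P) = \<sigma> *\<^sub>R H x"
      using H0(2)[of x] by (simp add: H_def h_def scaleR_right_distrib)
  qed
  define G where "G x = inverse (D x) *\<^sub>R H x" for x
  have Hc: "continuous_on A H" for A unfolding H_def by (intro continuous_intros H0c)
  have Gc: "continuous_on UNIV G" unfolding G_def by (intro continuous_intros Hc) (use Dn in auto)
  have Gp: "G (x + P) = \<sigma> *\<^sub>R G x" for x using H D_per by (simp add: G_def)
  have "integral {0..P} G = 0" if s: "\<sigma> = 1"
  proof -
    have i1: "(\<lambda>x. inverse (D x) *\<^sub>R H0 x) integrable_on {0..P}"
      by (intro integrable_continuous_interval continuous_intros H0c) (use Dn in auto)
    have i2: "(\<lambda>x. inverse (D x)) integrable_on {0..P}"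
      by (intro integrable_continuous_interval continuous_intros) (use Dn in auto)
    have "((\<lambda>x. inverse (D x) *\<^sub>R H0 x + inverse (D x) *\<^sub>R h) has_integral
        integral {0..P} (\<lambda>x. inverse (D x) *\<^sub>R H0 x) + integral {0..P} (\<lambda>x. inverse (D x)) *\<^sub>R h) {0..P}"
      by (intro has_integral_add integrable_integral i1
         has_integral_linear[OF integrable_integral[OF i2] bounded_linear_scaleR_left, unfolded o_def])
    then have "integral {0..P} G = integral {0..P} (\<lambda>x. inverse (D x) *\<^sub>R H0 x) + integral {0..P} (\<lambda>x. inverse (D x)) *\<^sub>R h"
      by (intro integral_unique) (simp add: G_def[abs_def] H_def scaleR_right_distrib)
    then show ?thesis using s Dint by (simp add: h_def)
  qed
  from twisted_antiderivative[OF Gc Gp this] obtain Z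
    where Z: "\<And>x. (Z has_vector_derivative G x) (at x)" "\<And>x. Z (x + P) = \<sigma> *\<^sub>R Z x" by blast
  have DG: "(\<lambda>y. D y *\<^sub>R G y) = H" using Dn by (auto simp: G_def)
  have "((\<lambda>y. D y *\<^sub>R G y) has_vector_derivative F x) (at x)" for x unfolding DG by (rule H)
  from C2DI[OF Z(1) this F(1)] have "C2D D Z" "qd D Z = F" by auto
  then show ?thesis using that Z(2) by (auto simp: adm_def)
qed

text \<open>The du Bois-Reymond argument: a continuous weak solution is a classical one.\<close>

lemma weak_solution:
  assumes f: "continuous_on UNIV f" "\<And>x. f (x + P) = \<sigma> *\<^sub>R f x"
    and G: "continuous_on UNIV G" "\<And>x. G (x + P) = \<sigma> *\<^sub>R G x"
    and weak: "\<And>\<eta>. adm \<eta> \<Longrightarrow> integral {0..P} (\<lambda>x. G x \<bullet> \<eta> x - f x \<bullet> qd D \<eta> x) = 0"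
  shows "adm f" "qd D f = G"
proof -
  have cf: "continuous_on A f" and cG: "continuous_on A G" for A
    using f(1) G(1) continuous_on_subset by blast+
  \<comment> \<open>Constants are admissible test functions in the periodic case, and they yield the
    solvability condition.\<close>
  have "integral {0..P} G = 0" if "\<sigma> = 1"
  proof (rule euclidean_eqI)
    fix v :: 'a assume "v \<in> Basis"
    have c: "C2D D (\<lambda>_. v)" "qd D (\<lambda>_. v) = (\<lambda>_. 0)" using C2DI[of "\<lambda>_. v" "\<lambda>_. 0" D "\<lambda>_. 0"] by auto
    then have "adm (\<lambda>_. v)" unfolding adm_def using that by simp
    from weak[OF this] have "integral {0..P} (\<lambda>x. G x \<bullet> v) = 0" by (simp add: c)
    moreover have "integral {0..P} (\<lambda>x. G x \<bullet> v) = integral {0..P} G \<bullet> v"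
      by (intro integral_component_eq integrable_continuous_interval cG)
    ultimately show "integral {0..P} G \<bullet> v = 0 \<bullet> v" by simp
  qed
  then obtain K where K: "adm K" "qd D K = G" using solve_quasi_derivative[OF G] by blast
  \<comment> \<open>\<open>K\<close> solves the equation classically, so \<open>K - f\<close> should
    be constant. With \<open>m\<close> its mean (zero in the antiperiodic case), the test function
    with quasi-derivative \<open>F\<close> shows that the integral of |F|^2 vanishes.\<close>
  define m where "m = (if \<sigma> = 1 then (1 / P) *\<^sub>R integral {0..P} (\<lambda>x. K x - f x) else 0)"
  define F where "F x = K x - f x - m" for x
  have cK: "continuous_on A K" for A using K C2D_D(4) adm_C2D by blast
  have cKf: "(\<lambda>x. K x - f x) integrable_on {0..P}"
    by (intro integrable_continuous_interval continuous_intros cf cK)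
  have Fc: "continuous_on A F" for A unfolding F_def by (intro continuous_intros cf cK)
  have Fp: "F (x + P) = \<sigma> *\<^sub>R F x" for x
    using K(1) f(2) by (auto simp: F_def adm_def m_def scaleR_diff_right)
  have F0: "integral {0..P} F = 0" if "\<sigma> = 1"
    unfolding F_def using cKf P_pos that
    by (subst Henstock_Kurzweil_Integration.integral_diff) (auto simp: m_def)
  then obtain \<eta> where \<eta>: "adm \<eta>" "qd D \<eta> = F" using solve_quasi_derivative[OF Fc Fp] by blast
  have i: "(\<lambda>x. D x * (dd u x \<bullet> dd v x) + u x \<bullet> qd D v x) integrable_on {0..P}" if "adm u" "adm v" for u v
    using green[OF that] by blast
  have "integral {0..P} (\<lambda>x. K x \<bullet> F x - \<eta> x \<bullet> G x) =
     integral {0..P} (\<lambda>x. (D x * (dd K x \<bullet> dd \<eta> x) + K x \<bullet> qd D \<eta> x) - (D x * (dd \<eta> x \<bullet> dd K x) + \<eta> x \<bullet> qd D K x))"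
    by (intro integral_cong) (simp add: K \<eta> inner_commute)
  also have "\<dots> = 0"
    using integral_unique[OF has_integral_diff[OF green[OF K(1) \<eta>(1)] green[OF \<eta>(1) K(1)]]] by simp
  finally have 1: "integral {0..P} (\<lambda>x. K x \<bullet> F x - \<eta> x \<bullet> G x) = 0" .
  have c\<eta>: "continuous_on A \<eta>" for A using \<eta> C2D_D(4) adm_C2D by blast
  have 2: "integral {0..P} (\<lambda>x. G x \<bullet> \<eta> x - f x \<bullet> F x) = 0" using weak[OF \<eta>(1)] by (simp add: \<eta>)
  have "integral {0..P} (\<lambda>x. (K x - f x) \<bullet> F x) =
      integral {0..P} (\<lambda>x. (K x \<bullet> F x - \<eta> x \<bullet> G x) + (G x \<bullet> \<eta> x - f x \<bullet> F x))"
    by (intro integral_cong) (simp add: inner_diff_left inner_commute inner_diff_right)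
  also have "\<dots> = 0"
    by (subst Henstock_Kurzweil_Integration.integral_add)
       (auto simp: 1 2 intro!: integrable_continuous_interval continuous_intros cf cK cG Fc c\<eta>)
  finally have 3: "integral {0..P} (\<lambda>x. (K x - f x) \<bullet> F x) = 0" .
  have "integral {0..P} (\<lambda>x. m \<bullet> F x) = m \<bullet> integral {0..P} F"
    using integral_component_eq[of F "{0..P}" m] integrable_continuous_interval[OF Fc] by (simp add: inner_commute)
  also have "\<dots> = 0" using F0 by (auto simp: m_def)
  finally have 4: "integral {0..P} (\<lambda>x. m \<bullet> F x) = 0" .
  have "integral {0..P} (\<lambda>x. F x \<bullet> F x) = integral {0..P} (\<lambda>x. (K x - f x) \<bullet> F x - m \<bullet> F x)"
    by (intro integral_cong) (simp add: F_def inner_diff_left)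
  also have "\<dots> = 0"
    by (subst Henstock_Kurzweil_Integration.integral_diff)
       (auto simp: 3 4 intro!: integrable_continuous_interval continuous_intros cf cK Fc)
  finally have 5: "integral {0..P} (\<lambda>x. F x \<bullet> F x) = 0" .
  have cFF: "continuous_on {0..P} (\<lambda>x. F x \<bullet> F x)" by (intro continuous_intros Fc)
  have F00: "F x = 0" if "x \<in> {0..P}" for x
    using integral_eq_0_iff[OF cFF P_pos] that 5 by simp
  have F_zero: "F x = 0" for x
  proof -
    obtain j :: int where "x + of_int j * P \<in> {0..P}" using reduce_period[OF P_pos] .
    moreover have "(F (y + P) = 0) = (F y = 0)" for y using Fp sign by auto
    ultimately show ?thesis using F00 periodic_int[of "\<lambda>y. F y = 0" P x j] by auto
  qed
  then have fK: "f = (\<lambda>x. 1 *\<^sub>R K x + 1 *\<^sub>R (- m))" by (auto simp: F_def algebra_simps fun_eq_iff)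
  have mC: "C2D D (\<lambda>_. - m)" "qd D (\<lambda>_. - m) = (\<lambda>_. 0)" using C2DI[of "\<lambda>_. - m" "\<lambda>_. 0" D "\<lambda>_. 0"] by auto
  have "adm (\<lambda>_. - m)" using mC by (auto simp: adm_def m_def)
  then show "adm f" unfolding fK by (rule adm_lin[OF K(1)])
  show "qd D f = G" unfolding fK using C2D_lin(3)[OF adm_C2D[OF K(1)] mC(1), of 1 1] by (simp add: mC K)
qed

text \<open>A Garding inequality: the potential is bounded and the weight is bounded below, so a
  multiple of \<open>ip f f\<close> absorbs the zeroth-order term. One \<open>d\<close> serves as
  lower bound for both \<open>D\<close> and \<open>w\<close>.\<close>

lemma form_coercive:
  obtains d K where "d > 0" "K \<ge> 0"
    and "\<And>f. adm f \<Longrightarrow> form f f \<ge> d * integral {0..P} (\<lambda>x. dd f x \<bullet> dd f x) - K * ip f f"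
    and "\<And>f. adm f \<Longrightarrow> d * integral {0..P} (\<lambda>x. f x \<bullet> f x) \<le> ip f f"
proof -
  obtain d1 M1 where d1: "d1 > 0" "\<And>x. d1 \<le> D x" "\<And>x. D x \<le> M1"
    using positive_periodic_bounds[OF D_cont D_per P_pos D_pos] by blast
  obtain d2 M2 where d2: "d2 > 0" "\<And>x. d2 \<le> w x" "\<And>x. w x \<le> M2"
    using positive_periodic_bounds[OF w_cont w_per P_pos w_pos] by blast
  obtain K0 where K0: "\<And>x u. norm (V x u) \<le> K0 * norm u" using V_bound by blast
  define K where "K = max K0 0 / d2"
  have K: "K \<ge> 0" "K0 \<le> K * w x" for x
  proof -
    show K: "K \<ge> 0" using d2 by (simp add: K_def)
    have "K * d2 \<le> K * w x" using d2 K by (intro mult_left_mono) auto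
    then show "K0 \<le> K * w x" using d2 by (auto simp: K_def)
  qed
  define d where "d = min d1 d2"
  have d: "d > 0" "d \<le> D x" "d \<le> w x" for x using d1(1,2) d2(1,2) by (auto simp: d_def min_le_iff_disj)
  have idd: "(\<lambda>x. dd f x \<bullet> dd f x) integrable_on {0..P}" if "adm f" for f
    by (intro integrable_continuous_interval continuous_intros cont_dd adm_C2D that)
  have iff: "(\<lambda>x. f x \<bullet> f x) integrable_on {0..P}" if "adm f" for f
    by (intro integrable_continuous_interval continuous_intros C2D_D(4)[OF adm_C2D] that)
  show ?thesis
  proof (rule that[OF d(1) K(1)])
    fix f assume f: "adm f"
    have "d * integral {0..P} (\<lambda>x. dd f x \<bullet> dd f x) - K * ip f f =
       integral {0..P} (\<lambda>x. d * (dd f x \<bullet> dd f x) - K * (w x * (f x \<bullet> f x)))"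
      unfolding ip_def
      by (subst Henstock_Kurzweil_Integration.integral_diff)
         (auto intro!: integrable_on_cmult_left[where 'b = real, simplified] idd int_ip f)
    also have "\<dots> \<le> form f f"
      unfolding form_def
    proof (intro integral_le integrable_diff integrable_on_cmult_left[where 'b = real, simplified] idd int_ip int_form f)
      fix x assume "x \<in> {0..P}"
      have "\<bar>V x (f x) \<bullet> f x\<bar> \<le> (K0 * norm (f x)) * norm (f x)"
        by (rule order_trans[OF Cauchy_Schwarz_ineq2]) (intro mult_right_mono K0, auto)
      also have "\<dots> = K0 * (f x \<bullet> f x)" by (simp add: dot_square_norm power2_eq_square)
      also have "\<dots> \<le> (K * w x) * (f x \<bullet> f x)" by (intro mult_right_mono K) auto
      finally have "- (K * (w x * (f x \<bullet> f x))) \<le> V x (f x) \<bullet> f x" by (simp add: mult.assoc)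
      moreover have "d * (dd f x \<bullet> dd f x) \<le> D x * (dd f x \<bullet> dd f x)"
        by (intro mult_right_mono d) auto
      ultimately show "d * (dd f x \<bullet> dd f x) - K * (w x * (f x \<bullet> f x)) \<le> D x * (dd f x \<bullet> dd f x) + V x (f x) \<bullet> f x"
        by linarith
    qed
    finally show "d * integral {0..P} (\<lambda>x. dd f x \<bullet> dd f x) - K * ip f f \<le> form f f" .
    have "d * integral {0..P} (\<lambda>x. f x \<bullet> f x) = integral {0..P} (\<lambda>x. d * (f x \<bullet> f x))" by simp
    also have "\<dots> \<le> ip f f"
      unfolding ip_def
      by (intro integral_le integrable_on_cmult_left[where 'b = real, simplified] iff int_ip f mult_right_mono d) auto
    finally show "d * integral {0..P} (\<lambda>x. f x \<bullet> f x) \<le> ip f f" .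
  qed
qed

text \<open>Equicontinuity from bounded energy. The pointwise estimate |f'| \<le> 1 / \<eta> +
  \<eta> |f'|^2 replaces the Cauchy-Schwarz inequality for integrals, with \<eta> left free to
  balance the two terms.\<close>

lemma increment_bound:
  assumes f: "adm f" and E: "integral {0..P} (\<lambda>x. dd f x \<bullet> dd f x) \<le> E" and \<eta>: "\<eta> > 0"
    and xy: "x \<le> y" "y \<le> x + P"
  shows "norm (f y - f x) \<le> (y - x) / \<eta> + \<eta> * E"
proof -
  have c: "continuous_on A (dd f)" for A by (rule cont_dd[OF adm_C2D[OF f]])
  have idd: "(\<lambda>x. dd f x \<bullet> dd f x) integrable_on {p..r}" for p r
    by (intro integrable_continuous_interval continuous_intros c)
  have ft: "(dd f has_integral f y - f x) {x..y}"
    using xy C2D_D(1)[OF adm_C2D[OF f]]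
    by (intro fundamental_theorem_of_calculus) (auto intro: has_vector_derivative_at_within)
  have "norm (f y - f x) = norm (integral {x..y} (dd f))" using ft by (simp add: integral_unique)
  also have "\<dots> \<le> integral {x..y} (\<lambda>z. 1 / \<eta> + \<eta> * (dd f z \<bullet> dd f z))"
  proof (rule integral_norm_bound_integral)
    fix z
    define n where "n = norm (dd f z)"
    have "2 * n \<le> 1 / \<eta> + \<eta> * n\<^sup>2"
    proof -
      have "1 / \<eta> + \<eta> * n\<^sup>2 - 2 * n = (1 - \<eta> * n)\<^sup>2 / \<eta>"
        using \<eta> by (simp add: power2_eq_square field_simps)
      also have "\<dots> \<ge> 0" using \<eta> by simp
      finally show ?thesis by simp
    qed
    moreover have "n \<ge> 0" by (simp add: n_def)
    ultimately show "norm (dd f z) \<le> 1 / \<eta> + \<eta> * (dd f z \<bullet> dd f z)"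
      unfolding dot_square_norm n_def[symmetric] by linarith
  qed (use ft idd in \<open>auto intro!: integrable_add integrable_on_cmult_left[where 'b = real, simplified]\<close>)
  also have "\<dots> = (y - x) / \<eta> + \<eta> * integral {x..y} (\<lambda>z. dd f z \<bullet> dd f z)"
    using xy by (subst Henstock_Kurzweil_Integration.integral_add)
      (auto intro!: idd integrable_on_cmult_left[where 'b = real, simplified])
  also have "integral {x..y} (\<lambda>z. dd f z \<bullet> dd f z) \<le> integral {x..x+P} (\<lambda>z. dd f z \<bullet> dd f z)"
    using xy by (intro integral_subset_le idd) auto
  also have "\<dots> = integral {0..P} (\<lambda>z. dd f z \<bullet> dd f z)"
  proof (rule integral_period_shift)
    have "dd f (z + P) = \<sigma> *\<^sub>R dd f z" for z using f by (intro dd_shift) (auto simp: adm_def)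
    then show "dd f (z + P) \<bullet> dd f (z + P) = dd f z \<bullet> dd f z" for z using sign by auto
  qed (use P_pos in \<open>auto intro!: continuous_intros c\<close>)
  finally have "norm (f y - f x) \<le> (y - x) / \<eta> + \<eta> * integral {0..P} (\<lambda>z. dd f z \<bullet> dd f z)"
    using \<eta> by (simp add: mult_left_mono)
  also have "\<dots> \<le> (y - x) / \<eta> + \<eta> * E"
    using mult_left_mono[OF E, of \<eta>] \<eta> by simp
  finally show ?thesis .
qed

text \<open>Two values on a period differ by at most P + E, by \<open>increment_bound\<close> with
  parameter 1. Averaging the inequality over \<open>y\<close>, with n \<le> 1 + n^2, brings in the
  integral of |f|^2.\<close>

lemma sup_bound:
  assumes f: "adm f" and E: "integral {0..P} (\<lambda>x. dd f x \<bullet> dd f x) \<le> E"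
    and F: "integral {0..P} (\<lambda>x. f x \<bullet> f x) \<le> F" and x: "x \<in> {0..P}"
  shows "norm (f x) \<le> P + E + 1 + F / P"
proof -
  have iff: "(\<lambda>x. f x \<bullet> f x) integrable_on {0..P}"
    by (intro integrable_continuous_interval continuous_intros C2D_D(4)[OF adm_C2D] f)
  have "norm (f x) - (P + E + 1) \<le> f y \<bullet> f y" if y: "y \<in> {0..P}" for y
  proof -
    have "norm (f x - f y) \<le> P + E"
    proof (cases "x \<le> y")
      case True
      then show ?thesis
        using increment_bound[OF f E zero_less_one, of x y] x y by (simp add: norm_minus_commute)
    next
      case False
      then show ?thesis using increment_bound[OF f E zero_less_one, of y x] x y by simp
    qed
    then have 1: "norm (f x) \<le> norm (f y) + P + E" using norm_triangle_sub[of "f x" "f y"] by simp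
    have "norm (f y) \<le> 1 + norm (f y) ^ 2"
      using zero_le_power2[of "norm (f y) - 1/2"] by (simp add: power2_eq_square algebra_simps)
    with 1 show ?thesis by (simp add: dot_square_norm)
  qed
  then have "integral {0..P} (\<lambda>y. norm (f x) - (P + E + 1)) \<le> integral {0..P} (\<lambda>y. f y \<bullet> f y)"
    by (intro integral_le iff) auto
  then have "P * (norm (f x) - (P + E + 1)) \<le> F" using F P_pos by simp
  then show ?thesis using P_pos by (simp add: field_simps)
qed

lemma form_quadratic:
  assumes "adm f" "adm g"
  shows "form (\<lambda>x. a *\<^sub>R f x + b *\<^sub>R g x) (\<lambda>x. a *\<^sub>R f x + b *\<^sub>R g x) =
      a\<^sup>2 * form f f + 2 * a * b * form f g + b\<^sup>2 * form g g"
    and "ip (\<lambda>x. a *\<^sub>R f x + b *\<^sub>R g x) (\<lambda>x. a *\<^sub>R f x + b *\<^sub>R g x) =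
      a\<^sup>2 * ip f f + 2 * a * b * ip f g + b\<^sup>2 * ip g g"
proof -
  define h where "h x = a *\<^sub>R f x + b *\<^sub>R g x" for x
  have h: "adm h" unfolding h_def by (rule adm_lin[OF assms])
  have "form h h = a * form f h + b * form g h" "ip h h = a * ip f h + b * ip g h"
    using form_lin[OF assms h, of a b] ip_lin[OF assms h, of a b] by (simp_all add: h_def[abs_def])
  moreover have "form f h = a * form f f + b * form f g" "ip f h = a * ip f f + b * ip f g"
    using form_lin[OF assms assms(1), of a b] ip_lin[OF assms assms(1), of a b]
      form_sym[of f h] ip_sym[of f h] form_sym[of f g] ip_sym[of f g] by (simp_all add: h_def[abs_def])
  moreover have "form g h = a * form f g + b * form g g" "ip g h = a * ip f g + b * ip g g"
    using form_lin[OF assms assms(2), of a b] ip_lin[OF assms assms(2), of a b]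
      form_sym[of g h] ip_sym[of g h] by (simp_all add: h_def[abs_def])
  ultimately show "form (\<lambda>x. a *\<^sub>R f x + b *\<^sub>R g x) (\<lambda>x. a *\<^sub>R f x + b *\<^sub>R g x) =
      a\<^sup>2 * form f f + 2 * a * b * form f g + b\<^sup>2 * form g g"
    "ip (\<lambda>x. a *\<^sub>R f x + b *\<^sub>R g x) (\<lambda>x. a *\<^sub>R f x + b *\<^sub>R g x) =
      a\<^sup>2 * ip f f + 2 * a * b * ip f g + b\<^sup>2 * ip g g"
    unfolding h_def[symmetric] by (simp_all add: power2_eq_square algebra_simps)
qed

text \<open>Meant for the form minus its lowest multiple of \<open>ip\<close>, which is only
  semidefinite on the constraint space; hence the degenerate case c = 0 is covered too.\<close>

lemma semidefinite_cauchy_schwarz: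
  fixes a b c :: real
  assumes "\<And>t. a + 2 * t * b + t\<^sup>2 * c \<ge> 0"
  shows "b\<^sup>2 \<le> a * c"
proof (cases "c = 0")
  case True
  have "b = 0"
  proof (rule ccontr)
    assume "b \<noteq> 0"
    then show False using assms[of "- (a + 1) / (2 * b)"] True by (simp add: field_simps)
  qed
  then show ?thesis using True by simp
next
  case False
  have "c \<ge> 0"
  proof (rule ccontr)
    assume "\<not> c \<ge> 0"
    define t where "t = (\<bar>a\<bar> + 1 + 2 * \<bar>b\<bar>) / (- c) + 1"
    have t: "t \<ge> 1" "t * (- c) \<ge> \<bar>a\<bar> + 1 + 2 * \<bar>b\<bar>"
      using \<open>\<not> c \<ge> 0\<close> by (auto simp: t_def field_simps)
    have "t * (t * (- c)) \<ge> t * (\<bar>a\<bar> + 1 + 2 * \<bar>b\<bar>)" using t by (intro mult_left_mono) auto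
    then have 1: "t\<^sup>2 * c \<le> - (t * \<bar>a\<bar>) - t - 2 * (t * \<bar>b\<bar>)"
      by (simp add: power2_eq_square algebra_simps)
    have 2: "t * \<bar>a\<bar> \<ge> \<bar>a\<bar>" using t(1) mult_right_mono[of 1 t "\<bar>a\<bar>"] by simp
    have 3: "2 * t * b \<le> 2 * (t * \<bar>b\<bar>)" using t by (simp add: mult_left_mono)
    show False
      using assms[of t] t(1) 1 2 3 by linarith
  qed
  with False have "c > 0" by simp
  then show ?thesis using assms[of "- b / c"] by (simp add: field_simps power2_eq_square)
qed

text \<open>A minimising sequence for the form under the orthogonality constraints is bounded in \<open>H\<^sup>1\<close>,
  hence equicontinuous; a uniform limit is a weak solution.\<close>

lemma next_eigenfunction:
  fixes k :: nat
  assumes e: "\<And>i. i < k \<Longrightarrow> sol (l i) (e i)"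
    and e_orth: "\<And>i j. i < k \<Longrightarrow> j < k \<Longrightarrow> ip (e i) (e j) = (if i = j then 1 else 0)"
    and neg: "\<exists>f. adm f \<and> (\<forall>i<k. ip f (e i) = 0) \<and> form f f < 0"
  obtains f m where "sol m f" "m < 0" "ip f f = 1" "\<And>i. i < k \<Longrightarrow> ip f (e i) = 0"
proof -
  obtain d K where d: "d > 0" "K \<ge> 0"
    and coer: "\<And>f. adm f \<Longrightarrow> form f f \<ge> d * integral {0..P} (\<lambda>x. dd f x \<bullet> dd f x) - K * ip f f"
    and ipd: "\<And>f. adm f \<Longrightarrow> d * integral {0..P} (\<lambda>x. f x \<bullet> f x) \<le> ip f f"
    using form_coercive by blast
  have ae: "adm (e i)" if "i < k" for i using e[OF that] by (simp add: sol_def)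
  \<comment> \<open>The constraint space of functions orthogonal to the eigenfunctions found so far;
    the next eigenvalue is the infimum of the form over its unit sphere.\<close>
  define C where "C = {f. adm f \<and> (\<forall>i<k. ip f (e i) = 0)}"
  have C_lin: "(\<lambda>x. a *\<^sub>R f x + b *\<^sub>R g x) \<in> C" if "f \<in> C" "g \<in> C" for a b f g
    using that ae by (auto simp: C_def adm_lin ip_lin)
  have Cadm: "adm f" if "f \<in> C" for f using that by (simp add: C_def)
  define Q where "Q = (\<lambda>f. form f f) ` {f \<in> C. ip f f = 1}"
  have idd0: "integral {0..P} (\<lambda>x. dd f x \<bullet> dd f x) \<ge> 0" if "adm f" for f
    by (intro integral_nonneg integrable_continuous_interval continuous_intros cont_dd adm_C2D that) auto
  have lowC: "form f f \<ge> - K" if "f \<in> C" "ip f f = 1" for f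
    using coer[OF Cadm[OF that(1)]] that(2)
      mult_nonneg_nonneg[OF less_imp_le[OF d(1)] idd0[OF Cadm[OF that(1)]]] by simp
  have bdd: "bdd_below Q" unfolding Q_def using lowC by (intro bdd_belowI[of _ "- K"]) auto
  define m where "m = Inf Q"
  have scale: "form (\<lambda>x. a *\<^sub>R f x + 0 *\<^sub>R f x) (\<lambda>x. a *\<^sub>R f x + 0 *\<^sub>R f x) = a\<^sup>2 * form f f"
    "ip (\<lambda>x. a *\<^sub>R f x + 0 *\<^sub>R f x) (\<lambda>x. a *\<^sub>R f x + 0 *\<^sub>R f x) = a\<^sup>2 * ip f f" if "adm f" for a f
    using form_quadratic[OF that that, of a 0] by simp_all
  have normalised: "\<exists>g\<in>C. ip g g = 1 \<and> form g g = form f f / ip f f" if "f \<in> C" "ip f f > 0" for f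
  proof -
    define a where "a = 1 / sqrt (ip f f)"
    have "a\<^sup>2 = 1 / ip f f" using that by (simp add: a_def power_divide)
    then show ?thesis
      using scale[OF Cadm[OF that(1)], of a] C_lin[OF that(1) that(1), of a 0] that(2)
      by (intro bexI[of _ "\<lambda>x. a *\<^sub>R f x + 0 *\<^sub>R f x"]) auto
  qed
  have m_le: "m * ip f f \<le> form f f" if "f \<in> C" for f
  proof (cases "ip f f > 0")
    case True
    then obtain g where "g \<in> C" "ip g g = 1" "form g g = form f f / ip f f" using normalised \<open>f \<in> C\<close> by blast
    then have "form f f / ip f f \<in> Q" unfolding Q_def by (intro image_eqI[of _ _ g]) auto
    then have "m \<le> form f f / ip f f" unfolding m_def using bdd by (intro cInf_lower)
    then show ?thesis using True by (simp add: field_simps)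
  next
    case False
    then have "ip f f = 0" using ip_nonneg[OF Cadm[OF that]] by simp
    then show ?thesis using coer[OF Cadm[OF that]]
        mult_nonneg_nonneg[OF less_imp_le[OF d(1)] idd0[OF Cadm[OF that]]] by simp
  qed
  obtain f0 where f0: "f0 \<in> C" "form f0 f0 < 0" using neg by (auto simp: C_def)
  have "ip f0 f0 > 0"
  proof (rule ccontr)
    assume "\<not> ip f0 f0 > 0"
    then have "ip f0 f0 = 0" using ip_nonneg[OF Cadm[OF f0(1)]] by simp
    then show False using m_le[OF f0(1)] f0(2) by simp
  qed
  then obtain g0 where g0: "g0 \<in> C" "ip g0 g0 = 1" "form g0 g0 < 0"
    using normalised[OF f0(1)] f0(2) by (metis divide_neg_pos)
  have Qne: "Q \<noteq> {}" using g0 by (auto simp: Q_def)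
  have m_neg: "m < 0" using g0 bdd cInf_lower[of "form g0 g0" Q] by (auto simp: Q_def m_def)
  have "\<exists>f\<in>C. ip f f = 1 \<and> form f f < m + 1 / real (Suc n)" for n
  proof -
    have "\<exists>y\<in>Q. y < m + 1 / real (Suc n)"
      by (rule cInf_lessD[OF Qne]) (simp add: m_def[symmetric])
    then show ?thesis by (auto simp: Q_def simp del: of_nat_Suc)
  qed
  then obtain f where f: "\<And>n. f n \<in> C" "\<And>n. ip (f n) (f n) = 1" "\<And>n. form (f n) (f n) < m + 1 / real (Suc n)"
    by metis
  have fa: "adm (f n)" for n using Cadm[OF f(1)] .
  define E where "E = (1 + K) / d"
  define F where "F = 1 / d"
  have fE: "integral {0..P} (\<lambda>x. dd (f n) x \<bullet> dd (f n) x) \<le> E" for n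
  proof -
    have "1 / real (Suc n) \<le> 1" by simp
    then have "form (f n) (f n) \<le> 1" using f(3)[of n] m_neg by linarith
    then show ?thesis using coer[OF fa[of n]] f(2)[of n] d by (simp add: E_def field_simps)
  qed
  have fF: "integral {0..P} (\<lambda>x. f n x \<bullet> f n x) \<le> F" for n
    using ipd[OF fa[of n]] f(2)[of n] d by (simp add: F_def field_simps)
  have E0: "E \<ge> 0" using d by (simp add: E_def)
  \<comment> \<open>The energy bound \<open>E\<close> is uniform along the sequence, so \<eta> can
    be chosen against \<open>E\<close> first, and \<delta> against \<eta> afterwards.\<close>
  have equi: "\<exists>\<delta>>0. \<forall>n. \<forall>x y. \<bar>x - y\<bar> < \<delta> \<longrightarrow> norm (f n x - f n y) \<le> \<epsilon>" if "\<epsilon> > 0" for \<epsilon>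
  proof -
    define \<eta> where "\<eta> = \<epsilon> / (2 * (E + 1))"
    have \<eta>: "\<eta> > 0" "\<eta> * E \<le> \<epsilon> / 2"
      using that E0 by (auto simp: \<eta>_def field_simps)
    define \<delta> where "\<delta> = min P (\<eta> * \<epsilon> / 2)"
    have *: "norm (f n y - f n x) \<le> \<epsilon>" if xy: "x \<le> y" "y - x < \<delta>" for n x y
    proof -
      have "(y - x) / \<eta> \<le> \<epsilon> / 2" using xy \<eta> by (simp add: \<delta>_def field_simps)
      moreover have "y \<le> x + P" using xy by (simp add: \<delta>_def)
      ultimately show ?thesis using increment_bound[OF fa fE \<eta>(1) xy(1), of n] \<eta>(2) by linarith
    qed
    show ?thesis
    proof (intro exI[of _ \<delta>] conjI allI impI)
      show "\<delta> > 0" using P_pos \<eta> that by (simp add: \<delta>_def)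
      fix n x y assume "\<bar>x - y\<bar> < \<delta>"
      then show "norm (f n x - f n y) \<le> \<epsilon>"
        using *[of x y n] *[of y x n] by (cases "x \<le> y") (auto simp: norm_minus_commute)
    qed
  qed
  define B where "B = P + E + 1 + F / P"
  have fB: "norm (f n x) \<le> B" if "x \<in> {0..P}" for n x
    unfolding B_def by (rule sup_bound[OF fa fE fF that])
  have eqc: "\<exists>\<delta>. 0 < \<delta> \<and> (\<forall>n y. y \<in> {0..P} \<and> norm (x - y) < \<delta> \<longrightarrow> norm (f n x - f n y) < \<epsilon>)"
    if "\<epsilon> > 0" for x \<epsilon>
  proof -
    obtain \<delta> where \<delta>: "\<delta> > 0" "\<And>n x y. \<bar>x - y\<bar> < \<delta> \<Longrightarrow> norm (f n x - f n y) \<le> \<epsilon> / 2"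
      using equi[of "\<epsilon> / 2"] \<open>\<epsilon> > 0\<close> by auto
    have "norm (f n x - f n y) < \<epsilon>" if "norm (x - y) < \<delta>" for n y
      using \<delta>(2)[of x y n] that \<open>\<epsilon> > 0\<close> by simp
    with \<delta>(1) show ?thesis by blast
  qed
  obtain g r where r: "strict_mono (r :: nat \<Rightarrow> nat)"
    and gr: "\<And>\<epsilon>. 0 < \<epsilon> \<Longrightarrow> \<exists>N. \<forall>n x. n \<ge> N \<and> x \<in> {0..P} \<longrightarrow> norm (f (r n) x - g x) < \<epsilon>"
  proof (rule Arzela_Ascoli[of "{0..P}" f B])
    show "norm (f n x) \<le> B" if "x \<in> {0..P}" for n x using fB[OF that] .
    show "\<exists>\<delta>. 0 < \<delta> \<and> (\<forall>n y. y \<in> {0..P} \<and> norm (x - y) < \<delta> \<longrightarrow> norm (f n x - f n y) < \<epsilon>)"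
      if "x \<in> {0..P}" "\<epsilon> > 0" for x \<epsilon> using eqc[OF that(2)] .
  qed (use that in auto)
  have conv0: "(\<lambda>n. f (r n) x) \<longlonglongrightarrow> g x" if "x \<in> {0..P}" for x
    unfolding LIMSEQ_iff using gr that by blast
  \<comment> \<open>Arzela-Ascoli gives convergence on one period. Translation by \<open>P\<close>
    multiplies the whole sequence by \<open>\<sigma>\<close>, so convergence spreads to the
    line.\<close>
  have "(convergent (\<lambda>n. f (r n) (x + P))) = convergent (\<lambda>n. f (r n) x)" for x
  proof -
    have *: "convergent (\<lambda>n. \<sigma> *\<^sub>R u n) \<longleftrightarrow> convergent u" for u :: "nat \<Rightarrow> 'a"
      using sign convergent_minus_iff[of u] by auto
    show ?thesis using fa *[of "\<lambda>n. f (r n) x"] by (simp add: adm_def)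
  qed
  then have conv: "convergent (\<lambda>n. f (r n) x)" for x
    using periodic_int[of "\<lambda>x. convergent (\<lambda>n. f (r n) x)" P x] reduce_period[OF P_pos, of x] conv0
    by (metis convergentI)
  define G where "G x = lim (\<lambda>n. f (r n) x)" for x
  have G: "(\<lambda>n. f (r n) x) \<longlonglongrightarrow> G x" for x
    using conv by (simp add: G_def convergent_LIMSEQ_iff)
  have Gp: "G (x + P) = \<sigma> *\<^sub>R G x" for x
    using LIMSEQ_unique[OF G[of "x + P"]] tendsto_scaleR[OF tendsto_const G[of x], of \<sigma>] fa by (simp add: adm_def)
  have Gcont: "continuous_on UNIV G"
    unfolding continuous_on_iff
  proof (intro ballI allI impI)
    fix x :: real and \<epsilon> :: real assume "\<epsilon> > 0"
    then obtain \<delta> where \<delta>: "\<delta> > 0" "\<And>n x y. \<bar>x - y\<bar> < \<delta> \<Longrightarrow> norm (f n x - f n y) \<le> \<epsilon> / 2"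
      using equi[of "\<epsilon> / 2"] by auto
    have "norm (G y - G x) \<le> \<epsilon> / 2" if "\<bar>y - x\<bar> < \<delta>" for y
      using \<delta>(2)[OF that]
      by (intro Lim_bounded[OF tendsto_norm[OF tendsto_diff[OF G G]]]) auto
    then have "norm (G y - G x) < \<epsilon>" if "\<bar>y - x\<bar> < \<delta>" for y
      using that \<open>\<epsilon> > 0\<close> by fastforce
    then show "\<exists>\<delta>>0. \<forall>x'\<in>UNIV. dist x' x < \<delta> \<longrightarrow> dist (G x') (G x) < \<epsilon>"
      using \<delta>(1) by (intro exI[of _ \<delta>]) (simp add: dist_norm)
  qed
  have lim_int: "(\<lambda>n. integral {0..P} (\<lambda>x. f (r n) x \<bullet> h x)) \<longlonglongrightarrow> integral {0..P} (\<lambda>x. G x \<bullet> h x)"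
    if "continuous_on UNIV h" for h
  proof (rule dominated_convergence(2))
    have ch: "continuous_on {0..P} h" using that continuous_on_subset by blast
    show "(\<lambda>x. f (r n) x \<bullet> h x) integrable_on {0..P}" for n
      by (intro integrable_continuous_interval continuous_intros ch C2D_D(4)[OF adm_C2D] fa)
    show "(\<lambda>x. B * norm (h x)) integrable_on {0..P}"
      by (intro integrable_continuous_interval continuous_intros ch)
    show "norm (f (r n) x \<bullet> h x) \<le> B * norm (h x)" if "x \<in> {0..P}" for n x
      using order_trans[OF Cauchy_Schwarz_ineq2 mult_right_mono[OF fB[OF that] norm_ge_zero]] by simp
    show "(\<lambda>n. f (r n) x \<bullet> h x) \<longlonglongrightarrow> G x \<bullet> h x" for x by (intro tendsto_intros G)
  qed
  \<comment> \<open>\<open>R\<close> is nonnegative on \<open>C\<close> by the choice of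
    \<open>m\<close>, so Cauchy-Schwarz holds there. Since \<open>R (f n) (f n)\<close> is at most 1
    / (n + 1), \<open>R (f n)\<close> tends to 0 against each element of \<open>C\<close>.\<close>
  define R where "R = (\<lambda>u v. form u v - m * ip u v)"
  have R_lin: "R (\<lambda>x. a *\<^sub>R u x + b *\<^sub>R v x) h = a * R u h + b * R v h" if "adm u" "adm v" "adm h" for a b u v h
    using that by (simp add: R_def form_lin ip_lin algebra_simps)
  have R_sym: "R u v = R v u" for u v by (simp add: R_def form_sym[of u] ip_sym[of u])
  have Rf: "R (f n) (f n) \<le> 1 / real (Suc n)" for n using f(2,3)[of n] by (simp add: R_def)
  have "(\<lambda>n. R (f n) \<eta>) \<longlonglongrightarrow> 0" if \<eta>: "\<eta> \<in> C" for \<eta>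
  proof -
    have CS: "(R (f n) \<eta>)\<^sup>2 \<le> R (f n) (f n) * R \<eta> \<eta>" for n
    proof (rule semidefinite_cauchy_schwarz)
      fix t
      have "0 \<le> R (\<lambda>x. 1 *\<^sub>R f n x + t *\<^sub>R \<eta> x) (\<lambda>x. 1 *\<^sub>R f n x + t *\<^sub>R \<eta> x)"
        using m_le[OF C_lin[OF f(1)[of n] \<eta>, of 1 t]] unfolding R_def by simp
      also have "\<dots> = R (f n) (f n) + 2 * t * R (f n) \<eta> + t\<^sup>2 * R \<eta> \<eta>"
        unfolding R_def form_quadratic[OF fa Cadm[OF \<eta>]] by (simp add: algebra_simps)
      finally show "0 \<le> R (f n) (f n) + 2 * t * R (f n) \<eta> + t\<^sup>2 * R \<eta> \<eta>" .
    qed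
    have R\<eta>: "R \<eta> \<eta> \<ge> 0" using m_le[OF \<eta>] by (simp add: R_def)
    have le: "(R (f n) \<eta>)\<^sup>2 \<le> 1 / real (Suc n) * R \<eta> \<eta>" for n
      using CS[of n] mult_right_mono[OF Rf[of n] R\<eta>] by linarith
    have lim0: "(\<lambda>n. 1 / real (Suc n) * R \<eta> \<eta>) \<longlonglongrightarrow> 0"
      using tendsto_mult_left_zero[OF LIMSEQ_inverse_real_of_nat] by (simp add: inverse_eq_divide)
    have "(\<lambda>n. (R (f n) \<eta>)\<^sup>2) \<longlonglongrightarrow> 0"
    proof (rule tendsto_sandwich[OF _ _ tendsto_const lim0])
      show "\<forall>\<^sub>F n in sequentially. 0 \<le> (R (f n) \<eta>)\<^sup>2" by simp
      show "\<forall>\<^sub>F n in sequentially. (R (f n) \<eta>)\<^sup>2 \<le> 1 / real (Suc n) * R \<eta> \<eta>"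
        by (rule always_eventually) (intro allI le)
    qed
    then show ?thesis by (simp add: tendsto_null_power)
  qed
  then have RC: "(\<lambda>n. R (f (r n)) \<eta>) \<longlonglongrightarrow> 0" if "\<eta> \<in> C" for \<eta>
    using LIMSEQ_subseq_LIMSEQ[OF _ r, of "\<lambda>n. R (f n) \<eta>"] that by (simp add: o_def)
  have RA: "(\<lambda>n. R (f (r n)) \<eta>) \<longlonglongrightarrow> 0" if \<eta>: "adm \<eta>" for \<eta>
  proof -
    \<comment> \<open>A general test function is split into its projection onto the earlier
      eigenfunctions and an element of \<open>C\<close>. On the projection \<open>R (f n)\<close>
      vanishes exactly, because the \<open>e i\<close> solve their equations and are orthogonal to
      \<open>f n\<close>.\<close>
    define p where "p x = (\<Sum>i<k. ip \<eta> (e i) *\<^sub>R e i x)" for x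
    have pa: "adm p" unfolding p_def by (intro adm_sum ae) auto
    define \<zeta> where "\<zeta> = (\<lambda>x. 1 *\<^sub>R \<eta> x + (-1) *\<^sub>R p x)"
    have za: "adm \<zeta>" unfolding \<zeta>_def by (intro adm_lin \<eta> pa)
    have "ip p (e j) = ip \<eta> (e j)" if "j < k" for j
    proof -
      have "ip p (e j) = (\<Sum>i<k. ip \<eta> (e i) * ip (e i) (e j))"
        unfolding p_def using ae that by (intro form_sum) auto
      also have "\<dots> = (\<Sum>i<k. if i = j then ip \<eta> (e j) else 0)"
        using that by (intro sum.cong) (auto simp: e_orth)
      finally show ?thesis using that by simp
    qed
    then have "ip \<zeta> (e j) = 0" if "j < k" for j
      unfolding \<zeta>_def ip_lin[OF \<eta> pa ae[OF that]] using that by simp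
    then have "\<zeta> \<in> C" using za by (simp add: C_def)
    moreover have "R (f n) \<eta> = R (f n) \<zeta>" for n
    proof -
      have "R p (f n) = 0"
      proof -
        have "form (e i) (f n) = 0" "ip (e i) (f n) = 0" if "i < k" for i
          using form_sol[OF fa[of n] e[OF that]] f(1)[of n] that
          by (auto simp: C_def form_sym[of "e i"] ip_sym[of "e i"])
        then have "form p (f n) = 0" "ip p (f n) = 0"
          unfolding p_def using form_sum[of "{..<k}" e "f n" "\<lambda>i. ip \<eta> (e i)"] ae fa by simp_all
        then show ?thesis unfolding R_def by simp
      qed
      then show ?thesis
        unfolding \<zeta>_def R_sym[of "f n"] R_lin[OF \<eta> pa fa] by simp
    qed
    ultimately show ?thesis using RC by simp
  qed
  define H where "H x = V x (G x) - (m * w x) *\<^sub>R G x" for x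
  have Hc: "continuous_on UNIV H" unfolding H_def by (intro continuous_intros cont_V Gcont)
  have Hp: "H (x + P) = \<sigma> *\<^sub>R H x" for x
    using V_lin[of x \<sigma> "G x" 0 0] by (simp add: H_def Gp V_per w_per scaleR_diff_right mult.commute)
  have weak: "integral {0..P} (\<lambda>x. H x \<bullet> \<eta> x - G x \<bullet> qd D \<eta> x) = 0" if \<eta>: "adm \<eta>" for \<eta>
  proof -
    \<comment> \<open>All derivatives are moved to the test function, so that the passage to the
      limit uses only bounded pointwise convergence of the functions themselves.\<close>
    define h where "h x = V x (\<eta> x) - (m * w x) *\<^sub>R \<eta> x - qd D \<eta> x" for x
    have hc: "continuous_on UNIV h"
      unfolding h_def by (intro continuous_intros cont_V C2D_D[OF adm_C2D[OF \<eta>]])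
    have "R (f n) \<eta> = integral {0..P} (\<lambda>x. f n x \<bullet> h x)" for n
    proof -
      have "R (f n) \<eta> = integral {0..P} (\<lambda>x. (D x * (dd (f n) x \<bullet> dd \<eta> x) + V x (f n x) \<bullet> \<eta> x) -
          m * (w x * (f n x \<bullet> \<eta> x)))"
        unfolding R_def form_def ip_def
        by (subst Henstock_Kurzweil_Integration.integral_diff)
           (auto intro!: integrable_on_cmult_left[where 'b = real, simplified] int_ip int_form fa \<eta>)
      also have "\<dots> = integral {0..P} (\<lambda>x. (D x * (dd (f n) x \<bullet> dd \<eta> x) + f n x \<bullet> qd D \<eta> x) + f n x \<bullet> h x)"
        by (intro integral_cong)
           (simp add: h_def inner_diff_right V_sym[of _ "f n _" "\<eta> _"] inner_commute[of "f n _" "V _ (\<eta> _)"])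
      also have "\<dots> = 0 + integral {0..P} (\<lambda>x. f n x \<bullet> h x)"
      proof -
        have "(\<lambda>x. f n x \<bullet> h x) integrable_on {0..P}"
          by (intro integrable_continuous_interval continuous_intros C2D_D(4)[OF adm_C2D[OF fa]]
              continuous_on_subset[OF hc] subset_UNIV)
        then show ?thesis
          by (intro integral_unique has_integral_add green[OF fa \<eta>] integrable_integral)
      qed
      finally show ?thesis by simp
    qed
    with RA[OF \<eta>] lim_int[OF hc] have "integral {0..P} (\<lambda>x. G x \<bullet> h x) = 0"
      using LIMSEQ_unique by auto
    also have "integral {0..P} (\<lambda>x. G x \<bullet> h x) = integral {0..P} (\<lambda>x. H x \<bullet> \<eta> x - G x \<bullet> qd D \<eta> x)"
      by (intro integral_cong)
         (simp add: h_def H_def inner_diff_right inner_diff_left V_sym[of _ "G _" "\<eta> _"] inner_commute[of "G _" "V _ (\<eta> _)"])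
    finally show ?thesis .
  qed
  have Gadm: "adm G" and Gq: "qd D G = H" using weak_solution[OF Gcont Gp Hc Hp weak] by auto
  have "sol m G" using Gadm Gq by (simp add: sol_def H_def)
  moreover have "ip G (e i) = 0" if "i < k" for i
  proof -
    have c: "continuous_on UNIV (\<lambda>x. w x *\<^sub>R e i x)" by (intro continuous_intros C2D_D(4)[OF adm_C2D] ae that)
    have "ip (f n) (e i) = 0" for n using f(1)[of n] that by (auto simp: C_def)
    then show ?thesis using LIMSEQ_unique[OF lim_int[OF c]] by (simp add: ip_def)
  qed
  \<comment> \<open>No mass is lost in the limit: the sequence is uniformly bounded by
    \<open>B\<close> and converges pointwise.\<close>
  moreover have "ip G G = 1"
  proof -
    have "(\<lambda>n. integral {0..P} (\<lambda>x. w x * (f (r n) x \<bullet> f (r n) x))) \<longlonglongrightarrow> integral {0..P} (\<lambda>x. w x * (G x \<bullet> G x))"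
    proof (rule dominated_convergence(2))
      show "(\<lambda>x. w x * (f (r n) x \<bullet> f (r n) x)) integrable_on {0..P}" for n by (rule int_ip[OF fa fa])
      show "(\<lambda>x. w x * (B * B)) integrable_on {0..P}"
        by (intro integrable_continuous_interval continuous_intros)
      show "norm (w x * (f (r n) x \<bullet> f (r n) x)) \<le> w x * (B * B)" if "x \<in> {0..P}" for n x
        using fB[OF that, of "r n"] w_pos[of x] mult_mono[OF fB[OF that, of "r n"] fB[OF that, of "r n"]]
        by (simp add: dot_square_norm power2_eq_square abs_mult)
      show "(\<lambda>n. w x * (f (r n) x \<bullet> f (r n) x)) \<longlonglongrightarrow> w x * (G x \<bullet> G x)" for x by (intro tendsto_intros G)
    qed
    then show ?thesis using f(2) LIMSEQ_unique[of "\<lambda>n. 1" _ 1] by (auto simp: ip_def LIMSEQ_const_iff)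
  qed
  ultimately show ?thesis using that m_neg by blast
qed

text \<open>The Courant-Fischer principle by induction: as long as k < N, some nontrivial
  combination of the \<open>N\<close> trial functions is orthogonal to the k eigenfunctions already
  found, and its form is negative, so \<open>next_eigenfunction\<close> applies.\<close>

theorem negative_eigenfunctions:
  fixes N :: nat
  assumes g: "\<And>i. i < N \<Longrightarrow> adm (g i)"
    and neg: "\<And>c. \<exists>i<N. c i \<noteq> 0 \<Longrightarrow> form (\<lambda>x. \<Sum>i<N. c i *\<^sub>R g i x) (\<lambda>x. \<Sum>i<N. c i *\<^sub>R g i x) < 0"
  obtains e l where "\<And>i. i < N \<Longrightarrow> sol (l i) (e i)" "\<And>i. i < N \<Longrightarrow> l i < 0"
    "\<And>i j. i < N \<Longrightarrow> j < N \<Longrightarrow> ip (e i) (e j) = (if i = j then 1 else 0)"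
proof -
  have "\<exists>e l. \<forall>i<k. sol (l i) (e i) \<and> l i < 0 \<and> (\<forall>j<k. ip (e i) (e j) = (if i = j then 1 else 0))"
    if "k \<le> N" for k
    using that
  proof (induction k)
    case (Suc k)
    then obtain e l where el: "\<And>i. i < k \<Longrightarrow> sol (l i) (e i)" "\<And>i. i < k \<Longrightarrow> l i < 0"
      "\<And>i j. i < k \<Longrightarrow> j < k \<Longrightarrow> ip (e i) (e j) = (if i = j then 1 else 0)" by auto
    obtain c where c: "\<exists>i\<in>{..<N}. c i \<noteq> 0" "\<And>j. j < k \<Longrightarrow> (\<Sum>i<N. c i * ip (g i) (e j)) = 0"
      using common_kernel_vector[of "{..<N}" k "\<lambda>i j. ip (g i) (e j)"] Suc.prems by auto
    define f where "f x = (\<Sum>i<N. c i *\<^sub>R g i x)" for x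
    have "adm f" unfolding f_def using g by (intro adm_sum) auto
    moreover have "ip f (e j) = 0" if "j < k" for j
    proof -
      have "ip f (e j) = (\<Sum>i<N. c i * ip (g i) (e j))"
        unfolding f_def using g el(1)[OF that] by (intro form_sum) (auto simp: sol_def)
      then show ?thesis using c(2)[OF that] by simp
    qed
    moreover have "form f f < 0" unfolding f_def using neg c(1) by auto
    ultimately have ex: "\<exists>f. adm f \<and> (\<forall>i<k. ip f (e i) = 0) \<and> form f f < 0" by blast
    obtain h m where h: "sol m h" "m < 0" "ip h h = 1" "\<And>i. i < k \<Longrightarrow> ip h (e i) = 0"
    proof (rule next_eigenfunction[of k l e])
      show "sol (l i) (e i)" if "i < k" for i using el(1)[OF that] .
      show "ip (e i) (e j) = (if i = j then 1 else 0)" if "i < k" "j < k" for i j using el(3)[OF that] .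
      show "\<exists>f. adm f \<and> (\<forall>i<k. ip f (e i) = 0) \<and> form f f < 0" by (rule ex)
    qed (use that in blast)
    have h': "ip (e i) h = 0" if "i < k" for i using h(4)[OF that] ip_sym[of "e i" h] by simp
    have "\<forall>i<Suc k. sol ((l(k := m)) i) ((e(k := h)) i) \<and> (l(k := m)) i < 0 \<and>
        (\<forall>j<Suc k. ip ((e(k := h)) i) ((e(k := h)) j) = (if i = j then 1 else 0))"
      using el h h' by (auto simp: less_Suc_eq)
    then show ?case by blast
  qed auto
  from this[of N] show ?thesis using that by auto
qed

text \<open>A Gronwall argument for E = |f|^2 + |D f'|^2. The equation gives |E'| \<le> C E, so E
  exp (- C x) is nonincreasing and E exp (C x) nondecreasing; the first settles the points right of
  \<open>x0\<close>, the second those left of it.\<close>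

lemma linear_ode_unique:
  assumes f: "C2D D f" "\<And>x. qd D f x = V x (f x) - (l * w x) *\<^sub>R f x"
    and zero: "f x0 = 0" "dd f x0 = 0"
  shows "f x = 0"
proof -
  obtain d M where d: "d > 0" "\<And>x. d \<le> D x" "\<And>x. D x \<le> M"
    using positive_periodic_bounds[OF D_cont D_per P_pos D_pos] by blast
  obtain d2 M2 where d2: "d2 > 0" "\<And>x. d2 \<le> w x" "\<And>x. w x \<le> M2"
    using positive_periodic_bounds[OF w_cont w_per P_pos w_pos] by blast
  obtain K0 where K0: "\<And>x u. norm (V x u) \<le> K0 * norm u" using V_bound by blast
  define C where "C = 1 / d + (K0 + \<bar>l\<bar> * M2)"
  define v where "v x = D x *\<^sub>R dd f x" for x
  define E where "E x = f x \<bullet> f x + v x \<bullet> v x" for x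
  define E' where "E' x = 2 * (f x \<bullet> dd f x + v x \<bullet> qd D f x)" for x
  have dE: "(E has_real_derivative E' x) (at x)" for x
  proof -
    have "((\<lambda>x. f x \<bullet> f x + v x \<bullet> v x) has_vector_derivative
        (f x \<bullet> dd f x + dd f x \<bullet> f x) + (v x \<bullet> qd D f x + qd D f x \<bullet> v x)) (at x)"
      unfolding v_def
      by (intro has_vector_derivative_add bounded_bilinear.has_vector_derivative[OF bounded_bilinear_inner] C2D_D[OF f(1)])
    then show ?thesis
      unfolding has_real_derivative_iff_has_vector_derivative
      by (simp add: E_def[abs_def] E'_def inner_commute)
  qed
  have E0: "E x \<ge> 0" for x by (simp add: E_def)
  have bound: "\<bar>E' x\<bar> \<le> C * E x" for x
  proof -
    have dn: "norm (dd f x) \<le> 1 / d * norm (v x)"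
    proof -
      have "norm (v x) = D x * norm (dd f x)" using D_pos[of x] by (simp add: v_def)
      moreover have "d * norm (dd f x) \<le> D x * norm (dd f x)" using d by (intro mult_right_mono) auto
      ultimately show ?thesis using d by (simp add: field_simps)
    qed
    have qn: "norm (qd D f x) \<le> (K0 + \<bar>l\<bar> * M2) * norm (f x)"
    proof -
      have "norm (qd D f x) \<le> norm (V x (f x)) + norm ((l * w x) *\<^sub>R f x)"
        unfolding f(2) by (rule norm_triangle_ineq4)
      also have "\<dots> \<le> K0 * norm (f x) + (\<bar>l\<bar> * M2) * norm (f x)"
        using d2 w_pos[of x] by (intro add_mono K0) (auto simp: abs_mult intro!: mult_right_mono mult_left_mono)
      finally show ?thesis by (simp add: algebra_simps)
    qed
    have "\<bar>f x \<bullet> dd f x + v x \<bullet> qd D f x\<bar> \<le> norm (f x) * norm (dd f x) + norm (v x) * norm (qd D f x)"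
      by (rule order_trans[OF abs_triangle_ineq add_mono[OF Cauchy_Schwarz_ineq2 Cauchy_Schwarz_ineq2]])
    also have "\<dots> \<le> norm (f x) * (1 / d * norm (v x)) + norm (v x) * ((K0 + \<bar>l\<bar> * M2) * norm (f x))"
      by (intro add_mono mult_left_mono dn qn) auto
    also have "\<dots> = C * (norm (f x) * norm (v x))" by (simp add: C_def algebra_simps)
    finally have 1: "\<bar>f x \<bullet> dd f x + v x \<bullet> qd D f x\<bar> \<le> C * (norm (f x) * norm (v x))" .
    have K00: "K0 + \<bar>l\<bar> * M2 \<ge> 0"
    proof -
      obtain u :: 'a where "u \<in> Basis" using nonempty_Basis by blast
      then have "K0 \<ge> 0" using K0[of x u] norm_ge_zero[of "V x u"]
        by (metis norm_Basis mult_1_right order_trans)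
      moreover have "M2 \<ge> 0" using d2(1) d2(2)[of 0] d2(3)[of 0] by linarith
      ultimately show ?thesis by simp
    qed
    have "2 * (norm (f x) * norm (v x)) \<le> E x"
      using zero_le_power2[of "norm (f x) - norm (v x)"]
      by (simp add: E_def dot_square_norm power2_diff)
    then have "C * (2 * (norm (f x) * norm (v x))) \<le> C * E x"
      using K00 d by (intro mult_left_mono) (auto simp: C_def)
    with 1 show ?thesis by (simp add: E'_def abs_mult)
  qed
  have Ex0: "E x0 = 0" using zero by (simp add: E_def v_def)
  have "E x \<le> 0"
  proof (cases "x \<ge> x0")
    case True
    have "E x * exp (- C * x) \<le> E x0 * exp (- C * x0)"
    proof (rule DERIV_nonpos_imp_nonincreasing[OF True])
      fix y
      have "((\<lambda>y. E y * exp (- C * y)) has_real_derivative (E' y - C * E y) * exp (- C * y)) (at y)"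
        by (auto intro!: derivative_eq_intros dE simp: algebra_simps)
      moreover have "(E' y - C * E y) * exp (- C * y) \<le> 0"
        using bound[of y] by (intro mult_nonpos_nonneg) auto
      ultimately show "\<exists>z. ((\<lambda>y. E y * exp (- C * y)) has_real_derivative z) (at y) \<and> z \<le> 0" by blast
    qed
    then show ?thesis by (simp add: Ex0 mult_le_0_iff)
  next
    case False
    then have "x \<le> x0" by simp
    then have "E x * exp (C * x) \<le> E x0 * exp (C * x0)"
    proof (rule DERIV_nonneg_imp_nondecreasing)
      fix y
      have "((\<lambda>y. E y * exp (C * y)) has_real_derivative (E' y + C * E y) * exp (C * y)) (at y)"
        by (auto intro!: derivative_eq_intros dE simp: algebra_simps)
      moreover have "(E' y + C * E y) * exp (C * y) \<ge> 0"
        using bound[of y] by (intro mult_nonneg_nonneg) auto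
      ultimately show "\<exists>z. ((\<lambda>y. E y * exp (C * y)) has_real_derivative z) (at y) \<and> 0 \<le> z" by blast
    qed
    then show ?thesis by (simp add: Ex0 mult_le_0_iff)
  qed
  moreover have "f x \<bullet> f x \<le> E x" by (simp add: E_def)
  ultimately have "f x \<bullet> f x = 0" using inner_ge_zero[of "f x"] by linarith
  then show ?thesis by simp
qed

end

section \<open>Equispaced zeros and trigonometric functions\<close>

text \<open>\<open>k * tan (k * (x - m))\<close> is minus the logarithmic derivative of cos (k (x -
  m)), which is positive on the interval because k (r - p) < pi. Completing the square with it
  leaves a total derivative that vanishes at the end points together with \<open>f\<close>.\<close>

lemma wirtinger_interval:
  fixes f :: "real \<Rightarrow> real"
  assumes f: "\<And>x. x \<in> {p..r} \<Longrightarrow> (f has_real_derivative f' x) (at x)" and c: "continuous_on {p..r} f'"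
    and zero: "f p = 0" "f r = 0" and k: "k \<ge> 0" "k * (r - p) < pi" and pr: "p \<le> r"
  shows "k\<^sup>2 * integral {p..r} (\<lambda>x. (f x)\<^sup>2) \<le> integral {p..r} (\<lambda>x. (f' x)\<^sup>2)"
proof -
  define m where "m = (p + r) / 2"
  define h where "h x = (f' x + k * tan (k * (x - m)) * f x)\<^sup>2" for x
  have cf: "continuous_on {p..r} f"
    using f by (meson DERIV_isCont continuous_at_imp_continuous_on)
  have cosn: "cos (k * (x - m)) > 0" if "x \<in> {p..r}" for x
  proof -
    have "\<bar>x - m\<bar> \<le> (r - p) / 2" using that unfolding m_def abs_le_iff by (auto simp: field_simps)
    then have "k * \<bar>x - m\<bar> \<le> k * ((r - p) / 2)" using k by (intro mult_left_mono)
    then have "\<bar>k * (x - m)\<bar> < pi / 2" using k by (simp add: abs_mult)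
    then show ?thesis by (intro cos_gt_zero_pi) auto
  qed
  have D: "((\<lambda>x. k * tan (k * (x - m)) * (f x)\<^sup>2) has_real_derivative
      h x - ((f' x)\<^sup>2 - k\<^sup>2 * (f x)\<^sup>2)) (at x)" if "x \<in> {p..r}" for x
  proof -
    have t: "inverse ((cos (k * (x - m)))\<^sup>2) = 1 + (tan (k * (x - m)))\<^sup>2"
      using tan_sec[of "k * (x - m)"] cosn[OF that] by (simp add: power_inverse)
    have T: "((\<lambda>x. tan (k * (x - m))) has_real_derivative k * (1 + (tan (k * (x - m)))\<^sup>2)) (at x)"
      using cosn[OF that] unfolding t[symmetric] by (auto intro!: derivative_eq_intros)
    have "((\<lambda>x. (k * tan (k * (x - m))) * (f x * f x)) has_real_derivative
       (k * (k * (1 + (tan (k * (x - m)))\<^sup>2))) * (f x * f x) + (f' x * f x + f' x * f x) * (k * tan (k * (x - m)))) (at x)"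
      by (intro DERIV_mult DERIV_cmult T f[OF that])
    then show ?thesis
      unfolding h_def power2_eq_square by (simp add: algebra_simps)
  qed
  have int: "((\<lambda>x. h x - ((f' x)\<^sup>2 - k\<^sup>2 * (f x)\<^sup>2)) has_integral
     k * tan (k * (r - m)) * (f r)\<^sup>2 - k * tan (k * (p - m)) * (f p)\<^sup>2) {p..r}"
    using pr by (intro fundamental_theorem_of_calculus)
      (auto intro!: has_field_derivative_at_within D simp flip: has_real_derivative_iff_has_vector_derivative)
  have i1: "(\<lambda>x. (f' x)\<^sup>2) integrable_on {p..r}" and i2: "(\<lambda>x. (f x)\<^sup>2) integrable_on {p..r}"
    by (intro integrable_continuous_interval continuous_intros c cf)+
  have i3: "h integrable_on {p..r}"
    unfolding h_def by (intro integrable_continuous_interval continuous_intros c cf) (use cosn in force)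
  have "integral {p..r} (\<lambda>x. h x - ((f' x)\<^sup>2 - k\<^sup>2 * (f x)\<^sup>2)) = 0"
    using integral_unique[OF int] zero by simp
  moreover have "integral {p..r} (\<lambda>x. h x - ((f' x)\<^sup>2 - k\<^sup>2 * (f x)\<^sup>2)) =
      integral {p..r} h - (integral {p..r} (\<lambda>x. (f' x)\<^sup>2) - k\<^sup>2 * integral {p..r} (\<lambda>x. (f x)\<^sup>2))"
    using i1 i2 i3
    by (simp add: Henstock_Kurzweil_Integration.integral_diff integrable_diff
        integrable_on_cmult_left[where 'b = real, simplified])
  moreover have "integral {p..r} h \<ge> 0" using i3 by (intro integral_nonneg) (auto simp: h_def)
  ultimately show ?thesis by linarith
qed

text \<open>The zeros cut the period into pieces of length P / N, to which
  \<open>wirtinger_interval\<close> applies. The zero at \<open>P\<close> comes from the one at 0,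
  so only \<open>N\<close> conditions are imposed on \<open>f\<close>.\<close>

lemma wirtinger_equispaced:
  fixes f :: "real \<Rightarrow> real"
  assumes f: "\<And>x. (f has_real_derivative f' x) (at x)" and c: "continuous_on UNIV f'"
    and N: "N > 0" and zero: "\<And>i. i < N \<Longrightarrow> f (P * real i / real N) = 0" and per: "f P = \<sigma> * f 0"
    and k: "k \<ge> 0" "k * P < pi * real N" and P: "P > 0"
  shows "k\<^sup>2 * integral {0..P} (\<lambda>x. (f x)\<^sup>2) \<le> integral {0..P} (\<lambda>x. (f' x)\<^sup>2)"
proof -
  define x where "x i = P * real i / real N" for i :: nat
  have c': "continuous_on A f'" for A using c continuous_on_subset by blast
  have cf: "continuous_on A f" for A using f by (meson DERIV_isCont continuous_at_imp_continuous_on)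
  have i1: "(\<lambda>x. (f' x)\<^sup>2) integrable_on {u..v}" and i2: "(\<lambda>x. (f x)\<^sup>2) integrable_on {u..v}" for u v
    by (intro integrable_continuous_interval continuous_intros c' cf)+
  have z: "f (x i) = 0" if "i \<le> N" for i
    using zero[of i] zero[of 0] per N that by (cases "i = N") (auto simp: x_def)
  have mono: "x i \<le> x (Suc i)" "0 \<le> x i" for i using P by (auto simp: x_def divide_right_mono)
  have "k\<^sup>2 * integral {0..x n} (\<lambda>x. (f x)\<^sup>2) \<le> integral {0..x n} (\<lambda>x. (f' x)\<^sup>2)" if "n \<le> N" for n
    using that
  proof (induction n)
    case 0
    then show ?case by (simp add: x_def)
  next
    case (Suc n)
    have len: "x (Suc n) - x n = P / real N" by (simp add: x_def field_simps add_divide_distrib)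
    have "k\<^sup>2 * integral {x n..x (Suc n)} (\<lambda>x. (f x)\<^sup>2) \<le> integral {x n..x (Suc n)} (\<lambda>x. (f' x)\<^sup>2)"
      using Suc.prems N k mono[of n]
      by (intro wirtinger_interval f c' z) (auto simp: len field_simps)
    moreover have "integral {0..x (Suc n)} g = integral {0..x n} g + integral {x n..x (Suc n)} g"
      if "\<And>u v. g integrable_on {u..v}" for g :: "real \<Rightarrow> real"
      using Henstock_Kurzweil_Integration.integral_combine[of 0 "x n" "x (Suc n)" g] mono[of n] that by simp
    ultimately show ?case using Suc i1 i2 by (simp add: distrib_left)
  qed
  from this[of N] show ?thesis using N by (simp add: x_def)
qed

lemma C2D_Pair:
  assumes "C2D D X" "C2D D Y"
  shows "C2D D (\<lambda>x. (X x, Y x))" "dd (\<lambda>x. (X x, Y x)) = (\<lambda>x. (dd X x, dd Y x))"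
    "qd D (\<lambda>x. (X x, Y x)) = (\<lambda>x. (qd D X x, qd D Y x))"
proof -
  note d = C2D_D[OF assms(1)] and e = C2D_D[OF assms(2)]
  show "C2D D (\<lambda>x. (X x, Y x))" "dd (\<lambda>x. (X x, Y x)) = (\<lambda>x. (dd X x, dd Y x))"
    "qd D (\<lambda>x. (X x, Y x)) = (\<lambda>x. (qd D X x, qd D Y x))"
    using C2DI[of "\<lambda>x. (X x, Y x)" "\<lambda>x. (dd X x, dd Y x)" D "\<lambda>x. (qd D X x, qd D Y x)"]
      has_vector_derivative_Pair[OF d(1) e(1)] has_vector_derivative_Pair[OF d(2) e(2)]
      continuous_on_Pair[OF d(3) e(3)] by auto
qed

lemma cos_shift_pi: "cos (x + pi * real n) = (-1) ^ n * cos x"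
  and sin_shift_pi: "sin (x + pi * real n) = (-1) ^ n * sin x"
proof -
  have "cos (x + pi * real n) = (-1) ^ n * cos x \<and> sin (x + pi * real n) = (-1) ^ n * sin x"
  proof (induction n)
    case (Suc n)
    have "x + pi * real (Suc n) = (x + pi * real n) + pi" by (simp add: algebra_simps)
    then show ?case using Suc by (simp only: cos_periodic_pi sin_periodic_pi) simp
  qed auto
  then show "cos (x + pi * real n) = (-1) ^ n * cos x" "sin (x + pi * real n) = (-1) ^ n * sin x" by auto
qed

section \<open>The coefficients of the Jacobi equation\<close>

locale otsuki =
  fixes b :: real
  assumes b_gt: "- pi / 2 < b" and b_lt: "b < 0"
begin

text \<open>The angle \<open>x\<close> with \<open>sin \<phi> = amp * sin x\<close> removes the square root singularities at the turning
  points of \<open>\<phi>\<close>. In this variable \<open>cc\<close> and \<open>SS\<close> are the cosine and sine of \<open>\<phi>\<close>, while \<open>gg\<close>, \<open>kk\<close> and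
  \<open>DD / cc\<close> are the derivatives of \<open>\<phi>\<close>, \<open>\<theta>\<close> and \<open>x\<close> with respect to the arclength of the profile curve.\<close>

definition amp :: real where "amp = - sin b"
definition kap :: real where "kap = (cos b)\<^sup>2"
definition cc :: "real \<Rightarrow> real" where "cc x = sqrt (1 - (amp * sin x)\<^sup>2)"
definition SS :: "real \<Rightarrow> real" where "SS x = amp * sin x"
definition DD :: "real \<Rightarrow> real" where "DD x = sqrt ((cc x)\<^sup>2 + kap)"
definition gg :: "real \<Rightarrow> real" where "gg x = amp * cos x * DD x / (cc x)\<^sup>2"
definition kk :: "real \<Rightarrow> real" where "kk x = kap / (cc x) ^ 3"

lemma amp: "0 < amp" "amp < 1"
  using b_gt b_lt sin_lt_zero[of "-b + pi"] sin_gt_zero[of "-b"] sin_monotone_2pi[of "-pi/2" b]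
  by (auto simp: amp_def)

lemma kap: "kap = 1 - amp\<^sup>2" "0 < kap" "kap < 1"
proof -
  show 1: "kap = 1 - amp\<^sup>2" by (simp add: kap_def amp_def cos_squared_eq)
  have "amp\<^sup>2 < 1\<^sup>2" using amp by (intro power_strict_mono) auto
  then show "0 < kap" "kap < 1" using amp by (auto simp: 1)
qed

lemma SS_bound: "(SS x)\<^sup>2 \<le> amp\<^sup>2"
  using mult_left_mono[of "(sin x)\<^sup>2" 1 "amp\<^sup>2"]
  by (simp add: SS_def power_mult_distrib abs_square_le_1)

lemma cc2: "(cc x)\<^sup>2 = 1 - (SS x)\<^sup>2"
  using SS_bound[of x] kap by (simp add: cc_def SS_def)

lemma cc_bounds: "0 < cc x" "kap \<le> (cc x)\<^sup>2" "(cc x)\<^sup>2 \<le> 1"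
proof -
  show 1: "kap \<le> (cc x)\<^sup>2" "(cc x)\<^sup>2 \<le> 1" using SS_bound[of x] by (simp_all add: cc2 kap)
  have "cc x \<noteq> 0" using 1 kap by auto
  moreover have "cc x \<ge> 0" unfolding cc_def using SS_bound[of x] kap by (simp add: SS_def)
  ultimately show "0 < cc x" by simp
qed

lemma DD2: "(DD x)\<^sup>2 = (cc x)\<^sup>2 + kap" using kap by (simp add: DD_def)
lemma DD_pos: "0 < DD x" using kap by (simp add: DD_def add_nonneg_pos)
lemma nz [simp]: "cc x \<noteq> 0" "DD x \<noteq> 0" using cc_bounds[of x] DD_pos[of x] by auto

text \<open>Together with \<open>DD2\<close> this factors cos^4 \<phi> - cos^4 b into
  \<open>(amp * cos x)\<^sup>2\<close> and \<open>(DD x)\<^sup>2\<close>; the first factor carries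
  the zeros at the turning points.\<close>

lemma ampcos: "(amp * cos x)\<^sup>2 = (cc x)\<^sup>2 - kap"
proof -
  have "(amp * cos x)\<^sup>2 = amp\<^sup>2 - (SS x)\<^sup>2" using sin_cos_squared_add[of x]
    by (simp add: SS_def power_mult_distrib cos_squared_eq algebra_simps)
  then show ?thesis by (simp add: cc2 kap)
qed

lemma gg2: "(gg x)\<^sup>2 * (cc x) ^ 4 = (cc x) ^ 4 - kap\<^sup>2"
proof -
  have "(gg x)\<^sup>2 * (cc x) ^ 4 = (amp * cos x)\<^sup>2 * (DD x)\<^sup>2"
    by (simp add: gg_def power_divide power_mult_distrib)
  also have "\<dots> = (cc x) ^ 4 - kap\<^sup>2"
    unfolding ampcos DD2 by (simp add: algebra_simps power2_eq_square power4_eq_xxxx)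
  finally show ?thesis .
qed

text \<open>Unit speed of the profile curve: \<open>gg\<close> and \<open>cc * kk\<close> are the
  components of its velocity in the metric d\<phi>^2 + cos^2 \<phi> d\<theta>^2.\<close>

lemma gg2': "(gg x)\<^sup>2 = 1 - (cc x * kk x)\<^sup>2"
proof -
  have "(cc x * kk x)\<^sup>2 = kap\<^sup>2 / (cc x) ^ 4"
    by (simp add: kk_def power_divide power_mult_distrib power2_eq_square power3_eq_cube power4_eq_xxxx)
  moreover have "(gg x)\<^sup>2 = ((cc x) ^ 4 - kap\<^sup>2) / (cc x) ^ 4"
    using gg2[of x] by (simp add: field_simps)
  ultimately show ?thesis by (simp add: diff_divide_distrib)
qed

lemma shift: "SS (x + pi * real n) = (-1) ^ n * SS x" "cc (x + pi * real n) = cc x"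
  "DD (x + pi * real n) = DD x" "gg (x + pi * real n) = (-1) ^ n * gg x" "kk (x + pi * real n) = kk x"
  by (simp_all add: SS_def cc_def DD_def gg_def kk_def cos_shift_pi sin_shift_pi power_mult_distrib flip: power_mult)

text \<open>Derivatives in \<open>x\<close> are written as \<open>cc x / DD x\<close> times the
  derivative in arclength, the form in which all later computations take place.\<close>

lemma deriv_cc: "(cc has_real_derivative cc x / DD x * (- SS x * gg x)) (at x)"
proof -
  have "((\<lambda>x. sqrt (1 - (amp * sin x)\<^sup>2)) has_real_derivative - (amp * sin x) * (amp * cos x) / cc x) (at x)"
    using cc2[of x] cc_bounds[of x] unfolding SS_def
    by (auto intro!: derivative_eq_intros simp: cc_def power2_eq_square field_simps)
  moreover have "- (amp * sin x) * (amp * cos x) / cc x = cc x / DD x * (- SS x * gg x)"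
    by (simp add: SS_def gg_def power2_eq_square)
  ultimately show ?thesis by (simp add: cc_def[abs_def])
qed

lemma deriv_SS: "(SS has_real_derivative cc x / DD x * (cc x * gg x)) (at x)"
proof -
  have "((\<lambda>x. amp * sin x) has_real_derivative amp * cos x) (at x)"
    by (auto intro!: derivative_eq_intros)
  then show ?thesis by (simp add: SS_def[abs_def] gg_def field_simps power2_eq_square)
qed

lemma deriv_DD: "(DD has_real_derivative cc x / DD x * (- SS x * gg x * cc x / DD x)) (at x)"
proof -
  have "((\<lambda>x. sqrt ((cc x)\<^sup>2 + kap)) has_real_derivative cc x * (cc x / DD x * (- SS x * gg x)) / DD x) (at x)"
    using DD_pos[of x] by (auto intro!: derivative_eq_intros deriv_cc simp: DD_def divide_simps)
  then show ?thesis by (simp add: DD_def[abs_def] field_simps)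
qed

text \<open>Formally this is the derivative of \<open>gg2'\<close>, but that route divides by
  \<open>gg\<close>, which vanishes at the turning points; so the quotient in \<open>gg_def\<close>
  is differentiated directly.\<close>

lemma deriv_gg: "(gg has_real_derivative cc x / DD x * (- 2 * cc x * (kk x)\<^sup>2 * SS x)) (at x)"
proof -
  have "(gg has_real_derivative ((- (amp * sin x) * DD x + cc x / DD x * (- SS x * gg x * cc x / DD x) * (amp * cos x)) * (cc x)\<^sup>2
      - amp * cos x * DD x * (2 * cc x * (cc x / DD x * (- SS x * gg x)))) / ((cc x)\<^sup>2 * (cc x)\<^sup>2)) (at x)"
    unfolding gg_def[abs_def]
    by (rule derivative_eq_intros refl deriv_DD deriv_cc | simp)+ (simp add: gg_def algebra_simps)
  moreover have "((- (amp * sin x) * DD x + cc x / DD x * (- SS x * gg x * cc x / DD x) * (amp * cos x)) * (cc x)\<^sup>2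
      - amp * cos x * DD x * (2 * cc x * (cc x / DD x * (- SS x * gg x)))) / ((cc x)\<^sup>2 * (cc x)\<^sup>2)
     = cc x / DD x * (- 2 * cc x * (kk x)\<^sup>2 * SS x)"
  proof -
    define C E u s where "C = cc x" "E = DD x" "u = amp * cos x" "s = SS x"
    have nz: "C \<noteq> 0" "E \<noteq> 0" by (auto simp: C_E_u_s_def)
    have E2: "E * E = C * C + kap" using DD2[of x] by (simp add: C_E_u_s_def power2_eq_square)
    have u2: "u * u = C * C - kap" using ampcos[of x] by (simp add: C_E_u_s_def power2_eq_square)
    have g: "gg x = u * E / (C * C)" by (simp add: gg_def C_E_u_s_def power2_eq_square)
    have k: "kk x = kap / (C * C * C)" by (simp add: kk_def C_E_u_s_def power3_eq_cube)
    have "- s * (E * E) - s * (u * u) + 2 * s * (u * u) * (E * E) / (C * C) = - 2 * kap * kap * s / (C * C)"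
      unfolding E2 u2 using nz by (simp add: field_simps)
    moreover have "((- s * E + C / E * (- s * (u * E / (C * C)) * C / E) * u) * (C * C)
      - u * E * (2 * C * (C / E * (- s * (u * E / (C * C)))))) / (C * C * (C * C)) =
      (- s * (E * E) - s * (u * u) + 2 * s * (u * u) * (E * E) / (C * C)) / (E * (C * C))"
      using nz by (simp add: field_simps)
    ultimately have "((- s * E + C / E * (- s * (u * E / (C * C)) * C / E) * u) * (C * C)
      - u * E * (2 * C * (C / E * (- s * (u * E / (C * C)))))) / (C * C * (C * C)) =
      (- 2 * kap * kap * s / (C * C)) / (E * (C * C))" by simp
    also have "\<dots> = C / E * (- 2 * C * (kap / (C * C * C) * (kap / (C * C * C))) * s)"
      using nz by (simp add: field_simps)
    finally show ?thesis
      unfolding g k power2_eq_square SS_def[symmetric] C_E_u_s_def[symmetric] .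
  qed
  ultimately show ?thesis by simp
qed

lemma smooth_coeffs: "smooth SS" "smooth cc" "smooth DD" "smooth gg" "smooth kk"
proof -
  show S: "smooth SS" unfolding SS_def[abs_def] by (intro smooth_mult smooth_const smooth_sin_cos)
  have "smooth (\<lambda>x. sqrt (1 - (SS x)\<^sup>2))"
    by (intro smooth_sqrt smooth_diff smooth_const smooth_power S) (metis cc2 cc_bounds(1) zero_less_power)
  then show C: "smooth cc" by (simp add: cc_def[abs_def] SS_def)
  show D: "smooth DD" unfolding DD_def[abs_def]
    by (intro smooth_sqrt smooth_add smooth_const smooth_power C) (use kap in \<open>simp add: add_nonneg_pos\<close>)
  show "smooth gg" unfolding gg_def[abs_def]
    by (intro smooth_divide smooth_mult smooth_const smooth_power smooth_sin_cos C D) auto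
  show "smooth kk" unfolding kk_def[abs_def]
    by (intro smooth_divide smooth_const smooth_power C) auto
qed

text \<open>The function \<theta> in the angle variable. The base point - pi / 2 is where \<phi> =
  b, that is t = 0.\<close>

definition th :: "real \<Rightarrow> real" where
  "th = (SOME f. f (- pi / 2) = 0 \<and> (\<forall>x. (f has_real_derivative cc x / DD x * kk x) (at x)))"

lemma th: "th (- pi / 2) = 0" "(th has_real_derivative cc x / DD x * kk x) (at x)"
proof -
  have "continuous_on UNIV (\<lambda>x. cc x / DD x * kk x)"
    by (intro continuous_intros smooth_continuous smooth_coeffs) auto
  then obtain F where F: "\<And>x. (F has_vector_derivative cc x / DD x * kk x) (at x)"
    using ex_antiderivative by blast
  have "((\<lambda>x. F x - F (- pi / 2)) has_real_derivative cc x / DD x * kk x) (at x)" for x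
    using has_vector_derivative_diff[OF F[of x] has_vector_derivative_const]
    by (simp add: has_real_derivative_iff_has_vector_derivative)
  then have "\<exists>f. f (- pi / 2) = 0 \<and> (\<forall>x. (f has_real_derivative cc x / DD x * kk x) (at x))"
    by (intro exI[of _ "\<lambda>x. F x - F (- pi / 2)"]) auto
  from someI_ex[OF this] show "th (- pi / 2) = 0" "(th has_real_derivative cc x / DD x * kk x) (at x)"
    unfolding th_def[symmetric] by auto
qed

lemma smooth_th: "smooth th"
  by (rule smooth_real[OF th(2)[unfolded has_real_derivative_iff_has_vector_derivative]])
     (intro smooth_mult smooth_divide smooth_coeffs, auto)

text \<open>A normal section with components \<open>X x * cos (l * \<alpha>)\<close> and \<open>Y x * sin (l * \<alpha>)\<close> in the adapted frame is a
  Jacobi eigensection iff \<open>(X, Y)\<close> solves the system with potential \<open>VV l\<close> and weight \<open>ww\<close>.\<close>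

definition UX :: "real \<Rightarrow> real \<Rightarrow> real" where "UX l x = l\<^sup>2 - 2 + 3 * (gg x)\<^sup>2 - 2 * (cc x)\<^sup>2"
definition UY :: "real \<Rightarrow> real \<Rightarrow> real" where "UY l x = l\<^sup>2 - 2 + 3 * (gg x)\<^sup>2 - 2 * (cc x)\<^sup>2 * (gg x)\<^sup>2"

definition VV :: "real \<Rightarrow> real \<Rightarrow> real \<times> real \<Rightarrow> real \<times> real" where
  "VV l x u = ((UX l x * fst u + 2 * l * gg x * snd u) / DD x, (UY l x * snd u + 2 * l * gg x * fst u) / DD x)"

definition ww :: "real \<Rightarrow> real" where "ww x = (cc x)\<^sup>2 / DD x"

lemma cont_coeffs [continuous_intros]:
  "continuous_on A SS" "continuous_on A cc" "continuous_on A DD" "continuous_on A gg" "continuous_on A kk"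
  "continuous_on A th" "continuous_on A (UX l)" "continuous_on A (UY l)" "continuous_on A ww"
proof -
  show c: "continuous_on A SS" "continuous_on A cc" "continuous_on A DD" "continuous_on A gg" "continuous_on A kk"
    "continuous_on A th"
    using smooth_coeffs smooth_th smooth_continuous continuous_on_subset by blast+
  show "continuous_on A (UX l)" "continuous_on A (UY l)" "continuous_on A ww"
    unfolding UX_def[abs_def] UY_def[abs_def] ww_def[abs_def] by (intro continuous_intros c; simp)+
qed

text \<open>Translation by pi reverses the sign of \<open>gg\<close> in the off-diagonal entries, so
  for the potential only even multiples of pi are taken as periods.\<close>

lemma sturm_liouville_VV:
  assumes "even n" "n > 0" "\<sigma> = 1 \<or> \<sigma> = -1"
  shows "sturm_liouville DD ww (VV l) (pi * real n) \<sigma>"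
  unfolding sturm_liouville_def
proof (intro conjI allI impI)
  show VVc: "continuous_on UNIV (\<lambda>x. VV l x (f x))" if "continuous_on UNIV f" for f
    unfolding VV_def by (intro continuous_intros that) auto
  show lin: "linear (VV l x)" for x
    by (rule linearI) (auto simp: VV_def algebra_simps add_divide_distrib)
  show "VV l x u \<bullet> v = VV l x v \<bullet> u" for x u v
    by (simp add: VV_def inner_prod_def algebra_simps add_divide_distrib)
  show "VV l (x + pi * real n) = VV l x" for x
    using assms(1) by (auto simp: VV_def UX_def UY_def shift fun_eq_iff)
  have p: "UX l (x + pi * real n) = UX l x" "UY l (x + pi * real n) = UY l x" for x
    using assms(1) by (auto simp: UX_def UY_def shift)
  show "\<exists>K. \<forall>x u. norm (VV l x u) \<le> K * norm u"
  proof -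
    define h where "h x = (\<bar>UX l x\<bar> + \<bar>UY l x\<bar> + 4 * \<bar>l\<bar> * \<bar>gg x\<bar> + 1) / DD x" for x
    have h0: "h x > 0" for x unfolding h_def using DD_pos[of x] by (intro divide_pos_pos add_nonneg_pos) auto
    have "continuous_on UNIV h" unfolding h_def[abs_def] by (intro continuous_intros) auto
    moreover have "h (x + pi * real n) = h x" for x using assms(1) by (simp add: h_def p shift)
    ultimately obtain d M where M: "\<And>x. h x \<le> M"
      using positive_periodic_bounds[of h "pi * real n"] assms(2) h0 by (metis mult_pos_pos pi_gt_zero of_nat_0_less_iff)
    have "norm (VV l x u) \<le> M * norm u" for x u
    proof -
      have f: "\<bar>fst u\<bar> \<le> norm u" "\<bar>snd u\<bar> \<le> norm u"
        using norm_fst_le[of "fst u" "snd u"] norm_snd_le[of "snd u" "fst u"] by (simp_all add: norm_Pair1)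
      have "norm (VV l x u) \<le> norm (fst (VV l x u)) + norm (snd (VV l x u))"
        by (metis norm_Pair_le prod.collapse)
      also have "\<dots> \<le> (\<bar>UX l x\<bar> * norm u + 2 * \<bar>l\<bar> * \<bar>gg x\<bar> * norm u) / DD x + (\<bar>UY l x\<bar> * norm u + 2 * \<bar>l\<bar> * \<bar>gg x\<bar> * norm u) / DD x"
        unfolding VV_def using DD_pos[of x] f
        by (auto simp: abs_mult intro!: add_mono divide_right_mono order_trans[OF abs_triangle_ineq] mult_left_mono)
      also have "\<dots> \<le> h x * norm u"
        unfolding h_def using DD_pos[of x] by (simp add: field_simps)
      also have "\<dots> \<le> M * norm u" by (intro mult_right_mono M) auto
      finally show ?thesis .
    qed
    then show ?thesis by blast
  qed
  show "ww x > 0" for x unfolding ww_def using DD_pos[of x] cc_bounds[of x] by simp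
  show "continuous_on UNIV ww" by (rule cont_coeffs)
qed (use assms DD_pos in \<open>auto intro: cont_coeffs simp: shift ww_def\<close>)

text \<open>The predicate \<open>sol\<close> freed from its locale, so that frequency and sign can
  vary within one statement.\<close>

definition osol :: "nat \<Rightarrow> real \<Rightarrow> real \<Rightarrow> real \<Rightarrow> (real \<Rightarrow> real \<times> real) \<Rightarrow> bool" where
  "osol n \<sigma> l m f \<longleftrightarrow> C2D DD f \<and> (\<forall>x. f (x + pi * real n) = \<sigma> *\<^sub>R f x) \<and>
    (\<forall>x. qd DD f x = VV l x (f x) - (m * ww x) *\<^sub>R f x)"

lemma osol_sol:
  assumes "even n" "n > 0" "\<sigma> = 1 \<or> \<sigma> = -1"
  shows "osol n \<sigma> l m f \<longleftrightarrow> sturm_liouville.sol DD ww (VV l) (pi * real n) \<sigma> m f"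
proof -
  interpret sturm_liouville DD ww "VV l" "pi * real n" \<sigma> by (rule sturm_liouville_VV[OF assms])
  show ?thesis by (auto simp: osol_def sol_def adm_def)
qed

text \<open>The flux is simple in arclength: \<open>DD\<close> times the \<open>x\<close>-derivative
  equals \<open>cc * Xs\<close>, and differentiating the factor \<open>cc\<close> produces the term
  in \<open>SS * gg\<close>.\<close>

lemma arclength_C2D:
  assumes "\<And>x. (X has_real_derivative cc x / DD x * Xs x) (at x)"
    and "\<And>x. (Xs has_real_derivative cc x / DD x * Xss x) (at x)" and "continuous_on UNIV Xss"
  shows "C2D DD X" "dd X = (\<lambda>x. cc x / DD x * Xs x)"
    "qd DD X = (\<lambda>x. cc x / DD x * (cc x * Xss x - SS x * gg x * Xs x))"
proof -
  have Xs: "continuous_on UNIV Xs"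
    using assms(2) by (meson DERIV_isCont continuous_at_imp_continuous_on)
  have "((\<lambda>y. cc y * Xs y) has_real_derivative cc x / DD x * (cc x * Xss x - SS x * gg x * Xs x)) (at x)" for x
    by (rule derivative_eq_intros deriv_cc assms(2) refl)+ (simp add: algebra_simps)
  moreover have "(\<lambda>y. DD y *\<^sub>R (cc y / DD y * Xs y)) = (\<lambda>y. cc y * Xs y)" by auto
  ultimately have 2: "((\<lambda>y. DD y *\<^sub>R (cc y / DD y * Xs y)) has_vector_derivative
      cc x / DD x * (cc x * Xss x - SS x * gg x * Xs x)) (at x)" for x
    by (simp add: has_real_derivative_iff_has_vector_derivative)
  have 3: "continuous_on UNIV (\<lambda>x. cc x / DD x * (cc x * Xss x - SS x * gg x * Xs x))"
    by (intro continuous_intros assms(3) Xs) auto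
  show "C2D DD X" "dd X = (\<lambda>x. cc x / DD x * Xs x)"
    "qd DD X = (\<lambda>x. cc x / DD x * (cc x * Xss x - SS x * gg x * Xs x))"
    using C2DI[OF assms(1)[unfolded has_real_derivative_iff_has_vector_derivative] 2 3] by auto
qed

lemma osolI:
  assumes X: "\<And>x. (X has_real_derivative cc x / DD x * Xs x) (at x)"
      "\<And>x. (Xs has_real_derivative cc x / DD x * Xss x) (at x)" "continuous_on UNIV Xss"
    and Y: "\<And>x. (Y has_real_derivative cc x / DD x * Ys x) (at x)"
      "\<And>x. (Ys has_real_derivative cc x / DD x * Yss x) (at x)" "continuous_on UNIV Yss"
    and per: "\<And>x. X (x + pi * real n) = \<sigma> * X x" "\<And>x. Y (x + pi * real n) = \<sigma> * Y x"
    and eq: "\<And>x. cc x * (cc x * Xss x - SS x * gg x * Xs x) = UX l x * X x + 2 * l * gg x * Y x"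
      "\<And>x. cc x * (cc x * Yss x - SS x * gg x * Ys x) = UY l x * Y x + 2 * l * gg x * X x"
  shows "osol n \<sigma> l 0 (\<lambda>x. (X x, Y x))"
  using C2D_Pair[OF arclength_C2D(1)[OF X] arclength_C2D(1)[OF Y]] per
  unfolding osol_def arclength_C2D(3)[OF X] arclength_C2D(3)[OF Y]
  by (simp add: VV_def eq[symmetric])

section \<open>Explicit null solutions\<close>

text \<open>\<open>sd f f'\<close>: \<open>f'\<close> is the derivative of \<open>f\<close> with respect to arclength.\<close>

definition sd :: "(real \<Rightarrow> real) \<Rightarrow> (real \<Rightarrow> real) \<Rightarrow> bool" where
  "sd f f' \<longleftrightarrow> (\<forall>x. (f has_real_derivative cc x / DD x * f' x) (at x))"

lemma sdD: "sd f f' \<Longrightarrow> (f has_real_derivative cc x / DD x * f' x) (at x)"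
  by (simp add: sd_def)

lemma sd_cong: "sd f f' \<Longrightarrow> (\<And>x. f' x = h x) \<Longrightarrow> sd f h"
  by (simp add: sd_def)

lemma sd_const: "sd (\<lambda>_. r) (\<lambda>_. 0)" by (simp add: sd_def)

lemma sd_mult: "sd f f' \<Longrightarrow> sd h h' \<Longrightarrow> sd (\<lambda>x. f x * h x) (\<lambda>x. f' x * h x + f x * h' x)"
  unfolding sd_def by (auto intro!: derivative_eq_intros simp: algebra_simps)

lemma sd_add: "sd f f' \<Longrightarrow> sd h h' \<Longrightarrow> sd (\<lambda>x. f x + h x) (\<lambda>x. f' x + h' x)"
  unfolding sd_def distrib_left by (auto intro: DERIV_add)

lemma sd_diff: "sd f f' \<Longrightarrow> sd h h' \<Longrightarrow> sd (\<lambda>x. f x - h x) (\<lambda>x. f' x - h' x)"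
  unfolding sd_def right_diff_distrib by (auto intro: DERIV_diff)

lemma sd_minus: "sd f f' \<Longrightarrow> sd (\<lambda>x. - f x) (\<lambda>x. - f' x)"
  unfolding sd_def by (auto intro!: derivative_eq_intros simp: algebra_simps)

lemma sd_divide: "sd f f' \<Longrightarrow> sd h h' \<Longrightarrow> (\<And>x. h x \<noteq> 0) \<Longrightarrow>
    sd (\<lambda>x. f x / h x) (\<lambda>x. (f' x * h x - f x * h' x) / (h x * h x))"
  unfolding sd_def by (auto intro!: derivative_eq_intros simp: algebra_simps)

lemma sd_cc: "sd cc (\<lambda>x. - SS x * gg x)"
  and sd_SS: "sd SS (\<lambda>x. cc x * gg x)"
  and sd_gg: "sd gg (\<lambda>x. - 2 * cc x * (kk x)\<^sup>2 * SS x)"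
  and sd_th: "sd th kk"
  unfolding sd_def using deriv_cc deriv_SS deriv_gg th(2) by auto

lemma sd_kk: "sd kk (\<lambda>x. 3 * kk x * SS x * gg x / cc x)"
proof -
  have "sd (\<lambda>x. kap / (cc x * (cc x * cc x))) (\<lambda>x. 3 * kk x * SS x * gg x / cc x)"
    by (rule sd_cong, (rule sd_const sd_divide sd_const sd_mult sd_cc)+)
       (auto simp: kk_def field_simps power3_eq_cube)
  then show ?thesis by (simp add: kk_def[abs_def] power3_eq_cube mult.assoc)
qed

lemma sd_cos_th: "sd (\<lambda>x. cos (r * (th x + d))) (\<lambda>x. - r * kk x * sin (r * (th x + d)))"
  and sd_sin_th: "sd (\<lambda>x. sin (r * (th x + d))) (\<lambda>x. r * kk x * cos (r * (th x + d)))"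
  unfolding sd_def by (auto intro!: derivative_eq_intros th(2) simp: algebra_simps)

text \<open>The null solutions that come from rotations are verified as polynomial identities modulo
  these two relations.\<close>

lemma rel: "SS x * SS x = 1 - cc x * cc x" "(cc x * kk x) * (cc x * kk x) = 1 - gg x * gg x"
  using cc2[of x] gg2'[of x] by (simp_all add: power2_eq_square)

lemma osol_sdI:
  assumes X: "sd X Xs" "sd Xs Xss" "continuous_on UNIV Xss"
    and Y: "sd Y Ys" "sd Ys Yss" "continuous_on UNIV Yss"
    and per: "\<And>x. X (x + pi * real n) = \<sigma> * X x" "\<And>x. Y (x + pi * real n) = \<sigma> * Y x"
    and eq: "\<And>x. cc x * (cc x * Xss x - SS x * gg x * Xs x) = UX l x * X x + 2 * l * gg x * Y x"
      "\<And>x. cc x * (cc x * Yss x - SS x * gg x * Ys x) = UY l x * Y x + 2 * l * gg x * X x"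
  shows "osol n \<sigma> l 0 (\<lambda>x. (X x, Y x))"
  by (rule osolI[OF sdD[OF X(1)] sdD[OF X(2)] X(3) sdD[OF Y(1)] sdD[OF Y(2)] Y(3) per eq])

lemma th_shift: "th (x + pi * real n) = th x + real n * th (pi / 2)"
proof -
  have step: "th (y + pi) = th y + th (pi / 2)" for y
  proof -
    have "((\<lambda>y. th (y + pi) - th y) has_real_derivative 0) (at y)" for y
    proof -
      have "((\<lambda>y. th (y + pi)) has_real_derivative cc (y + pi) / DD (y + pi) * kk (y + pi)) (at y)"
        using th(2)[of "y + pi"] DERIV_shift by blast
      then show ?thesis using shift[of y 1] by (auto intro!: derivative_eq_intros th(2))
    qed
    then have "th (y + pi) - th y = th (- pi / 2 + pi) - th (- pi / 2)"
      using DERIV_isconst_all by blast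
    moreover have "- pi / 2 + pi = pi / 2" by simp
    ultimately show ?thesis by (simp only: th(1))
  qed
  show ?thesis
  proof (induction n)
    case (Suc n)
    then show ?case using step[of "x + pi * real n"] by (simp add: algebra_simps)
  qed auto
qed

text \<open>The hypothesis is the closing condition of the surface: over \<open>n\<close> half turns
  \<theta> advances by m pi.\<close>

lemma cos_sin_th_shift:
  assumes "real n * th (pi / 2) = real m * pi"
  shows "cos (th (x + pi * real n) + d) = (-1) ^ m * cos (th x + d)"
    and "sin (th (x + pi * real n) + d) = (-1) ^ m * sin (th x + d)"
    and "cos (2 * (th (x + pi * real n) + d)) = cos (2 * (th x + d))"
proof -
  have e: "th (x + pi * real n) + d = (th x + d) + pi * real m"
    "2 * (th (x + pi * real n) + d) = 2 * (th x + d) + pi * real (2 * m)"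
    by (simp_all add: th_shift assms)
  show "cos (th (x + pi * real n) + d) = (-1) ^ m * cos (th x + d)"
    "sin (th (x + pi * real n) + d) = (-1) ^ m * sin (th x + d)"
    unfolding e cos_shift_pi sin_shift_pi by simp_all
  have "(-1 :: real) ^ (2 * m) = 1" by simp
  then show "cos (2 * (th (x + pi * real n) + d)) = cos (2 * (th x + d))"
    unfolding e(2) cos_shift_pi by (simp only: mult_1)
qed

text \<open>In R^4 = R^2 tensor R^2, with \<alpha> turning the first factor and \<theta> the second,
  these come from the rotations J tensor S, where J is the quarter turn and S is symmetric and
  traceless. The matrix entries of S in the turning basis have the angle 2 \<theta>; the two choices
  of S correspond to two values of \<open>d\<close>.\<close>

lemma null_solution_0_first:
  assumes "even n" "real n * th (pi / 2) = real m * pi"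
  shows "osol n 1 0 0 (\<lambda>x. (cc x * cos (2 * (th x + d)), 0))"
proof (rule osol_sdI)
  let ?C = "\<lambda>x. cos (2 * (th x + d))" and ?S = "\<lambda>x. sin (2 * (th x + d))"
  show "sd (\<lambda>x. cc x * ?C x) (\<lambda>x. - SS x * gg x * ?C x - 2 * (cc x * kk x) * ?S x)"
    by (rule sd_cong, (rule sd_const sd_mult sd_cc sd_cos_th)+) (simp add: algebra_simps)
  show "sd (\<lambda>x. - SS x * gg x * ?C x - 2 * (cc x * kk x) * ?S x)
      (\<lambda>x. ?C x * (- cc x * (gg x * gg x) + 2 * cc x * (kk x * kk x) * (SS x * SS x) - 4 * cc x * (kk x * kk x))
         - 2 * SS x * gg x * kk x * ?S x)"
    by (rule sd_cong, (rule sd_const sd_mult sd_diff sd_minus sd_const sd_cc sd_SS sd_gg sd_kk sd_cos_th sd_sin_th)+)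
       (simp add: algebra_simps power2_eq_square)
  show "cc x * (cc x * (?C x * (- cc x * (gg x * gg x) + 2 * cc x * (kk x * kk x) * (SS x * SS x) - 4 * cc x * (kk x * kk x))
         - 2 * SS x * gg x * kk x * ?S x) - SS x * gg x * (- SS x * gg x * ?C x - 2 * (cc x * kk x) * ?S x)) =
      UX 0 x * (cc x * ?C x) + 2 * 0 * gg x * 0" for x
    using rel[of x] unfolding UX_def power2_eq_square by algebra
  show "sd (\<lambda>_. 0) (\<lambda>_. 0)" "sd (\<lambda>_. 0) (\<lambda>_. 0)" by (rule sd_const)+
  show "cc (x + pi * real n) * ?C (x + pi * real n) = 1 * (cc x * ?C x)" for x
    by (simp only: shift cos_sin_th_shift(3)[OF assms(2)] mult_1)
qed (use assms in \<open>auto intro!: continuous_intros\<close>)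

lemma sd_ccgg: "sd (\<lambda>x. cc x * gg x) (\<lambda>x. - SS x * (2 - gg x * gg x))"
proof (rule sd_cong, (rule sd_const sd_mult sd_cc sd_gg)+)
  show "- SS x * gg x * gg x + cc x * (- 2 * cc x * (kk x)\<^sup>2 * SS x) = - SS x * (2 - gg x * gg x)" for x
    using rel[of x] unfolding power2_eq_square by algebra
qed

lemma sd_ccgg': "sd (\<lambda>x. - SS x * (2 - gg x * gg x))
    (\<lambda>x. - cc x * gg x * (2 - gg x * gg x) - 4 * cc x * (SS x * SS x) * gg x * (kk x * kk x))"
  by (rule sd_cong, (rule sd_const sd_mult sd_minus sd_diff sd_const sd_SS sd_gg)+)
     (simp add: algebra_simps power2_eq_square)

text \<open>Isolated because \<open>Y2\<close> reuses it: the terms of its equation that contain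
  \<open>II\<close> are a multiple of this identity.\<close>

lemma ccgg_equation:
  "cc x * (cc x * (- cc x * gg x * (2 - gg x * gg x) - 4 * cc x * (SS x * SS x) * gg x * (kk x * kk x))
     - SS x * gg x * (- SS x * (2 - gg x * gg x))) = UY 0 x * (cc x * gg x)"
  using rel[of x] unfolding UY_def power2_eq_square by algebra

text \<open>Up to sign, the normal part of the rotation that increases \<theta>; it does not depend
  on \<alpha> and has only a second component.\<close>

lemma null_solution_0_second:
  assumes "even n"
  shows "osol n 1 0 0 (\<lambda>x. (0, cc x * gg x))"
proof (rule osol_sdI)
  show "sd (\<lambda>_. 0) (\<lambda>_. 0)" "sd (\<lambda>_. 0) (\<lambda>_. 0)" by (rule sd_const)+
  show "cc x * (cc x * (- cc x * gg x * (2 - gg x * gg x) - 4 * cc x * (SS x * SS x) * gg x * (kk x * kk x))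
     - SS x * gg x * (- SS x * (2 - gg x * gg x))) = UY 0 x * (cc x * gg x) + 2 * 0 * gg x * 0" for x
    unfolding ccgg_equation by simp
  show "sd (\<lambda>x. cc x * gg x) (\<lambda>x. - SS x * (2 - gg x * gg x))" by (rule sd_ccgg)
  show "sd (\<lambda>x. - SS x * (2 - gg x * gg x))
    (\<lambda>x. - cc x * gg x * (2 - gg x * gg x) - 4 * cc x * (SS x * SS x) * gg x * (kk x * kk x))"
    by (rule sd_ccgg')
qed (use assms in \<open>auto intro!: continuous_intros simp: shift\<close>)

text \<open>These come from the rotations S tensor J, with S symmetric and traceless in the
  \<alpha>-factor and J the quarter turn in the \<theta>-factor; such an S produces the angle 2
  \<alpha>.\<close>

lemma null_solution_2:
  assumes "even n"
  shows "osol n 1 2 0 (\<lambda>x. (cc x, - (cc x * gg x)))"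
proof (rule osol_sdI)
  show "sd cc (\<lambda>x. - SS x * gg x)" by (rule sd_cc)
  show "sd (\<lambda>x. - SS x * gg x) (\<lambda>x. - cc x * (gg x * gg x) + 2 * cc x * (kk x * kk x) * (SS x * SS x))"
    by (rule sd_cong, (rule sd_const sd_mult sd_minus sd_SS sd_gg)+) (simp add: algebra_simps power2_eq_square)
  show "sd (\<lambda>x. - (cc x * gg x)) (\<lambda>x. - (- SS x * (2 - gg x * gg x)))" by (intro sd_minus sd_ccgg)
  show "sd (\<lambda>x. - (- SS x * (2 - gg x * gg x)))
    (\<lambda>x. - (- cc x * gg x * (2 - gg x * gg x) - 4 * cc x * (SS x * SS x) * gg x * (kk x * kk x)))"
    by (intro sd_minus sd_ccgg')
  show "cc x * (cc x * (- cc x * (gg x * gg x) + 2 * cc x * (kk x * kk x) * (SS x * SS x)) - SS x * gg x * (- SS x * gg x)) =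
     UX 2 x * cc x + 2 * 2 * gg x * - (cc x * gg x)" for x
    using rel[of x] unfolding UX_def power2_eq_square by algebra
  show "cc x * (cc x * (- (- cc x * gg x * (2 - gg x * gg x) - 4 * cc x * (SS x * SS x) * gg x * (kk x * kk x)))
      - SS x * gg x * (- (- SS x * (2 - gg x * gg x)))) = UY 2 x * (- (cc x * gg x)) + 2 * 2 * gg x * cc x" for x
    using rel[of x] unfolding UY_def power2_eq_square by algebra
qed (use assms in \<open>auto intro!: continuous_intros simp: shift\<close>)

text \<open>These come from the rotations that mix the fifth axis with R^4. Over the period the
  functions of \<theta> acquire the factor \<open>(-1) ^ m\<close>, which decides between periodic
  and antiperiodic.\<close>

lemma null_solution_1:
  assumes "even n" "real n * th (pi / 2) = real m * pi"
  shows "osol n ((-1) ^ m) 1 0 (\<lambda>x. (SS x * cos (th x + d), - (cc x * kk x * sin (th x + d) + SS x * gg x * cos (th x + d))))"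
proof (rule osol_sdI)
  let ?C = "\<lambda>x. cos (th x + d)" and ?S = "\<lambda>x. sin (th x + d)"
  have sC: "sd ?C (\<lambda>x. - kk x * ?S x)" and sS: "sd ?S (\<lambda>x. kk x * ?C x)"
    using sd_cos_th[of 1 d] sd_sin_th[of 1 d] by simp_all
  note sds = sd_mult sd_add sd_diff sd_minus sd_const sd_cc sd_SS sd_gg sd_kk sC sS
  \<comment> \<open>Numerators of the second derivatives: the derivative of \<open>kk\<close> has
    \<open>cc\<close> in its denominator, and clearing it leaves polynomial identities.\<close>
  let ?NX = "\<lambda>x. cc x * (- SS x * (gg x * gg x) - 2 * (cc x * cc x) * (kk x * kk x) * SS x - SS x * (kk x * kk x)) * ?C x
      - (2 * (cc x * cc x) + 3 * (SS x * SS x)) * gg x * kk x * ?S x"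
  let ?q = "\<lambda>x. cc x * (kk x * kk x) + cc x * (gg x * gg x) - 2 * cc x * (kk x * kk x) * (SS x * SS x)"
  let ?NY = "\<lambda>x. - (kk x * (3 * (SS x * SS x) * (gg x * gg x) + cc x * cc x * (gg x * gg x) - 2 * (cc x * cc x) * (kk x * kk x) * (SS x * SS x)) * ?S x
      + cc x * (kk x * kk x) * SS x * gg x * ?C x
      + cc x * (5 * (kk x * kk x) * SS x * gg x - SS x * (gg x * gg x * gg x) - 8 * (cc x * cc x) * (kk x * kk x) * gg x * SS x
          - 10 * (kk x * kk x) * (SS x * SS x * SS x) * gg x) * ?C x
      - cc x * ?q x * kk x * ?S x)"
  show "sd (\<lambda>x. SS x * ?C x) (\<lambda>x. cc x * gg x * ?C x - SS x * kk x * ?S x)"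
    by (rule sd_cong, (rule sd_const sds)+) (simp add: algebra_simps)
  show "sd (\<lambda>x. cc x * gg x * ?C x - SS x * kk x * ?S x) (\<lambda>x. ?NX x / cc x)"
    by (rule sd_cong, (rule sd_const sds)+) (simp add: field_simps power2_eq_square)
  show "cc x * (cc x * (?NX x / cc x) - SS x * gg x * (cc x * gg x * ?C x - SS x * kk x * ?S x)) =
     UX 1 x * (SS x * ?C x) + 2 * 1 * gg x * - (cc x * kk x * ?S x + SS x * gg x * ?C x)" for x
  proof -
    have "cc x * (?NX x - SS x * gg x * (cc x * gg x * ?C x - SS x * kk x * ?S x)) =
     UX 1 x * (SS x * ?C x) + 2 * 1 * gg x * - (cc x * kk x * ?S x + SS x * gg x * ?C x)"
      using rel[of x] unfolding UX_def power2_eq_square by algebra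
    then show ?thesis by simp
  qed
  show "sd (\<lambda>x. - (cc x * kk x * ?S x + SS x * gg x * ?C x)) (\<lambda>x. - (kk x * SS x * gg x * ?S x + ?q x * ?C x))"
    by (rule sd_cong, (rule sd_const sds)+) (simp add: field_simps power2_eq_square)
  show "sd (\<lambda>x. - (kk x * SS x * gg x * ?S x + ?q x * ?C x)) (\<lambda>x. ?NY x / cc x)"
    by (rule sd_cong, (rule sd_const sds)+) (simp add: field_simps power2_eq_square)
  show "cc x * (cc x * (?NY x / cc x) - SS x * gg x * (- (kk x * SS x * gg x * ?S x + ?q x * ?C x))) =
     UY 1 x * (- (cc x * kk x * ?S x + SS x * gg x * ?C x)) + 2 * 1 * gg x * (SS x * ?C x)" for x
  proof -
    have "cc x * (?NY x - SS x * gg x * (- (kk x * SS x * gg x * ?S x + ?q x * ?C x))) =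
     UY 1 x * (- (cc x * kk x * ?S x + SS x * gg x * ?C x)) + 2 * 1 * gg x * (SS x * ?C x)"
      using rel[of x] unfolding UY_def power2_eq_square by algebra
    then show ?thesis by simp
  qed
  have sg: "(-1 :: real) ^ n = 1" using assms(1) by simp
  show "SS (x + pi * real n) * ?C (x + pi * real n) = (- 1) ^ m * (SS x * ?C x)" for x
    by (simp only: shift cos_sin_th_shift[OF assms(2)] sg mult_1 mult.left_commute)
  show "- (cc (x + pi * real n) * kk (x + pi * real n) * ?S (x + pi * real n) + SS (x + pi * real n) * gg (x + pi * real n) * ?C (x + pi * real n)) =
      (- 1) ^ m * - (cc x * kk x * ?S x + SS x * gg x * ?C x)" for x
    by (simp only: shift cos_sin_th_shift[OF assms(2)] sg mult_1) (simp add: algebra_simps)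
qed (auto intro!: continuous_intros)

section \<open>The null space in frequency zero\<close>

text \<open>\<open>Y2\<close> is the second solution of the equation solved by \<open>cc * gg\<close>, from reduction of order; its first
  term absorbs the poles of the integrand \<open>1 / (cc * gg)\<^sup>2\<close>. It is not periodic because \<open>II\<close> is monotone.\<close>

definition II :: "real \<Rightarrow> real" where
  "II = (SOME f. f (- pi / 2) = 0 \<and> sd f (\<lambda>x. (SS x)\<^sup>2 * ((cc x)\<^sup>2 - 2 * kap) / (cc x * DD x ^ 4)))"

lemma II: "II (- pi / 2) = 0" "sd II (\<lambda>x. (SS x)\<^sup>2 * ((cc x)\<^sup>2 - 2 * kap) / (cc x * DD x ^ 4))"
proof -
  let ?h = "\<lambda>x. (SS x)\<^sup>2 * ((cc x)\<^sup>2 - 2 * kap) / (cc x * DD x ^ 4)"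
  have "continuous_on UNIV (\<lambda>x. cc x / DD x * ?h x)" by (intro continuous_intros) auto
  then obtain F where F: "\<And>x. (F has_vector_derivative cc x / DD x * ?h x) (at x)"
    using ex_antiderivative by blast
  have "((\<lambda>x. F x - F (- pi / 2)) has_real_derivative cc x / DD x * ?h x) (at x)" for x
    using has_vector_derivative_diff[OF F[of x] has_vector_derivative_const]
    by (simp add: has_real_derivative_iff_has_vector_derivative)
  then have "\<exists>f. f (- pi / 2) = 0 \<and> sd f ?h"
    by (intro exI[of _ "\<lambda>x. F x - F (- pi / 2)"]) (auto simp: sd_def)
  from someI_ex[OF this] show "II (- pi / 2) = 0" "sd II ?h"
    unfolding II_def[symmetric] by auto
qed

definition Y2 :: "real \<Rightarrow> real" where "Y2 x = cc x * SS x / (cc x * cc x + kap) - cc x * gg x * II x"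
definition Y2' :: "real \<Rightarrow> real" where
  "Y2' x = gg x * (cc x * cc x * (cc x * cc x) + kap) / ((cc x * cc x + kap) * (cc x * cc x + kap)) + SS x * (2 - gg x * gg x) * II x"

lemma II': "sd II (\<lambda>x. SS x * SS x * (cc x * cc x - 2 * kap) / (cc x * ((cc x * cc x + kap) * (cc x * cc x + kap))))"
proof -
  have "DD x ^ 4 = (cc x * cc x + kap) * (cc x * cc x + kap)" for x
    using DD2[of x] by (simp add: power4_eq_xxxx power2_eq_square mult.assoc)
  then show ?thesis using II(2) by (simp add: power2_eq_square)
qed

lemma nz2 [simp]: "cc x * cc x + kap \<noteq> 0"
  using kap cc_bounds[of x] by (smt (verit) mult_pos_pos)

lemma gg2_rational: "gg x * gg x = (cc x * cc x - kap) * (cc x * cc x + kap) / (cc x * cc x * (cc x * cc x))"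
  using gg2[of x] by (simp add: power4_eq_xxxx power2_eq_square field_simps)

lemma sd_Y2: "sd Y2 Y2'"
proof -
  have "sd (\<lambda>x. cc x * SS x / (cc x * cc x + kap) - cc x * gg x * II x) Y2'"
  proof (rule sd_cong, (rule sd_const sd_diff sd_ccgg sd_mult sd_divide sd_add sd_cc sd_SS sd_gg II' nz2)+)
    fix x
    define C S G K J where "C = cc x" "S = SS x" "G = gg x" "K = kap" "J = II x"
    note defs = C_S_G_K_J_def
    have nz: "C \<noteq> 0" "C * C + K \<noteq> 0" by (auto simp: defs)
    have S2: "S * S = 1 - C * C" using rel(1)[of x] by (simp add: defs)
    show "((- SS x * gg x * SS x + cc x * (cc x * gg x)) * (cc x * cc x + kap) -
          cc x * SS x * (- SS x * gg x * cc x + cc x * (- SS x * gg x) + 0)) /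
         ((cc x * cc x + kap) * (cc x * cc x + kap)) -
         (- SS x * (2 - gg x * gg x) * II x +
          cc x * gg x * (SS x * SS x * (cc x * cc x - 2 * kap) / (cc x * ((cc x * cc x + kap) * (cc x * cc x + kap))))) = Y2' x"
    proof -
      have "(- S * G * S + C * (C * G)) * (C * C + K) - C * S * (- S * G * C + C * (- S * G)) - G * (S * S * (C * C - 2 * K))
        = G * (C * C * (C * C) + K)"
        using S2 by algebra
      then have "((- S * G * S + C * (C * G)) * (C * C + K) - C * S * (- S * G * C + C * (- S * G)) - G * (S * S * (C * C - 2 * K)))
         / ((C * C + K) * (C * C + K)) = G * (C * C * (C * C) + K) / ((C * C + K) * (C * C + K))"
        by (rule arg_cong)
      then show ?thesis
        unfolding Y2'_def defs[symmetric] using nz by (simp add: diff_divide_distrib)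
    qed
  qed
  then show ?thesis by (simp add: Y2_def[abs_def])
qed

definition Y2'' :: "real \<Rightarrow> real" where
  "Y2'' x = (- 2 * kap * kap * SS x * (cc x * cc x * (cc x * cc x) + kap) / (cc x * cc x * (cc x * cc x) * cc x)
     - 4 * (cc x * cc x * cc x) * SS x * (gg x * gg x)) / ((cc x * cc x + kap) * (cc x * cc x + kap))
   + 4 * cc x * SS x * (gg x * gg x) * (cc x * cc x * (cc x * cc x) + kap) / ((cc x * cc x + kap) * (cc x * cc x + kap) * (cc x * cc x + kap))
   + (cc x * gg x * (2 - gg x * gg x) + 4 * cc x * (SS x * SS x) * gg x * (kk x * kk x)) * II x
   + SS x * (2 - gg x * gg x) * (SS x * SS x * (cc x * cc x - 2 * kap)) / (cc x * ((cc x * cc x + kap) * (cc x * cc x + kap)))"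

lemma sd_Y2': "sd Y2' Y2''"
proof -
  have k: "kk x = kap / (cc x * cc x * cc x)" for x by (simp add: kk_def power3_eq_cube)
  have "sd (\<lambda>x. gg x * (cc x * cc x * (cc x * cc x) + kap) / ((cc x * cc x + kap) * (cc x * cc x + kap)) + SS x * (2 - gg x * gg x) * II x) Y2''"
  proof (rule sd_cong, (rule sd_const sd_add sd_mult sd_divide sd_diff sd_cc sd_SS sd_gg II' nz2 no_zero_divisors)+)
    fix x
    define C S G J where "C = cc x" "S = SS x" "G = gg x" "J = II x"
    note defs = C_S_G_J_def
    define E where "E = C * C + kap"
    have nz: "C \<noteq> 0" "E \<noteq> 0" by (auto simp: defs E_def)
    have E: "cc x * cc x + kap = E" by (simp add: E_def defs)
    show "(((- 2 * cc x * (kk x)\<^sup>2 * SS x) * (cc x * cc x * (cc x * cc x) + kap) +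
         gg x * ((- SS x * gg x * cc x + cc x * (- SS x * gg x)) * (cc x * cc x) + cc x * cc x * (- SS x * gg x * cc x + cc x * (- SS x * gg x)) + 0)) *
        ((cc x * cc x + kap) * (cc x * cc x + kap)) -
        gg x * (cc x * cc x * (cc x * cc x) + kap) *
        ((- SS x * gg x * cc x + cc x * (- SS x * gg x) + 0) * (cc x * cc x + kap) +
         (cc x * cc x + kap) * (- SS x * gg x * cc x + cc x * (- SS x * gg x) + 0))) /
       ((cc x * cc x + kap) * (cc x * cc x + kap) * ((cc x * cc x + kap) * (cc x * cc x + kap))) +
       ((cc x * gg x * (2 - gg x * gg x) + SS x * (0 - (- 2 * cc x * (kk x)\<^sup>2 * SS x * gg x + gg x * (- 2 * cc x * (kk x)\<^sup>2 * SS x)))) * II x +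
        SS x * (2 - gg x * gg x) *
        (SS x * SS x * (cc x * cc x - 2 * kap) / (cc x * ((cc x * cc x + kap) * (cc x * cc x + kap))))) = Y2'' x"
      unfolding Y2''_def E power2_eq_square k
      unfolding defs[symmetric] using nz by (simp add: field_simps)
  qed
  then show ?thesis by (simp add: Y2'_def[abs_def])
qed

text \<open>The terms containing \<open>II\<close> form a multiple of \<open>ccgg_equation\<close>.
  What remains is a rational identity, checked after eliminating the squares of \<open>SS\<close>
  and \<open>gg\<close>.\<close>

lemma Y2_equation: "cc x * (cc x * Y2'' x - SS x * gg x * Y2' x) = UY 0 x * Y2 x"
proof -
  define C S G K J k where "C = cc x" "S = SS x" "G = gg x" "K = kap" "J = II x" "k = kk x"
  note defs = C_S_G_K_J_k_def
  define E where "E = C * C + K"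
  have nz: "C \<noteq> 0" "E \<noteq> 0" by (auto simp: defs E_def)
  have E: "cc x * cc x + kap = E" by (simp add: E_def defs)
  have S2: "S * S = 1 - C * C" using rel(1)[of x] by (simp add: defs)
  have G2: "G * G = (C * C - K) * E / (C * C * (C * C))" using gg2_rational[of x] by (simp add: defs E_def)
  have main: "C * (C * (- C * G * (2 - G * G) - 4 * C * (S * S) * G * (k * k)) - S * G * (- S * (2 - G * G))) = UY 0 x * (C * G)"
    using ccgg_equation[of x] by (simp add: defs)
  let ?P = "(- 2 * K * K * S * (C * C * (C * C) + K) / (C * C * (C * C) * C) - 4 * (C * C * C) * S * (G * G)) / (E * E)
     + 4 * C * S * (G * G) * (C * C * (C * C) + K) / (E * E * E)
     + S * (2 - G * G) * (S * S * (C * C - 2 * K)) / (C * (E * E))"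
  \<comment> \<open>Eliminating \<open>K\<close> in favour of \<open>E\<close> leaves an identity in
    \<open>C\<close> and \<open>E\<close> alone, both known to be nonzero.\<close>
  have KE: "K = E - C * C" by (simp add: E_def)
  have "C * (C * ?P - S * G * (G * (C * C * (C * C) + K) / (E * E))) = (- 2 + 3 * (G * G) - 2 * (C * C) * (G * G)) * (C * S / E)"
  proof -
    have "C * (C * ?P - S * G * (G * (C * C * (C * C) + K) / (E * E))) =
      C * S * (C * ((- 2 * K * K * (C * C * (C * C) + K) / (C * C * (C * C) * C) - 4 * (C * C * C) * (G * G)) / (E * E)
     + 4 * C * (G * G) * (C * C * (C * C) + K) / (E * E * E)
     + (2 - G * G) * ((S * S) * (C * C - 2 * K)) / (C * (E * E))) - (G * G) * (C * C * (C * C) + K) / (E * E))"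
      using nz by (simp add: field_simps)
    also have "\<dots> = C * S * ((- 2 + 3 * (G * G) - 2 * (C * C) * (G * G)) / E)"
      unfolding S2 G2 KE using nz by (simp add: field_simps)
    finally show ?thesis by simp
  qed
  moreover have "UY 0 x = - 2 + 3 * (G * G) - 2 * (C * C) * (G * G)"
    by (simp add: UY_def defs power2_eq_square)
  ultimately have main2: "C * (C * ?P - S * G * (G * (C * C * (C * C) + K) / (E * E))) = UY 0 x * (C * S / E)" by simp
  have e2: "Y2'' x = ?P + (C * G * (2 - G * G) + 4 * C * (S * S) * G * (k * k)) * J"
    unfolding Y2''_def E unfolding defs[symmetric] by (simp only: ac_simps)
  have e1: "Y2' x = G * (C * C * (C * C) + K) / (E * E) + S * (2 - G * G) * J"
    unfolding Y2'_def E unfolding defs[symmetric] ..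
  have aux: "C * (C * (p + (C * G * (2 - G * G) + 4 * C * (S * S) * G * (k * k)) * J) - S * G * (r + S * (2 - G * G) * J)) =
     C * (C * p - S * G * r) - C * (C * (- C * G * (2 - G * G) - 4 * C * (S * S) * G * (k * k)) - S * G * (- S * (2 - G * G))) * J"
    for p r by (simp add: algebra_simps)
  have "cc x * (cc x * Y2'' x - SS x * gg x * Y2' x) =
     C * (C * ?P - S * G * (G * (C * C * (C * C) + K) / (E * E))) -
     C * (C * (- C * G * (2 - G * G) - 4 * C * (S * S) * G * (k * k)) - S * G * (- S * (2 - G * G))) * J"
    unfolding e1 e2 unfolding defs[symmetric] by (rule aux)
  also have "\<dots> = UY 0 x * Y2 x"
    unfolding main main2 Y2_def E unfolding defs[symmetric] by (simp add: algebra_simps)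
  finally show ?thesis .
qed

lemma Y2_C2D: "C2D DD Y2" "dd Y2 = (\<lambda>x. cc x / DD x * Y2' x)" "qd DD Y2 = (\<lambda>x. UY 0 x * Y2 x / DD x)"
proof -
  have II_cont: "continuous_on UNIV II"
    using sdD[OF II(2)] by (meson DERIV_isCont continuous_at_imp_continuous_on)
  have c: "continuous_on UNIV Y2''"
    unfolding Y2''_def[abs_def] by (intro continuous_intros II_cont) auto
  show "C2D DD Y2" "dd Y2 = (\<lambda>x. cc x / DD x * Y2' x)"
    using arclength_C2D(1,2)[OF sdD[OF sd_Y2] sdD[OF sd_Y2'] c] by auto
  have "cc x / DD x * (cc x * Y2'' x - SS x * gg x * Y2' x) = UY 0 x * Y2 x / DD x" for x
    using Y2_equation[of x] by simp
  then show "qd DD Y2 = (\<lambda>x. UY 0 x * Y2 x / DD x)"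
    using arclength_C2D(3)[OF sdD[OF sd_Y2] sdD[OF sd_Y2'] c] by simp
qed

text \<open>The integrand has the sign of cc^2 - 2 kap \<le> 1 - 2 kap, which is negative for amp^2
  < 1/2, except where \<open>SS\<close> vanishes. A strict decrease on the left half is combined
  with a weak one on the right.\<close>

lemma II_negative:
  assumes "amp\<^sup>2 < 1 / 2"
  shows "II (pi / 2) < 0"
proof -
  let ?h = "\<lambda>x. cc x / DD x * ((SS x)\<^sup>2 * ((cc x)\<^sup>2 - 2 * kap) / (cc x * DD x ^ 4))"
  have neg: "(cc x)\<^sup>2 - 2 * kap < 0" for x using cc_bounds(3)[of x] assms by (simp add: kap)
  have h: "?h x \<le> 0" "SS x \<noteq> 0 \<Longrightarrow> ?h x < 0" for x
  proof -
    have eq: "?h x = (SS x)\<^sup>2 * (((cc x)\<^sup>2 - 2 * kap) / DD x ^ 5)"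
      by (simp add: field_simps numeral_eq_Suc)
    have lt: "((cc x)\<^sup>2 - 2 * kap) / DD x ^ 5 < 0" using neg[of x] DD_pos[of x] by (simp add: divide_neg_pos)
    show "?h x \<le> 0" unfolding eq using lt by (intro mult_nonneg_nonpos) auto
    show "?h x < 0" if "SS x \<noteq> 0" unfolding eq using lt that by (intro mult_pos_neg) auto
  qed
  have d: "(II has_real_derivative ?h x) (at x)" for x by (rule sdD[OF II(2)])
  have "II (pi / 2) \<le> II 0"
  proof (rule DERIV_nonpos_imp_nonincreasing[where f = II and a = 0 and b = "pi / 2"])
    fix x assume "0 \<le> x" "x \<le> pi / 2"
    show "\<exists>y. (II has_real_derivative y) (at x) \<and> y \<le> 0" using d h(1) by blast
  qed simp
  moreover have "II 0 < II (- pi / 2)"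
  proof (rule DERIV_neg_imp_decreasing_open[where f = II and a = "- pi / 2" and b = 0])
    fix x assume x: "- pi / 2 < x" "x < 0"
    then have "sin x < 0" using sin_gt_zero[of "- x"] by auto
    then have "SS x \<noteq> 0" using amp by (simp add: SS_def)
    with d h(2) show "\<exists>y. (II has_real_derivative y) (at x) \<and> y < 0" by blast
  next
    show "continuous_on {- pi / 2..0} II" using d by (meson DERIV_isCont continuous_at_imp_continuous_on)
  qed simp
  ultimately show ?thesis using II(1) by linarith
qed

lemma II_shift: "II (x + pi * real n) = II x + real n * II (pi / 2)"
proof -
  have step: "II (y + pi) = II y + II (pi / 2)" for y
  proof -
    have "((\<lambda>y. II (y + pi) - II y) has_real_derivative 0) (at y)" for y
    proof -
      let ?h = "\<lambda>x. cc x / DD x * ((SS x)\<^sup>2 * ((cc x)\<^sup>2 - 2 * kap) / (cc x * DD x ^ 4))"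
      have "((\<lambda>y. II (y + pi)) has_real_derivative ?h (y + pi)) (at y)"
        using sdD[OF II(2), of "y + pi"] DERIV_shift by blast
      moreover have "?h (y + pi) = ?h y" using shift[of y 1] by simp
      ultimately show ?thesis using DERIV_diff[OF _ sdD[OF II(2)]] by fastforce
    qed
    then have "II (y + pi) - II y = II (- pi / 2 + pi) - II (- pi / 2)"
      using DERIV_isconst_all by blast
    moreover have "- pi / 2 + pi = pi / 2" by simp
    ultimately show ?thesis by (simp only: II(1))
  qed
  show ?thesis
  proof (induction n)
    case (Suc n)
    then show ?case using step[of "x + pi * real n"] by (simp add: algebra_simps)
  qed auto
qed

lemma osol_unique:
  fixes n :: nat and \<sigma> :: real
  assumes n: "even n" "n > 0" "\<sigma> = 1 \<or> \<sigma> = -1"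
    and f: "C2D DD f" "\<And>x. qd DD f x = VV l x (f x) - (m * ww x) *\<^sub>R f x" and "f x0 = 0" "dd f x0 = 0"
  shows "f x = 0"
proof -
  interpret sturm_liouville DD ww "VV l" "pi * real n" \<sigma> by (rule sturm_liouville_VV[OF n])
  show ?thesis by (rule linear_ode_unique[OF f assms(6,7)])
qed

text \<open>The second component of \<open>f\<close> at - pi / 2 is left free. There
  \<open>gg\<close> and the derivative of \<open>Y2\<close> vanish, so by uniqueness
  \<open>f\<close> is a multiple of (0, Y2). The drift of \<open>II\<close>, seen at 0 where
  \<open>gg\<close> is positive, excludes a nonzero multiple. Hence frequency 0 contributes at most
  three to the nullity.\<close>

lemma null_space_0:
  assumes n: "even n" "n > 0" and a: "amp\<^sup>2 < 1 / 2"
    and f: "osol n 1 0 0 f" "fst (f (- pi / 2)) = 0" "fst (dd f (- pi / 2)) = 0" "snd (dd f (- pi / 2)) = 0"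
  shows "f x = 0"
proof -
  let ?x0 = "- pi / 2 :: real"
  have g0: "gg ?x0 = 0" by (simp add: gg_def)
  have Y20: "Y2 ?x0 \<noteq> 0" unfolding Y2_def g0 SS_def using amp by simp
  have Y2'0: "dd Y2 ?x0 = 0" unfolding Y2_C2D Y2'_def g0 II(1) by simp
  define k where "k = snd (f ?x0) / Y2 ?x0"
  define h where "h = (\<lambda>x. 1 *\<^sub>R f x + (- k) *\<^sub>R (0, Y2 x))"
  have fC: "C2D DD f" using f by (simp add: osol_def)
  have z: "C2D DD (\<lambda>_. 0 :: real)" "dd (\<lambda>_. 0 :: real) = (\<lambda>_. 0)" "qd DD (\<lambda>_. 0 :: real) = (\<lambda>_. 0)"
    by (rule C2D_zero)+
  note P = C2D_Pair[OF z(1) Y2_C2D(1)]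
  note hl = C2D_lin[OF fC P(1), of 1 "- k", folded h_def]
  have "h x = 0" for x
  proof (rule osol_unique[OF n, of 1 h 0 0 ?x0])
    show "qd DD h x = VV 0 x (h x) - (0 * ww x) *\<^sub>R h x" for x
      using f(1) unfolding hl(3) P(3) z(3) Y2_C2D(3) osol_def
      by (simp add: h_def VV_def algebra_simps diff_divide_distrib prod_eq_iff)
    show "h ?x0 = 0" using f(2) Y20 by (simp add: h_def k_def prod_eq_iff)
    show "dd h ?x0 = 0" unfolding hl(2) P(2) z(2) using f(3,4) Y2'0 by (simp add: prod_eq_iff)
  qed (use hl in auto)
  then have fY: "f x = (0, k * Y2 x)" for x
    using arg_cong[OF \<open>\<And>x. h x = 0\<close>[of x], of fst] arg_cong[OF \<open>\<And>x. h x = 0\<close>[of x], of snd]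
    by (simp add: h_def prod_eq_iff)
  have "k = 0"
  proof (rule ccontr)
    assume "k \<noteq> 0"
    moreover have "k * Y2 (0 + pi * real n) = k * Y2 0"
      using f(1) fY unfolding osol_def by (metis scaleR_one snd_conv)
    ultimately have "Y2 (0 + pi * real n) = Y2 0" by simp
    then have "cc 0 * gg 0 * (real n * II (pi / 2)) = 0"
      using n unfolding Y2_def shift II_shift by (simp add: algebra_simps)
    moreover have "gg 0 > 0" using amp DD_pos[of 0] cc_bounds(1)[of 0] by (simp add: gg_def)
    ultimately show False using n II_negative[OF a] by simp
  qed
  with fY show ?thesis by (simp add: zero_prod_def)
qed

end

section \<open>Small amplitude\<close>

locale otsuki_small = otsuki +
  assumes amp_small: "amp \<le> 1 / 100"
begin

lemma kap_small: "kap \<ge> 9999 / 10000"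
proof -
  have "amp\<^sup>2 \<le> (1 / 100)\<^sup>2" using amp amp_small by (intro power_mono) auto
  then show ?thesis by (simp add: kap power2_eq_square)
qed

text \<open>1 - (9999/10000)^2 is just below 1/4900. Its square root 1/70 controls the coupling of
  the two components and reappears as l / 35 in later estimates.\<close>

lemma gg_small: "(gg x)\<^sup>2 \<le> 1 / 4900" "\<bar>gg x\<bar> \<le> 1 / 70"
proof -
  have "kap * kap \<ge> (9999 / 10000) * (9999 / 10000)" using kap_small kap by (intro mult_mono) auto
  moreover have "(cc x * kk x)\<^sup>2 \<ge> kap * kap"
  proof -
    have "(cc x * kk x)\<^sup>2 = kap\<^sup>2 / ((cc x)\<^sup>2)\<^sup>2"
      by (simp add: kk_def power_divide power_mult_distrib power2_eq_square power3_eq_cube)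
    moreover have "((cc x)\<^sup>2)\<^sup>2 \<le> 1" "((cc x)\<^sup>2)\<^sup>2 > 0"
      using cc_bounds[of x] power_mono[of "(cc x)\<^sup>2" 1 2] by simp_all
    moreover have "kap\<^sup>2 / 1 \<le> kap\<^sup>2 / ((cc x)\<^sup>2)\<^sup>2" using calculation(2,3) by (intro divide_left_mono) auto
    ultimately show ?thesis by (simp add: power2_eq_square)
  qed
  ultimately show 1: "(gg x)\<^sup>2 \<le> 1 / 4900" unfolding gg2' by linarith
  then have "\<bar>gg x\<bar>\<^sup>2 \<le> (1 / 70)\<^sup>2" by (simp add: power2_eq_square)
  then show "\<bar>gg x\<bar> \<le> 1 / 70" by (rule power2_le_imp_le) simp
qed

lemma SS_small: "\<bar>SS x\<bar> \<le> 1 / 100"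
proof -
  have "\<bar>SS x\<bar> \<le> amp" using SS_bound[of x] amp by (metis abs_le_square_iff abs_of_pos)
  then show ?thesis using amp_small by simp
qed

text \<open>The error 1/1000 absorbs 3 gg^2 \<le> 3/4900 and the deviation of 2 cc^2 from 2, which
  is at most 2/10000.\<close>

lemma UXY_bounds: "UX l x \<ge> l\<^sup>2 - 4" "UY l x \<ge> l\<^sup>2 - 2" "UX l x \<le> l\<^sup>2 - 4 + 1 / 1000" "UY l x \<le> l\<^sup>2 - 2 + 1 / 1000"
proof -
  have "(cc x)\<^sup>2 * (gg x)\<^sup>2 \<le> 1 * (gg x)\<^sup>2" using cc_bounds[of x] by (intro mult_right_mono) auto
  moreover have "0 \<le> (cc x)\<^sup>2 * (gg x)\<^sup>2" "0 \<le> (gg x)\<^sup>2" by auto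
  ultimately show "UX l x \<ge> l\<^sup>2 - 4" "UY l x \<ge> l\<^sup>2 - 2" "UX l x \<le> l\<^sup>2 - 4 + 1 / 1000" "UY l x \<le> l\<^sup>2 - 2 + 1 / 1000"
    using gg_small(1)[of x] cc_bounds[of x] kap_small unfolding UX_def UY_def by linarith+
qed

lemma cross_bound: "\<bar>2 * gg x * X * Y\<bar> \<le> (X\<^sup>2 + Y\<^sup>2) / 70"
proof -
  have "\<bar>2 * X * Y\<bar> \<le> X\<^sup>2 + Y\<^sup>2"
    using zero_le_power2[of "X - Y"] zero_le_power2[of "X + Y"] unfolding abs_le_iff
    by (simp add: power2_eq_square algebra_simps)
  then have "\<bar>gg x\<bar> * \<bar>2 * X * Y\<bar> \<le> (1 / 70) * (X\<^sup>2 + Y\<^sup>2)"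
    using gg_small(2)[of x] by (intro mult_mono) auto
  then show ?thesis by (simp add: abs_mult mult_ac)
qed

lemma VV_inner: "DD x * (VV l x u \<bullet> u) = UX l x * (fst u)\<^sup>2 + UY l x * (snd u)\<^sup>2 + 2 * l * (2 * gg x * fst u * snd u)"
  by (simp add: VV_def inner_prod_def power2_eq_square field_simps)

text \<open>The diagonal part is at least l^2 - 4 and the coupling at most l / 35; for l \<ge> 3 the
  difference exceeds 1, so the form dominates \<open>ip\<close>.\<close>

lemma positive_modes:
  assumes n: "even n" "n > 0" "\<sigma> = 1 \<or> \<sigma> = -1" and l: "l \<ge> 3" and m: "m \<le> 0" and f: "osol n \<sigma> l m f"
  shows "f x = 0"
proof -
  interpret sturm_liouville DD ww "VV l" "pi * real n" \<sigma> by (rule sturm_liouville_VV[OF n])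
  have s: "sol m f" using f osol_sol[OF n] by simp
  then have a: "adm f" by (simp add: sol_def)
  have "ip f f \<le> form f f"
    unfolding ip_def form_def
  proof (rule integral_le)
    fix x
    define u where "u = f x"
    have c: "\<bar>2 * gg x * fst u * snd u\<bar> \<le> ((fst u)\<^sup>2 + (snd u)\<^sup>2) / 70" by (rule cross_bound)
    have "l\<^sup>2 \<ge> 3 * l" using l by (simp add: power2_eq_square)
    then have l2: "l\<^sup>2 \<ge> 3 * l" "l\<^sup>2 \<ge> 9" using l by auto
    have b1: "(l\<^sup>2 - 4) * (fst u)\<^sup>2 \<le> UX l x * (fst u)\<^sup>2" "(l\<^sup>2 - 4) * (snd u)\<^sup>2 \<le> UY l x * (snd u)\<^sup>2"
      using UXY_bounds(1,2)[of l x] by (intro mult_right_mono; simp)+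
    have b2: "2 * l * (- (((fst u)\<^sup>2 + (snd u)\<^sup>2) / 70)) \<le> 2 * l * (2 * gg x * fst u * snd u)"
    proof (rule mult_left_mono)
      show "- (((fst u)\<^sup>2 + (snd u)\<^sup>2) / 70) \<le> 2 * gg x * fst u * snd u"
        using abs_le_D2[OF c] by linarith
    qed (use l in auto)
    have "DD x * (VV l x u \<bullet> u) \<ge> (l\<^sup>2 - 4 - l / 35) * ((fst u)\<^sup>2 + (snd u)\<^sup>2)"
    proof -
      have "(l\<^sup>2 - 4 - l / 35) * (p + q) = (l\<^sup>2 - 4) * p + (l\<^sup>2 - 4) * q + 2 * l * (- ((p + q) / 70))" for p q
        by (simp add: field_simps)
      from this[of "(fst u)\<^sup>2" "(snd u)\<^sup>2"] show ?thesis using b1 b2 unfolding VV_inner by linarith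
    qed
    moreover have "(l\<^sup>2 - 4 - l / 35) * ((fst u)\<^sup>2 + (snd u)\<^sup>2) \<ge> 1 * ((fst u)\<^sup>2 + (snd u)\<^sup>2)"
      using l2 l by (intro mult_right_mono) auto
    moreover have "(cc x)\<^sup>2 * ((fst u)\<^sup>2 + (snd u)\<^sup>2) \<le> 1 * ((fst u)\<^sup>2 + (snd u)\<^sup>2)"
      using cc_bounds[of x] by (intro mult_right_mono) auto
    ultimately have "(cc x)\<^sup>2 * (u \<bullet> u) \<le> DD x * (VV l x u \<bullet> u)"
      by (simp add: inner_prod_def power2_eq_square)
    then have "ww x * (u \<bullet> u) \<le> VV l x u \<bullet> u" using DD_pos[of x] by (simp add: ww_def field_simps)
    moreover have "0 \<le> DD x * (dd f x \<bullet> dd f x)" using DD_pos[of x] by simp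
    ultimately show "ww x * (f x \<bullet> f x) \<le> DD x * (dd f x \<bullet> dd f x) + VV l x (f x) \<bullet> f x"
      unfolding u_def by linarith
  qed (auto intro: int_ip int_form a)
  also have "form f f = m * ip f f" by (rule form_sol[OF a s])
  also have "\<dots> \<le> 0" using m ip_nonneg[OF a] by (rule mult_nonpos_nonneg)
  finally show ?thesis using ip_zero_imp[OF a] by blast
qed

text \<open>Subtracting the total derivative of \<open>Bd\<close> from the integrand of the form leaves the nonnegative
  density \<open>Pos\<close>; this is the factorisation of the operator by its explicit null solution.\<close>

lemma null_space_2:
  fixes n :: nat
  assumes n: "even n" "n > 0" "\<sigma> = 1 \<or> \<sigma> = -1" and m: "m \<le> 0" and f: "osol n \<sigma> 2 m f"
  shows "m < 0 \<Longrightarrow> f x = 0" and "fst (f 0) = 0 \<Longrightarrow> f x = 0"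
proof -
  interpret sturm_liouville DD ww "VV 2" "pi * real n" \<sigma> by (rule sturm_liouville_VV[OF n])
  have s: "sol m f" using f osol_sol[OF n] by simp
  then have a: "adm f" by (simp add: sol_def)
  note fC = adm_C2D[OF a]
  define X Y where "X x = fst (f x)" and "Y x = snd (f x)" for x
  define Xs Ys where "Xs x = DD x / cc x * fst (dd f x)" and "Ys x = DD x / cc x * snd (dd f x)" for x
  have sdX: "sd X Xs" and sdY: "sd Y Ys"
    using bounded_linear.has_vector_derivative[OF bounded_linear_fst C2D_D(1)[OF fC]]
      bounded_linear.has_vector_derivative[OF bounded_linear_snd C2D_D(1)[OF fC]]
    by (auto simp: sd_def has_real_derivative_iff_has_vector_derivative X_def[abs_def] Y_def[abs_def] Xs_def Ys_def)
  \<comment> \<open>On the explicit solution \<open>(cc, - (cc * gg))\<close> one has \<xi> = 1 and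
    \<eta> = 0. In these coordinates the form loses its zeroth-order terms in \<xi>.\<close>
  define \<xi> where "\<xi> x = X x / cc x" for x
  define \<eta> where "\<eta> x = Y x + gg x * X x" for x
  define \<xi>s where "\<xi>s x = (Xs x * cc x - X x * (- SS x * gg x)) / (cc x * cc x)" for x
  define \<eta>s where "\<eta>s x = Ys x + ((- 2 * cc x * (kk x)\<^sup>2 * SS x) * X x + gg x * Xs x)" for x
  have sd\<xi>: "sd \<xi> \<xi>s" unfolding \<xi>_def[abs_def] \<xi>s_def[abs_def] by (intro sd_divide sdX sd_cc nz)
  have sd\<eta>: "sd \<eta> \<eta>s" unfolding \<eta>_def[abs_def] \<eta>s_def[abs_def] by (intro sd_add sd_mult sdX sdY sd_gg)
  have X: "X x = cc x * \<xi> x" and Y: "Y x = \<eta> x - gg x * (cc x * \<xi> x)"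
    and Xs: "Xs x = cc x * \<xi>s x - SS x * gg x * \<xi> x" for x
    by (simp_all add: \<xi>_def \<eta>_def \<xi>s_def field_simps)
  have Ys: "Ys x = \<eta>s x + 2 * cc x * (kk x * kk x) * SS x * (cc x * \<xi> x) - gg x * (cc x * \<xi>s x - SS x * gg x * \<xi> x)" for x
    unfolding \<eta>s_def Xs[of x] X[of x] by (simp add: power2_eq_square algebra_simps)
  \<comment> \<open>Chosen so that every term with undifferentiated \<xi> becomes part of a total
    derivative. \<open>Bd\<close> is quadratic in \<xi> and \<eta>, so the sign
    \<open>\<sigma>\<close> cancels and its values at both ends agree.\<close>
  define Bd where "Bd x = - (cc x * cc x * SS x * (gg x * (3 - gg x * gg x)) * (\<xi> x * \<xi> x)) +
     2 * cc x * SS x * (2 - gg x * gg x) * (\<xi> x * \<eta> x)" for x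
  define Pos where "Pos x = cc x * (cc x * cc x * (1 + gg x * gg x) * (\<xi>s x * \<xi>s x) +
      2 * \<xi>s x * (- (cc x * gg x * \<eta>s x) - SS x * (2 - gg x * gg x) * \<eta> x) + \<eta>s x * \<eta>s x) + UY 2 x / cc x * (\<eta> x * \<eta> x)" for x
  define Bds where "Bds x = cc x * (Xs x * Xs x + Ys x * Ys x) +
      (UX 2 x * (X x * X x) + UY 2 x * (Y x * Y x) + 8 * gg x * X x * Y x) / cc x - Pos x" for x
  have sdBd: "sd Bd Bds"
  proof -
    have "sd (\<lambda>x. - (cc x * cc x * SS x * (gg x * (3 - gg x * gg x)) * (\<xi> x * \<xi> x)) +
       2 * cc x * SS x * (2 - gg x * gg x) * (\<xi> x * \<eta> x)) Bds"
    proof (rule sd_cong, (rule sd_const sd_add sd_minus sd_mult sd_diff sd_cc sd_SS sd_gg sd\<xi> sd\<eta>)+)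
      fix x
      let ?c = "cc x" and ?g = "gg x" and ?S = "SS x" and ?k = "kk x"
      let ?gs = "- 2 * ?c * (?k)\<^sup>2 * ?S"
      show "- (((((- ?S * ?g) * ?c + ?c * (- ?S * ?g)) * ?S + ?c * ?c * (?c * ?g)) * (?g * (3 - ?g * ?g)) +
         ?c * ?c * ?S * (?gs * (3 - ?g * ?g) + ?g * (0 - (?gs * ?g + ?g * ?gs)))) * (\<xi> x * \<xi> x) +
         ?c * ?c * ?S * (?g * (3 - ?g * ?g)) * (\<xi>s x * \<xi> x + \<xi> x * \<xi>s x)) +
         ((((0 * ?c + 2 * (- ?S * ?g)) * ?S + 2 * ?c * (?c * ?g)) * (2 - ?g * ?g) + 2 * ?c * ?S * (0 - (?gs * ?g + ?g * ?gs))) * (\<xi> x * \<eta> x) +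
         2 * ?c * ?S * (2 - ?g * ?g) * (\<xi>s x * \<eta> x + \<xi> x * \<eta>s x)) = Bds x"
      proof -
        define i where "i = inverse ?c"
        have i: "?c * i = 1" by (simp add: i_def)
        have d: "u / ?c = u * i" for u by (simp add: i_def divide_inverse)
        show ?thesis
          unfolding Bds_def Pos_def X Y Xs Ys UX_def UY_def d power2_eq_square
          using rel[of x] i by algebra
      qed
    qed
    then show ?thesis by (simp add: Bd_def[abs_def])
  qed
  have \<xi>per: "\<xi> (x + pi * real n) = \<sigma> * \<xi> x" and \<eta>per: "\<eta> (x + pi * real n) = \<sigma> * \<eta> x" for x
    using a n(1) by (auto simp: \<xi>_def \<eta>_def X_def Y_def adm_def shift algebra_simps)
  have cont: "continuous_on A X" "continuous_on A Y" "continuous_on A Xs" "continuous_on A Ys" for A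
    unfolding X_def[abs_def] Y_def[abs_def] Xs_def[abs_def] Ys_def[abs_def]
    by (intro continuous_intros C2D_D(4)[OF fC] cont_dd[OF fC]; simp)+
  have cont2: "continuous_on A \<xi>" "continuous_on A \<eta>" "continuous_on A \<xi>s" "continuous_on A \<eta>s" for A
    unfolding \<xi>_def[abs_def] \<eta>_def[abs_def] \<xi>s_def[abs_def] \<eta>s_def[abs_def]
    by (intro continuous_intros cont; simp)+
  have contP: "continuous_on A (\<lambda>x. cc x / DD x * Pos x)" for A
    unfolding Pos_def by (intro continuous_intros cont2) auto
  have int: "((\<lambda>x. cc x / DD x * Bds x) has_integral Bd (pi * real n) - Bd 0) {0..pi * real n}"
    using sdD[OF sdBd] P_pos
    by (intro fundamental_theorem_of_calculus)
       (auto simp flip: has_real_derivative_iff_has_vector_derivative intro: has_field_derivative_at_within)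
  have "Bd (pi * real n) = Bd 0"
    using \<xi>per[of 0] \<eta>per[of 0] shift[of 0 n] n by (auto simp: Bd_def)
  with int have int0: "((\<lambda>x. cc x / DD x * Bds x) has_integral 0) {0..pi * real n}" by simp
  have "form f f = integral {0..pi * real n} (\<lambda>x. cc x / DD x * Bds x + cc x / DD x * Pos x)"
    unfolding form_def
  proof (rule integral_cong)
    fix x
    have 1: "DD x * (dd f x \<bullet> dd f x) = cc x / DD x * (cc x * (Xs x * Xs x + Ys x * Ys x))"
      by (simp add: Xs_def Ys_def inner_prod_def field_simps)
    have 2: "VV 2 x (f x) \<bullet> f x = cc x / DD x * ((UX 2 x * (X x * X x) + UY 2 x * (Y x * Y x) + 8 * gg x * X x * Y x) / cc x)"
    proof -
      have "VV 2 x (f x) \<bullet> f x = (DD x * (VV 2 x (f x) \<bullet> f x)) / DD x" by simp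
      then show ?thesis unfolding VV_inner by (simp add: X_def Y_def power2_eq_square mult_ac)
    qed
    show "DD x * (dd f x \<bullet> dd f x) + VV 2 x (f x) \<bullet> f x = cc x / DD x * Bds x + cc x / DD x * Pos x"
      unfolding 1 2 Bds_def by (simp add: algebra_simps)
  qed
  also have "\<dots> = integral {0..pi * real n} (\<lambda>x. cc x / DD x * Pos x)"
    using integral_unique[OF has_integral_add[OF int0 integrable_integral[OF integrable_continuous_interval[OF contP]]]]
    by simp
  finally have form: "form f f = integral {0..pi * real n} (\<lambda>x. cc x / DD x * Pos x)" .
  \<comment> \<open>Small amplitude keeps the coefficients of the cross terms below 1/70 and 1/40,
    while \<open>UY 2 x\<close> \<ge> 2 supplies the square of \<eta>.\<close>
  have Pos: "cc x / 2 * ((cc x * \<xi>s x)\<^sup>2 + (\<eta> x)\<^sup>2) \<le> Pos x" for x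
  proof -
    define p q r c g S where "p = cc x * \<xi>s x" "q = \<eta>s x" "r = \<eta> x" "c = cc x" "g = gg x" "S = SS x"
    note defs = p_q_r_c_g_S_def
    have c: "0 < c" "c \<le> 1" "99 / 100 \<le> c"
    proof -
      show "0 < c" using cc_bounds by (simp add: defs)
      have "(cc x)\<^sup>2 \<le> 1\<^sup>2" using cc_bounds(3)[of x] by simp
      then show "c \<le> 1" unfolding defs by (rule power2_le_imp_le) simp
      have "(99 / 100)\<^sup>2 \<le> (cc x)\<^sup>2" using cc_bounds(2)[of x] kap_small by (simp add: power2_eq_square)
      then show "99 / 100 \<le> c" unfolding defs by (rule power2_le_imp_le) (use cc_bounds(1)[of x] in simp)
    qed
    have g: "\<bar>g\<bar> \<le> 1 / 70" and S: "\<bar>S\<bar> \<le> 1 / 100" using gg_small(2) SS_small by (auto simp: defs)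
    have U: "UY 2 x \<ge> 2" using UXY_bounds(2)[of 2 x] by simp
    have y: "\<xi>s x = p / c" using c by (simp add: defs)
    have PosE: "Pos x = c * (p\<^sup>2 * (1 + g * g) - 2 * g * p * q - 2 * (S * (2 - g * g) / c) * p * r + q\<^sup>2) + UY 2 x / c * r\<^sup>2"
      unfolding Pos_def y defs(2-6)[symmetric] using c by (simp add: power2_eq_square field_simps)
    have ab: "\<bar>2 * (h * u * v)\<bar> \<le> \<bar>h\<bar> * (u\<^sup>2 + v\<^sup>2)" for h u v :: real
    proof -
      have "\<bar>2 * u * v\<bar> \<le> u\<^sup>2 + v\<^sup>2"
        using zero_le_power2[of "u - v"] zero_le_power2[of "u + v"] unfolding abs_le_iff
        by (simp add: power2_eq_square algebra_simps)
      from mult_left_mono[OF this, of "\<bar>h\<bar>"] show ?thesis by (simp add: abs_mult mult_ac)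
    qed
    define h where "h = S * (2 - g * g) / c"
    have h: "\<bar>h\<bar> \<le> 1 / 40"
    proof -
      have gg1: "g * g \<le> 1" "0 \<le> g * g" using g abs_square_le_1[of g] by (auto simp: power2_eq_square)
      have 1: "\<bar>S * (2 - g * g)\<bar> \<le> (1 / 100) * 2"
        unfolding abs_mult using S gg1 by (intro mult_mono) auto
      have "\<bar>h\<bar> = \<bar>S * (2 - g * g)\<bar> / c" using c by (simp add: h_def)
      also have "\<dots> \<le> (1 / 50) / (99 / 100)"
        using 1 c by (intro frac_le) auto
      also have "\<dots> \<le> 1 / 40" by simp
      finally show ?thesis .
    qed
    have 1: "2 * (g * p * q) \<le> 1 / 70 * (p\<^sup>2 + q\<^sup>2)"
      by (rule order_trans[OF abs_ge_self order_trans[OF ab mult_right_mono[OF g]]]) simp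
    have 2: "2 * (h * p * r) \<le> 1 / 40 * (p\<^sup>2 + r\<^sup>2)"
      by (rule order_trans[OF abs_ge_self order_trans[OF ab mult_right_mono[OF h]]]) simp
    have 3: "p\<^sup>2 * (1 + g * g) \<ge> p\<^sup>2" using mult_left_mono[of 1 "1 + g * g" "p\<^sup>2"] by simp
    have 4: "q\<^sup>2 \<ge> 0" "r\<^sup>2 \<ge> 0" "p\<^sup>2 \<ge> 0" by auto
    have "p\<^sup>2 / 2 - r\<^sup>2 / 2 \<le> p\<^sup>2 * (1 + g * g) - 2 * (g * p * q) - 2 * (h * p * r) + q\<^sup>2"
      using 1 2 3 4 by argo
    then have "p\<^sup>2 / 2 - r\<^sup>2 / 2 \<le> p\<^sup>2 * (1 + g * g) - 2 * g * p * q - 2 * h * p * r + q\<^sup>2"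
      by (simp only: mult.assoc)
    then have "c * (p\<^sup>2 / 2 - r\<^sup>2 / 2) \<le> c * (p\<^sup>2 * (1 + g * g) - 2 * g * p * q - 2 * h * p * r + q\<^sup>2)"
      using c by (intro mult_left_mono) auto
    moreover have "c * r\<^sup>2 \<le> UY 2 x / c * r\<^sup>2"
    proof (rule mult_right_mono)
      have "c * c \<le> 1" using c by (simp add: mult_le_one)
      then show "c \<le> UY 2 x / c" using U c by (simp add: field_simps)
    qed simp
    moreover have "cc x * \<xi>s x = p" by (simp add: defs)
    ultimately show ?thesis
      unfolding PosE h_def[symmetric] by (simp add: defs(3,4)[symmetric] algebra_simps)
  qed
  have Pos0: "cc x / DD x * Pos x \<ge> 0" for x
    using order_trans[OF _ Pos[of x], of 0] cc_bounds(1)[of x] DD_pos[of x] by simp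
  have "form f f = m * ip f f" by (rule form_sol[OF a s])
  also have "\<dots> \<le> 0" using m ip_nonneg[OF a] by (rule mult_nonpos_nonneg)
  finally have le: "form f f \<le> 0" .
  have ge: "form f f \<ge> 0"
    unfolding form using Pos0 by (intro integral_nonneg integrable_continuous_interval contP) auto
  show "f x = 0" if "m < 0"
  proof -
    have "m * ip f f = 0" using form_sol[OF a s] le ge by simp
    then show ?thesis using that ip_zero_imp[OF a] by simp
  qed
  show "f x = 0" if f0: "fst (f 0) = 0"
  proof (rule adm_eq_zero[OF a])
    \<comment> \<open>A vanishing form forces \<xi> to be constant and \<eta> = 0, so the first
      component at 0 determines the solution: each phase of frequency 2 contributes at most one to
      the nullity.\<close>
    have "integral {0..pi * real n} (\<lambda>x. cc x / DD x * Pos x) = 0" using le ge form by simp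
    then have P0: "cc x / DD x * Pos x = 0" if "x \<in> {0..pi * real n}" for x
      using integral_eq_0_iff[OF contP P_pos Pos0] that by simp
    have z: "\<xi>s x = 0 \<and> \<eta> x = 0" if "x \<in> {0..pi * real n}" for x
    proof -
      have "(cc x * \<xi>s x)\<^sup>2 + (\<eta> x)\<^sup>2 \<le> 0"
        using P0[OF that] Pos[of x] cc_bounds(1)[of x] by (simp add: mult_le_0_iff)
      then show ?thesis by (simp add: sum_power2_le_zero_iff)
    qed
    fix x assume x: "x \<in> {0..pi * real n}"
    have "\<xi> x = \<xi> 0"
    proof (cases "x = 0")
      case False
      show ?thesis
      proof (rule DERIV_isconst2[where a = 0 and b = x and x = x])
        show "continuous_on {0..x} \<xi>" by (rule cont2)
        show "(\<xi> has_real_derivative 0) (at y)" if "0 < y" "y < x" for y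
          using sdD[OF sd\<xi>, of y] z[of y] that x by simp
      qed (use False x in auto)
    qed simp
    then have "\<xi> x = 0" using f0 by (simp add: \<xi>_def X_def)
    then have "X x = 0" "Y x = 0" using z[OF x] X Y by auto
    then show "f x = 0" by (simp add: X_def Y_def prod_eq_iff)
  qed
qed

text \<open>Equispaced zeros of both components allow Wirtinger's inequality, which makes the form
  nonnegative on the sum, whereas it is negative on sums of solutions with negative eigenvalues.\<close>

lemma vanishing_sums:
  fixes n NX NY :: nat
  assumes n: "even n" "n > 0" "\<sigma> = 1 \<or> \<sigma> = -1" and l: "0 \<le> l" "l \<le> 1"
    and kX: "kX \<ge> 0" "19998 / 10000 * kX\<^sup>2 \<ge> 4 - l\<^sup>2 + l / 35" "kX * real n < real NX"
    and kY: "kY \<ge> 0" "19998 / 10000 * kY\<^sup>2 \<ge> 2 - l\<^sup>2 + l / 35" "kY * real n < real NY"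
    and F: "finite F" "\<And>m. m \<in> F \<Longrightarrow> m < 0" "\<And>m. m \<in> F \<Longrightarrow> osol n \<sigma> l m (f m)"
    and zX: "\<And>i. i < NX \<Longrightarrow> (\<Sum>m\<in>F. fst (f m (pi * real n * real i / real NX))) = 0"
    and zY: "\<And>i. i < NY \<Longrightarrow> (\<Sum>m\<in>F. snd (f m (pi * real n * real i / real NY))) = 0"
    and m: "m \<in> F"
  shows "f m x = 0"
proof -
  interpret sturm_liouville DD ww "VV l" "pi * real n" \<sigma> by (rule sturm_liouville_VV[OF n])
  have s: "sol m (f m)" if "m \<in> F" for m using F(3)[OF that] osol_sol[OF n] by simp
  then have a: "adm (f m)" if "m \<in> F" for m using that by (simp add: sol_def)
  define u where "u x = (\<Sum>m\<in>F. f m x)" for x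
  have au: "adm u" unfolding u_def using adm_sum[of F f "\<lambda>_. 1"] F(1) a by simp
  note uC = adm_C2D[OF au]
  define X Y where "X x = fst (u x)" and "Y x = snd (u x)" for x
  define X' Y' where "X' x = fst (dd u x)" and "Y' x = snd (dd u x)" for x
  have dX: "(X has_real_derivative X' x) (at x)" and dY: "(Y has_real_derivative Y' x) (at x)" for x
    using bounded_linear.has_vector_derivative[OF bounded_linear_fst C2D_D(1)[OF uC]]
      bounded_linear.has_vector_derivative[OF bounded_linear_snd C2D_D(1)[OF uC]]
    by (auto simp: has_real_derivative_iff_has_vector_derivative X_def[abs_def] Y_def[abs_def] X'_def Y'_def)
  have cont: "continuous_on A X" "continuous_on A Y" "continuous_on A X'" "continuous_on A Y'" for A
    unfolding X_def[abs_def] Y_def[abs_def] X'_def[abs_def] Y'_def[abs_def]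
    by (intro continuous_intros C2D_D(4)[OF uC] cont_dd[OF uC])+
  let ?P = "pi * real n"
  have per: "X ?P = \<sigma> * X 0" "Y ?P = \<sigma> * Y 0"
    using au unfolding adm_def X_def Y_def by (metis add_0 fst_scaleR snd_scaleR real_scaleR_def)+
  have WX: "kX\<^sup>2 * integral {0..?P} (\<lambda>x. (X x)\<^sup>2) \<le> integral {0..?P} (\<lambda>x. (X' x)\<^sup>2)"
  proof (rule wirtinger_equispaced[OF dX cont(3)])
    show "NX > 0" using kX n by (cases NX) (auto simp: mult_less_0_iff)
    show "X (?P * real i / real NX) = 0" if "i < NX" for i using zX[OF that] by (simp add: X_def u_def fst_sum)
    show "kX * ?P < pi * real NX" using kX(3) by (simp add: mult.left_commute)
  qed (use per kX P_pos in auto)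
  have WY: "kY\<^sup>2 * integral {0..?P} (\<lambda>x. (Y x)\<^sup>2) \<le> integral {0..?P} (\<lambda>x. (Y' x)\<^sup>2)"
  proof (rule wirtinger_equispaced[OF dY cont(4)])
    show "NY > 0" using kY n by (cases NY) (auto simp: mult_less_0_iff)
    show "Y (?P * real i / real NY) = 0" if "i < NY" for i using zY[OF that] by (simp add: Y_def u_def snd_sum)
    show "kY * ?P < pi * real NY" using kY(3) by (simp add: mult.left_commute)
  qed (use per kY P_pos in auto)
  \<comment> \<open>The minimum of \<open>DD\<close>, with square 2 kap \<ge> 19998/10000. After
    multiplication by \<open>d\<close>, the comparison of \<open>d * k\<^sup>2\<close> with
    \<open>B / d\<close> is the numerical hypothesis on k.\<close>
  define d where "d = sqrt (2 * kap)"
  have d: "d > 0" "d\<^sup>2 = 2 * kap" using kap by (auto simp: d_def)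
  have dD: "d \<le> DD x" for x unfolding d_def DD_def using cc_bounds(2)[of x] by simp
  \<comment> \<open>The term l / 35 is the coupling 2 l / 70, which \<open>cross_bound\<close>
    spreads over the squares of both components.\<close>
  define BX BY where "BX = 4 - l\<^sup>2 + l / 35" and "BY = 2 - l\<^sup>2 + l / 35"
  have l2: "l\<^sup>2 \<le> 1" using l by (simp add: power_le_one)
  have B0: "BX \<ge> 0" "BY \<ge> 0" using l l2 by (auto simp: BX_def BY_def)
  have BX: "BX / d \<le> d * kX\<^sup>2" and BY: "BY / d \<le> d * kY\<^sup>2"
  proof -
    have "19998 / 10000 * z\<^sup>2 \<le> d\<^sup>2 * z\<^sup>2" for z using kap_small d by (intro mult_right_mono) auto
    then have "BX \<le> d\<^sup>2 * kX\<^sup>2" "BY \<le> d\<^sup>2 * kY\<^sup>2" using kX(2) kY(2) unfolding BX_def BY_def by (meson order_trans)+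
    then show "BX / d \<le> d * kX\<^sup>2" "BY / d \<le> d * kY\<^sup>2" using d by (simp_all add: field_simps power2_eq_square)
  qed
  have ints: "(\<lambda>x. (X x)\<^sup>2) integrable_on {0..?P}" "(\<lambda>x. (Y x)\<^sup>2) integrable_on {0..?P}"
    "(\<lambda>x. (X' x)\<^sup>2) integrable_on {0..?P}" "(\<lambda>x. (Y' x)\<^sup>2) integrable_on {0..?P}"
    by (intro integrable_continuous_interval continuous_intros cont)+
  have "integral {0..?P} (\<lambda>x. (d * (X' x)\<^sup>2 + d * (Y' x)\<^sup>2) - (BX / d * (X x)\<^sup>2 + BY / d * (Y x)\<^sup>2)) \<le> form u u"
    unfolding form_def
  proof (rule integral_le)
    show "(\<lambda>x. (d * (X' x)\<^sup>2 + d * (Y' x)\<^sup>2) - (BX / d * (X x)\<^sup>2 + BY / d * (Y x)\<^sup>2)) integrable_on {0..?P}"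
      by (intro integrable_continuous_interval continuous_intros cont)
    fix x
    have "(l\<^sup>2 - 4) * (X x)\<^sup>2 \<le> UX l x * (X x)\<^sup>2" "(l\<^sup>2 - 2) * (Y x)\<^sup>2 \<le> UY l x * (Y x)\<^sup>2"
      using UXY_bounds(1,2)[of l x] by (intro mult_right_mono; simp)+
    moreover have "2 * l * (- (((X x)\<^sup>2 + (Y x)\<^sup>2) / 70)) \<le> 2 * l * (2 * gg x * X x * Y x)"
    proof (rule mult_left_mono)
      show "- (((X x)\<^sup>2 + (Y x)\<^sup>2) / 70) \<le> 2 * gg x * X x * Y x"
        using abs_le_D2[OF cross_bound[of x "X x" "Y x"]] by linarith
    qed (use l in auto)
    moreover have "BX * p + BY * q = - ((l\<^sup>2 - 4) * p + (l\<^sup>2 - 2) * q + 2 * l * (- ((p + q) / 70)))" for p q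
      by (simp add: BX_def BY_def field_simps)
    ultimately have "- (BX * (X x)\<^sup>2 + BY * (Y x)\<^sup>2) \<le> DD x * (VV l x (u x) \<bullet> u x)"
      unfolding VV_inner X_def[symmetric] Y_def[symmetric] by (smt (verit))
    then have "- ((BX * (X x)\<^sup>2 + BY * (Y x)\<^sup>2) / DD x) \<le> VV l x (u x) \<bullet> u x"
      using DD_pos[of x] by (simp add: field_simps)
    moreover have "(BX * (X x)\<^sup>2 + BY * (Y x)\<^sup>2) / DD x \<le> (BX * (X x)\<^sup>2 + BY * (Y x)\<^sup>2) / d"
      using dD[of x] d B0 by (intro divide_left_mono) (auto intro!: add_nonneg_nonneg mult_pos_pos DD_pos)
    moreover have "d * (dd u x \<bullet> dd u x) \<le> DD x * (dd u x \<bullet> dd u x)" using dD by (intro mult_right_mono) auto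
    moreover have "dd u x \<bullet> dd u x = (X' x)\<^sup>2 + (Y' x)\<^sup>2"
      by (simp add: X'_def Y'_def inner_prod_def power2_eq_square)
    ultimately show "(d * (X' x)\<^sup>2 + d * (Y' x)\<^sup>2) - (BX / d * (X x)\<^sup>2 + BY / d * (Y x)\<^sup>2) \<le>
        DD x * (dd u x \<bullet> dd u x) + VV l x (u x) \<bullet> u x"
      by (simp add: distrib_left add_divide_distrib)
  qed (rule int_form[OF au au])
  also have "integral {0..?P} (\<lambda>x. (d * (X' x)\<^sup>2 + d * (Y' x)\<^sup>2) - (BX / d * (X x)\<^sup>2 + BY / d * (Y x)\<^sup>2)) =
     (d * integral {0..?P} (\<lambda>x. (X' x)\<^sup>2) + d * integral {0..?P} (\<lambda>x. (Y' x)\<^sup>2)) -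
     (BX / d * integral {0..?P} (\<lambda>x. (X x)\<^sup>2) + BY / d * integral {0..?P} (\<lambda>x. (Y x)\<^sup>2))"
    by (intro integral_unique has_integral_diff has_integral_add has_integral_mult_right integrable_integral ints)
  finally have "(d * integral {0..?P} (\<lambda>x. (X' x)\<^sup>2) + d * integral {0..?P} (\<lambda>x. (Y' x)\<^sup>2)) -
     (BX / d * integral {0..?P} (\<lambda>x. (X x)\<^sup>2) + BY / d * integral {0..?P} (\<lambda>x. (Y x)\<^sup>2)) \<le> form u u" .
  moreover have "BX / d * integral {0..?P} (\<lambda>x. (X x)\<^sup>2) \<le> d * kX\<^sup>2 * integral {0..?P} (\<lambda>x. (X x)\<^sup>2)"
    "BY / d * integral {0..?P} (\<lambda>x. (Y x)\<^sup>2) \<le> d * kY\<^sup>2 * integral {0..?P} (\<lambda>x. (Y x)\<^sup>2)"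
    by (intro mult_right_mono BX BY integral_nonneg ints; simp)+
  moreover have "d * (kX\<^sup>2 * integral {0..?P} (\<lambda>x. (X x)\<^sup>2)) \<le> d * integral {0..?P} (\<lambda>x. (X' x)\<^sup>2)"
    "d * (kY\<^sup>2 * integral {0..?P} (\<lambda>x. (Y x)\<^sup>2)) \<le> d * integral {0..?P} (\<lambda>x. (Y' x)\<^sup>2)"
    using d WX WY by (intro mult_left_mono; simp)+
  ultimately have "form u u \<ge> 0" by (simp add: mult.assoc)
  then show ?thesis
    using negative_sols_vanish[OF F(1) s F(2) _ m] unfolding u_def by blast
qed

end

section \<open>Negative modes\<close>

lemma has_integral_cos_phase:
  fixes \<mu> P d :: real and m :: int
  assumes "\<mu> * P = 2 * pi * of_int m" "P > 0"
  shows "((\<lambda>x. cos (\<mu> * x - d)) has_integral (if m = 0 then P * cos d else 0)) {0..P}"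
proof (cases "m = 0")
  case True
  then have "\<mu> = 0" using assms by simp
  then show ?thesis using True has_integral_const_real[of "cos d" 0 P] assms(2) by simp
next
  case False
  then have \<mu>: "\<mu> \<noteq> 0" using assms by auto
  have "((\<lambda>x. sin (\<mu> * x - d) / \<mu>) has_real_derivative cos (\<mu> * x - d)) (at x within S)" for x S
    using \<mu> by (auto intro!: derivative_eq_intros)
  then have "((\<lambda>x. cos (\<mu> * x - d)) has_integral sin (\<mu> * P - d) / \<mu> - sin (\<mu> * 0 - d) / \<mu>) {0..P}"
    using assms(2) unfolding has_real_derivative_iff_has_vector_derivative
    by (intro fundamental_theorem_of_calculus) auto
  moreover have "sin (\<mu> * P - d) = sin (- d)"
  proof -
    show ?thesis unfolding assms(1) by (simp add: sin_diff sin_int_2pin cos_int_2pin)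
  qed
  ultimately show ?thesis using False by simp
qed

text \<open>Indices 2 k and 2 k + 1 share a frequency and give its cosine and sine. After division
  by \<open>n\<close>, even frequencies (s = 0) are periodic and odd ones (s = 1) antiperiodic over
  pi n. The constant is left out; its loss is covered by the rounding margin of the lower
  bound.\<close>

definition tfreq :: "nat \<Rightarrow> nat \<Rightarrow> nat" where "tfreq s i = 2 * (i div 2 + 1) - s"

definition tfun :: "nat \<Rightarrow> nat \<Rightarrow> nat \<Rightarrow> real \<Rightarrow> real"
  where "tfun n s i x = cos (real (tfreq s i) / real n * x - real (i mod 2) * (pi / 2))"

text \<open>Written as a cosine with shifted phase, so that \<open>cos_product_integral\<close>
  serves the functions and their derivatives alike.\<close>

definition tfun' :: "nat \<Rightarrow> nat \<Rightarrow> nat \<Rightarrow> real \<Rightarrow> real"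
  where "tfun' n s i x = real (tfreq s i) / real n * cos (real (tfreq s i) / real n * x - (real (i mod 2) * (pi / 2) - pi / 2))"

lemma smooth_vector_derivative:
  fixes f :: "real \<Rightarrow> 'a::real_normed_vector"
  assumes "smooth f"
  shows "(f has_vector_derivative frechet_derivative f (at x) 1) (at x)"
proof -
  have d: "(f has_derivative frechet_derivative f (at x)) (at x)"
    by (rule smooth_frechet_derivative(2)[OF assms])
  have "frechet_derivative f (at x) = (\<lambda>h. h *\<^sub>R frechet_derivative f (at x) 1)"
  proof
    fix h :: real
    show "frechet_derivative f (at x) h = h *\<^sub>R frechet_derivative f (at x) 1"
      using linear_scale[OF has_derivative_linear[OF d], of h 1] by simp
  qed
  with d show ?thesis unfolding has_vector_derivative_def by simp
qed

lemma deriv_tfun: "(tfun n s i has_real_derivative tfun' n s i x) (at x)"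
proof -
  have "((\<lambda>x. cos (r * x - d)) has_real_derivative r * cos (r * x - (d - pi / 2))) (at x)" for r d
  proof -
    have "cos (r * x - (d - pi / 2)) = - sin (r * x - d)"
      using cos_add[of "r * x - d" "pi / 2"] by (simp add: algebra_simps)
    then show ?thesis by (auto intro!: derivative_eq_intros)
  qed
  then show ?thesis unfolding tfun_def[abs_def] tfun'_def by blast
qed

lemma tfun_shift: "s \<le> 1 \<Longrightarrow> n > 0 \<Longrightarrow> tfun n s i (x + pi * real n) = (-1) ^ s * tfun n s i x"
proof -
  assume s: "s \<le> 1" and n: "n > 0"
  have "tfun n s i (x + pi * real n) = cos ((real (tfreq s i) / real n * x - real (i mod 2) * (pi / 2)) + pi * real (tfreq s i))"
  proof -
    have "real (tfreq s i) / real n * (x + pi * real n) - d = (real (tfreq s i) / real n * x - d) + pi * real (tfreq s i)" for d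
      using n by (simp add: field_simps)
    then show ?thesis by (simp only: tfun_def)
  qed
  also have "\<dots> = (-1) ^ tfreq s i * tfun n s i x" by (simp only: cos_shift_pi tfun_def)
  also have "(-1 :: real) ^ tfreq s i = (-1) ^ s" using s by (cases s) (auto simp: tfreq_def)
  finally show ?thesis .
qed

text \<open>Product to sum. The sum of two frequencies never vanishes since
  \<open>s \<le> 1\<close>, and their difference vanishes exactly for indices of the same
  pair.\<close>

lemma cos_product_integral:
  assumes s: "s \<le> 1" and n: "n > 0"
  shows "((\<lambda>x. cos (real (tfreq s i) / real n * x - d) * cos (real (tfreq s k) / real n * x - e)) has_integral
     (if i div 2 = k div 2 then pi * real n / 2 * cos (d - e) else 0)) {0..pi * real n}"
proof -
  let ?a = "real (tfreq s i) / real n" and ?b = "real (tfreq s k) / real n" and ?P = "pi * real n"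
  have P: "?P > 0" using n by simp
  have 1: "(?a - ?b) * ?P = 2 * pi * of_int (int (i div 2) - int (k div 2))"
    using s n by (simp add: tfreq_def field_simps of_nat_diff)
  have 2: "(?a + ?b) * ?P = 2 * pi * of_int (int (i div 2) + int (k div 2) + 2 - int s)"
    using s n by (simp add: tfreq_def field_simps of_nat_diff)
  have ne: "int (i div 2) + int (k div 2) + 2 - int s \<noteq> 0" using s by linarith
  have "((\<lambda>x. (1/2) * cos ((?a - ?b) * x - (d - e)) + (1/2) * cos ((?a + ?b) * x - (d + e))) has_integral
     (1/2) * (if int (i div 2) - int (k div 2) = 0 then ?P * cos (d - e) else 0) +
     (1/2) * (if int (i div 2) + int (k div 2) + 2 - int s = 0 then ?P * cos (d + e) else 0)) {0..?P}"
    by (intro has_integral_add has_integral_mult_right has_integral_cos_phase 1 2 P)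
  moreover have "(1/2) * cos ((u - v) * x - (d - e)) + (1/2) * cos ((u + v) * x - (d + e)) = cos (u * x - d) * cos (v * x - e)"
    for u v x :: real
  proof -
    have "(u - v) * x - (d - e) = (u * x - d) - (v * x - e)" "(u + v) * x - (d + e) = (u * x - d) + (v * x - e)"
      by (simp_all add: algebra_simps)
    then show ?thesis by (simp only: cos_add cos_diff) (simp add: algebra_simps)
  qed
  ultimately show ?thesis using ne by (auto split: if_splits)
qed

lemma tfun_orthogonal:
  assumes s: "s \<le> 1" and n: "n > 0"
  shows "((\<lambda>x. tfun n s i x * tfun n s k x) has_integral (if i = k then pi * real n / 2 else 0)) {0..pi * real n}"
    and "((\<lambda>x. tfun' n s i x * tfun' n s k x) has_integral
      (if i = k then (real (tfreq s i) / real n)\<^sup>2 * (pi * real n / 2) else 0)) {0..pi * real n}"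
proof -
  have cs: "cos (real (i mod 2) * (pi / 2) - real (k mod 2) * (pi / 2)) = (if i mod 2 = k mod 2 then 1 else 0)"
  proof -
    consider "i mod 2 = 0" "k mod 2 = 0" | "i mod 2 = 0" "k mod 2 = 1" | "i mod 2 = 1" "k mod 2 = 0" | "i mod 2 = 1" "k mod 2 = 1"
      by linarith
    then show ?thesis by cases auto
  qed
  have ik: "i = k \<longleftrightarrow> i div 2 = k div 2 \<and> i mod 2 = k mod 2" by (metis div_mult_mod_eq)
  show "((\<lambda>x. tfun n s i x * tfun n s k x) has_integral (if i = k then pi * real n / 2 else 0)) {0..pi * real n}"
    using cos_product_integral[OF s n, of i "real (i mod 2) * (pi / 2)" k "real (k mod 2) * (pi / 2)"]
    unfolding tfun_def cs ik by (auto split: if_splits)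
  have I: "((\<lambda>x. tfun' n s i x * tfun' n s k x) has_integral
     (real (tfreq s i) / real n * (real (tfreq s k) / real n)) * (if i div 2 = k div 2 then pi * real n / 2 * cos (real (i mod 2) * (pi / 2) - real (k mod 2) * (pi / 2)) else 0)) {0..pi * real n}"
  proof -
    have "(a * u) * (b * v) = (a * b) * (u * v)" for a b u v :: real by simp
    moreover have "(u - pi / 2) - (v - pi / 2) = u - v" for u v :: real by simp
    ultimately show ?thesis
      using has_integral_mult_right[OF cos_product_integral[OF s n, of i "real (i mod 2) * (pi / 2) - pi / 2" k "real (k mod 2) * (pi / 2) - pi / 2"],
       of "real (tfreq s i) / real n * (real (tfreq s k) / real n)"]
      unfolding tfun'_def by (simp only:)
  qed
  show "((\<lambda>x. tfun' n s i x * tfun' n s k x) has_integral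
      (if i = k then (real (tfreq s i) / real n)\<^sup>2 * (pi * real n / 2) else 0)) {0..pi * real n}"
  proof -
    have "r i * r k * (if i div 2 = k div 2 then z * (if i mod 2 = k mod 2 then 1 else 0) else 0) =
        (if i div 2 = k div 2 \<and> i mod 2 = k mod 2 then (r i)\<^sup>2 * z else 0)"
      if "\<And>i k. i div 2 = k div 2 \<Longrightarrow> r i = r k" for r :: "nat \<Rightarrow> real" and z
      using that[of i k] by (simp add: power2_eq_square)
    from this[of "\<lambda>i. real (tfreq s i) / real n"] I show ?thesis
      unfolding cs ik by (simp add: tfreq_def)
  qed
qed

lemma has_integral_square_sum:
  fixes u :: "nat \<Rightarrow> real \<Rightarrow> real"
  assumes "\<And>i k. i < N \<Longrightarrow> k < N \<Longrightarrow> ((\<lambda>x. u i x * u k x) has_integral (if i = k then h i else 0)) S"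
  shows "((\<lambda>x. (\<Sum>i<N. c i * u i x)\<^sup>2) has_integral (\<Sum>i<N. (c i)\<^sup>2 * h i)) S"
proof -
  have "((\<lambda>x. \<Sum>i<N. \<Sum>k<N. (c i * c k) * (u i x * u k x)) has_integral
     (\<Sum>i<N. \<Sum>k<N. (c i * c k) * (if i = k then h i else 0))) S"
    by (intro has_integral_sum has_integral_mult_right assms) auto
  moreover have "(\<Sum>i<N. \<Sum>k<N. (c i * c k) * (u i x * u k x)) = (\<Sum>i<N. c i * u i x)\<^sup>2" for x
    by (simp add: power2_eq_square sum_product mult_ac)
  moreover have "(\<Sum>i<N. \<Sum>k<N. (c i * c k) * (if i = k then h i else 0)) = (\<Sum>i<N. (c i)\<^sup>2 * h i)"
  proof (intro sum.cong refl)
    fix i assume i: "i \<in> {..<N}"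
    have "(\<Sum>k<N. (c i * c k) * (if i = k then h i else 0)) = (\<Sum>k<N. if k = i then (c i)\<^sup>2 * h i else 0)"
      by (intro sum.cong) (auto simp: power2_eq_square)
    then show "(\<Sum>k<N. (c i * c k) * (if i = k then h i else 0)) = (c i)\<^sup>2 * h i" using i by simp
  qed
  ultimately show ?thesis by simp
qed

lemma sum_lessThan_add:
  fixes f :: "nat \<Rightarrow> 'a::comm_monoid_add"
  shows "(\<Sum>i<M + N. f i) = (\<Sum>i<M. f i) + (\<Sum>i<N. f (M + i))"
  by (induction N) (auto simp: add_ac)

context otsuki_small
begin

text \<open>The form is negative on the span of trigonometric functions of sufficiently low frequency.\<close>

lemma many_negative_modes:
  fixes n s MX MY :: nat
  assumes n: "even n" "n > 0" and s: "s \<le> 1" and l: "0 \<le> l" "l \<le> 1"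
    and kX: "real (2 * MX) \<le> kX * real n" "2 * kX\<^sup>2 < 4 - l\<^sup>2 - 1 / 1000 - l / 35"
    and kY: "real (2 * MY) \<le> kY * real n" "2 * kY\<^sup>2 < 2 - l\<^sup>2 - 1 / 1000 - l / 35"
  obtains e m where "\<And>i. i < 2 * MX + 2 * MY \<Longrightarrow> osol n ((-1) ^ s) l (m i) (e i)"
    "\<And>i. i < 2 * MX + 2 * MY \<Longrightarrow> m i < 0"
    "\<And>c i. (\<And>x. (\<Sum>i<2 * MX + 2 * MY. c i *\<^sub>R e i x) = 0) \<Longrightarrow> i < 2 * MX + 2 * MY \<Longrightarrow> c i = 0"
proof -
  let ?\<sigma> = "(-1) ^ s :: real"
  have \<sigma>: "?\<sigma> = 1 \<or> ?\<sigma> = -1" using s by (cases s) auto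
  interpret sturm_liouville DD ww "VV l" "pi * real n" ?\<sigma> by (rule sturm_liouville_VV[OF n \<sigma>])
  let ?P = "pi * real n" and ?N = "2 * MX + 2 * MY"
  have C: "C2D DD (tfun n s i)" "dd (tfun n s i) = tfun' n s i" for i
  proof -
    have "smooth (tfun n s i)" unfolding tfun_def[abs_def]
      by (intro smooth_compose[OF smooth_sin_cos(2)] smooth_diff smooth_const smooth_linear) (rule bounded_linear_mult_right)
    have sm': "smooth (tfun' n s i)" unfolding tfun'_def[abs_def]
      by (intro smooth_mult smooth_const smooth_compose[OF smooth_sin_cos(2)] smooth_diff smooth_linear) (rule bounded_linear_mult_right)
    have sm: "smooth (\<lambda>y. DD y *\<^sub>R tfun' n s i y)" by (intro smooth_scaleR smooth_coeffs sm')
    have 2: "((\<lambda>y. DD y *\<^sub>R tfun' n s i y) has_vector_derivative frechet_derivative (\<lambda>y. DD y *\<^sub>R tfun' n s i y) (at x) 1) (at x)" for x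
      by (rule smooth_vector_derivative[OF sm])
    have 3: "continuous_on UNIV (\<lambda>x. frechet_derivative (\<lambda>y. DD y *\<^sub>R tfun' n s i y) (at x) 1)"
      by (rule smooth_continuous[OF smooth_frechet_derivative(1)[OF sm]])
    show "C2D DD (tfun n s i)" "dd (tfun n s i) = tfun' n s i"
      using C2DI[OF deriv_tfun[unfolded has_real_derivative_iff_has_vector_derivative] 2 3] by auto
  qed
  define g where "g i = (\<lambda>x. if i < 2 * MX then (tfun n s i x, 0) else (0, tfun n s (i - 2 * MX) x))" for i
  have z: "C2D DD (\<lambda>_. 0 :: real)" "dd (\<lambda>_. 0 :: real) = (\<lambda>_. 0)" by (rule C2D_zero)+
  have g1: "C2D DD (g i)" "dd (g i) = (\<lambda>x. if i < 2 * MX then (tfun' n s i x, 0) else (0, tfun' n s (i - 2 * MX) x))" for i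
    using C2D_Pair[OF C(1) z(1), of i] C2D_Pair[OF z(1) C(1), of "i - 2 * MX"]
    unfolding g_def C(2) z(2) by (cases "i < 2 * MX"; simp)+
  have ga: "adm (g i)" for i
    using g1(1) tfun_shift[OF s n(2)] by (auto simp: adm_def g_def)
  \<comment> \<open>An upper bound of \<open>DD\<close>, because cc^2 and kap are at most 1.
    Combined with upper bounds of the potential it bounds the form from above on the trial
    functions.\<close>
  define q where "q = sqrt 2"
  have q: "q > 0" "q * q = 2" by (auto simp: q_def)
  have Dq: "DD x \<le> q" for x unfolding q_def DD_def using cc_bounds(3)[of x] kap(3) by simp
  define BX BY where "BX = 4 - l\<^sup>2 - 1 / 1000 - l / 35" and "BY = 2 - l\<^sup>2 - 1 / 1000 - l / 35"
  have B: "BX > 2 * kX\<^sup>2" "BY > 2 * kY\<^sup>2" using kX kY by (auto simp: BX_def BY_def)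
  then have B0: "BX > 0" "BY > 0" using zero_le_power2[of kX] zero_le_power2[of kY] by linarith+
  have neg: "form (\<lambda>x. \<Sum>i<?N. c i *\<^sub>R g i x) (\<lambda>x. \<Sum>i<?N. c i *\<^sub>R g i x) < 0" if c: "\<exists>i<?N. c i \<noteq> 0" for c
  proof -
    define u where "u = (\<lambda>x. \<Sum>i<?N. c i *\<^sub>R g i x)"
    have ua: "adm u" unfolding u_def by (intro adm_sum ga) auto
    have du: "dd u = (\<lambda>x. \<Sum>i<?N. c i *\<^sub>R dd (g i) x)"
      unfolding u_def using C2D_sum[of "{..<?N}" DD g c] g1 by auto
    define X Y where "X x = (\<Sum>i<2*MX. c i * tfun n s i x)" and "Y x = (\<Sum>i<2*MY. c (2*MX + i) * tfun n s i x)" for x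
    define X' Y' where "X' x = (\<Sum>i<2*MX. c i * tfun' n s i x)" and "Y' x = (\<Sum>i<2*MY. c (2*MX + i) * tfun' n s i x)" for x
    have uXY: "u x = (X x, Y x)" for x
      by (simp add: u_def sum_lessThan_add g_def X_def Y_def prod_eq_iff fst_sum snd_sum)
    have dXY: "dd u x = (X' x, Y' x)" for x
      by (simp add: du g1 sum_lessThan_add X'_def Y'_def prod_eq_iff fst_sum snd_sum)
    let ?SX = "\<Sum>i<2*MX. (c i)\<^sup>2" and ?SY = "\<Sum>i<2*MY. (c (2*MX + i))\<^sup>2"
    have freq: "(real (tfreq s i) / real n)\<^sup>2 \<le> k\<^sup>2" if "i < 2 * M" "real (2 * M) \<le> k * real n" for i M k
    proof (rule power_mono)
      have "i div 2 < M" using that(1) by (simp add: less_mult_imp_div_less mult.commute)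
      then have "tfreq s i \<le> 2 * M" by (simp add: tfreq_def)
      then have "real (tfreq s i) \<le> k * real n" using that(2) by linarith
      then show "real (tfreq s i) / real n \<le> k" using n by (simp add: field_simps)
    qed simp
    have iX: "((\<lambda>x. (X x)\<^sup>2) has_integral (\<Sum>i<2*MX. (c i)\<^sup>2 * (?P / 2))) {0..?P}"
      unfolding X_def by (rule has_integral_square_sum) (rule tfun_orthogonal(1)[OF s n(2)])
    have iY: "((\<lambda>x. (Y x)\<^sup>2) has_integral (\<Sum>i<2*MY. (c (2*MX + i))\<^sup>2 * (?P / 2))) {0..?P}"
      unfolding Y_def by (rule has_integral_square_sum) (rule tfun_orthogonal(1)[OF s n(2)])
    have iX': "((\<lambda>x. (X' x)\<^sup>2) has_integral (\<Sum>i<2*MX. (c i)\<^sup>2 * ((real (tfreq s i) / real n)\<^sup>2 * (?P / 2)))) {0..?P}"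
      unfolding X'_def by (rule has_integral_square_sum) (rule tfun_orthogonal(2)[OF s n(2)])
    have iY': "((\<lambda>x. (Y' x)\<^sup>2) has_integral (\<Sum>i<2*MY. (c (2*MX + i))\<^sup>2 * ((real (tfreq s i) / real n)\<^sup>2 * (?P / 2)))) {0..?P}"
      unfolding Y'_def by (rule has_integral_square_sum) (rule tfun_orthogonal(2)[OF s n(2)])
    have bX: "(\<Sum>i<2*MX. (c i)\<^sup>2 * ((real (tfreq s i) / real n)\<^sup>2 * (?P / 2))) \<le> kX\<^sup>2 * (?P / 2) * ?SX"
      unfolding sum_distrib_left
    proof (intro sum_mono)
      fix i assume "i \<in> {..<2*MX}"
      then have "(c i)\<^sup>2 * ((real (tfreq s i) / real n)\<^sup>2 * (?P / 2)) \<le> (c i)\<^sup>2 * (kX\<^sup>2 * (?P / 2))"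
        using freq[of i MX kX] kX by (intro mult_left_mono mult_right_mono) auto
      then show "(c i)\<^sup>2 * ((real (tfreq s i) / real n)\<^sup>2 * (?P / 2)) \<le> kX\<^sup>2 * (?P / 2) * (c i)\<^sup>2" by (simp add: mult_ac)
    qed
    have bY: "(\<Sum>i<2*MY. (c (2*MX + i))\<^sup>2 * ((real (tfreq s i) / real n)\<^sup>2 * (?P / 2))) \<le> kY\<^sup>2 * (?P / 2) * ?SY"
      unfolding sum_distrib_left
    proof (intro sum_mono)
      fix i assume "i \<in> {..<2*MY}"
      then have "(c (2*MX + i))\<^sup>2 * ((real (tfreq s i) / real n)\<^sup>2 * (?P / 2)) \<le> (c (2*MX + i))\<^sup>2 * (kY\<^sup>2 * (?P / 2))"
        using freq[of i MY kY] kY by (intro mult_left_mono mult_right_mono) auto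
      then show "(c (2*MX + i))\<^sup>2 * ((real (tfreq s i) / real n)\<^sup>2 * (?P / 2)) \<le> kY\<^sup>2 * (?P / 2) * (c (2*MX + i))\<^sup>2" by (simp add: mult_ac)
    qed
    have I: "((\<lambda>x. q * ((X' x)\<^sup>2 + (Y' x)\<^sup>2) - (1 / q) * (BX * (X x)\<^sup>2 + BY * (Y x)\<^sup>2)) has_integral
       q * ((\<Sum>i<2*MX. (c i)\<^sup>2 * ((real (tfreq s i) / real n)\<^sup>2 * (?P / 2))) + (\<Sum>i<2*MY. (c (2*MX + i))\<^sup>2 * ((real (tfreq s i) / real n)\<^sup>2 * (?P / 2)))) -
       (1 / q) * (BX * (\<Sum>i<2*MX. (c i)\<^sup>2 * (?P / 2)) + BY * (\<Sum>i<2*MY. (c (2*MX + i))\<^sup>2 * (?P / 2)))) {0..?P}"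
      by (intro has_integral_diff has_integral_mult_right has_integral_add iX iY iX' iY')
    have "form u u \<le> integral {0..?P} (\<lambda>x. q * ((X' x)\<^sup>2 + (Y' x)\<^sup>2) - (1 / q) * (BX * (X x)\<^sup>2 + BY * (Y x)\<^sup>2))"
      unfolding form_def
    proof (rule integral_le[OF int_form[OF ua ua] has_integral_integrable[OF I]])
      fix x
      have "UX l x * (X x)\<^sup>2 \<le> (l\<^sup>2 - 4 + 1 / 1000) * (X x)\<^sup>2" "UY l x * (Y x)\<^sup>2 \<le> (l\<^sup>2 - 2 + 1 / 1000) * (Y x)\<^sup>2"
        using UXY_bounds(3,4)[of l x] by (intro mult_right_mono; simp)+
      moreover have "2 * l * (2 * gg x * X x * Y x) \<le> 2 * l * (((X x)\<^sup>2 + (Y x)\<^sup>2) / 70)"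
        using abs_le_D1[OF cross_bound[of x "X x" "Y x"]] l by (intro mult_left_mono) auto
      moreover have "BX * v + BY * w = - ((l\<^sup>2 - 4 + 1/1000) * v + (l\<^sup>2 - 2 + 1/1000) * w + 2 * l * ((v + w) / 70))" for v w
        by (simp add: BX_def BY_def field_simps)
      ultimately have "DD x * (VV l x (u x) \<bullet> u x) \<le> - (BX * (X x)\<^sup>2 + BY * (Y x)\<^sup>2)"
        unfolding VV_inner uXY fst_conv snd_conv by (smt (verit))
      then have "VV l x (u x) \<bullet> u x \<le> - ((BX * (X x)\<^sup>2 + BY * (Y x)\<^sup>2) / DD x)"
        using DD_pos[of x] by (simp add: field_simps)
      moreover have "(BX * (X x)\<^sup>2 + BY * (Y x)\<^sup>2) / q \<le> (BX * (X x)\<^sup>2 + BY * (Y x)\<^sup>2) / DD x"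
        using Dq[of x] q B0 by (intro divide_left_mono) (auto intro!: add_nonneg_nonneg mult_pos_pos DD_pos)
      moreover have "DD x * (dd u x \<bullet> dd u x) \<le> q * (dd u x \<bullet> dd u x)" using Dq by (intro mult_right_mono) auto
      moreover have "dd u x \<bullet> dd u x = (X' x)\<^sup>2 + (Y' x)\<^sup>2"
        by (simp add: dXY inner_prod_def power2_eq_square)
      ultimately show "DD x * (dd u x \<bullet> dd u x) + VV l x (u x) \<bullet> u x \<le> q * ((X' x)\<^sup>2 + (Y' x)\<^sup>2) - (1 / q) * (BX * (X x)\<^sup>2 + BY * (Y x)\<^sup>2)"
        by simp
    qed
    also have "\<dots> = q * ((\<Sum>i<2*MX. (c i)\<^sup>2 * ((real (tfreq s i) / real n)\<^sup>2 * (?P / 2))) + (\<Sum>i<2*MY. (c (2*MX + i))\<^sup>2 * ((real (tfreq s i) / real n)\<^sup>2 * (?P / 2)))) -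
       (1 / q) * (BX * (\<Sum>i<2*MX. (c i)\<^sup>2 * (?P / 2)) + BY * (\<Sum>i<2*MY. (c (2*MX + i))\<^sup>2 * (?P / 2)))"
      by (rule integral_unique[OF I])
    also have "\<dots> \<le> q * (kX\<^sup>2 * (?P / 2) * ?SX + kY\<^sup>2 * (?P / 2) * ?SY) -
       (1 / q) * (BX * (\<Sum>i<2*MX. (c i)\<^sup>2 * (?P / 2)) + BY * (\<Sum>i<2*MY. (c (2*MX + i))\<^sup>2 * (?P / 2)))"
      using q bX bY by (intro diff_right_mono mult_left_mono add_mono) auto
    also have "\<dots> = (?P / (2 * q)) * ((2 * kX\<^sup>2 - BX) * ?SX + (2 * kY\<^sup>2 - BY) * ?SY)"
    proof -
      \<comment> \<open>With q = 2 / q the kinetic and the potential part share the factor 1 / q,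
        and negativity reduces to 2 k^2 < B in each component.\<close>
      have iq: "q = 2 / q" using q by (simp add: field_simps)
      have "q * (kX\<^sup>2 * (?P / 2) * a + kY\<^sup>2 * (?P / 2) * b) - (1 / q) * (BX * (a * (?P / 2)) + BY * (b * (?P / 2))) =
         (?P / (2 * q)) * ((2 * kX\<^sup>2 - BX) * a + (2 * kY\<^sup>2 - BY) * b)" for a b
        by (subst iq) (use q in \<open>simp add: field_simps\<close>)
      then show ?thesis by (simp only: sum_distrib_right[symmetric])
    qed
    also have "\<dots> < 0"
    proof -
      have nn: "?SX \<ge> 0" "?SY \<ge> 0" by (auto intro: sum_nonneg)
      have "?SX > 0 \<or> ?SY > 0"
      proof -
        obtain i where i: "i < ?N" "c i \<noteq> 0" using c by blast
        show ?thesis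
        proof (cases "i < 2 * MX")
          case True
          then have "?SX > 0" using i by (intro sum_pos2[of _ i]) auto
          then show ?thesis ..
        next
          case False
          then have "?SY > 0" using i by (intro sum_pos2[of _ "i - 2 * MX"]) auto
          then show ?thesis ..
        qed
      qed
      then have "(2 * kX\<^sup>2 - BX) * ?SX + (2 * kY\<^sup>2 - BY) * ?SY < 0"
      proof
        assume "?SX > 0"
        then have "(2 * kX\<^sup>2 - BX) * ?SX < 0" using B by (intro mult_neg_pos) auto
        moreover have "(2 * kY\<^sup>2 - BY) * ?SY \<le> 0" using B nn by (intro mult_nonpos_nonneg) auto
        ultimately show ?thesis by simp
      next
        assume "?SY > 0"
        then have "(2 * kY\<^sup>2 - BY) * ?SY < 0" using B by (intro mult_neg_pos) auto
        moreover have "(2 * kX\<^sup>2 - BX) * ?SX \<le> 0" using B nn by (intro mult_nonpos_nonneg) auto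
        ultimately show ?thesis by simp
      qed
      moreover have "?P / (2 * q) > 0" using q n by simp
      ultimately show ?thesis by (rule mult_pos_neg[rotated])
    qed
    finally show ?thesis unfolding u_def .
  qed
  obtain e m where em: "\<And>i. i < ?N \<Longrightarrow> sol (m i) (e i)" "\<And>i. i < ?N \<Longrightarrow> m i < 0"
    "\<And>i j. i < ?N \<Longrightarrow> j < ?N \<Longrightarrow> ip (e i) (e j) = (if i = j then 1 else 0)"
  proof (rule negative_eigenfunctions[of ?N g])
    show "adm (g i)" for i by (rule ga)
    show "form (\<lambda>x. \<Sum>i<?N. c i *\<^sub>R g i x) (\<lambda>x. \<Sum>i<?N. c i *\<^sub>R g i x) < 0" if "\<exists>i<?N. c i \<noteq> 0" for c
      using neg[OF that] .
  qed (use that in blast)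
  have ae: "adm (e i)" if "i < ?N" for i using em(1)[OF that] by (simp add: sol_def)
  show ?thesis
  proof (rule that[of m e])
    show "osol n ?\<sigma> l (m i) (e i)" if "i < ?N" for i using em(1)[OF that] osol_sol[OF n \<sigma>] by simp
    show "m i < 0" if "i < ?N" for i by (rule em(2)[OF that])
    show "c i = 0" if z: "\<And>x. (\<Sum>i<?N. c i *\<^sub>R e i x) = 0" and i: "i < ?N" for c i
    proof -
      have "0 = ip (\<lambda>x. \<Sum>i<?N. c i *\<^sub>R e i x) (e i)" unfolding z by (simp add: ip_def)
      also have "\<dots> = (\<Sum>k<?N. c k * ip (e k) (e i))" using ae i by (intro form_sum) auto
      also have "\<dots> = (\<Sum>k<?N. if k = i then c i else 0)" using em(3) i by (intro sum.cong) auto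
      finally show ?thesis using i by simp
    qed
  qed
qed

end

section \<open>Arclength and the period map\<close>

text \<open>The addition formula rewrites the usual antiderivative arctan (r tan x) / r, which is
  singular at the end points, as the everywhere smooth function \<open>F\<close>.\<close>

lemma integral_reciprocal_quadratic:
  fixes r :: real
  assumes r: "r > 0"
  shows "((\<lambda>x. 1 / ((cos x)\<^sup>2 + r\<^sup>2 * (sin x)\<^sup>2)) has_integral pi / r) {- pi / 2..pi / 2}"
proof -
  define q where "q x = (cos x)\<^sup>2 + r * (sin x)\<^sup>2" for x
  define F where "F x = (1 / r) * (x - arctan ((1 - r) * (sin x * cos x) / q x))" for x
  have sc: "(sin x)\<^sup>2 = 1 - (cos x)\<^sup>2" for x :: real by (rule sin_squared_eq)
  have pos: "(cos x)\<^sup>2 + z * (sin x)\<^sup>2 > 0" if "z > 0" for x z :: real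
  proof (cases "cos x = 0")
    case True
    then have "(sin x)\<^sup>2 = 1" by (simp add: sc)
    then show ?thesis using that True by simp
  next
    case False
    then show ?thesis using that by (intro add_pos_nonneg) auto
  qed
  have q: "q x > 0" for x using pos[OF r] by (simp add: q_def)
  have D: "(F has_real_derivative 1 / ((cos x)\<^sup>2 + r\<^sup>2 * (sin x)\<^sup>2)) (at x)" for x
  proof -
    define u where "u x = (1 - r) * (sin x * cos x) / q x" for x
    define s c where "s = sin x" and "c = cos x"
    have cs: "c * c = 1 - s * s" using sin_cos_squared_add[of x] by (simp add: s_def c_def power2_eq_square algebra_simps)
    have du: "(u has_real_derivative ((1 - r) * (c * c - s * s) * q x - (1 - r) * (s * c) * (2 * (r - 1) * s * c)) / (q x * q x)) (at x)"
      unfolding u_def[abs_def] q_def[abs_def] using q[of x, unfolded q_def]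
      by (auto intro!: derivative_eq_intros simp: s_def c_def algebra_simps)
    have "(F has_real_derivative (1 / r) * (1 - inverse (1 + (u x)\<^sup>2) *
       (((1 - r) * (c * c - s * s) * q x - (1 - r) * (s * c) * (2 * (r - 1) * s * c)) / (q x * q x)))) (at x)"
      unfolding F_def[abs_def] u_def[symmetric]
      using r by (auto intro!: derivative_eq_intros DERIV_arctan[THEN DERIV_chain2] du)
    moreover have "(1 / r) * (1 - inverse (1 + (u x)\<^sup>2) *
       (((1 - r) * (c * c - s * s) * q x - (1 - r) * (s * c) * (2 * (r - 1) * s * c)) / (q x * q x))) = 1 / (c * c + r * r * (s * s))"
    proof -
      define Q where "Q = q x"
      have Q: "Q = c * c + r * (s * s)" by (simp add: Q_def q_def s_def c_def power2_eq_square)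
      have Qn: "Q \<noteq> 0" using q[of x] by (simp add: Q_def)
      define w where "w = c * c + r * r * (s * s)"
      have w: "w \<noteq> 0" using pos[of "r * r" x] r by (simp add: w_def s_def c_def power2_eq_square)
      have ux: "u x = (1 - r) * (s * c) / Q" by (simp add: u_def Q_def s_def c_def)
      have "Q * Q + (1 - r) * (s * c) * ((1 - r) * (s * c)) = w"
        unfolding Q w_def using cs by algebra
      then have "1 + (u x)\<^sup>2 = w / (Q * Q)"
        unfolding ux using Qn by (simp add: power2_eq_square field_simps)
      moreover have "(1 - r) * (c * c - s * s) * Q - (1 - r) * (s * c) * (2 * (r - 1) * s * c) = (1 - r) * (c * c - r * (s * s))"
        unfolding Q using cs by algebra
      ultimately have "(1 / r) * (1 - inverse (1 + (u x)\<^sup>2) *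
       (((1 - r) * (c * c - s * s) * q x - (1 - r) * (s * c) * (2 * (r - 1) * s * c)) / (q x * q x))) =
        (1 / r) * (1 - (1 - r) * (c * c - r * (s * s)) / w)"
        unfolding Q_def[symmetric] using Qn w by simp
      also have "\<dots> = (1 / r) * ((w - (1 - r) * (c * c - r * (s * s))) / w)" using w by (simp add: diff_divide_distrib)
      also have "w - (1 - r) * (c * c - r * (s * s)) = r" unfolding w_def using cs by algebra
      finally show ?thesis using r by (simp add: w_def)
    qed
    ultimately show ?thesis by (simp add: s_def c_def power2_eq_square)
  qed
  have "((\<lambda>x. 1 / ((cos x)\<^sup>2 + r\<^sup>2 * (sin x)\<^sup>2)) has_integral F (pi / 2) - F (- pi / 2)) {- pi / 2..pi / 2}"
    using D by (intro fundamental_theorem_of_calculus)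
      (auto intro: has_field_derivative_at_within simp flip: has_real_derivative_iff_has_vector_derivative)
  moreover have "F (pi / 2) - F (- pi / 2) = pi / r" using r by (simp add: F_def field_simps)
  ultimately show ?thesis by simp
qed

context otsuki
begin

text \<open>Time as a function of the angle: dt / ds = 2 pi cos \<phi> along the profile, with t = 0
  at - pi / 2.\<close>

definition tau :: "real \<Rightarrow> real" where
  "tau = (SOME f. f (- pi / 2) = 0 \<and> sd f (\<lambda>x. 2 * pi * cc x))"

lemma tau: "tau (- pi / 2) = 0" "sd tau (\<lambda>x. 2 * pi * cc x)"
proof -
  have "continuous_on UNIV (\<lambda>x. cc x / DD x * (2 * pi * cc x))" by (intro continuous_intros) auto
  then obtain F where F: "\<And>x. (F has_vector_derivative cc x / DD x * (2 * pi * cc x)) (at x)"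
    using ex_antiderivative by blast
  have "((\<lambda>x. F x - F (- pi / 2)) has_real_derivative cc x / DD x * (2 * pi * cc x)) (at x)" for x
    using has_vector_derivative_diff[OF F[of x] has_vector_derivative_const]
    by (simp add: has_real_derivative_iff_has_vector_derivative)
  then have "\<exists>f. f (- pi / 2) = 0 \<and> sd f (\<lambda>x. 2 * pi * cc x)"
    by (intro exI[of _ "\<lambda>x. F x - F (- pi / 2)"]) (auto simp: sd_def)
  from someI_ex[OF this] show "tau (- pi / 2) = 0" "sd tau (\<lambda>x. 2 * pi * cc x)"
    unfolding tau_def[symmetric] by auto
qed

lemma tau_pos: "cc x / DD x * (2 * pi * cc x) > 0"
  using cc_bounds(1)[of x] DD_pos[of x] by simp

lemma tau_strict: "x < y \<Longrightarrow> tau x < tau y"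
  by (rule DERIV_pos_imp_increasing) (use sdD[OF tau(2)] tau_pos in blast)+

lemma tau_cont: "isCont tau x"
  using sdD[OF tau(2)] DERIV_isCont by blast

lemma tau_shift: "tau (x + pi * real n) = tau x + real n * tau (pi / 2)"
proof -
  have step: "tau (y + pi) = tau y + tau (pi / 2)" for y
  proof -
    have "((\<lambda>y. tau (y + pi) - tau y) has_real_derivative 0) (at y)" for y
    proof -
      have "((\<lambda>y. tau (y + pi)) has_real_derivative cc (y + pi) / DD (y + pi) * (2 * pi * cc (y + pi))) (at y)"
        using sdD[OF tau(2), of "y + pi"] DERIV_shift by blast
      moreover have "cc (y + pi) / DD (y + pi) * (2 * pi * cc (y + pi)) = cc y / DD y * (2 * pi * cc y)"
        using shift[of y 1] by simp
      ultimately show ?thesis using DERIV_diff[OF _ sdD[OF tau(2)]] by fastforce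
    qed
    then have "tau (y + pi) - tau y = tau (- pi / 2 + pi) - tau (- pi / 2)"
      using DERIV_isconst_all by blast
    moreover have "- pi / 2 + pi = pi / 2" by simp
    ultimately show ?thesis by (simp only: tau(1))
  qed
  show ?thesis
  proof (induction n)
    case (Suc n)
    then show ?case using step[of "x + pi * real n"] by (simp add: algebra_simps)
  qed auto
qed

definition TT :: real where "TT = tau (pi / 2)"

lemma TT_pos: "TT > 0"
  using tau_strict[of "- pi / 2" "pi / 2"] tau(1) by (simp add: TT_def)

lemma tau_surj: "\<exists>x. tau x = t"
proof -
  obtain n :: nat where n: "\<bar>t\<bar> < real n * TT" using TT_pos reals_Archimedean3 by blast
  have 1: "tau (- pi / 2 + pi * real n) = real n * TT" by (simp only: tau_shift tau(1) TT_def)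
  have 2: "tau (- pi / 2 - pi * real n) = - (real n * TT)"
    using tau_shift[of "- pi / 2 - pi * real n" n] tau(1) by (simp add: TT_def)
  have "\<exists>x\<ge>- pi / 2 - pi * real n. x \<le> - pi / 2 + pi * real n \<and> tau x = t"
    using n 1 2 by (intro IVT) (auto simp: tau_cont abs_less_iff less_imp_le)
  then show ?thesis by blast
qed

definition Psi :: "real \<Rightarrow> real" where "Psi t = (THE x. tau x = t)"

lemma Psi: "tau (Psi t) = t" "Psi (tau x) = x"
proof -
  have inj: "tau x = tau y \<Longrightarrow> x = y" for x y using tau_strict by (metis linorder_neqE_linordered_idom less_irrefl)
  obtain y where y: "tau y = t" using tau_surj by blast
  then have "Psi t = y" unfolding Psi_def using inj by (intro the_equality) auto
  then show "tau (Psi t) = t" using y by simp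
  show "Psi (tau x) = x" unfolding Psi_def using inj by (intro the_equality) auto
qed

lemma Psi_0: "Psi 0 = - pi / 2"
  using Psi(2)[of "- pi / 2"] tau(1) by simp

lemma Psi_shift: "Psi (t + real n * TT) = Psi t + pi * real n"
  using Psi(2)[of "Psi t + pi * real n"] Psi(1)[of t] by (simp add: tau_shift TT_def)

lemma deriv_Psi: "(Psi has_real_derivative DD (Psi t) / (2 * pi * (cc (Psi t))\<^sup>2)) (at t)"
proof -
  have "isCont Psi (tau (Psi t))"
    by (rule isCont_inverse_function[where d = 1]) (auto simp: Psi tau_cont)
  then have "isCont Psi t" by (simp add: Psi)
  then have "(Psi has_real_derivative inverse (cc (Psi t) / DD (Psi t) * (2 * pi * cc (Psi t)))) (at t)"
    using sdD[OF tau(2), of "Psi t"] tau_pos[of "Psi t"]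
    by (intro DERIV_inverse_function[where f = tau and a = "t - 1" and b = "t + 1"]) (auto simp: Psi)
  then show ?thesis by (simp add: power2_eq_square mult_ac)
qed

text \<open>The inverse of \<open>tau\<close> solves an autonomous equation with smooth right-hand
  side, so no regularity theorem for inverse functions beyond the first derivative enters.\<close>

lemma smooth_Psi: "smooth Psi"
  by (rule smooth_ode[where G = "\<lambda>x. DD x / (2 * pi * (cc x)\<^sup>2)"])
     (use deriv_Psi in \<open>auto intro!: smooth_divide smooth_mult smooth_const smooth_power smooth_coeffs
       simp: has_real_derivative_iff_has_vector_derivative\<close>)

section \<open>Identification of phi, theta and Xi in the angle variable\<close>

definition jj :: "real \<Rightarrow> real" where "jj x = arcsin (sin x / amp)"

lemma sin_b_bounds:
  assumes "x \<in> {b..- b}"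
  shows "\<bar>sin x\<bar> \<le> amp" "x \<in> {b<..<- b} \<Longrightarrow> \<bar>sin x\<bar> < amp" "cos x > 0"
proof -
  have m: "sin u \<le> sin v" if "b \<le> u" "u \<le> v" "v \<le> - b" for u v
    using that b_gt b_lt by (intro sin_monotone_2pi_le) auto
  have sm: "sin u < sin v" if "b \<le> u" "u < v" "v \<le> - b" for u v
    using that b_gt b_lt by (intro sin_monotone_2pi) auto
  show "\<bar>sin x\<bar> \<le> amp" using m[of b x] m[of x "- b"] assms by (auto simp: amp_def abs_le_iff)
  show "\<bar>sin x\<bar> < amp" if "x \<in> {b<..<- b}" using sm[of b x] sm[of x "- b"] that by (auto simp: amp_def abs_less_iff)
  show "cos x > 0" using assms b_gt b_lt by (intro cos_gt_zero_pi) auto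
qed

lemma jj_props:
  assumes "x \<in> {b..- b}"
  shows "SS (jj x) = sin x" "cc (jj x) = cos x" "jj x \<in> {- pi / 2..pi / 2}"
    "amp * cos (jj x) = sqrt (amp\<^sup>2 - (sin x)\<^sup>2)"
proof -
  have r: "- 1 \<le> sin x / amp" "sin x / amp \<le> 1"
    using sin_b_bounds(1)[OF assms] amp by (auto simp: field_simps abs_le_iff)
  show S: "SS (jj x) = sin x" using amp r by (simp add: SS_def jj_def)
  have "(cc (jj x))\<^sup>2 = (cos x)\<^sup>2" unfolding cc2 S by (simp add: cos_squared_eq)
  then show "cc (jj x) = cos x" using cc_bounds(1)[of "jj x"] sin_b_bounds(3)[OF assms] by (simp add: power2_eq_iff)
  show "jj x \<in> {- pi / 2..pi / 2}" using arcsin_bounded[OF r] by (simp add: jj_def)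
  have "cos (jj x) = sqrt (1 - (sin x / amp)\<^sup>2)" using cos_arcsin[OF r] by (simp add: jj_def)
  moreover have "amp * sqrt z = sqrt (amp\<^sup>2 * z)" for z using amp by (simp add: real_sqrt_mult)
  moreover have "amp\<^sup>2 * (1 - (sin x / amp)\<^sup>2) = amp\<^sup>2 - (sin x)\<^sup>2"
    using amp by (simp add: power_divide right_diff_distrib)
  ultimately show "amp * cos (jj x) = sqrt (amp\<^sup>2 - (sin x)\<^sup>2)" by simp
qed

text \<open>The square root is a smooth factor times \<open>cos (jj x)\<close>, and the derivative
  of \<open>jj\<close> has the same cosine in its denominator; so the singular integrands become
  smooth in the angle.\<close>

lemma radicand:
  assumes "x \<in> {b..- b}"
  shows "sqrt (cos x ^ 4 - cos b ^ 4) = amp * cos (jj x) * DD (jj x)"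
proof -
  have 1: "amp\<^sup>2 - (sin x)\<^sup>2 = (cos x)\<^sup>2 - (cos b)\<^sup>2"
    using kap(1) by (simp add: kap_def sin_squared_eq)
  have "cos x ^ 4 - cos b ^ 4 = (amp\<^sup>2 - (sin x)\<^sup>2) * ((cc (jj x))\<^sup>2 + kap)"
    unfolding 1 jj_props(2)[OF assms] kap_def by (simp add: algebra_simps power2_eq_square power4_eq_xxxx)
  then show ?thesis using jj_props(4)[OF assms] by (simp add: real_sqrt_mult DD_def)
qed

text \<open>\<open>jj\<close> is continuous up to the turning points, but its derivative blows up
  there. The fundamental theorem with derivatives only in the interior still applies and also yields
  integrability.\<close>

lemma substitution_integral:
  assumes h: "sd h h'" and x: "x \<in> {b..- b}"
  shows "((\<lambda>s. h' (jj s) * (cos s)\<^sup>2 / sqrt (cos s ^ 4 - cos b ^ 4)) has_integral h (jj x) - h (- pi / 2)) {b..x}"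
proof -
  have jb: "jj b = - pi / 2" using amp by (simp add: jj_def amp_def)
  have "((\<lambda>s. h' (jj s) * (cos s)\<^sup>2 / sqrt (cos s ^ 4 - cos b ^ 4)) has_integral h (jj x) - h (jj b)) {b..x}"
  proof (rule fundamental_theorem_of_calculus_interior)
    show "b \<le> x" using x by simp
    have bd: "- 1 \<le> sin s / amp \<and> sin s / amp \<le> 1" if "s \<in> {b..x}" for s
    proof -
      have "\<bar>sin s\<bar> \<le> amp" using that x by (intro sin_b_bounds(1)) auto
      then have "- amp \<le> sin s" "sin s \<le> amp" by linarith+
      then show ?thesis using amp by (simp add: field_simps)
    qed
    have cj: "continuous_on {b..x} jj"
      unfolding jj_def[abs_def] using bd amp by (intro continuous_intros) auto
    have ch: "continuous_on UNIV h"
      using sdD[OF h] by (meson DERIV_isCont continuous_at_imp_continuous_on)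
    show "continuous_on {b..x} (\<lambda>s. h (jj s))"
      by (rule continuous_on_compose2[OF ch cj]) simp
    fix s assume s: "s \<in> {b<..<x}"
    then have s': "s \<in> {b..- b}" "s \<in> {b<..<- b}" using x by auto
    have lt: "\<bar>sin s\<bar> < amp" by (rule sin_b_bounds(2)[OF s'])
    then have r: "- 1 < sin s / amp" "sin s / amp < 1" using amp by (auto simp: field_simps abs_less_iff)
    have cj: "cos (jj s) = sqrt (1 - (sin s / amp)\<^sup>2)" using cos_arcsin[of "sin s / amp"] r by (simp add: jj_def)
    have cj0: "cos (jj s) > 0"
      using jj_props(4)[OF s'(1)] power2_strict_mono[of "\<bar>sin s\<bar>" amp] lt amp
      by (metis abs_ge_zero abs_power2 diff_gt_0_iff_gt power2_abs real_sqrt_gt_zero zero_less_mult_pos power_strict_mono pos2)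
    have "(jj has_real_derivative cos s / (amp * cos (jj s))) (at s)"
    proof -
      have "((\<lambda>s. sin s / amp) has_real_derivative cos s / amp) (at s)" using amp by (auto intro!: derivative_eq_intros)
      from DERIV_chain2[OF DERIV_arcsin[OF r] this] show ?thesis
        unfolding jj_def[abs_def, symmetric] cj[symmetric] by (simp add: divide_inverse mult_ac)
    qed
    from DERIV_chain2[OF sdD[OF h] this]
    have "((\<lambda>s. h (jj s)) has_real_derivative cc (jj s) / DD (jj s) * h' (jj s) * (cos s / (amp * cos (jj s)))) (at s)" .
    then show "((\<lambda>s. h (jj s)) has_vector_derivative h' (jj s) * (cos s)\<^sup>2 / sqrt (cos s ^ 4 - cos b ^ 4)) (at s)"
      unfolding radicand[OF s'(1)] jj_props(2)[OF s'(1)]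
      using cj0 amp by (simp add: has_real_derivative_iff_has_vector_derivative power2_eq_square mult_ac)
  qed
  then show ?thesis by (simp add: jb)
qed

lemma time_of_eq: "x \<in> {b..- b} \<Longrightarrow> time_of b x = tau (jj x)"
proof -
  assume x: "x \<in> {b..- b}"
  have "((\<lambda>s. 2 * pi * cos s ^ 3 / sqrt (cos s ^ 4 - cos b ^ 4)) has_integral tau (jj x) - tau (- pi / 2)) {b..x}"
  proof (rule has_integral_eq[OF _ substitution_integral[OF tau(2) x]])
    fix s assume "s \<in> {b..x}"
    then have "s \<in> {b..- b}" using x by auto
    then show "2 * pi * cc (jj s) * (cos s)\<^sup>2 / sqrt (cos s ^ 4 - cos b ^ 4) = 2 * pi * cos s ^ 3 / sqrt (cos s ^ 4 - cos b ^ 4)"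
      by (simp add: jj_props power2_eq_square power3_eq_cube)
  qed
  then show ?thesis unfolding time_of_def tau(1) by (simp add: integral_unique)
qed

lemma Xi_eq: "Xi b = th (pi / 2)"
proof -
  have b: "- b \<in> {b..- b}" using b_lt by simp
  have j: "jj (- b) = pi / 2" using amp by (simp add: jj_def amp_def)
  have "((\<lambda>s. (cos b)\<^sup>2 / (cos s * sqrt (cos s ^ 4 - cos b ^ 4))) has_integral th (jj (- b)) - th (- pi / 2)) {b..- b}"
  proof (rule has_integral_eq[OF _ substitution_integral[OF sd_th b]])
    fix s assume s: "s \<in> {b..- b}"
    then show "kk (jj s) * (cos s)\<^sup>2 / sqrt (cos s ^ 4 - cos b ^ 4) = (cos b)\<^sup>2 / (cos s * sqrt (cos s ^ 4 - cos b ^ 4))"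
      using sin_b_bounds(3)[OF s] by (simp add: kk_def jj_props[OF s] kap_def power2_eq_square power3_eq_cube)
  qed
  then show ?thesis unfolding Xi_def th(1) j by (simp add: integral_unique)
qed

lemma half_period_eq: "half_period b = TT"
proof -
  have "jj (- b) = pi / 2" using amp by (simp add: jj_def amp_def)
  moreover have "time_of b (- b) = tau (jj (- b))" by (rule time_of_eq) (use b_lt in simp)
  ultimately show ?thesis by (simp only: half_period_def TT_def)
qed

lemma phi_eq: "phi b t = arcsin (SS (Psi t))"
proof -
  define n where "n = \<lfloor>t / TT\<rfloor>"
  define r where "r = t - of_int n * TT"
  have r: "0 \<le> r" "r < TT"
    using floor_divide_lower[OF TT_pos, of t] floor_divide_upper[OF TT_pos, of t]
    by (auto simp: r_def n_def algebra_simps)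
  define y where "y = Psi r"
  have y: "- pi / 2 \<le> y" "y < pi / 2"
  proof -
    show "- pi / 2 \<le> y" using tau_strict[of y "- pi / 2"] r(1) Psi(1)[of r] tau(1) by (force simp: y_def)
    show "y < pi / 2"
    proof (rule ccontr)
      assume "\<not> y < pi / 2"
      then have "pi / 2 = y \<or> pi / 2 < y" by auto
      then have "TT \<le> tau y" using tau_strict[of "pi / 2" y] unfolding TT_def
        by (metis order.order_iff_strict)
      then show False using r Psi(1)[of r] by (simp add: y_def)
    qed
  qed
  define x where "x = arcsin (SS y)"
  have Sy: "\<bar>SS y\<bar> \<le> amp" using SS_bound[of y] amp by (metis abs_le_square_iff abs_of_pos)
  have Sy1: "- 1 \<le> SS y" "SS y \<le> 1" using Sy amp by (auto simp: abs_le_iff)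
  have "arcsin (- amp) = b" "arcsin amp = - b"
    using b_gt b_lt by (simp_all add: amp_def arcsin_sin arcsin_minus)
  then have x: "x \<in> {b..- b}"
    using arcsin_le_mono[of "- amp" "SS y"] arcsin_le_mono[of "SS y" amp] Sy amp
    by (auto simp: x_def abs_le_iff)
  have "jj x = y"
  proof -
    have "sin x = amp * sin y" using Sy1 by (simp add: x_def SS_def)
    then have "jj x = arcsin (sin y)" using amp by (simp add: jj_def)
    then show ?thesis using y by (simp add: arcsin_sin)
  qed
  then have tx: "time_of b x = r" using time_of_eq[OF x] Psi(1) by (simp add: y_def)
  have inj: "inj_on (time_of b) {b..- b}"
  proof (rule inj_onI)
    fix u v assume u: "u \<in> {b..- b}" and v: "v \<in> {b..- b}" and "time_of b u = time_of b v"
    then have "tau (jj u) = tau (jj v)" by (simp add: time_of_eq)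
    then have "Psi (tau (jj u)) = Psi (tau (jj v))" by (rule arg_cong)
    then have "jj u = jj v" unfolding Psi(2) .
    then have "SS (jj u) = SS (jj v)" by (rule arg_cong)
    then have su: "sin u = sin v" unfolding jj_props(1)[OF u] jj_props(1)[OF v] .
    have as: "arcsin (sin z) = z" if "z \<in> {b..- b}" for z
    proof (rule arcsin_sin)
      show "- (pi / 2) \<le> z" "z \<le> pi / 2" using that b_gt by auto
    qed
    show "u = v" using as[OF u] as[OF v] unfolding su by (rule trans[OF sym])
  qed
  have "inv_into {b..- b} (time_of b) r = x" using inv_into_f_eq[OF inj x tx] .
  then have phi: "phi b t = (if even n then 1 else - 1) * x"
    unfolding phi_def Let_def half_period_eq n_def[symmetric] r_def[symmetric] by simp
  \<comment> \<open>The sign in the definition of \<open>phi\<close> is the one that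
    \<open>SS\<close> acquires under n shifts by pi; for negative n the shift is read backwards,
    from \<open>t\<close> to \<open>r\<close>.\<close>
  have Pt: "SS (Psi t) = (if even n then 1 else - 1) * SS y"
  proof (cases "n \<ge> 0")
    case True
    then have "t = r + real (nat n) * TT" by (simp add: r_def)
    then have "Psi t = y + pi * real (nat n)" using Psi_shift by (simp add: y_def)
    then have "SS (Psi t) = (-1) ^ nat n * SS y" by (simp only: shift)
    then show ?thesis using True by (auto simp: even_nat_iff)
  next
    case False
    then have "r = t + real (nat (- n)) * TT" by (simp add: r_def)
    then have "y = Psi t + pi * real (nat (- n))" using Psi_shift by (simp add: y_def)
    then have "SS y = (-1) ^ nat (- n) * SS (Psi t)" by (simp only: shift)
    then show ?thesis using False by (auto simp: even_nat_iff)
  qed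
  show ?thesis unfolding phi Pt x_def using Sy1 by (simp add: arcsin_minus)
qed

lemma cos_phi: "cos (phi b t) = cc (Psi t)" and sin_phi: "sin (phi b t) = SS (Psi t)"
proof -
  have "\<bar>SS (Psi t)\<bar> \<le> amp" using SS_bound[of "Psi t"] amp by (metis abs_le_square_iff abs_of_pos)
  then have "- 1 \<le> SS (Psi t)" "SS (Psi t) \<le> 1" using amp by (auto simp: abs_le_iff)
  then show "cos (phi b t) = cc (Psi t)" "sin (phi b t) = SS (Psi t)"
    by (simp_all add: phi_eq cos_arcsin cc_def SS_def)
qed

text \<open>Two candidates for the definite description have a difference with zero derivative and
  agree at 0.\<close>

lemma theta_eq: "theta b t = th (Psi t)"
proof -
  have d: "((\<lambda>t. th (Psi t)) has_real_derivative cos b ^ 2 / (2 * pi * cos (phi b t) ^ 4)) (at t)" for t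
  proof -
    have "((\<lambda>t. th (Psi t)) has_real_derivative (cc (Psi t) / DD (Psi t) * kk (Psi t)) * (DD (Psi t) / (2 * pi * (cc (Psi t))\<^sup>2))) (at t)"
      by (rule DERIV_chain2[OF th(2) deriv_Psi])
    then show ?thesis
      by (simp add: cos_phi kk_def kap_def power2_eq_square power3_eq_cube power4_eq_xxxx mult_ac)
  qed
  have "theta b = (\<lambda>t. th (Psi t))"
    unfolding theta_def
  proof (rule the_equality)
    show "th (Psi 0) = 0 \<and> (\<forall>t. ((\<lambda>t. th (Psi t)) has_real_derivative cos b ^ 2 / (2 * pi * cos (phi b t) ^ 4)) (at t))"
      using d by (simp only: Psi_0 th(1)) simp
    fix f :: "real \<Rightarrow> real"
    assume f: "f 0 = 0 \<and> (\<forall>t. (f has_real_derivative cos b ^ 2 / (2 * pi * cos (phi b t) ^ 4)) (at t))"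
    show "f = (\<lambda>t. th (Psi t))"
    proof
      fix t
      have "((\<lambda>t. f t - th (Psi t)) has_real_derivative 0) (at t)" for t
        using DERIV_diff[OF conjunct2[OF f, rule_format] d] by simp
      then have "f t - th (Psi t) = f 0 - th (Psi 0)" using DERIV_isconst_all by blast
      then show "f t = th (Psi t)" using f by (simp only: Psi_0 th(1))
    qed
  qed
  then show ?thesis by simp
qed

text \<open>The bound tends to pi sqrt 2 / 2 as kap tends to 1 and decreases with kap, so a value of
  \<open>Xi\<close> close to that limit forces a small amplitude.\<close>

lemma Xi_upper_bound: "Xi b \<le> pi * (3 / (2 * sqrt 2) - 1 / (2 * sqrt (1 + kap)))"
proof -
  \<comment> \<open>The minimum of \<open>DD\<close>. The integrand kap / (C^2 E) is estimated by 1
    / E \<le> \<mu> / (2 E^2) + 1 / (2 \<mu>), which becomes sharp at small amplitude. As kap / (C^2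
    E^2) = 1 / C^2 - 1 / E^2, the majorant has elementary integrals.\<close>
  define \<mu> where "\<mu> = sqrt (2 * kap)"
  have \<mu>: "\<mu> > 0" "\<mu> * \<mu> = 2 * kap" using kap by (auto simp: \<mu>_def)
  have cq: "(cc x)\<^sup>2 = (cos x)\<^sup>2 + (sqrt kap)\<^sup>2 * (sin x)\<^sup>2" for x
  proof -
    have "(sqrt kap)\<^sup>2 = 1 - amp\<^sup>2" using kap by simp
    then show ?thesis unfolding cc2 SS_def power_mult_distrib sin_squared_eq by algebra
  qed
  define r where "r = sqrt (2 * kap / (1 + kap))"
  have r: "r > 0" "r\<^sup>2 = 2 * kap / (1 + kap)" using kap by (auto simp: r_def)
  have dq: "(DD x)\<^sup>2 = (1 + kap) * ((cos x)\<^sup>2 + r\<^sup>2 * (sin x)\<^sup>2)" for x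
    using kap unfolding DD2 cq r by (simp add: sin_squared_eq field_simps)
  have I1: "((\<lambda>x. 1 / (cc x)\<^sup>2) has_integral pi / sqrt kap) {- pi / 2..pi / 2}"
    unfolding cq by (rule integral_reciprocal_quadratic) (use kap in simp)
  have I2: "((\<lambda>x. 1 / (DD x)\<^sup>2) has_integral (1 / (1 + kap)) * (pi / r)) {- pi / 2..pi / 2}"
    using has_integral_mult_right[OF integral_reciprocal_quadratic[OF r(1)], of "1 / (1 + kap)"]
    unfolding dq by simp
  have I: "((\<lambda>x. cc x / DD x * kk x) has_integral th (pi / 2) - th (- pi / 2)) {- pi / 2..pi / 2}"
    using th(2) by (intro fundamental_theorem_of_calculus)
      (auto intro: has_field_derivative_at_within simp flip: has_real_derivative_iff_has_vector_derivative)
  have J: "((\<lambda>x. \<mu> / 2 * (1 / (cc x)\<^sup>2 - 1 / (DD x)\<^sup>2) + kap / (2 * \<mu>) * (1 / (cc x)\<^sup>2)) has_integral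
      \<mu> / 2 * (pi / sqrt kap - (1 / (1 + kap)) * (pi / r)) + kap / (2 * \<mu>) * (pi / sqrt kap)) {- pi / 2..pi / 2}"
    by (intro has_integral_add has_integral_diff has_integral_mult_right I1 I2)
  have "th (pi / 2) - th (- pi / 2) \<le> \<mu> / 2 * (pi / sqrt kap - (1 / (1 + kap)) * (pi / r)) + kap / (2 * \<mu>) * (pi / sqrt kap)"
  proof (rule has_integral_le[OF I J])
    fix x
    define C E where "C = cc x" and "E = DD x"
    have CE: "C > 0" "E > 0" "E\<^sup>2 = C\<^sup>2 + kap" using cc_bounds DD_pos DD2 by (auto simp: C_def E_def)
    have "1 / C\<^sup>2 - 1 / E\<^sup>2 = (E\<^sup>2 - C\<^sup>2) / (C\<^sup>2 * E\<^sup>2)" using CE(1,2) by (simp add: field_simps)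
    then have "1 / C\<^sup>2 - 1 / E\<^sup>2 = kap / (C\<^sup>2 * E\<^sup>2)" using CE(3) by simp
    then have e: "\<mu> / 2 * (1 / C\<^sup>2 - 1 / E\<^sup>2) = \<mu> / 2 * (kap / (C\<^sup>2 * E\<^sup>2))" by simp
    have "\<mu> / 2 * (1 / C\<^sup>2 - 1 / E\<^sup>2) + kap / (2 * \<mu>) * (1 / C\<^sup>2) - kap / (C\<^sup>2 * E)
       = kap / (2 * \<mu> * C\<^sup>2) * (\<mu> / E - 1)\<^sup>2"
      unfolding e using CE(1,2) \<mu>(1) by (simp add: power2_eq_square field_simps)
    also have "\<dots> \<ge> 0" using CE \<mu> kap by (intro mult_nonneg_nonneg) auto
    finally have "kap / (C\<^sup>2 * E) \<le> \<mu> / 2 * (1 / C\<^sup>2 - 1 / E\<^sup>2) + kap / (2 * \<mu>) * (1 / C\<^sup>2)" by simp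
    moreover have "C / E * kk x = kap / (C\<^sup>2 * E)"
      by (simp add: kk_def C_def E_def power2_eq_square power3_eq_cube)
    ultimately show "cc x / DD x * kk x \<le> \<mu> / 2 * (1 / (cc x)\<^sup>2 - 1 / (DD x)\<^sup>2) + kap / (2 * \<mu>) * (1 / (cc x)\<^sup>2)"
      by (simp add: C_def E_def)
  qed
  also have "\<mu> / 2 * (pi / sqrt kap - (1 / (1 + kap)) * (pi / r)) + kap / (2 * \<mu>) * (pi / sqrt kap) =
     pi * (3 / (2 * sqrt 2) - 1 / (2 * sqrt (1 + kap)))"
  proof -
    define sk sp s2 where "sk = sqrt kap" and "sp = sqrt (1 + kap)" and "s2 = sqrt 2"
    have p: "sk > 0" "sp > 0" "s2 > 0" "kap = sk * sk" "1 + kap = sp * sp" "s2 * s2 = 2"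
      using kap by (auto simp: sk_def sp_def s2_def)
    have e: "\<mu> = s2 * sk" "r = s2 * sk / sp"
      by (simp_all add: \<mu>_def r_def sk_def sp_def s2_def real_sqrt_mult real_sqrt_divide)
    have "s2 * sk / 2 * (pi / sk - (1 / (sp * sp)) * (pi / (s2 * sk / sp))) + sk * sk / (2 * (s2 * sk)) * (pi / sk) =
      pi * (s2 / 2 + 1 / (2 * s2) - 1 / (2 * sp))"
      using p(1-3) by (simp add: field_simps)
    also have "s2 / 2 + 1 / (2 * s2) = 3 / (2 * s2)" using p by (simp add: field_simps)
    finally show ?thesis unfolding e sk_def[symmetric] p(5) sp_def[symmetric] s2_def[symmetric] unfolding p(4)
      using p(2) by simp
  qed
  finally show ?thesis unfolding Xi_eq th(1) by (simp only: diff_zero)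
qed

end

section \<open>The moving frame\<close>

lemma UNIV_5: "(UNIV :: 5 set) = {1, 2, 3, 4, 5}"
proof -
  have "x = 1 \<or> x = 2 \<or> x = 3 \<or> x = 4 \<or> x = 5" for x :: 5
  proof (induct x)
    case (of_int z)
    then have "0 \<le> z" and "z < 5" by simp_all
    then have "z = 0 \<or> z = 1 \<or> z = 2 \<or> z = 3 \<or> z = 4" by arith
    then show ?case by auto
  qed
  then show ?thesis by auto
qed

lemma distinct_5: "distinct [1, 2, 3, 4, 5 :: 5]"
  by simp

lemma sum_5: "sum f (UNIV :: 5 set) = f 1 + f 2 + f 3 + f 4 + f 5"
  unfolding UNIV_5 using distinct_5 by (simp add: add.assoc)

lemma vector_5_nth:
  "(vector [a, b, c, d, e] :: real ^ 5) $ 1 = a" "(vector [a, b, c, d, e] :: real ^ 5) $ 2 = b"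
  "(vector [a, b, c, d, e] :: real ^ 5) $ 3 = c" "(vector [a, b, c, d, e] :: real ^ 5) $ 4 = d"
  "(vector [a, b, c, d, e] :: real ^ 5) $ 5 = e"
  unfolding vector_def by simp_all

lemma eq_5_iff: "(u :: real ^ 5) = v \<longleftrightarrow> u $ 1 = v $ 1 \<and> u $ 2 = v $ 2 \<and> u $ 3 = v $ 3 \<and> u $ 4 = v $ 4 \<and> u $ 5 = v $ 5"
proof -
  have "u = v \<longleftrightarrow> (\<forall>i\<in>UNIV. u $ i = v $ i)" by (simp add: vec_eq_iff)
  then show ?thesis unfolding UNIV_5 by simp
qed

lemma inner_5: "(u :: real ^ 5) \<bullet> v = u $ 1 * v $ 1 + u $ 2 * v $ 2 + u $ 3 * v $ 3 + u $ 4 * v $ 4 + u $ 5 * v $ 5"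
  by (simp add: inner_vec_def sum_5)

lemma vector_5_axis: "(vector [a, b, c, d, e] :: real ^ 5) =
    a *\<^sub>R axis 1 1 + b *\<^sub>R axis 2 1 + c *\<^sub>R axis 3 1 + d *\<^sub>R axis 4 1 + e *\<^sub>R axis 5 1"
  using distinct_5 by (simp add: eq_5_iff vector_5_nth axis_def)

context otsuki
begin

text \<open>\<open>pd f fa fs\<close>: derivatives \<open>fa\<close> in \<open>\<alpha>\<close> and \<open>fs\<close> in the arclength of the profile curve.\<close>

definition pd :: "(plane \<Rightarrow> 'b::real_normed_vector) \<Rightarrow> 'b \<Rightarrow> 'b \<Rightarrow> plane \<Rightarrow> bool" where
  "pd f fa fs z \<longleftrightarrow> (f has_derivative (\<lambda>v. fst v *\<^sub>R fa + (snd v / (2 * pi * cc (Psi (snd z)))) *\<^sub>R fs)) (at z)"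

lemma pd_const: "pd (\<lambda>_. k) 0 0 z"
  by (simp add: pd_def)

lemma pd_add: "pd f fa fs z \<Longrightarrow> pd g ga gs z \<Longrightarrow> pd (\<lambda>z. f z + g z) (fa + ga) (fs + gs) z"
  unfolding pd_def by (rule has_derivative_eq_rhs, erule (1) has_derivative_add) (auto simp: scaleR_right_distrib)

lemma pd_bounded_linear: "bounded_linear h \<Longrightarrow> pd f fa fs z \<Longrightarrow> pd (\<lambda>z. h (f z)) (h fa) (h fs) z"
  unfolding pd_def
  by (rule has_derivative_eq_rhs, erule (1) bounded_linear.has_derivative)
     (auto simp: linear_add linear_scale bounded_linear.linear)

lemma pd_diff: "pd f fa fs z \<Longrightarrow> pd g ga gs z \<Longrightarrow> pd (\<lambda>z. f z - g z) (fa - ga) (fs - gs) z"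
  unfolding pd_def by (rule has_derivative_eq_rhs, erule (1) has_derivative_diff) (auto simp: scaleR_right_diff_distrib)

lemma pd_mult:
  fixes f g :: "plane \<Rightarrow> real"
  shows "pd f fa fs z \<Longrightarrow> pd g ga gs z \<Longrightarrow> pd (\<lambda>z. f z * g z) (fa * g z + f z * ga) (fs * g z + f z * gs) z"
  unfolding pd_def by (rule has_derivative_eq_rhs, erule (1) has_derivative_mult) (auto simp: algebra_simps add_divide_distrib)

lemma pd_cong: "pd f fa fs z \<Longrightarrow> fa = ga \<Longrightarrow> fs = gs \<Longrightarrow> pd f ga gs z"
  by simp

lemma pd_t:
  assumes "sd h h'"
  shows "pd (\<lambda>z. h (Psi (snd z))) 0 (h' (Psi (snd z))) z"
proof -
  let ?x = "Psi (snd z)"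
  have "((\<lambda>t. h (Psi t)) has_real_derivative (cc ?x / DD ?x * h' ?x) * (DD ?x / (2 * pi * (cc ?x)\<^sup>2))) (at (snd z))"
    by (rule DERIV_chain2[OF sdD[OF assms] deriv_Psi])
  moreover have "(cc ?x / DD ?x * h' ?x) * (DD ?x / (2 * pi * (cc ?x)\<^sup>2)) = h' ?x / (2 * pi * cc ?x)"
    by (simp add: power2_eq_square)
  ultimately have "((\<lambda>t. h (Psi t)) has_derivative (\<lambda>k. k * (h' ?x / (2 * pi * cc ?x)))) (at (snd z))"
    by (simp only: has_field_derivative_def mult_commute_abs)
  from has_derivative_compose[OF has_derivative_snd[OF has_derivative_ident] this]
  show ?thesis by (simp add: pd_def)
qed

lemma pd_alpha:
  assumes "(h has_real_derivative h') (at (fst z))"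
  shows "pd (\<lambda>z. h (fst z)) h' 0 z"
proof -
  have "(h has_derivative (\<lambda>k. k * h')) (at (fst z))"
    using assms by (simp add: has_field_derivative_def mult_commute_abs)
  from has_derivative_compose[OF has_derivative_fst[OF has_derivative_ident] this]
  show ?thesis by (simp add: pd_def)
qed

text \<open>Coordinates in the basis formed by (cos \<alpha>, sin \<alpha>) tensor (sin \<theta>,
  cos \<theta>), its derivatives in \<theta>, in \<alpha> and in both, and the fifth axis. It is
  orthonormal, being built from two plane rotations.\<close>

definition cmb :: "plane \<Rightarrow> real \<Rightarrow> real \<Rightarrow> real \<Rightarrow> real \<Rightarrow> real \<Rightarrow> R5" where
  "cmb z c1 c2 c3 c4 c5 = (let C = cos (fst z); S = sin (fst z); E = cos (th (Psi (snd z))); F = sin (th (Psi (snd z))) in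
     vector [C * F * c1 + C * E * c2 - S * F * c3 - S * E * c4,
             S * F * c1 + S * E * c2 + C * F * c3 + C * E * c4,
             C * E * c1 - C * F * c2 - S * E * c3 + S * F * c4,
             S * E * c1 - S * F * c2 + C * E * c3 - C * F * c4, c5])"

lemma cmb_inner: "cmb z c1 c2 c3 c4 c5 \<bullet> cmb z d1 d2 d3 d4 d5 = c1 * d1 + c2 * d2 + c3 * d3 + c4 * d4 + c5 * d5"
proof -
  define C S E F where "C = cos (fst z)" "S = sin (fst z)" "E = cos (th (Psi (snd z)))" "F = sin (th (Psi (snd z)))"
  have "C * C + S * S = 1" "E * E + F * F = 1"
    using sin_cos_squared_add2[of "fst z"] sin_cos_squared_add2[of "th (Psi (snd z))"]
    by (auto simp: C_S_E_F_def power2_eq_square)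
  then show ?thesis
    unfolding cmb_def Let_def C_S_E_F_def[symmetric] inner_5 vector_5_nth by algebra
qed

lemma cmb_complete: "\<exists>c1 c2 c3 c4 c5. w = cmb z c1 c2 c3 c4 c5"
proof -
  define C S E F where "C = cos (fst z)" "S = sin (fst z)" "E = cos (th (Psi (snd z)))" "F = sin (th (Psi (snd z)))"
  have r: "C * C + S * S = 1" "E * E + F * F = 1"
    using sin_cos_squared_add2[of "fst z"] sin_cos_squared_add2[of "th (Psi (snd z))"]
    by (auto simp: C_S_E_F_def power2_eq_square)
  have "w = cmb z (C * F * w $ 1 + S * F * w $ 2 + C * E * w $ 3 + S * E * w $ 4)
      (C * E * w $ 1 + S * E * w $ 2 - C * F * w $ 3 - S * F * w $ 4)
      (- S * F * w $ 1 + C * F * w $ 2 - S * E * w $ 3 + C * E * w $ 4)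
      (- S * E * w $ 1 + C * E * w $ 2 + S * F * w $ 3 - C * F * w $ 4) (w $ 5)"
    unfolding cmb_def Let_def C_S_E_F_def[symmetric] eq_5_iff vector_5_nth
  proof (intro conjI)
  qed (rule refl | use r in algebra)+
  then show ?thesis by blast
qed

lemma pd_vector:
  assumes "pd f1 a1 s1 z" "pd f2 a2 s2 z" "pd f3 a3 s3 z" "pd f4 a4 s4 z" "pd f5 a5 s5 z"
  shows "pd (\<lambda>z. vector [f1 z, f2 z, f3 z, f4 z, f5 z] :: R5) (vector [a1, a2, a3, a4, a5]) (vector [s1, s2, s3, s4, s5]) z"
  unfolding vector_5_axis
  by (intro pd_add pd_bounded_linear[OF bounded_linear_scaleR_left] assms)

text \<open>Differentiating in \<alpha> or \<theta> permutes the basis vectors up to sign, and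
  \<theta> changes at rate \<open>kk\<close> in arclength.\<close>

lemma pd_cmb:
  assumes "pd c1 a1 s1 z" "pd c2 a2 s2 z" "pd c3 a3 s3 z" "pd c4 a4 s4 z" "pd c5 a5 s5 z"
  defines "K \<equiv> kk (Psi (snd z))"
  shows "pd (\<lambda>z. cmb z (c1 z) (c2 z) (c3 z) (c4 z) (c5 z))
    (cmb z (a1 - c3 z) (a2 - c4 z) (a3 + c1 z) (a4 + c2 z) a5)
    (cmb z (s1 - K * c2 z) (s2 + K * c1 z) (s3 - K * c4 z) (s4 + K * c3 z) s5) z"
proof -
  have C: "pd (\<lambda>z. cos (fst z)) (- sin (fst z)) 0 z" and S: "pd (\<lambda>z. sin (fst z)) (cos (fst z)) 0 z"
    by (intro pd_alpha; auto intro!: derivative_eq_intros)+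
  have E: "pd (\<lambda>z. cos (th (Psi (snd z)))) 0 (- K * sin (th (Psi (snd z)))) z"
    and F: "pd (\<lambda>z. sin (th (Psi (snd z)))) 0 (K * cos (th (Psi (snd z)))) z"
    using pd_t[OF sd_cos_th[of 1 0], of z] pd_t[OF sd_sin_th[of 1 0], of z] by (simp_all add: K_def)
  show ?thesis
    unfolding cmb_def Let_def
    by (rule pd_cong, rule pd_vector, (rule pd_add pd_diff pd_mult C S E F assms)+)
       (simp_all add: algebra_simps)
qed

lemma cmb_cong: "p1 = q1 \<Longrightarrow> p2 = q2 \<Longrightarrow> p3 = q3 \<Longrightarrow> p4 = q4 \<Longrightarrow> p5 = q5 \<Longrightarrow>
    cmb z p1 p2 p3 p4 p5 = cmb z q1 q2 q3 q4 q5"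
  by simp

text \<open>Coordinates in the orthonormal frame given by the position vector, two tangent and two normal vectors.\<close>

definition fr :: "plane \<Rightarrow> real \<Rightarrow> real \<Rightarrow> real \<Rightarrow> real \<Rightarrow> real \<Rightarrow> R5" where
  "fr z a0 a1 a2 x y = (let C = cc (Psi (snd z)); S = SS (Psi (snd z)); G = gg (Psi (snd z)); K = kk (Psi (snd z)) in
     cmb z (C * a0 - S * G * a2 - S * (C * K) * y) (C * K * a2 - G * y) a1 x (S * a0 + C * G * a2 + C * (C * K) * y))"

lemma fr_inner: "fr z a0 a1 a2 x y \<bullet> fr z b0 b1 b2 x' y' = a0 * b0 + a1 * b1 + a2 * b2 + x * x' + y * y'"
  unfolding fr_def Let_def cmb_inner using rel[of "Psi (snd z)"] by algebra

lemma cmb_scaleR: "r *\<^sub>R cmb z c1 c2 c3 c4 c5 = cmb z (r * c1) (r * c2) (r * c3) (r * c4) (r * c5)"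
  by (simp add: cmb_def Let_def eq_5_iff vector_5_nth algebra_simps)

lemma cmb_add: "cmb z c1 c2 c3 c4 c5 + cmb z d1 d2 d3 d4 d5 = cmb z (c1 + d1) (c2 + d2) (c3 + d3) (c4 + d4) (c5 + d5)"
  by (simp add: cmb_def Let_def eq_5_iff vector_5_nth algebra_simps)

lemma fr_scaleR: "r *\<^sub>R fr z a0 a1 a2 x y = fr z (r * a0) (r * a1) (r * a2) (r * x) (r * y)"
  by (simp add: fr_def Let_def cmb_scaleR algebra_simps)

lemma fr_add: "fr z a0 a1 a2 x y + fr z b0 b1 b2 x' y' = fr z (a0 + b0) (a1 + b1) (a2 + b2) (x + x') (y + y')"
  by (simp add: fr_def Let_def cmb_add algebra_simps)

lemma fr_minus: "- fr z a0 a1 a2 x y = fr z (- a0) (- a1) (- a2) (- x) (- y)"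
  using fr_scaleR[of "-1" z a0 a1 a2 x y] by simp

lemma fr_diff: "fr z a0 a1 a2 x y - fr z b0 b1 b2 x' y' = fr z (a0 - b0) (a1 - b1) (a2 - b2) (x - x') (y - y')"
  unfolding diff_conv_add_uminus fr_minus fr_add ..

lemma fr_zero: "fr z 0 0 0 0 0 = 0"
  using fr_scaleR[of 0 z 0 0 0 0 0] by simp

lemma fr_complete: "w = fr z (w \<bullet> fr z 1 0 0 0 0) (w \<bullet> fr z 0 1 0 0 0) (w \<bullet> fr z 0 0 1 0 0) (w \<bullet> fr z 0 0 0 1 0) (w \<bullet> fr z 0 0 0 0 1)"
proof -
  obtain c1 c2 c3 c4 c5 where w: "w = cmb z c1 c2 c3 c4 c5" using cmb_complete by blast
  have "\<exists>a0 a1 a2 x y. w = fr z a0 a1 a2 x y"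
  proof -
    define C S G k where "C = cc (Psi (snd z))" and "S = SS (Psi (snd z))" and "G = gg (Psi (snd z))" and "k = cc (Psi (snd z)) * kk (Psi (snd z))"
    have r: "S * S = 1 - C * C" "k * k = 1 - G * G" using rel[of "Psi (snd z)"] by (simp_all add: C_def S_def G_def k_def)
    have "w = fr z (C * c1 + S * c5) c3 (- S * G * c1 + k * c2 + C * G * c5) c4 (- S * k * c1 - G * c2 + C * k * c5)"
      unfolding w fr_def Let_def C_def[symmetric] S_def[symmetric] G_def[symmetric] k_def[unfolded C_def[symmetric], symmetric]
      by (rule cmb_cong) (rule refl | use r in algebra)+
    then show ?thesis by blast
  qed
  then obtain a0 a1 a2 x y where "w = fr z a0 a1 a2 x y" by blast
  then show ?thesis by (simp add: fr_inner)
qed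

text \<open>The structure equations of the moving frame. In the normal connection the two normal
  vectors turn into each other at rate \<open>gg\<close> in \<alpha> and are parallel along the
  profile; this is the source of the coupling \<open>2 * l * gg\<close>.\<close>

lemma pd_fr:
  assumes "pd a0 a0a a0s z" "pd a1 a1a a1s z" "pd a2 a2a a2s z" "pd x xa xs z" "pd y ya ys z"
  defines "C \<equiv> cc (Psi (snd z))" and "S \<equiv> SS (Psi (snd z))" and "G \<equiv> gg (Psi (snd z))" and "K \<equiv> kk (Psi (snd z))"
  shows "pd (\<lambda>z. fr z (a0 z) (a1 z) (a2 z) (x z) (y z))
    (fr z (a0a - C * a1 z) (a1a + C * a0 z - S * G * a2 z - S * (C * K) * y z) (a2a + S * G * a1 z - C * K * x z)
       (xa + C * K * a2 z - G * y z) (ya + S * (C * K) * a1 z + G * x z))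
    (fr z (a0s - a2 z) (a1s - K * x z) (a2s + a0 z + K * S * y z) (xs + K * a1 z) (ys - K * S * a2 z)) z"
proof -
  note defs = C_def S_def G_def K_def
  have C: "pd (\<lambda>z. cc (Psi (snd z))) 0 (- S * G) z" using pd_t[OF sd_cc] by (simp add: defs)
  have S: "pd (\<lambda>z. SS (Psi (snd z))) 0 (C * G) z" using pd_t[OF sd_SS] by (simp add: defs)
  have G: "pd (\<lambda>z. gg (Psi (snd z))) 0 (- 2 * C * (K * K) * S) z" using pd_t[OF sd_gg] by (simp add: defs power2_eq_square)
  have "sd (\<lambda>x. cc x * kk x) (\<lambda>x. 2 * kk x * SS x * gg x)"
    by (rule sd_cong, rule sd_mult, rule sd_cc, rule sd_kk) (simp add: field_simps)
  from pd_t[OF this] have CK: "pd (\<lambda>z. cc (Psi (snd z)) * kk (Psi (snd z))) 0 (2 * K * S * G) z" by (simp add: defs)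
  have r: "S * S = 1 - C * C" "(C * K) * (C * K) = 1 - G * G" using rel[of "Psi (snd z)"] by (simp_all add: defs)
  show ?thesis
    unfolding fr_def Let_def
  proof (rule pd_cong, rule pd_cmb, (rule CK pd_add pd_diff pd_mult C S G assms)+; (rule cmb_cong; (unfold defs[symmetric])?))
  qed (rule refl | use r in \<open>algebra | simp add: algebra_simps\<close>)+
qed

definition Da :: "(plane \<Rightarrow> real) \<Rightarrow> plane \<Rightarrow> real" where
  "Da f z = frechet_derivative f (at z) (1, 0)"

text \<open>The derivative in arclength: \<open>2 * pi * cc\<close> is the reciprocal of the length
  of the coordinate vector in \<open>t\<close>.\<close>

definition Ds :: "(plane \<Rightarrow> real) \<Rightarrow> plane \<Rightarrow> real" where
  "Ds f z = 2 * pi * cc (Psi (snd z)) * frechet_derivative f (at z) (0, 1)"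

lemma pd_frechet:
  assumes "pd f fa fs z"
  shows "frechet_derivative f (at z) = (\<lambda>v. fst v *\<^sub>R fa + (snd v / (2 * pi * cc (Psi (snd z)))) *\<^sub>R fs)"
  by (rule frechet_derivative_at[OF assms[unfolded pd_def], symmetric])

lemma pd_unique: "pd f fa fs z \<Longrightarrow> Da f z = fa \<and> Ds f z = fs"
  by (simp add: Da_def Ds_def pd_frechet)

lemma smooth_Psi_snd:
  fixes h :: "real \<Rightarrow> real"
  shows "smooth h \<Longrightarrow> smooth (\<lambda>z :: plane. h (Psi (snd z)))"
  by (rule smooth_compose[OF _ smooth_compose[OF smooth_Psi smooth_linear[OF bounded_linear_snd]]])

lemma smooth_fst:
  fixes h :: "real \<Rightarrow> real"
  shows "smooth h \<Longrightarrow> smooth (\<lambda>z :: plane. h (fst z))"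
  by (rule smooth_compose[OF _ smooth_linear[OF bounded_linear_fst]])

lemma pd_smooth:
  assumes "smooth f"
  shows "pd f (Da f z) (Ds f z) z"
proof -
  have d: "(f has_derivative frechet_derivative f (at z)) (at z)" by (rule smooth_frechet_derivative(2)[OF assms])
  have "frechet_derivative f (at z) = (\<lambda>v. fst v *\<^sub>R Da f z + (snd v / (2 * pi * cc (Psi (snd z)))) *\<^sub>R Ds f z)"
  proof
    fix v :: plane
    have "v = fst v *\<^sub>R (1, 0) + snd v *\<^sub>R (0, 1)" by (simp add: prod_eq_iff)
    then have "frechet_derivative f (at z) v = fst v *\<^sub>R frechet_derivative f (at z) (1, 0) + snd v *\<^sub>R frechet_derivative f (at z) (0, 1)"
      using linear_add[OF has_derivative_linear[OF d], of "fst v *\<^sub>R (1, 0)" "snd v *\<^sub>R (0, 1)"]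
        linear_scale[OF has_derivative_linear[OF d]] by (simp only:)
    then show "frechet_derivative f (at z) v = fst v *\<^sub>R Da f z + (snd v / (2 * pi * cc (Psi (snd z)))) *\<^sub>R Ds f z"
      by (simp add: Da_def Ds_def)
  qed
  with d show ?thesis unfolding pd_def by simp
qed

lemma smooth_Da: "smooth f \<Longrightarrow> smooth (Da f)"
  unfolding Da_def[abs_def] by (rule smooth_frechet_derivative(1))

lemma smooth_Ds: "smooth f \<Longrightarrow> smooth (Ds f)"
  unfolding Ds_def[abs_def]
  by (intro smooth_mult smooth_const smooth_Psi_snd smooth_coeffs smooth_frechet_derivative(1))

lemma smooth_cmb:
  assumes "smooth c1" "smooth c2" "smooth c3" "smooth c4" "smooth c5"
  shows "smooth (\<lambda>z. cmb z (c1 z) (c2 z) (c3 z) (c4 z) (c5 z))"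
proof -
  have v: "smooth (\<lambda>z. vector [f1 z, f2 z, f3 z, f4 z, f5 z] :: R5)"
    if "smooth f1" "smooth f2" "smooth f3" "smooth f4" "smooth f5" for f1 f2 f3 f4 f5 :: "plane \<Rightarrow> real"
    unfolding vector_5_axis by (intro smooth_add smooth_scaleR smooth_const that)
  show ?thesis
    unfolding cmb_def Let_def
    by (intro v smooth_add smooth_diff smooth_mult assms smooth_fst smooth_sin_cos
        smooth_Psi_snd[OF smooth_compose[OF smooth_sin_cos(1) smooth_th]]
        smooth_Psi_snd[OF smooth_compose[OF smooth_sin_cos(2) smooth_th]])
qed

lemma smooth_fr:
  assumes "smooth a0" "smooth a1" "smooth a2" "smooth x" "smooth y"
  shows "smooth (\<lambda>z. fr z (a0 z) (a1 z) (a2 z) (x z) (y z))"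
  unfolding fr_def Let_def
  by (intro smooth_cmb smooth_add smooth_diff smooth_mult assms smooth_Psi_snd smooth_coeffs)

section \<open>The Jacobi operator in the moving frame\<close>

abbreviation "ub \<equiv> otsuki_bipolar b"

lemma ub_fr: "ub = (\<lambda>z. fr z 1 0 0 0 0)"
proof
  fix z :: plane
  show "ub z = fr z 1 0 0 0 0"
    by (cases z) (simp add: otsuki_bipolar_def fr_def Let_def cmb_def cos_phi sin_phi theta_eq eq_5_iff vector_5_nth algebra_simps)
qed

lemma pd_ub: "pd ub (fr z 0 (cc (Psi (snd z))) 0 0 0) (fr z 0 0 1 0 0) z"
  unfolding ub_fr using pd_fr[OF pd_const[of 1] pd_const[of 0] pd_const[of 0] pd_const[of 0] pd_const[of 0]] by simp

lemma norm_fr: "norm (fr z a0 a1 a2 x y) = sqrt (a0\<^sup>2 + a1\<^sup>2 + a2\<^sup>2 + x\<^sup>2 + y\<^sup>2)"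
  by (simp add: norm_eq_sqrt_inner fr_inner power2_eq_square)

text \<open>The two coordinate vectors are orthogonal, so the Gram-Schmidt correction
  vanishes.\<close>

lemma tangent_frame_ub:
  "tangent_frame ub 1 z = (1 / cc (Psi (snd z)), 0)"
  "tangent_frame ub 2 z = (0, 2 * pi * cc (Psi (snd z)))"
proof -
  have 1: "frechet_derivative ub (at z) (1, 0) = fr z 0 (cc (Psi (snd z))) 0 0 0"
    "frechet_derivative ub (at z) (0, 1) = fr z 0 0 (1 / (2 * pi * cc (Psi (snd z)))) 0 0"
    by (simp_all add: pd_frechet[OF pd_ub] fr_scaleR fr_zero)
  show "tangent_frame ub 1 z = (1 / cc (Psi (snd z)), 0)"
    "tangent_frame ub 2 z = (0, 2 * pi * cc (Psi (snd z)))"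
    unfolding tangent_frame_def Let_def 1 fr_inner norm_fr using cc_bounds(1)[of "Psi (snd z)"]
    by (simp_all add: norm_fr real_sqrt_divide real_sqrt_mult)
qed

lemma deriv_along_ub:
  assumes "pd X Xa Xs z"
  shows "deriv_along (tangent_frame ub 1) X z = (1 / cc (Psi (snd z))) *\<^sub>R Xa"
    and "deriv_along (tangent_frame ub 2) X z = Xs"
  unfolding deriv_along_def pd_frechet[OF assms] tangent_frame_ub by simp_all

lemma pushed_frame_ub:
  "pushed_frame ub 1 = (\<lambda>z. fr z 0 1 0 0 0)" "pushed_frame ub 2 = (\<lambda>z. fr z 0 0 1 0 0)"
  unfolding pushed_frame_def using deriv_along_ub[OF pd_ub]
  by (auto simp: fun_eq_iff fr_scaleR)

lemma normal_part_ub: "normal_part ub z (fr z a0 a1 a2 x y) = fr z 0 0 0 x y"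
proof -
  have "(1::nat) \<noteq> 2" by simp
  moreover have "ub z = fr z 1 0 0 0 0" by (simp add: ub_fr)
  ultimately show ?thesis
    unfolding normal_part_def
    by (simp add: pushed_frame_ub fr_inner fr_scaleR fr_add fr_diff del: One_nat_def)
qed

lemma nabla_normal_ub:
  assumes x: "smooth x" and y: "smooth y"
  shows "nabla_normal ub (tangent_frame ub 1) (\<lambda>z. fr z 0 0 0 (x z) (y z)) =
      (\<lambda>z. fr z 0 0 0 ((Da x z - gg (Psi (snd z)) * y z) / cc (Psi (snd z))) ((Da y z + gg (Psi (snd z)) * x z) / cc (Psi (snd z))))"
    and "nabla_normal ub (tangent_frame ub 2) (\<lambda>z. fr z 0 0 0 (x z) (y z)) = (\<lambda>z. fr z 0 0 0 (Ds x z) (Ds y z))"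
proof -
  note p = pd_fr[OF pd_const[of 0] pd_const[of 0] pd_const[of 0] pd_smooth[OF x] pd_smooth[OF y]]
  show "nabla_normal ub (tangent_frame ub 1) (\<lambda>z. fr z 0 0 0 (x z) (y z)) =
      (\<lambda>z. fr z 0 0 0 ((Da x z - gg (Psi (snd z)) * y z) / cc (Psi (snd z))) ((Da y z + gg (Psi (snd z)) * x z) / cc (Psi (snd z))))"
    "nabla_normal ub (tangent_frame ub 2) (\<lambda>z. fr z 0 0 0 (x z) (y z)) = (\<lambda>z. fr z 0 0 0 (Ds x z) (Ds y z))"
    unfolding nabla_normal_def deriv_along_ub[OF p] by (simp_all add: fr_scaleR normal_part_ub fun_eq_iff)
qed

definition Lx :: "(plane \<Rightarrow> real) \<Rightarrow> (plane \<Rightarrow> real) \<Rightarrow> plane \<Rightarrow> real" where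
  "Lx x y z = (let C = cc (Psi (snd z)); S = SS (Psi (snd z)); G = gg (Psi (snd z)); K = kk (Psi (snd z)) in
     S * G / C * Ds x z - (Da (Da x) z - 2 * G * Da y z - G\<^sup>2 * x z) / C\<^sup>2 - Ds (Ds x) z - 2 * x z - 2 * K\<^sup>2 * x z)"

definition Ly :: "(plane \<Rightarrow> real) \<Rightarrow> (plane \<Rightarrow> real) \<Rightarrow> plane \<Rightarrow> real" where
  "Ly x y z = (let C = cc (Psi (snd z)); S = SS (Psi (snd z)); G = gg (Psi (snd z)); K = kk (Psi (snd z)) in
     S * G / C * Ds y z - (Da (Da y) z + 2 * G * Da x z - G\<^sup>2 * y z) / C\<^sup>2 - Ds (Ds y) z - 2 * y z - 2 * (K * S)\<^sup>2 * y z)"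

text \<open>Of the two tangential terms only the derivative of e1 along itself survives, equal to SS
  gg / cc times e2. In the normal frame the second fundamental form has diagonal entries (0, SS kk)
  and (0, - SS kk), whose sum zero is minimality, and off-diagonal entry (kk, 0).\<close>

lemma jacobi_op_ub:
  assumes x: "smooth x" and y: "smooth y"
  shows "jacobi_op ub (\<lambda>z. fr z 0 0 0 (x z) (y z)) z = fr z 0 0 0 (Lx x y z) (Ly x y z)"
proof -
  define C S G K where "C = cc (Psi (snd z))" and "S = SS (Psi (snd z))" and "G = gg (Psi (snd z))" and "K = kk (Psi (snd z))"
  note defs = C_def S_def G_def K_def
  have Cn: "C \<noteq> 0" by (simp add: C_def)
  have one: "(1::nat) \<noteq> 2" by simp
  let ?X = "\<lambda>z. fr z 0 0 0 (x z) (y z)"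
  let ?e1 = "tangent_frame ub 1" and ?e2 = "tangent_frame ub 2"
  have pe1: "pd (pushed_frame ub 1) (fr z (- C) 0 (S * G) 0 (S * (C * K))) (fr z 0 0 0 K 0) z"
    unfolding pushed_frame_ub defs
    using pd_fr[OF pd_const[of 0] pd_const[of 1] pd_const[of 0] pd_const[of 0] pd_const[of 0]] by simp
  have pe2: "pd (pushed_frame ub 2) (fr z 0 (- (S * G)) 0 (C * K) 0) (fr z (- 1) 0 0 0 (- (K * S))) z"
    unfolding pushed_frame_ub defs
    using pd_fr[OF pd_const[of 0] pd_const[of 0] pd_const[of 1] pd_const[of 0] pd_const[of 0]] by simp
  have p1: "deriv_along ?e1 ub = pushed_frame ub 1" "deriv_along ?e2 ub = pushed_frame ub 2"
    by (simp_all add: pushed_frame_def)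
  have nt1: "nabla_tangent ub ?e1 ?e1 z = (S * G / C) *\<^sub>R ?e2 z"
    unfolding nabla_tangent_def p1 deriv_along_ub[OF pe1] using one
    by (simp add: pushed_frame_ub fr_inner fr_scaleR defs del: One_nat_def)
  have nt2: "nabla_tangent ub ?e2 ?e2 z = 0"
    unfolding nabla_tangent_def p1 deriv_along_ub[OF pe2] using one
    by (simp add: pushed_frame_ub fr_inner del: One_nat_def)
  note pX = pd_fr[OF pd_const[of 0] pd_const[of 0] pd_const[of 0] pd_smooth[OF x] pd_smooth[OF y], of z]
  have n1: "nabla_normal ub (nabla_tangent ub ?e1 ?e1) ?X z = fr z 0 0 0 (S * G / C * Ds x z) (S * G / C * Ds y z)"
  proof -
    have "deriv_along (nabla_tangent ub ?e1 ?e1) ?X z = (S * G / C) *\<^sub>R deriv_along ?e2 ?X z"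
      unfolding deriv_along_def nt1 pd_frechet[OF pX] by (simp add: scaleR_right_distrib)
    then show ?thesis
      unfolding nabla_normal_def deriv_along_ub[OF pX] by (simp add: fr_scaleR normal_part_ub)
  qed
  have n2: "nabla_normal ub (nabla_tangent ub ?e2 ?e2) ?X z = 0"
    unfolding nabla_normal_def deriv_along_def nt2 pd_frechet[OF pX]
    using normal_part_ub[of z 0 0 0 0 0] by (simp add: fr_zero)
  have sm: "smooth (\<lambda>z. (Da x z - gg (Psi (snd z)) * y z) / cc (Psi (snd z)))"
    "smooth (\<lambda>z. (Da y z + gg (Psi (snd z)) * x z) / cc (Psi (snd z)))"
    by (intro smooth_divide smooth_add smooth_diff smooth_mult smooth_Da x y smooth_Psi_snd smooth_coeffs nz)+
  have cci: "pd (\<lambda>z. inverse (cc (Psi (snd z)))) 0 (S * G / (C * C)) z"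
  proof -
    have "sd (\<lambda>x. 1 / cc x) (\<lambda>x. SS x * gg x / (cc x * cc x))"
      by (rule sd_cong, rule sd_divide, rule sd_const, rule sd_cc) auto
    from pd_t[OF this] show ?thesis by (simp add: defs inverse_eq_divide)
  qed
  have G: "pd (\<lambda>z. gg (Psi (snd z))) 0 (- 2 * C * K\<^sup>2 * S) z" using pd_t[OF sd_gg] by (simp add: defs)
  have D1: "Da (\<lambda>z. (Da x z - gg (Psi (snd z)) * y z) / cc (Psi (snd z))) z = (Da (Da x) z - G * Da y z) / C"
    unfolding divide_inverse
    by (rule conjunct1[OF pd_unique], rule pd_cong, (rule pd_mult pd_diff cci G pd_smooth smooth_Da x y)+)
       (simp_all add: defs divide_inverse)
  have D2: "Da (\<lambda>z. (Da y z + gg (Psi (snd z)) * x z) / cc (Psi (snd z))) z = (Da (Da y) z + G * Da x z) / C"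
    unfolding divide_inverse
    by (rule conjunct1[OF pd_unique], rule pd_cong, (rule pd_mult pd_add cci G pd_smooth smooth_Da x y)+)
       (simp_all add: defs divide_inverse)
  have n3: "nabla_normal ub ?e1 (nabla_normal ub ?e1 ?X) z =
      fr z 0 0 0 ((Da (Da x) z - 2 * G * Da y z - G\<^sup>2 * x z) / C\<^sup>2) ((Da (Da y) z + 2 * G * Da x z - G\<^sup>2 * y z) / C\<^sup>2)"
  proof -
    have "((p - G * q) / C - G * ((q + G * r) / C)) / C = (p - 2 * G * q - G\<^sup>2 * r) / C\<^sup>2"
      "((p + G * q) / C + G * ((q - G * r) / C)) / C = (p + 2 * G * q - G\<^sup>2 * r) / C\<^sup>2" for p q r
      by (simp_all add: power2_eq_square algebra_simps flip: add_divide_distrib diff_divide_distrib)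
    then show ?thesis
      unfolding nabla_normal_ub(1)[OF x y] nabla_normal_ub(1)[OF sm] D1 D2 defs[symmetric] by simp
  qed
  have n4: "nabla_normal ub ?e2 (nabla_normal ub ?e2 ?X) z = fr z 0 0 0 (Ds (Ds x) z) (Ds (Ds y) z)"
    unfolding nabla_normal_ub(2)[OF x y] nabla_normal_ub(2)[OF smooth_Ds[OF x] smooth_Ds[OF y]] ..
  have nl: "normal_laplacian ub ?X z = fr z 0 0 0
      (S * G / C * Ds x z - (Da (Da x) z - 2 * G * Da y z - G\<^sup>2 * x z) / C\<^sup>2 - Ds (Ds x) z)
      (S * G / C * Ds y z - (Da (Da y) z + 2 * G * Da x z - G\<^sup>2 * y z) / C\<^sup>2 - Ds (Ds y) z)"
    unfolding normal_laplacian_def Let_def using one n1 n2 n3 n4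
    by (simp add: fr_diff fr_add fr_minus del: One_nat_def)
  have s11: "second_ff ub ?e1 ?e1 z = fr z 0 0 0 0 (S * K)"
    unfolding second_ff_def p1 deriv_along_ub[OF pe1] using Cn by (simp add: fr_scaleR normal_part_ub defs)
  have s12: "second_ff ub ?e1 ?e2 z = fr z 0 0 0 K 0"
    unfolding second_ff_def p1 deriv_along_ub[OF pe2] using Cn by (simp add: fr_scaleR normal_part_ub defs)
  have s21: "second_ff ub ?e2 ?e1 z = fr z 0 0 0 K 0"
    unfolding second_ff_def p1 deriv_along_ub[OF pe1] by (simp add: normal_part_ub)
  have s22: "second_ff ub ?e2 ?e2 z = fr z 0 0 0 0 (- (K * S))"
    unfolding second_ff_def p1 deriv_along_ub[OF pe2] by (simp add: normal_part_ub)
  have si: "simons_op ub ?X z = fr z 0 0 0 (2 * K\<^sup>2 * x z) (2 * (K * S)\<^sup>2 * y z)"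
    unfolding simons_op_def Let_def using one
    by (simp add: s11 s12 s21 s22 fr_inner fr_scaleR fr_add power2_eq_square mult_ac del: One_nat_def)
  show ?thesis
    unfolding jacobi_op_def nl si fr_scaleR fr_diff Lx_def Ly_def Let_def defs[symmetric] by simp
qed

end

section \<open>Fourier modes of normal sections\<close>

text \<open>Two phases for each positive frequency; for frequency zero the single phase \<open>\<pi> / 4\<close> keeps both
  components nonzero.\<close>

definition mode_l :: "nat \<Rightarrow> nat" where "mode_l j = (j + 1) div 2"
definition mode_d :: "nat \<Rightarrow> real" where "mode_d j = (if j = 0 then pi / 4 else if odd j then 0 else pi / 2)"
definition mcos :: "nat \<Rightarrow> real \<Rightarrow> real" where "mcos j a = cos (real (mode_l j) * a + mode_d j)"
definition msin :: "nat \<Rightarrow> real \<Rightarrow> real" where "msin j a = sin (real (mode_l j) * a + mode_d j)"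

text \<open>Half the sum and half the difference of the integrals belonging to the difference and
  the sum of the two frequencies. The phase pi / 4 of the constant mode makes its contribution to
  the second integral cos (pi / 2) = 0.\<close>

lemma mode_orthogonal:
  "((\<lambda>a. mcos i a * mcos j a) has_integral (if i = j then pi else 0)) {0..2*pi}"
  "((\<lambda>a. msin i a * msin j a) has_integral (if i = j then pi else 0)) {0..2*pi}"
proof -
  let ?l = "mode_l i" and ?k = "mode_l j" and ?d = "mode_d i" and ?e = "mode_d j"
  have 1: "((\<lambda>a. cos (real_of_int (int ?l - int ?k) * a - (?e - ?d))) has_integral
      (if int ?l - int ?k = 0 then 2 * pi * cos (?e - ?d) else 0)) {0..2*pi}"
    by (rule has_integral_cos_phase) auto
  have 2: "((\<lambda>a. cos (real_of_int (int ?l + int ?k) * a - (- ?e - ?d))) has_integral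
      (if int ?l + int ?k = 0 then 2 * pi * cos (- ?e - ?d) else 0)) {0..2*pi}"
    by (rule has_integral_cos_phase) auto
  have e: "cos (real_of_int (int ?l - int ?k) * a - (?e - ?d)) = mcos i a * mcos j a + msin i a * msin j a"
    "cos (real_of_int (int ?l + int ?k) * a - (- ?e - ?d)) = mcos i a * mcos j a - msin i a * msin j a" for a
  proof -
    have "real_of_int (int ?l - int ?k) * a - (?e - ?d) = (real ?l * a + ?d) - (real ?k * a + ?e)"
      "real_of_int (int ?l + int ?k) * a - (- ?e - ?d) = (real ?l * a + ?d) + (real ?k * a + ?e)"
      by (simp_all add: algebra_simps)
    then show "cos (real_of_int (int ?l - int ?k) * a - (?e - ?d)) = mcos i a * mcos j a + msin i a * msin j a"
      "cos (real_of_int (int ?l + int ?k) * a - (- ?e - ?d)) = mcos i a * mcos j a - msin i a * msin j a"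
      by (simp_all only: cos_diff cos_add mcos_def msin_def)
  qed
  have v: "(if int ?l - int ?k = 0 then 2 * pi * cos (?e - ?d) else 0) = (if i = j then 2 * pi else 0)"
    "(if int ?l + int ?k = 0 then 2 * pi * cos (- ?e - ?d) else 0) = 0"
  proof -
    consider "i = j" | "?l \<noteq> ?k" | "i \<noteq> j" "?l = ?k" by blast
    then show "(if int ?l - int ?k = 0 then 2 * pi * cos (?e - ?d) else 0) = (if i = j then 2 * pi else 0)"
    proof cases
      case 3
      then have "i \<noteq> 0" "j \<noteq> 0" "odd i \<longleftrightarrow> even j" unfolding mode_l_def by presburger+
      then show ?thesis using 3 by (auto simp: mode_d_def)
    qed auto
    show "(if int ?l + int ?k = 0 then 2 * pi * cos (- ?e - ?d) else 0) = 0"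
    proof (cases "int ?l + int ?k = 0")
      case True
      then have "i = 0" "j = 0" unfolding mode_l_def by presburger+
      then have "- ?e - ?d = - (pi / 2)" by (simp add: mode_d_def)
      then have "cos (- ?e - ?d) = 0" by (simp only: cos_minus cos_pi_half)
      then show ?thesis by simp
    qed simp
  qed
  note i1 = 1[unfolded e v] and i2 = 2[unfolded e v]
  show "((\<lambda>a. mcos i a * mcos j a) has_integral (if i = j then pi else 0)) {0..2*pi}"
    using has_integral_mult_right[OF has_integral_add[OF i1 i2], of "1/2"] by (auto split: if_splits)
  show "((\<lambda>a. msin i a * msin j a) has_integral (if i = j then pi else 0)) {0..2*pi}"
    using has_integral_mult_right[OF has_integral_diff[OF i1 i2], of "1/2"] by (auto split: if_splits)
qed

lemma deriv_mode:
  "(mcos j has_real_derivative - (real (mode_l j) * msin j a)) (at a)"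
  "(msin j has_real_derivative real (mode_l j) * mcos j a) (at a)"
  unfolding mcos_def[abs_def] msin_def[abs_def] by (auto intro!: derivative_eq_intros)

lemma smooth_mode: "smooth (mcos j)" "smooth (msin j)"
  unfolding mcos_def[abs_def] msin_def[abs_def]
  by (intro smooth_compose[OF smooth_sin_cos(2)] smooth_compose[OF smooth_sin_cos(1)] smooth_add
      smooth_linear[OF bounded_linear_mult_right] smooth_const)+

lemma mode_pi: "mcos j (a + pi) = (-1) ^ mode_l j * mcos j a" "msin j (a + pi) = (-1) ^ mode_l j * msin j a"
proof -
  have "real (mode_l j) * (a + pi) + mode_d j = (real (mode_l j) * a + mode_d j) + pi * real (mode_l j)"
    by (simp add: algebra_simps)
  then show "mcos j (a + pi) = (-1) ^ mode_l j * mcos j a" "msin j (a + pi) = (-1) ^ mode_l j * msin j a"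
    unfolding mcos_def msin_def by (simp_all only: cos_shift_pi sin_shift_pi)
qed

lemma mode_2pi: "mcos j (a + 2 * pi) = mcos j a" "msin j (a + 2 * pi) = msin j a"
  using mode_pi[of j "a + pi"] mode_pi[of j a] by (auto simp: algebra_simps simp flip: power_add mult_2)

text \<open>In either family, the modes 2 l - 1 and 2 l are the cosine and sine of frequency l up to
  order and sign, and mode 0 is a nonzero constant; so completeness of the trigonometric system
  applies.\<close>

lemma modes_complete:
  fixes h :: "real \<Rightarrow> real"
  assumes c: "continuous_on UNIV h" and per: "\<And>a. h (a + 2 * pi) = h a"
    and z: "(\<forall>j. integral {0..2*pi} (\<lambda>a. h a * mcos j a) = 0) \<or> (\<forall>j. integral {0..2*pi} (\<lambda>a. h a * msin j a) = 0)"
  shows "h a = 0"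
proof -
  have s4: "cos (pi / 4) \<noteq> 0" "sin (pi / 4) \<noteq> 0" by (simp_all add: cos_45 sin_45)
  have m0: "mcos 0 a = cos (pi / 4)" "msin 0 a = sin (pi / 4)" for a by (simp_all add: mcos_def msin_def mode_l_def mode_d_def)
  have mo: "mcos (2 * l - 1) a = cos (l * a)" "msin (2 * l - 1) a = sin (l * a)" if "l > 0" for l a
  proof -
    have "odd (2 * l - 1)" "2 * l - 1 \<noteq> 0" "mode_l (2 * l - 1) = l" using that unfolding mode_l_def by presburger+
    then show "mcos (2 * l - 1) a = cos (l * a)" "msin (2 * l - 1) a = sin (l * a)"
      by (simp_all add: mcos_def msin_def mode_d_def)
  qed
  have me: "mcos (2 * l) a = - sin (l * a)" "msin (2 * l) a = cos (l * a)" if "l > 0" for l a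
  proof -
    have "mode_l (2 * l) = l" unfolding mode_l_def by presburger
    then show "mcos (2 * l) a = - sin (l * a)" "msin (2 * l) a = cos (l * a)"
      using that by (simp_all add: mcos_def msin_def mode_d_def cos_add sin_add)
  qed
  have "integral {0..2*pi} (\<lambda>a. h a * cos (l * a)) = 0 \<and> integral {0..2*pi} (\<lambda>a. h a * sin (l * a)) = 0" for l :: nat
  proof (cases "l = 0")
    case True
    have "integral {0..2*pi} h = 0" using z
    proof
      assume j: "\<forall>j. integral {0..2*pi} (\<lambda>a. h a * mcos j a) = 0"
      from spec[OF j, of 0] show ?thesis using s4 by (simp add: m0)
    next
      assume j: "\<forall>j. integral {0..2*pi} (\<lambda>a. h a * msin j a) = 0"
      from spec[OF j, of 0] show ?thesis using s4 by (simp add: m0)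
    qed
    then show ?thesis using True by simp
  next
    case False
    then have l: "l > 0" by simp
    from z show ?thesis
    proof
      assume j: "\<forall>j. integral {0..2*pi} (\<lambda>a. h a * mcos j a) = 0"
      from spec[OF j, of "2 * l - 1"] spec[OF j, of "2 * l"] show ?thesis by (simp add: mo[OF l] me[OF l] del: One_nat_def)
    next
      assume j: "\<forall>j. integral {0..2*pi} (\<lambda>a. h a * msin j a) = 0"
      from spec[OF j, of "2 * l - 1"] spec[OF j, of "2 * l"] show ?thesis by (simp add: mo[OF l] me[OF l] del: One_nat_def)
    qed
  qed
  then show ?thesis using fourier_coefficients_zero_imp_zero[OF c per] by blast
qed

context otsuki
begin

text \<open>A Fourier coefficient in \<alpha>, as a function of the profile angle; inserting
  \<open>tau y\<close> for the time makes \<open>sd\<close> applicable.\<close>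

definition mint :: "(plane \<Rightarrow> real) \<Rightarrow> (real \<Rightarrow> real) \<Rightarrow> real \<Rightarrow> real" where
  "mint f k y = integral {0..2*pi} (\<lambda>a. f (a, tau y) * k a)"

lemma smooth_slice:
  assumes "smooth (f :: plane \<Rightarrow> real)"
  shows "continuous_on A (\<lambda>a. f (a, t))"
  by (rule continuous_on_compose2[OF smooth_continuous[OF assms]]) (auto intro!: continuous_intros)

lemma mint_sd:
  fixes f :: "plane \<Rightarrow> real" and k :: "real \<Rightarrow> real"
  assumes f: "smooth f" and k: "smooth k"
  shows "sd (mint f k) (mint (Ds f) k)"
  unfolding sd_def
proof
  fix y0 :: real
  define F where "F y a = f (a, tau y) * k a" for y a
  define Fy where "Fy y a = cc y / DD y * (Ds f (a, tau y) * k a)" for y a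
  have "((\<lambda>y. integral (cbox 0 (2*pi)) (F y)) has_vector_derivative integral (cbox 0 (2*pi)) (Fy y0)) (at y0 within UNIV)"
  proof (rule leibniz_rule_vector_derivative)
    fix y a
    have d: "pd f (Da f (a, tau y)) (Ds f (a, tau y)) (a, tau y)" by (rule pd_smooth[OF f])
    have t: "((\<lambda>y. (a, tau y)) has_derivative (\<lambda>h. (0, h * (cc y / DD y * (2 * pi * cc y))))) (at y)"
      using has_derivative_Pair[OF has_derivative_const sdD[OF tau(2), of y, unfolded has_field_derivative_def], of a]
      by (simp only: mult.commute)
    have "((\<lambda>y. f (a, tau y)) has_derivative (\<lambda>h. h * (cc y / DD y * Ds f (a, tau y)))) (at y)"
      using has_derivative_compose[OF t d[unfolded pd_def]] by (simp add: Psi mult_ac)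
    then have "((\<lambda>y. f (a, tau y)) has_real_derivative cc y / DD y * Ds f (a, tau y)) (at y)"
      by (simp only: has_field_derivative_def mult_commute_abs)
    then have "((\<lambda>y. f (a, tau y) * k a) has_real_derivative (cc y / DD y * Ds f (a, tau y)) * k a) (at y)"
      by (rule DERIV_cmult_right)
    then show "((\<lambda>y. F y a) has_vector_derivative Fy y a) (at y within UNIV)"
      by (simp add: F_def Fy_def has_real_derivative_iff_has_vector_derivative mult.assoc)
  next
    have tc: "continuous_on A tau" for A using tau_cont continuous_at_imp_continuous_on by blast
    show "F y integrable_on cbox 0 (2*pi)" for y
      unfolding F_def cbox_interval
      by (intro integrable_continuous_interval continuous_intros smooth_slice[OF f]
          continuous_on_subset[OF smooth_continuous[OF k]] subset_UNIV)
    have D: "continuous_on UNIV (Ds f)" by (rule smooth_continuous[OF smooth_Ds[OF f]])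
    have "continuous_on (UNIV \<times> cbox 0 (2*pi)) (\<lambda>u. cc (fst u) / DD (fst u) * (Ds f (snd u, tau (fst u)) * k (snd u)))"
      by (intro continuous_intros continuous_on_compose2[OF cont_coeffs(2) continuous_on_fst[OF continuous_on_id]]
          continuous_on_compose2[OF cont_coeffs(3) continuous_on_fst[OF continuous_on_id]]
          continuous_on_compose2[OF D] continuous_on_compose2[OF tc continuous_on_fst[OF continuous_on_id]]
          continuous_on_compose2[OF smooth_continuous[OF k] continuous_on_snd[OF continuous_on_id]]) auto
    then show "continuous_on (UNIV \<times> cbox 0 (2*pi)) (\<lambda>(y, a). Fy y a)"
      by (simp add: Fy_def split_def)
  qed auto
  moreover have "integral (cbox 0 (2*pi)) (Fy y0) = cc y0 / DD y0 * mint (Ds f) k y0"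
    unfolding Fy_def mint_def cbox_interval by (rule integral_mult_right)
  ultimately show "(mint f k has_real_derivative cc y0 / DD y0 * mint (Ds f) k y0) (at y0)"
    by (simp add: F_def[abs_def] mint_def[abs_def] has_real_derivative_iff_has_vector_derivative cbox_interval)
qed

lemma mint_integrable:
  fixes f :: "plane \<Rightarrow> real" and k :: "real \<Rightarrow> real"
  assumes "smooth f" "smooth k"
  shows "(\<lambda>a. f (a, tau y) * k a) integrable_on {0..2*pi}"
  by (intro integrable_continuous_interval continuous_intros smooth_slice[OF assms(1)]
      continuous_on_subset[OF smooth_continuous[OF assms(2)]] subset_UNIV)

lemma mint_Da:
  assumes f: "smooth f" and per: "\<And>z. f (z + (2 * pi, 0)) = f z"
    and k: "\<And>a. (k has_real_derivative k' a) (at a)" "smooth k" "smooth k'" "k (2 * pi) = k 0"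
  shows "mint (Da f) k y = - mint f k' y"
proof -
  have d: "((\<lambda>a. f (a, t)) has_real_derivative Da f (a, t)) (at a)" for a t
  proof -
    have "pd f (Da f (a, t)) (Ds f (a, t)) (a, t)" by (rule pd_smooth[OF f])
    moreover have "((\<lambda>a. (a, t)) has_derivative (\<lambda>h. (h, 0))) (at a)"
      by (intro has_derivative_Pair has_derivative_ident has_derivative_const)
    ultimately show ?thesis
      unfolding pd_def using has_derivative_compose by (fastforce simp: has_field_derivative_def mult_commute_abs)
  qed
  have "((\<lambda>a. f (a, tau y) * k a) has_real_derivative (Da f (a, tau y) * k a + f (a, tau y) * k' a)) (at a)" for a
    using DERIV_mult[OF d k(1)] by (simp add: mult.commute)
  then have "((\<lambda>a. Da f (a, tau y) * k a + f (a, tau y) * k' a) has_integral f (2 * pi, tau y) * k (2 * pi) - f (0, tau y) * k 0) {0..2*pi}"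
    by (intro fundamental_theorem_of_calculus)
       (auto intro: has_field_derivative_at_within simp flip: has_real_derivative_iff_has_vector_derivative)
  moreover have "f (2 * pi, tau y) = f (0, tau y)" using per[of "(0, tau y)"] by simp
  ultimately have "integral {0..2*pi} (\<lambda>a. Da f (a, tau y) * k a + f (a, tau y) * k' a) = 0" using k(4) by (simp add: integral_unique)
  then show ?thesis
    unfolding mint_def
    by (subst (asm) Henstock_Kurzweil_Integration.integral_add)
       (auto intro: mint_integrable smooth_Da f k)
qed

lemma mint_lin:
  assumes "finite I" "\<And>i. i \<in> I \<Longrightarrow> smooth (f i)" "smooth k"
  shows "mint (\<lambda>z. \<Sum>i\<in>I. c i * f i z) k y = (\<Sum>i\<in>I. c i * mint (f i) k y)"
proof -
  have "((\<lambda>a. \<Sum>i\<in>I. c i * (f i (a, tau y) * k a)) has_integral (\<Sum>i\<in>I. c i * mint (f i) k y)) {0..2*pi}"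
    unfolding mint_def using assms by (intro has_integral_sum has_integral_mult_right integrable_integral mint_integrable) auto
  then show ?thesis unfolding mint_def by (intro integral_unique) (simp add: sum_distrib_right mult.assoc)
qed

end

section \<open>Counting eigenvalues\<close>

lemma sum_fun_apply: "(\<Sum>i\<in>I. f i) x = (\<Sum>i\<in>I. f i x)"
  by (induction I rule: infinite_finite_induct) auto

lemma scaleR_fun_apply: "(c *\<^sub>R f) x = c *\<^sub>R f x"
  by (simp add: scaleR_fun_def)

lemma edim_ge: "finite S \<Longrightarrow> S \<subseteq> V \<Longrightarrow> independent S \<Longrightarrow> enat (card S) \<le> edim V"
  unfolding edim_def by (rule SUP_upper2[of S]) auto

text \<open>A bound on independent sets turns the supremum into a maximum, so an independent set
  realising the dimension can be picked.\<close>

lemma edim_attained: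
  fixes V :: "'a::real_vector set"
  assumes "\<And>S. finite S \<Longrightarrow> S \<subseteq> V \<Longrightarrow> independent S \<Longrightarrow> card S \<le> M"
  shows "\<exists>S. finite S \<and> S \<subseteq> V \<and> independent S \<and> edim V = enat (card S)"
proof -
  let ?P = "\<lambda>k. \<exists>S. finite S \<and> S \<subseteq> V \<and> independent S \<and> card S = k"
  have "?P 0" by (rule exI[of _ "{}"]) (simp add: real_vector.independent_empty)
  moreover have "\<forall>k. ?P k \<longrightarrow> k \<le> M" using assms by blast
  ultimately have "\<exists>k. ?P k \<and> (\<forall>k'. ?P k' \<longrightarrow> k' \<le> k)" using ex_has_greatest_nat[of ?P 0 "\<lambda>k. k" "Suc M"] by (metis less_Suc_eq_le)
  then obtain S where S: "finite S" "S \<subseteq> V" "independent S" and m: "\<And>T. finite T \<Longrightarrow> T \<subseteq> V \<Longrightarrow> independent T \<Longrightarrow> card T \<le> card S"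
    by blast
  have "edim V \<le> enat (card S)" unfolding edim_def by (rule SUP_least) (auto intro: m)
  with edim_ge[OF S] S show ?thesis by (blast intro: antisym)
qed

text \<open>Applied with all sets but one empty, the hypothesis first bounds every single dimension,
  so all suprema are attained; applied to the maximal sets it then bounds the sum.\<close>

lemma sum_edim_le:
  fixes V :: "'i \<Rightarrow> 'a::real_vector set"
  assumes F: "finite F"
    and le: "\<And>S. (\<And>l. l \<in> F \<Longrightarrow> finite (S l) \<and> S l \<subseteq> V l \<and> independent (S l)) \<Longrightarrow> (\<Sum>l\<in>F. card (S l)) \<le> M"
  shows "(\<Sum>l\<in>F. edim (V l)) \<le> enat M"
proof -
  have "\<exists>S. finite S \<and> S \<subseteq> V l \<and> independent S \<and> edim (V l) = enat (card S)" if l: "l \<in> F" for l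
  proof (rule edim_attained[of _ M])
    fix S assume "finite S" "S \<subseteq> V l" "independent S"
    then have "(\<Sum>l'\<in>F. card (if l' = l then S else {})) \<le> M"
      by (intro le) (auto simp: real_vector.independent_empty)
    moreover have "(\<Sum>l'\<in>F. card (if l' = l then S else {})) = (\<Sum>l'\<in>F. if l' = l then card S else 0)"
      by (intro sum.cong) auto
    ultimately show "card S \<le> M" using F l by simp
  qed
  then have "\<forall>l\<in>F. \<exists>S. finite S \<and> S \<subseteq> V l \<and> independent S \<and> edim (V l) = enat (card S)" by blast
  from bchoice[OF this] obtain S where
    S: "\<And>l. l \<in> F \<Longrightarrow> finite (S l) \<and> S l \<subseteq> V l \<and> independent (S l) \<and> edim (V l) = enat (card (S l))" by blast
  have "(\<Sum>l\<in>F. edim (V l)) = (\<Sum>l\<in>F. enat (card (S l)))" by (rule sum.cong) (use S in blast)+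
  also have "\<dots> = enat (\<Sum>l\<in>F. card (S l))" by (simp flip: of_nat_eq_enat)
  also have "\<dots> \<le> enat M" using le[of S] S by auto
  finally show ?thesis .
qed

lemma independent_family:
  fixes b :: "'i \<Rightarrow> 'a::real_vector"
  assumes T: "finite T" and ind: "\<And>c p. (\<Sum>p\<in>T. c p *\<^sub>R b p) = 0 \<Longrightarrow> p \<in> T \<Longrightarrow> c p = 0"
  shows "inj_on b T" "independent (b ` T)"
proof -
  show inj: "inj_on b T"
  proof (rule inj_onI, rule ccontr)
    fix p r assume pr: "p \<in> T" "r \<in> T" "b p = b r" "p \<noteq> r"
    define c :: "'i \<Rightarrow> real" where "c = (\<lambda>i. if i = p then 1 else if i = r then - 1 else 0)"
    have "(\<Sum>i\<in>T. c i *\<^sub>R b i) = (\<Sum>i\<in>{p, r}. c i *\<^sub>R b i)"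
      using pr T by (intro sum.mono_neutral_right) (auto simp: c_def)
    also have "\<dots> = 0" using pr by (simp add: c_def)
    finally show False using ind[of c p] pr by (simp add: c_def)
  qed
  show "independent (b ` T)"
  proof
    assume "dependent (b ` T)"
    then obtain u where u: "\<exists>v\<in>b ` T. u v \<noteq> 0" "(\<Sum>v\<in>b ` T. u v *\<^sub>R v) = 0"
      using real_vector.dependent_finite[of "b ` T"] T by auto
    have "(\<Sum>p\<in>T. u (b p) *\<^sub>R b p) = 0" using u(2) by (simp add: sum.reindex[OF inj])
    then have "\<And>p. p \<in> T \<Longrightarrow> u (b p) = 0" using ind[of "\<lambda>p. u (b p)"] by blast
    then show False using u(1) by auto
  qed
qed

text \<open>The family is grouped by eigenvalue, and each group inherits independence by padding its
  coefficients with zeros.\<close>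

lemma eigenvalue_count_ge:
  assumes I: "finite I" and b: "\<And>p. p \<in> I \<Longrightarrow> m p \<in> A \<and> b p \<in> jacobi_eigenspace u G (m p)"
    and ind: "\<And>c p. (\<Sum>p\<in>I. c p *\<^sub>R b p) = 0 \<Longrightarrow> p \<in> I \<Longrightarrow> c p = 0"
  shows "enat (card I) \<le> eigenvalue_count u G A"
proof -
  let ?T = "\<lambda>l. {p\<in>I. m p = l}"
  have ind': "inj_on b (?T l)" "independent (b ` ?T l)" for l
  proof -
    have "c p = 0" if "(\<Sum>p\<in>?T l. c p *\<^sub>R b p) = 0" "p \<in> ?T l" for c :: "_ \<Rightarrow> real" and p
    proof -
      have "(\<Sum>p\<in>I. (if p \<in> ?T l then c p else 0) *\<^sub>R b p) = (\<Sum>p\<in>?T l. c p *\<^sub>R b p)"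
        using I by (intro sum.mono_neutral_cong_right) auto
      with that ind[of "\<lambda>p. if p \<in> ?T l then c p else 0" p] show ?thesis by simp
    qed
    then show "inj_on b (?T l)" "independent (b ` ?T l)" using independent_family[of "?T l" b] I by auto
  qed
  have "card I = (\<Sum>l\<in>m ` I. card (?T l))"
    by (subst card_eq_sum, subst sum.image_gen[OF I, of _ m]) simp
  then have "enat (card I) = (\<Sum>l\<in>m ` I. enat (card (b ` ?T l)))"
    using I by (simp add: of_nat_eq_enat[symmetric] card_image[OF ind'(1)])
  also have "\<dots> \<le> (\<Sum>l\<in>m ` I. edim (jacobi_eigenspace u G l))"
    by (intro sum_mono edim_ge ind') (use I b in fastforce)+
  also have "\<dots> \<le> eigenvalue_count u G A"
    unfolding eigenvalue_count_def by (rule SUP_upper) (use I b in auto)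
  finally show ?thesis .
qed

text \<open>With more than \<open>M\<close> independent eigensections in total,
  \<open>common_kernel_vector\<close> gives a nontrivial combination annihilated by all
  \<open>M\<close> functionals. By \<open>van\<close> its component in each eigenspace is zero,
  against independence.\<close>

lemma eigenvalue_count_le:
  assumes sub: "\<And>l. subspace (jacobi_eigenspace u G l)"
    and L: "\<And>k S c l. k < M \<Longrightarrow> finite S \<Longrightarrow> S \<subseteq> jacobi_eigenspace u G l \<Longrightarrow>
      L k (\<Sum>X\<in>S. c X *\<^sub>R X) = (\<Sum>X\<in>S. c X * L k X)"
    and van: "\<And>F X l. finite F \<Longrightarrow> F \<subseteq> A \<Longrightarrow> (\<And>l. l \<in> F \<Longrightarrow> X l \<in> jacobi_eigenspace u G l) \<Longrightarrow>
      (\<And>k. k < M \<Longrightarrow> (\<Sum>l\<in>F. L k (X l)) = 0) \<Longrightarrow> l \<in> F \<Longrightarrow> X l = 0"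
  shows "eigenvalue_count u G A \<le> enat M"
  unfolding eigenvalue_count_def
proof (rule SUP_least)
  fix F assume "F \<in> {F. finite F \<and> F \<subseteq> A}"
  then have F: "finite F" "F \<subseteq> A" by auto
  show "(\<Sum>l\<in>F. edim (jacobi_eigenspace u G l)) \<le> enat M"
  proof (rule sum_edim_le[OF F(1)], rule ccontr)
    fix S assume S: "\<And>l. l \<in> F \<Longrightarrow> finite (S l) \<and> S l \<subseteq> jacobi_eigenspace u G l \<and> independent (S l)"
    assume "\<not> (\<Sum>l\<in>F. card (S l)) \<le> M"
    moreover have "card (Sigma F S) = (\<Sum>l\<in>F. card (S l))" using F S by (intro card_SigmaI) auto
    ultimately have "card (Sigma F S) > M" by simp
    moreover have "finite (Sigma F S)" using F S by auto
    ultimately obtain c where c: "\<exists>p\<in>Sigma F S. c p \<noteq> 0" "\<And>k. k < M \<Longrightarrow> (\<Sum>p\<in>Sigma F S. c p * L k (snd p)) = 0"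
      using common_kernel_vector[of "Sigma F S" M "\<lambda>p k. L k (snd p)"] by blast
    define Y where "Y l = (\<Sum>X\<in>S l. c (l, X) *\<^sub>R X)" for l
    have "Y l = 0" if "l \<in> F" for l
    proof (rule van[OF F _ _ that])
      show "Y l \<in> jacobi_eigenspace u G l" if "l \<in> F" for l
        unfolding Y_def using S[OF that] by (intro subspace_sum[OF sub] subspace_scale[OF sub]) auto
      show "(\<Sum>l\<in>F. L k (Y l)) = 0" if k: "k < M" for k
      proof -
        have "(\<Sum>l\<in>F. L k (Y l)) = (\<Sum>l\<in>F. \<Sum>X\<in>S l. c (l, X) * L k X)"
          unfolding Y_def using S F by (intro sum.cong refl L[OF k, of _ _ "\<lambda>X. c (_, X)"]) blast+
        also have "\<dots> = (\<Sum>p\<in>Sigma F S. c p * L k (snd p))"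
          using S F by (subst sum.Sigma) (auto simp: split_def)
        finally show ?thesis using c(2)[OF k] by simp
      qed
    qed
    then have "c (l, X) = 0" if "l \<in> F" "X \<in> S l" for l X
      using real_vector.independentD[of "S l" "S l" "\<lambda>X. c (l, X)" X] S that unfolding Y_def by auto
    then show False using c(1) by auto
  qed
qed

section \<open>Reduction to ordinary differential equations\<close>

context otsuki
begin

lemma mint_has_integral:
  fixes f :: "plane \<Rightarrow> real" and k :: "real \<Rightarrow> real"
  assumes "smooth f" "smooth k"
  shows "((\<lambda>a. f (a, tau y) * k a) has_integral mint f k y) {0..2*pi}"
  unfolding mint_def using mint_integrable[OF assms] by (rule integrable_integral)

lemma mint_relation:
  fixes k :: "real \<Rightarrow> real"
  assumes "smooth f1" "smooth f2" "smooth f3" "smooth f4" "smooth f5" "smooth k"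
    and "\<And>a. c1 * f1 (a, tau y) + c2 * f2 (a, tau y) + c3 * f3 (a, tau y) + c4 * f4 (a, tau y) + c5 * f5 (a, tau y) = 0"
  shows "c1 * mint f1 k y + c2 * mint f2 k y + c3 * mint f3 k y + c4 * mint f4 k y + c5 * mint f5 k y = 0"
proof -
  let ?I = "\<lambda>c f a. c * (f (a, tau y) * k a)"
  have "((\<lambda>a. ?I c1 f1 a + ?I c2 f2 a + ?I c3 f3 a + ?I c4 f4 a + ?I c5 f5 a) has_integral
      c1 * mint f1 k y + c2 * mint f2 k y + c3 * mint f3 k y + c4 * mint f4 k y + c5 * mint f5 k y) {0..2*pi}"
    by (intro has_integral_add has_integral_mult_right mint_has_integral assms)
  moreover have "?I c1 f1 a + ?I c2 f2 a + ?I c3 f3 a + ?I c4 f4 a + ?I c5 f5 a = 0" for a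
    using arg_cong[OF assms(7)[of a], of "\<lambda>v. v * k a"] by (simp add: algebra_simps)
  ultimately show ?thesis by (auto dest: has_integral_unique[OF _ has_integral_0])
qed

text \<open>Cosine in the first component is paired with sine in the second; the operator preserves
  this pairing, because its coupling terms contain exactly one derivative in \<alpha>.\<close>

definition lift :: "nat \<Rightarrow> (real \<Rightarrow> real \<times> real) \<Rightarrow> plane \<Rightarrow> R5" where
  "lift j f z = fr z 0 0 0 (fst (f (Psi (snd z))) * mcos j (fst z)) (snd (f (Psi (snd z))) * msin j (fst z))"

definition xc :: "(plane \<Rightarrow> R5) \<Rightarrow> plane \<Rightarrow> real" where "xc X z = X z \<bullet> fr z 0 0 0 1 0"
definition yc :: "(plane \<Rightarrow> R5) \<Rightarrow> plane \<Rightarrow> real" where "yc X z = X z \<bullet> fr z 0 0 0 0 1"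

definition md :: "nat \<Rightarrow> (plane \<Rightarrow> R5) \<Rightarrow> real \<Rightarrow> real \<times> real" where
  "md j X y = (mint (xc X) (mcos j) y, mint (yc X) (msin j) y)"

lemma smooth_xc: "smooth X \<Longrightarrow> smooth (xc X)" and smooth_yc: "smooth X \<Longrightarrow> smooth (yc X)"
  unfolding xc_def[abs_def] yc_def[abs_def] by (intro smooth_inner smooth_fr smooth_const; assumption)+

lemma md_sum:
  assumes "finite I" "\<And>i. i \<in> I \<Longrightarrow> smooth (X i)"
  shows "md j (\<Sum>i\<in>I. c i *\<^sub>R X i) y = (\<Sum>i\<in>I. c i *\<^sub>R md j (X i) y)"
proof -
  have "xc (\<Sum>i\<in>I. c i *\<^sub>R X i) = (\<lambda>z. \<Sum>i\<in>I. c i * xc (X i) z)" "yc (\<Sum>i\<in>I. c i *\<^sub>R X i) = (\<lambda>z. \<Sum>i\<in>I. c i * yc (X i) z)"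
    by (simp_all add: fun_eq_iff xc_def yc_def sum_fun_apply scaleR_fun_apply inner_sum_left)
  then show ?thesis
    using mint_lin[OF assms(1) smooth_xc[OF assms(2)] smooth_mode(1), where c = c and y = y]
      mint_lin[OF assms(1) smooth_yc[OF assms(2)] smooth_mode(2), where c = c and y = y]
    by (simp add: md_def prod_eq_iff fst_sum snd_sum)
qed

lemma md_lift: "md i (lift j f) y = (if i = j then pi else 0) *\<^sub>R f y"
proof -
  have x: "xc (lift j f) (a, tau y) = fst (f y) * mcos j a" and yy: "yc (lift j f) (a, tau y) = snd (f y) * msin j a" for a
    by (simp_all add: xc_def yc_def lift_def fr_inner Psi)
  have "mint (xc (lift j f)) (mcos i) y = fst (f y) * (if i = j then pi else 0)"
    unfolding mint_def x using has_integral_mult_right[OF mode_orthogonal(1)[of i j], of "fst (f y)"]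
    by (intro integral_unique) (simp add: mult_ac)
  moreover have "mint (yc (lift j f)) (msin i) y = snd (f y) * (if i = j then pi else 0)"
    unfolding mint_def yy using has_integral_mult_right[OF mode_orthogonal(2)[of i j], of "snd (f y)"]
    by (intro integral_unique) (simp add: mult_ac)
  ultimately show ?thesis by (simp add: md_def prod_eq_iff)
qed

lemma modes_zero:
  assumes X: "smooth X" "X = (\<lambda>z. fr z 0 0 0 (xc X z) (yc X z))"
    and per: "\<And>z. xc X (z + (2 * pi, 0)) = xc X z" "\<And>z. yc X (z + (2 * pi, 0)) = yc X z"
    and z: "\<And>j y. md j X y = 0"
  shows "X = 0"
proof -
  have "xc X (a, tau y) = 0 \<and> yc X (a, tau y) = 0" for a y
  proof
    show "xc X (a, tau y) = 0"
      using z by (intro modes_complete[of "\<lambda>a. xc X (a, tau y)"] smooth_slice smooth_xc X)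
        (auto simp: md_def mint_def zero_prod_def per(1)[of "(_, tau y)", simplified])
    show "yc X (a, tau y) = 0"
      using z by (intro modes_complete[of "\<lambda>a. yc X (a, tau y)"] smooth_slice smooth_yc X)
        (auto simp: md_def mint_def zero_prod_def per(2)[of "(_, tau y)", simplified])
  qed
  then have "xc X z = 0 \<and> yc X z = 0" for z using Psi(1)[of "snd z"] by (metis prod.collapse)
  then show ?thesis by (subst X(2)) (simp add: fun_eq_iff fr_zero)
qed

lemma smooth_arclength:
  assumes "sd X Xs" and "Ck k X" "Ck k Xs"
  shows "Ck (Suc k) X"
proof (rule Ck_Suc_real)
  show "(X has_vector_derivative cc x / DD x * Xs x) (at x)" for x
    using sdD[OF assms(1)] by (simp only: has_real_derivative_iff_has_vector_derivative)
  show "Ck k (\<lambda>x. cc x / DD x * Xs x)"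
    by (intro Ck_bilinear[OF bounded_bilinear_mult] smooth_Ck smooth_divide smooth_coeffs assms(3) nz)
qed

text \<open>Regularity in one variable: the equation expresses the second arclength derivatives by
  smooth multiples of lower ones, so the class of both components and their first derivatives rises
  by induction.\<close>

lemma osol_sd:
  assumes "osol n \<sigma> l m f"
  obtains X Y Xs Ys Xss Yss where "f = (\<lambda>x. (X x, Y x))" "sd X Xs" "sd Xs Xss" "sd Y Ys" "sd Ys Yss"
    "smooth X" "smooth Y"
    "\<And>x. cc x * (cc x * Xss x - SS x * gg x * Xs x) = UX l x * X x + 2 * l * gg x * Y x - m * (cc x)\<^sup>2 * X x"
    "\<And>x. cc x * (cc x * Yss x - SS x * gg x * Ys x) = UY l x * Y x + 2 * l * gg x * X x - m * (cc x)\<^sup>2 * Y x"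
proof -
  have C: "C2D DD f" and eq: "\<And>x. qd DD f x = VV l x (f x) - (m * ww x) *\<^sub>R f x" using assms by (auto simp: osol_def)
  define X Y where "X x = fst (f x)" and "Y x = snd (f x)" for x
  define Xs Ys where "Xs x = DD x / cc x * fst (dd f x)" and "Ys x = DD x / cc x * snd (dd f x)" for x
  define Xss where "Xss x = (SS x * gg x * Xs x + (UX l x * X x + 2 * l * gg x * Y x - m * (cc x)\<^sup>2 * X x) / cc x) / cc x" for x
  define Yss where "Yss x = (SS x * gg x * Ys x + (UY l x * Y x + 2 * l * gg x * X x - m * (cc x)\<^sup>2 * Y x) / cc x) / cc x" for x
  have sX: "sd X Xs" and sY: "sd Y Ys"
    using bounded_linear.has_vector_derivative[OF bounded_linear_fst C2D_D(1)[OF C]]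
      bounded_linear.has_vector_derivative[OF bounded_linear_snd C2D_D(1)[OF C]]
    by (auto simp: sd_def has_real_derivative_iff_has_vector_derivative X_def[abs_def] Y_def[abs_def] Xs_def Ys_def)
  have q: "sd (\<lambda>x. DD x * fst (dd f x)) (\<lambda>x. (UX l x * X x + 2 * l * gg x * Y x - m * (cc x)\<^sup>2 * X x) / cc x)"
    "sd (\<lambda>x. DD x * snd (dd f x)) (\<lambda>x. (UY l x * Y x + 2 * l * gg x * X x - m * (cc x)\<^sup>2 * Y x) / cc x)"
  proof -
    have "cc x / DD x * ((A - m * (cc x)\<^sup>2 * B) / cc x) = A / DD x - m * ww x * B" for x A B
      by (simp add: ww_def diff_divide_distrib right_diff_distrib)
    then show "sd (\<lambda>x. DD x * fst (dd f x)) (\<lambda>x. (UX l x * X x + 2 * l * gg x * Y x - m * (cc x)\<^sup>2 * X x) / cc x)"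
      "sd (\<lambda>x. DD x * snd (dd f x)) (\<lambda>x. (UY l x * Y x + 2 * l * gg x * X x - m * (cc x)\<^sup>2 * Y x) / cc x)"
      using bounded_linear.has_vector_derivative[OF bounded_linear_fst C2D_D(2)[OF C]]
        bounded_linear.has_vector_derivative[OF bounded_linear_snd C2D_D(2)[OF C]]
      unfolding sd_def has_real_derivative_iff_has_vector_derivative by (simp_all add: eq VV_def X_def Y_def)
  qed
  have e: "Xs = (\<lambda>x. DD x * fst (dd f x) / cc x)" "Ys = (\<lambda>x. DD x * snd (dd f x) / cc x)"
    by (simp_all add: Xs_def Ys_def fun_eq_iff)
  have sXs: "sd Xs Xss"
    unfolding e(1) by (rule sd_cong, rule sd_divide[OF q(1) sd_cc]) (auto simp: Xss_def Xs_def field_simps power2_eq_square)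
  have sYs: "sd Ys Yss"
    unfolding e(2) by (rule sd_cong, rule sd_divide[OF q(2) sd_cc]) (auto simp: Yss_def Ys_def field_simps power2_eq_square)
  have cont: "Ck 0 h" if "sd h h'" for h h'
    using sdD[OF that] by (auto intro!: continuous_at_imp_continuous_on DERIV_isCont)
  have U: "smooth (UX l)" "smooth (UY l)"
    unfolding UX_def[abs_def] UY_def[abs_def]
    by (intro smooth_add smooth_diff smooth_mult smooth_const smooth_power smooth_coeffs)+
  have "Ck k X \<and> Ck k Y \<and> Ck k Xs \<and> Ck k Ys" for k
  proof (induction k)
    case 0
    then show ?case using cont sX sY sXs sYs by blast
  next
    case (Suc k)
    have m: "Ck k (\<lambda>x. SS x * gg x / cc x * h1 x + (U x - m * (cc x)\<^sup>2) / (cc x)\<^sup>2 * h2 x + 2 * l * gg x / (cc x)\<^sup>2 * h3 x)"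
      if "smooth U" "Ck k h1" "Ck k h2" "Ck k h3" for U h1 h2 h3 :: "real \<Rightarrow> real"
      using that
      by (intro Ck_add Ck_bilinear[OF bounded_bilinear_mult])
         (auto intro!: smooth_Ck smooth_divide smooth_diff smooth_mult smooth_const smooth_power smooth_coeffs)
    have e: "Xss = (\<lambda>x. SS x * gg x / cc x * Xs x + (UX l x - m * (cc x)\<^sup>2) / (cc x)\<^sup>2 * X x + 2 * l * gg x / (cc x)\<^sup>2 * Y x)"
      "Yss = (\<lambda>x. SS x * gg x / cc x * Ys x + (UY l x - m * (cc x)\<^sup>2) / (cc x)\<^sup>2 * Y x + 2 * l * gg x / (cc x)\<^sup>2 * X x)"
      by (simp_all add: Xss_def Yss_def fun_eq_iff field_simps power2_eq_square)
    have "Ck k Xss" "Ck k Yss" unfolding e using Suc U by (blast intro: m)+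
    then show ?case using Suc smooth_arclength sX sY sXs sYs by blast
  qed
  then have "smooth X" "smooth Y" by (auto simp: smooth_def)
  moreover have "f = (\<lambda>x. (X x, Y x))" by (simp add: X_def Y_def)
  moreover have "cc x * (cc x * Xss x - SS x * gg x * Xs x) = UX l x * X x + 2 * l * gg x * Y x - m * (cc x)\<^sup>2 * X x"
    "cc x * (cc x * Yss x - SS x * gg x * Ys x) = UY l x * Y x + 2 * l * gg x * X x - m * (cc x)\<^sup>2 * Y x" for x
    by (simp_all add: Xss_def Yss_def)
  ultimately show ?thesis using that sX sY sXs sYs by blast
qed

lemma sd_osol:
  assumes X: "sd X Xs" "sd Xs Xss" "continuous_on UNIV Xss" and Y: "sd Y Ys" "sd Ys Yss" "continuous_on UNIV Yss"
    and per: "\<And>x. X (x + pi * real n) = \<sigma> * X x" "\<And>x. Y (x + pi * real n) = \<sigma> * Y x"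
    and eq: "\<And>x. cc x * (cc x * Xss x - SS x * gg x * Xs x) = UX l x * X x + 2 * l * gg x * Y x - m * (cc x)\<^sup>2 * X x"
      "\<And>x. cc x * (cc x * Yss x - SS x * gg x * Ys x) = UY l x * Y x + 2 * l * gg x * X x - m * (cc x)\<^sup>2 * Y x"
  shows "osol n \<sigma> l m (\<lambda>x. (X x, Y x))"
proof -
  note a = arclength_C2D[OF sdD[OF X(1)] sdD[OF X(2)] X(3)] arclength_C2D[OF sdD[OF Y(1)] sdD[OF Y(2)] Y(3)]
  have "cc x / DD x * (cc x * Xss x - SS x * gg x * Xs x) = (UX l x * X x + 2 * l * gg x * Y x) / DD x - m * ww x * X x"
    "cc x / DD x * (cc x * Yss x - SS x * gg x * Ys x) = (UY l x * Y x + 2 * l * gg x * X x) / DD x - m * ww x * Y x" for x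
    by (simp_all add: eq ww_def diff_divide_distrib)
  then show ?thesis
    unfolding osol_def using C2D_Pair[OF a(1) a(4)] per by (simp add: a(3,6) VV_def)
qed

text \<open>After multiplication by C^2, the curvature term 2 C^2 K^2 becomes 2 - 2 G^2; with the
  G^2 of the normal connection this gives the summand - 2 + 3 G^2 of both potentials. The second
  curvature term is smaller by 2 C^4 K^2, which replaces - 2 C^2 by - 2 C^2 G^2.\<close>

lemma jacobi_equation:
  fixes C S G K P Q X Y l m :: real
  assumes "C \<noteq> 0" "(C * K) * (C * K) = 1 - G * G"
  shows "S * G / C * Q - (- (l\<^sup>2 * X) - 2 * G * (l * Y) - G\<^sup>2 * X) / C\<^sup>2 - P - 2 * X - 2 * K\<^sup>2 * X = m * X \<longleftrightarrow>
      C * (C * P - S * G * Q) = (l\<^sup>2 - 2 + 3 * G\<^sup>2 - 2 * C\<^sup>2) * X + 2 * l * G * Y - m * C\<^sup>2 * X" (is "?L = _ \<longleftrightarrow> ?A = ?B")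
    and "(K * S)\<^sup>2 = K\<^sup>2 - (C * K)\<^sup>2 \<Longrightarrow> S * G / C * Q - (- (l\<^sup>2 * X) - 2 * G * (l * Y) - G\<^sup>2 * X) / C\<^sup>2 - P - 2 * X - 2 * (K * S)\<^sup>2 * X = m * X \<longleftrightarrow>
      C * (C * P - S * G * Q) = (l\<^sup>2 - 2 + 3 * G\<^sup>2 - 2 * C\<^sup>2 * G\<^sup>2) * X + 2 * l * G * Y - m * C\<^sup>2 * X"
      (is "_ \<Longrightarrow> ?L' = _ \<longleftrightarrow> ?A = ?B'")
proof -
  have C: "C\<^sup>2 * (S * G / C * Q - (- (l\<^sup>2 * X) - 2 * G * (l * Y) - G\<^sup>2 * X) / C\<^sup>2 - P - 2 * X - r * X) =
      S * G * C * Q + l\<^sup>2 * X + 2 * G * (l * Y) + G\<^sup>2 * X - C\<^sup>2 * P - 2 * C\<^sup>2 * X - r * C\<^sup>2 * X" for r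
    using assms(1) by (simp add: field_simps power2_eq_square)
  have iff: "u = m * X \<longleftrightarrow> C\<^sup>2 * u = C\<^sup>2 * (m * X)" for u using assms(1) by simp
  have k: "K\<^sup>2 * C\<^sup>2 = 1 - G\<^sup>2" using assms(2) by (simp add: power2_eq_square mult_ac)
  have "C\<^sup>2 * ?L - C\<^sup>2 * (m * X) = ?B - ?A"
    unfolding C using k by algebra
  then show "?L = m * X \<longleftrightarrow> ?A = ?B" unfolding iff[of ?L] by linarith
  assume s: "(K * S)\<^sup>2 = K\<^sup>2 - (C * K)\<^sup>2"
  have "C\<^sup>2 * ?L' - C\<^sup>2 * (m * X) = ?B' - ?A"
    unfolding C s using k by algebra
  then show "?L' = m * X \<longleftrightarrow> ?A = ?B'" unfolding iff[of ?L'] by linarith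
qed

lemma mode_equation:
  "S = SS y \<Longrightarrow> C = cc y \<Longrightarrow> G = gg y \<Longrightarrow> K = kk y \<Longrightarrow>
    S * G / C * Q - (- (l\<^sup>2 * X) - 2 * G * (l * Y) - G\<^sup>2 * X) / C\<^sup>2 - P - 2 * X - 2 * K\<^sup>2 * X = m * X \<longleftrightarrow>
    C * (C * P - S * G * Q) = UX l y * X + 2 * l * G * Y - m * C\<^sup>2 * X"
  "S = SS y \<Longrightarrow> C = cc y \<Longrightarrow> G = gg y \<Longrightarrow> K = kk y \<Longrightarrow>
    S * G / C * Q - (- (l\<^sup>2 * X) - 2 * G * (l * Y) - G\<^sup>2 * X) / C\<^sup>2 - P - 2 * X - 2 * (K * S)\<^sup>2 * X = m * X \<longleftrightarrow>
    C * (C * P - S * G * Q) = UY l y * X + 2 * l * G * Y - m * C\<^sup>2 * X"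
proof -
  have "(kk y * SS y)\<^sup>2 = (kk y)\<^sup>2 * (SS y * SS y)" by (simp add: power2_eq_square)
  also have "\<dots> = (kk y)\<^sup>2 - (cc y * kk y)\<^sup>2" unfolding rel(1) by (simp add: power2_eq_square algebra_simps)
  finally have s: "(kk y * SS y)\<^sup>2 = (kk y)\<^sup>2 - (cc y * kk y)\<^sup>2" .
  show "S = SS y \<Longrightarrow> C = cc y \<Longrightarrow> G = gg y \<Longrightarrow> K = kk y \<Longrightarrow>
    S * G / C * Q - (- (l\<^sup>2 * X) - 2 * G * (l * Y) - G\<^sup>2 * X) / C\<^sup>2 - P - 2 * X - 2 * K\<^sup>2 * X = m * X \<longleftrightarrow>
    C * (C * P - S * G * Q) = UX l y * X + 2 * l * G * Y - m * C\<^sup>2 * X"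
    unfolding UX_def by (simp only: jacobi_equation(1)[OF nz(1) rel(2)])
  show "S = SS y \<Longrightarrow> C = cc y \<Longrightarrow> G = gg y \<Longrightarrow> K = kk y \<Longrightarrow>
    S * G / C * Q - (- (l\<^sup>2 * X) - 2 * G * (l * Y) - G\<^sup>2 * X) / C\<^sup>2 - P - 2 * X - 2 * (K * S)\<^sup>2 * X = m * X \<longleftrightarrow>
    C * (C * P - S * G * Q) = UY l y * X + 2 * l * G * Y - m * C\<^sup>2 * X"
    unfolding UY_def by (simp only: jacobi_equation(2)[OF nz(1) rel(2) s])
qed

lemma Da_lin: "smooth f \<Longrightarrow> smooth g \<Longrightarrow> Da (\<lambda>z. c * f z + d * g z) = (\<lambda>z. c * Da f z + d * Da g z)"
  and Ds_lin: "smooth f \<Longrightarrow> smooth g \<Longrightarrow> Ds (\<lambda>z. c * f z + d * g z) = (\<lambda>z. c * Ds f z + d * Ds g z)"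
proof -
  assume f: "smooth f" and g: "smooth g"
  have "pd (\<lambda>z. c * f z + d * g z) (c * Da f z + d * Da g z) (c * Ds f z + d * Ds g z) z" for z
    by (rule pd_cong, (rule pd_add pd_mult pd_const pd_smooth f g)+) auto
  then show "Da (\<lambda>z. c * f z + d * g z) = (\<lambda>z. c * Da f z + d * Da g z)"
    "Ds (\<lambda>z. c * f z + d * g z) = (\<lambda>z. c * Ds f z + d * Ds g z)"
    using pd_unique by (blast intro: ext)+
qed

lemma Lx_lin:
  assumes "smooth x" "smooth y" "smooth x'" "smooth y'"
  shows "Lx (\<lambda>z. c * x z + d * x' z) (\<lambda>z. c * y z + d * y' z) z = c * Lx x y z + d * Lx x' y' z"
    and "Ly (\<lambda>z. c * x z + d * x' z) (\<lambda>z. c * y z + d * y' z) z = c * Ly x y z + d * Ly x' y' z"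
  by (simp_all add: Lx_def Ly_def Let_def Da_lin Ds_lin assms smooth_Da smooth_Ds algebra_simps add_divide_distrib diff_divide_distrib)

lemma Lx_product:
  fixes l :: real
  assumes X: "sd X Xs" "sd Xs Xss" and Y: "sd Y Ys" "sd Ys Yss"
    and x: "x = (\<lambda>z. X (Psi (snd z)) * mcos j (fst z))" and y: "y = (\<lambda>z. Y (Psi (snd z)) * msin j (fst z))" and l: "l = real (mode_l j)"
  shows "Lx x y z = mcos j (fst z) * (let t = Psi (snd z) in SS t * gg t / cc t * Xs t
        - (- (l\<^sup>2 * X t) - 2 * gg t * (l * Y t) - (gg t)\<^sup>2 * X t) / (cc t)\<^sup>2 - Xss t - 2 * X t - 2 * (kk t)\<^sup>2 * X t)"
    and "Ly x y z = msin j (fst z) * (let t = Psi (snd z) in SS t * gg t / cc t * Ys t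
        - (- (l\<^sup>2 * Y t) - 2 * gg t * (l * X t) - (gg t)\<^sup>2 * Y t) / (cc t)\<^sup>2 - Yss t - 2 * Y t - 2 * (kk t * SS t)\<^sup>2 * Y t)"
proof -
  have P: "pd (\<lambda>z. H (Psi (snd z)) * k (fst z)) (H (Psi (snd z)) * k' (fst z)) (H' (Psi (snd z)) * k (fst z)) z"
    if "sd H H'" "\<And>a. (k has_real_derivative k' a) (at a)" for H H' and k k' :: "real \<Rightarrow> real" and z
    by (rule pd_cong, rule pd_mult[OF pd_t[OF that(1)] pd_alpha[OF that(2)]]) auto
  have D: "Da (\<lambda>z. H (Psi (snd z)) * k (fst z)) = (\<lambda>z. H (Psi (snd z)) * k' (fst z))"
    "Ds (\<lambda>z. H (Psi (snd z)) * k (fst z)) = (\<lambda>z. H' (Psi (snd z)) * k (fst z))"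
    if "sd H H'" "\<And>a. (k has_real_derivative k' a) (at a)" for H H' and k k' :: "real \<Rightarrow> real"
    using pd_unique[OF P[OF that]] by blast+
  have m1: "(mcos j has_real_derivative - (l * msin j a)) (at a)" "(msin j has_real_derivative l * mcos j a) (at a)" for a
    unfolding l by (rule deriv_mode)+
  have m2: "((\<lambda>a. - (l * msin j a)) has_real_derivative - (l * (l * mcos j a))) (at a)"
    "((\<lambda>a. l * mcos j a) has_real_derivative l * - (l * msin j a)) (at a)" for a
    by (intro DERIV_minus DERIV_cmult m1)+
  have D1: "Da x = (\<lambda>z. X (Psi (snd z)) * - (l * msin j (fst z)))" "Da y = (\<lambda>z. Y (Psi (snd z)) * (l * mcos j (fst z)))"
    "Ds x = (\<lambda>z. Xs (Psi (snd z)) * mcos j (fst z))" "Ds y = (\<lambda>z. Ys (Psi (snd z)) * msin j (fst z))"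
    unfolding x y by (rule D[OF X(1) m1(1)] D[OF Y(1) m1(2)])+
  have D2: "Da (Da x) = (\<lambda>z. X (Psi (snd z)) * - (l * (l * mcos j (fst z))))" "Da (Da y) = (\<lambda>z. Y (Psi (snd z)) * (l * - (l * msin j (fst z))))"
    unfolding D1 by (rule D[OF X(1) m2(1)] D[OF Y(1) m2(2)])+
  have D3: "Ds (Ds x) = (\<lambda>z. Xss (Psi (snd z)) * mcos j (fst z))" "Ds (Ds y) = (\<lambda>z. Yss (Psi (snd z)) * msin j (fst z))"
    unfolding D1 by (rule D[OF X(2) m1(1)] D[OF Y(2) m1(2)])+
  show "Lx x y z = mcos j (fst z) * (let t = Psi (snd z) in SS t * gg t / cc t * Xs t
        - (- (l\<^sup>2 * X t) - 2 * gg t * (l * Y t) - (gg t)\<^sup>2 * X t) / (cc t)\<^sup>2 - Xss t - 2 * X t - 2 * (kk t)\<^sup>2 * X t)"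
    unfolding Lx_def Let_def D2 D3 unfolding D1 unfolding x by (simp add: algebra_simps power2_eq_square add_divide_distrib diff_divide_distrib)
  show "Ly x y z = msin j (fst z) * (let t = Psi (snd z) in SS t * gg t / cc t * Ys t
        - (- (l\<^sup>2 * Y t) - 2 * gg t * (l * X t) - (gg t)\<^sup>2 * Y t) / (cc t)\<^sup>2 - Yss t - 2 * Y t - 2 * (kk t * SS t)\<^sup>2 * Y t)"
    unfolding Ly_def Let_def D2 D3 unfolding D1 unfolding y by (simp add: algebra_simps power2_eq_square add_divide_distrib diff_divide_distrib)
qed

lemma mint_Da_mode:
  assumes f: "smooth f" and per: "\<And>z. f (z + (2 * pi, 0)) = f z"
  shows "mint (Da f) (mcos j) y = real (mode_l j) * mint f (msin j) y"
    and "mint (Da f) (msin j) y = - real (mode_l j) * mint f (mcos j) y"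
proof -
  have e: "mint f (\<lambda>a. c * k a) y = c * mint f k y" for c k
    unfolding mint_def using integral_mult_right[of "{0..2*pi}" c "\<lambda>a. f (a, tau y) * k a"] by (simp only: mult.left_commute)
  have "mint (Da f) (mcos j) y = - mint f (\<lambda>a. - real (mode_l j) * msin j a) y"
    by (rule mint_Da[OF f per]) (use deriv_mode(1)[of j] mode_2pi(1)[of j 0] in \<open>auto intro!: smooth_mode smooth_minus smooth_mult smooth_const\<close>)
  then show "mint (Da f) (mcos j) y = real (mode_l j) * mint f (msin j) y" unfolding e by simp
  have "mint (Da f) (msin j) y = - mint f (\<lambda>a. real (mode_l j) * mcos j a) y"
    by (rule mint_Da[OF f per]) (use deriv_mode(2)[of j] mode_2pi(2)[of j 0] in \<open>auto intro!: smooth_mode smooth_mult smooth_const\<close>)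
  then show "mint (Da f) (msin j) y = - real (mode_l j) * mint f (mcos j) y" unfolding e by simp
qed

lemma Da_periodic:
  assumes f: "smooth f" and per: "\<And>z. f (z + (2 * pi, 0)) = f z"
  shows "Da f (z + (2 * pi, 0)) = Da f z"
proof -
  have p: "pd f (Da f (z + (2 * pi, 0))) (Ds f (z + (2 * pi, 0))) (z + (2 * pi, 0))" by (rule pd_smooth[OF f])
  have "((\<lambda>z. f (z + (2 * pi, 0))) has_derivative
      (\<lambda>v. fst v *\<^sub>R Da f (z + (2 * pi, 0)) + (snd v / (2 * pi * cc (Psi (snd z)))) *\<^sub>R Ds f (z + (2 * pi, 0)))) (at z)"
    using has_derivative_compose[OF has_derivative_add[OF has_derivative_ident has_derivative_const] p[unfolded pd_def]] by simp
  then have "pd f (Da f (z + (2 * pi, 0))) (Ds f (z + (2 * pi, 0))) z" by (simp only: per pd_def)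
  then show ?thesis using pd_unique by metis
qed

text \<open>The component equations are integrated against a mode. Integration by parts turns
  derivatives in \<alpha> into factors l, and the single derivative in the coupling exchanges the
  cosine and sine coefficients.\<close>

lemma mode_ode:
  assumes x: "smooth x" "\<And>z. x (z + (2 * pi, 0)) = x z" and y: "smooth y" "\<And>z. y (z + (2 * pi, 0)) = y z"
    and eq: "\<And>z. Lx x y z = m * x z" "\<And>z. Ly x y z = m * y z" and l: "l = real (mode_l j)"
  shows "cc t * (cc t * mint (Ds (Ds x)) (mcos j) t - SS t * gg t * mint (Ds x) (mcos j) t) =
      UX l t * mint x (mcos j) t + 2 * l * gg t * mint y (msin j) t - m * (cc t)\<^sup>2 * mint x (mcos j) t"
    and "cc t * (cc t * mint (Ds (Ds y)) (msin j) t - SS t * gg t * mint (Ds y) (msin j) t) =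
      UY l t * mint y (msin j) t + 2 * l * gg t * mint x (mcos j) t - m * (cc t)\<^sup>2 * mint y (msin j) t"
proof -
  note smx = smooth_Ds[OF x(1)] smooth_Da[OF smooth_Da[OF x(1)]] smooth_Da[OF y(1)] smooth_Ds[OF smooth_Ds[OF x(1)]] x(1)
  note smy = smooth_Ds[OF y(1)] smooth_Da[OF smooth_Da[OF y(1)]] smooth_Da[OF x(1)] smooth_Ds[OF smooth_Ds[OF y(1)]] y(1)
  have "SS t * gg t / cc t * mint (Ds x) (mcos j) t + (- 1 / (cc t)\<^sup>2) * mint (Da (Da x)) (mcos j) t + (2 * gg t / (cc t)\<^sup>2) * mint (Da y) (mcos j) t
      + (- 1) * mint (Ds (Ds x)) (mcos j) t + ((gg t)\<^sup>2 / (cc t)\<^sup>2 - 2 - 2 * (kk t)\<^sup>2 - m) * mint x (mcos j) t = 0"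
    by (rule mint_relation[OF smx smooth_mode(1)])
       (use eq(1)[of "(_, tau t)"] in \<open>simp add: Lx_def Let_def Psi algebra_simps add_divide_distrib diff_divide_distrib\<close>)
  moreover have "mint (Da (Da x)) (mcos j) t = - l\<^sup>2 * mint x (mcos j) t" "mint (Da y) (mcos j) t = l * mint y (msin j) t"
    by (simp_all add: mint_Da_mode[OF smooth_Da[OF x(1)] Da_periodic[OF x]] mint_Da_mode[OF x] mint_Da_mode[OF y] l power2_eq_square)
  ultimately have "SS t * gg t / cc t * mint (Ds x) (mcos j) t - (- (l\<^sup>2 * mint x (mcos j) t) - 2 * gg t * (l * mint y (msin j) t) - (gg t)\<^sup>2 * mint x (mcos j) t) / (cc t)\<^sup>2
      - mint (Ds (Ds x)) (mcos j) t - 2 * mint x (mcos j) t - 2 * (kk t)\<^sup>2 * mint x (mcos j) t = m * mint x (mcos j) t"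
    by (simp add: algebra_simps add_divide_distrib diff_divide_distrib)
  then show "cc t * (cc t * mint (Ds (Ds x)) (mcos j) t - SS t * gg t * mint (Ds x) (mcos j) t) =
      UX l t * mint x (mcos j) t + 2 * l * gg t * mint y (msin j) t - m * (cc t)\<^sup>2 * mint x (mcos j) t"
    unfolding mode_equation(1)[OF refl refl refl refl] .
  have "SS t * gg t / cc t * mint (Ds y) (msin j) t + (- 1 / (cc t)\<^sup>2) * mint (Da (Da y)) (msin j) t + (- 2 * gg t / (cc t)\<^sup>2) * mint (Da x) (msin j) t
      + (- 1) * mint (Ds (Ds y)) (msin j) t + ((gg t)\<^sup>2 / (cc t)\<^sup>2 - 2 - 2 * (kk t * SS t)\<^sup>2 - m) * mint y (msin j) t = 0"
    by (rule mint_relation[OF smy smooth_mode(2)])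
       (use eq(2)[of "(_, tau t)"] in \<open>simp add: Ly_def Let_def Psi algebra_simps add_divide_distrib diff_divide_distrib\<close>)
  moreover have "mint (Da (Da y)) (msin j) t = - l\<^sup>2 * mint y (msin j) t" "mint (Da x) (msin j) t = - l * mint x (mcos j) t"
    by (simp_all add: mint_Da_mode[OF smooth_Da[OF y(1)] Da_periodic[OF y]] mint_Da_mode[OF x] mint_Da_mode[OF y] l power2_eq_square)
  ultimately have "SS t * gg t / cc t * mint (Ds y) (msin j) t - (- (l\<^sup>2 * mint y (msin j) t) - 2 * gg t * (l * mint x (mcos j) t) - (gg t)\<^sup>2 * mint y (msin j) t) / (cc t)\<^sup>2
      - mint (Ds (Ds y)) (msin j) t - 2 * mint y (msin j) t - 2 * (kk t * SS t)\<^sup>2 * mint y (msin j) t = m * mint y (msin j) t"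
    by (simp add: algebra_simps add_divide_distrib diff_divide_distrib)
  then show "cc t * (cc t * mint (Ds (Ds y)) (msin j) t - SS t * gg t * mint (Ds y) (msin j) t) =
      UY l t * mint y (msin j) t + 2 * l * gg t * mint x (mcos j) t - m * (cc t)\<^sup>2 * mint y (msin j) t"
    unfolding mode_equation(2)[OF refl refl refl refl] .
qed

text \<open>A translation in time by \<open>n\<close> half periods equals a lattice translation up
  to a shift of \<alpha> by pi, which costs the sign of the mode.\<close>

lemma mint_shift:
  assumes f: "smooth f" "\<And>z. f (z + (2 * pi, 0)) = f z" "\<And>z. f (z + (pi, real n * TT)) = f z"
    and k: "smooth k" "\<And>a. k (a + pi) = s * k a" "s = 1 \<or> s = -1"
  shows "mint f k (y + pi * real n) = s * mint f k y"
proof -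
  define h where "h a = f (a, tau (y + pi * real n)) * k a" for a
  have t: "tau (y + pi * real n) = tau y + real n * TT" by (simp add: tau_shift TT_def)
  have c: "continuous_on UNIV h" unfolding h_def
    by (intro continuous_intros smooth_slice f smooth_continuous k)
  have "k (a + 2 * pi) = k a" for a using k(2)[of "a + pi"] k(2)[of a] k(3) by (auto simp: algebra_simps)
  then have p: "h (a + 2 * pi) = h a" for a
    using f(2)[of "(a, tau (y + pi * real n))"] by (simp add: h_def)
  have "h (a + pi) = s * (f (a, tau y) * k a)" for a
    using f(3)[of "(a, tau y)"] by (simp add: h_def k(2) t)
  then have "integral {0..2 * pi} (\<lambda>a. s * (f (a, tau y) * k a)) = integral {0..2 * pi} (h \<circ> (+) pi)"
    by (simp add: o_def add.commute)
  also have "\<dots> = integral {pi..pi + 2 * pi} h" by (simp add: integral_shift_Icc_real add.commute)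
  also have "\<dots> = integral {0..2 * pi} h" by (rule integral_period_shift[OF c p]) simp
  finally show ?thesis by (simp add: mint_def h_def[abs_def])
qed

end

section \<open>Sections over the torus\<close>

locale otsuki_torus = otsuki +
  fixes p q :: nat
  assumes q_pos: "q > 0" and cop: "coprime p q" and th_half: "real q * th (pi / 2) = real p * pi"
begin

abbreviation "GG \<equiv> otsuki_translations q b"

text \<open>The number of half turns of \<^const>\<open>Psi\<close> over one period of the coefficients, and the sign
  picked up by the modes of frequency \<open>l\<close>.\<close>

definition nn :: nat where "nn = (if even q then q else 2 * q)"
definition pp :: nat where "pp = (if even q then p else 2 * p)"
definition sg :: "nat \<Rightarrow> real" where "sg l = (if even q then (-1) ^ l else 1)"

lemma nn: "even nn" "nn > 0" "real nn * th (pi / 2) = real pp * pi"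
  using q_pos th_half by (auto simp: nn_def pp_def)

lemma sg: "sg l = 1 \<or> sg l = -1"
  by (cases "even l") (auto simp: sg_def)

lemma sg_even: "even l \<Longrightarrow> sg l = 1" by (simp add: sg_def)

text \<open>For even q coprimality makes p odd. Thus the sign prescribed by the quotient agrees with
  the one that the null solutions of frequency 1 acquire.\<close>

lemma sg_odd: "odd l \<Longrightarrow> sg l = (-1) ^ pp"
  using cop by (cases "even q") (auto simp: sg_def pp_def coprime_commute dest: coprime_common_divisor_nat)

lemma GG: "GG = {(2 * pi, 0), (0, real (2 * q) * TT)} \<union> (if even q then {(pi, real q * TT)} else {})"
  by (simp add: otsuki_translations_def half_period_eq Let_def)

lemma GG_cases: "(\<forall>g\<in>GG. P g) \<longleftrightarrow> P (2 * pi, 0) \<and> P (0, real (2 * q) * TT) \<and> (even q \<longrightarrow> P (pi, real q * TT))"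
  unfolding GG by auto

text \<open>For even q the additional translation turns \<alpha> by pi and \<theta> by p pi with p
  odd; both factors of the tensor basis change sign, so the frame is unchanged and sections descend
  through their coordinates.\<close>

lemma fr_shift: "g \<in> GG \<Longrightarrow> fr (z + g) a0 a1 a2 x y = fr z a0 a1 a2 x y"
proof -
  define s where "s k = (-1 :: real) ^ k" for k :: nat
  have sq: "s k * s k = 1" for k by (simp add: s_def flip: power_mult_distrib)
  have c: "cmb z' c1 c2 c3 c4 c5 = cmb z c1 c2 c3 c4 c5"
    if "cos (fst z') = s k * cos (fst z)" "sin (fst z') = s k * sin (fst z)"
      "cos (th (Psi (snd z'))) = s k * cos (th (Psi (snd z)))" "sin (th (Psi (snd z'))) = s k * sin (th (Psi (snd z)))"
    for z' k c1 c2 c3 c4 c5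
  proof -
    have e: "s k * u * (s k * v) = u * v" for u v using sq[of k] by algebra
    show ?thesis unfolding cmb_def that Let_def e ..
  qed
  have "\<forall>g\<in>GG. fr (z + g) a0 a1 a2 x y = fr z a0 a1 a2 x y"
    unfolding GG_cases
  proof (intro conjI impI)
    show "fr (z + (2 * pi, 0)) a0 a1 a2 x y = fr z a0 a1 a2 x y"
      unfolding fr_def by (subst c[of _ 0]) (simp_all add: s_def)
    have e: "even (2 * q)" by simp
    have "real (2 * q) * th (pi / 2) = real (2 * p) * pi" using th_half by simp
    note t = cos_sin_th_shift[OF this, where d = 0, unfolded add_0_right]
    show "fr (z + (0, real (2 * q) * TT)) a0 a1 a2 x y = fr z a0 a1 a2 x y"
      unfolding fr_def snd_add snd_conv Psi_shift shift
      by (subst c[of _ 0]) (simp_all add: s_def Psi_shift t del: of_nat_mult of_nat_numeral)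
    assume q: "even q"
    then have "odd p" using cop by (auto simp: dest: coprime_common_divisor_nat)
    then have sp: "(-1) ^ p = s 1" by (simp add: s_def)
    note t = cos_sin_th_shift[OF th_half, where d = 0, unfolded add_0_right sp]
    have s1: "(-1) ^ q = (1 :: real)" using q by simp
    show "fr (z + (pi, real q * TT)) a0 a1 a2 x y = fr z a0 a1 a2 x y"
      unfolding fr_def snd_add snd_conv Psi_shift shift s1
      by (subst c[of _ 1]) (simp_all add: Psi_shift t, simp_all add: s_def)
  qed
  then show "g \<in> GG \<Longrightarrow> fr (z + g) a0 a1 a2 x y = fr z a0 a1 a2 x y" by blast
qed

abbreviation "EE \<equiv> jacobi_eigenspace ub GG"

lemma eigenspace_iff:
  "X \<in> EE m \<longleftrightarrow> smooth X \<and> (\<forall>z. X z = fr z 0 0 0 (xc X z) (yc X z)) \<and> (\<forall>z. \<forall>g\<in>GG. X (z + g) = X z) \<and>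
    (\<forall>z. Lx (xc X) (yc X) z = m * xc X z \<and> Ly (xc X) (yc X) z = m * yc X z)"
proof -
  have n: "(\<forall>z. X z \<bullet> ub z = 0) \<and> (\<forall>z v. X z \<bullet> frechet_derivative ub (at z) v = 0) \<longleftrightarrow> (\<forall>z. X z = fr z 0 0 0 (xc X z) (yc X z))"
  proof (intro iffI allI conjI)
    fix z v
    assume r: "\<forall>z. X z = fr z 0 0 0 (xc X z) (yc X z)"
    show "X z \<bullet> ub z = 0" by (subst spec[OF r]) (simp add: ub_fr fr_inner)
    show "X z \<bullet> frechet_derivative ub (at z) v = 0"
      by (subst spec[OF r]) (simp add: pd_frechet[OF pd_ub] fr_scaleR fr_add fr_inner)
  next
    fix z
    assume n: "(\<forall>z. X z \<bullet> ub z = 0) \<and> (\<forall>z v. X z \<bullet> frechet_derivative ub (at z) v = 0)"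
    have "X z \<bullet> fr z 1 0 0 0 0 = 0" using spec[OF conjunct1[OF n], of z] by (simp add: ub_fr)
    moreover have "X z \<bullet> frechet_derivative ub (at z) (1, 0) = 0" "X z \<bullet> frechet_derivative ub (at z) (0, 1) = 0" using n by blast+
    then have "X z \<bullet> fr z 0 1 0 0 0 = 0" "X z \<bullet> fr z 0 0 1 0 0 = 0"
    proof -
      have "fr z 0 (cc (Psi (snd z))) 0 0 0 = cc (Psi (snd z)) *\<^sub>R fr z 0 1 0 0 0" by (simp add: fr_scaleR)
      with \<open>X z \<bullet> frechet_derivative ub (at z) (1, 0) = 0\<close> show "X z \<bullet> fr z 0 1 0 0 0 = 0"
        by (simp add: pd_frechet[OF pd_ub])
      from \<open>X z \<bullet> frechet_derivative ub (at z) (0, 1) = 0\<close> show "X z \<bullet> fr z 0 0 1 0 0 = 0"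
        by (simp add: pd_frechet[OF pd_ub])
    qed
    ultimately show "X z = fr z 0 0 0 (xc X z) (yc X z)" using fr_complete[of "X z" z] by (simp add: xc_def yc_def)
  qed
  have j: "(\<forall>z. jacobi_op ub X z = m *\<^sub>R X z) \<longleftrightarrow> (\<forall>z. Lx (xc X) (yc X) z = m * xc X z \<and> Ly (xc X) (yc X) z = m * yc X z)"
    if X: "smooth X" and r: "\<forall>z. X z = fr z 0 0 0 (xc X z) (yc X z)"
  proof -
    have i: "fr z 0 0 0 u v = fr z 0 0 0 u' v' \<longleftrightarrow> u = u' \<and> v = v'" for z u v u' v'
      using fr_inner[of z 0 0 0 u v 0 0 0 1 0] fr_inner[of z 0 0 0 u' v' 0 0 0 1 0]
        fr_inner[of z 0 0 0 u v 0 0 0 0 1] fr_inner[of z 0 0 0 u' v' 0 0 0 0 1] by auto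
    have "X = (\<lambda>z. fr z 0 0 0 (xc X z) (yc X z))" using r by blast
    then have "jacobi_op ub X z = fr z 0 0 0 (Lx (xc X) (yc X) z) (Ly (xc X) (yc X) z)" for z
      using jacobi_op_ub[OF smooth_xc[OF X] smooth_yc[OF X], of z] by (simp only: )
    moreover have "m *\<^sub>R X z = fr z 0 0 0 (m * xc X z) (m * yc X z)" for z
      by (subst spec[OF r]) (simp add: fr_scaleR)
    ultimately show ?thesis by (simp add: i)
  qed
  show ?thesis unfolding jacobi_eigenspace_def normal_section_def mem_Collect_eq using n j by blast
qed

lemma eigensection:
  assumes "X \<in> EE m"
  shows "smooth X" "X z = fr z 0 0 0 (xc X z) (yc X z)" "g \<in> GG \<Longrightarrow> X (z + g) = X z"
    "Lx (xc X) (yc X) z = m * xc X z" "Ly (xc X) (yc X) z = m * yc X z"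
  using assms unfolding eigenspace_iff by blast+

lemma eigensectionI:
  assumes "smooth X" "\<And>z. X z = fr z 0 0 0 (xc X z) (yc X z)" "\<And>z g. g \<in> GG \<Longrightarrow> X (z + g) = X z"
    "\<And>z. Lx (xc X) (yc X) z = m * xc X z" "\<And>z. Ly (xc X) (yc X) z = m * yc X z"
  shows "X \<in> EE m"
  unfolding eigenspace_iff using assms by blast

lemma subspace_EE: "subspace (EE m)"
proof -
  have "(\<lambda>z. c *\<^sub>R X z + d *\<^sub>R Y z) \<in> EE m" if X: "X \<in> EE m" and Y: "Y \<in> EE m" for X Y c d
  proof -
    note X = eigensection[OF X] and Y = eigensection[OF Y]
    let ?Z = "\<lambda>z. c *\<^sub>R X z + d *\<^sub>R Y z"
    have e: "xc ?Z = (\<lambda>z. c * xc X z + d * xc Y z)" "yc ?Z = (\<lambda>z. c * yc X z + d * yc Y z)"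
      by (simp_all add: fun_eq_iff xc_def yc_def inner_add_left)
    have r1: "?Z z = fr z 0 0 0 (xc ?Z z) (yc ?Z z)" for z
    proof -
      have "?Z z = c *\<^sub>R fr z 0 0 0 (xc X z) (yc X z) + d *\<^sub>R fr z 0 0 0 (xc Y z) (yc Y z)" using X(2) Y(2) by metis
      then show ?thesis unfolding e by (simp only: fr_scaleR fr_add mult_zero_right add_0_right)
    qed
    have r2: "smooth ?Z" by (intro smooth_add smooth_scaleR smooth_const X(1) Y(1))
    have r3: "?Z (z + g) = ?Z z" if "g \<in> GG" for z g using X(3) Y(3) that by simp
    have r4: "Lx (xc ?Z) (yc ?Z) z = m * xc ?Z z" "Ly (xc ?Z) (yc ?Z) z = m * yc ?Z z" for z
      unfolding e by (simp_all add: Lx_lin smooth_xc[OF X(1)] smooth_xc[OF Y(1)] smooth_yc[OF X(1)] smooth_yc[OF Y(1)]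
          X(4,5) Y(4,5) algebra_simps)
    show ?thesis by (rule eigensectionI[OF r2 r1 r3 r4])
  qed
  note c = this
  have "(\<lambda>z. 0) \<in> EE m"
    using Lx_lin[of "\<lambda>_. 0" "\<lambda>_. 0" "\<lambda>_. 0" "\<lambda>_. 0" 0 0]
    by (intro eigensectionI) (simp_all add: xc_def[abs_def] yc_def[abs_def] fr_zero)
  then show ?thesis
    unfolding subspace_def using c[of _ _ 1 1] c[of _ _ _ 0]
    by (auto simp: zero_fun_def plus_fun_def scaleR_fun_def)
qed

lemma eigensection_components:
  assumes "X \<in> EE m" "g \<in> GG"
  shows "xc X (z + g) = xc X z" "yc X (z + g) = yc X z"
  using eigensection(3)[OF assms] by (simp_all add: xc_def yc_def fr_shift[OF assms(2)])

text \<open>For even q the period condition comes from the combined translation, which costs the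
  sign of the mode; for odd q it comes from the pure translation in time. This is where
  \<open>nn\<close> and \<open>sg\<close> originate.\<close>

lemma eigensection_mode:
  assumes X: "X \<in> EE m"
  shows "osol nn (sg (mode_l j)) (real (mode_l j)) m (md j X)"
proof -
  have x: "smooth (xc X)" and y: "smooth (yc X)" using eigensection(1)[OF X] smooth_xc smooth_yc by blast+
  note per = eigensection_components[OF X]
  have g1: "(2 * pi, 0) \<in> GG" and g2: "(0, real (2 * q) * TT) \<in> GG" and g3: "even q \<Longrightarrow> (pi, real q * TT) \<in> GG" unfolding GG by auto
  note p1 = per[OF g1]
  have c: "continuous_on UNIV (mint f k)" if "smooth f" "smooth k" for f k
    using sdD[OF mint_sd[OF that]] by (meson DERIV_isCont continuous_at_imp_continuous_on)
  have sh: "mint f k (t + pi * real nn) = sg (mode_l j) * mint f k t"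
    if f: "smooth f" "\<And>z g. g \<in> GG \<Longrightarrow> f (z + g) = f z" and k: "smooth k" "\<And>a. k (a + pi) = (-1) ^ mode_l j * k a" for f k t
  proof (cases "even q")
    case True
    have "mint f k (t + pi * real q) = (-1) ^ mode_l j * mint f k t"
      by (rule mint_shift[OF f(1) f(2)[OF g1] f(2)[OF g3[OF True]] k]) (cases "even (mode_l j)"; simp)
    then show ?thesis using True by (simp add: nn_def sg_def)
  next
    case False
    have "tau (t + pi * real (2 * q)) = tau t + real (2 * q) * TT" by (simp only: tau_shift TT_def)
    then have "f (a, tau (t + pi * real (2 * q))) = f (a, tau t)" for a using f(2)[OF g2, of "(a, tau t)"] by simp
    then show ?thesis using False unfolding nn_def sg_def mint_def by simp
  qed
  note o = mode_ode[OF x p1(1) y p1(2) eigensection(4,5)[OF X] refl]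
  show ?thesis
    unfolding md_def
    by (rule sd_osol[OF mint_sd[OF x smooth_mode(1)] mint_sd[OF smooth_Ds[OF x] smooth_mode(1)] c
          mint_sd[OF y smooth_mode(2)] mint_sd[OF smooth_Ds[OF y] smooth_mode(2)] c])
       (auto intro!: smooth_Ds x y smooth_mode sh per mode_pi o)
qed

lemma eigensection_zero:
  assumes X: "X \<in> EE m" and z: "\<And>j y. md j X y = 0"
  shows "X = 0"
proof (rule modes_zero[OF _ _ _ _ z])
  have "(2 * pi, 0) \<in> GG" unfolding GG by auto
  then show "xc X (z + (2 * pi, 0)) = xc X z" "yc X (z + (2 * pi, 0)) = yc X z" for z
    using eigensection_components[OF X] by blast+
  show "smooth X" by (rule eigensection(1)[OF X])
  show "X = (\<lambda>z. fr z 0 0 0 (xc X z) (yc X z))" by (rule ext, rule eigensection(2)[OF X])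
qed

lemma lift_eigensection:
  assumes f: "osol nn (sg (mode_l j)) (real (mode_l j)) m f"
  shows "lift j f \<in> EE m"
proof -
  obtain X Y Xs Ys Xss Yss where F: "f = (\<lambda>x. (X x, Y x))" and s: "sd X Xs" "sd Xs Xss" "sd Y Ys" "sd Ys Yss" and sm: "smooth X" "smooth Y"
    and eq: "\<And>x. cc x * (cc x * Xss x - SS x * gg x * Xs x) = UX (real (mode_l j)) x * X x + 2 * real (mode_l j) * gg x * Y x - m * (cc x)\<^sup>2 * X x"
      "\<And>x. cc x * (cc x * Yss x - SS x * gg x * Ys x) = UY (real (mode_l j)) x * Y x + 2 * real (mode_l j) * gg x * X x - m * (cc x)\<^sup>2 * Y x"
    by (rule osol_sd[OF f]) (rule that)
  have per: "f (x + pi * real nn) = sg (mode_l j) *\<^sub>R f x" for x using f by (simp add: osol_def)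
  have e: "xc (lift j f) = (\<lambda>z. X (Psi (snd z)) * mcos j (fst z))" "yc (lift j f) = (\<lambda>z. Y (Psi (snd z)) * msin j (fst z))"
    by (simp_all add: xc_def yc_def lift_def fr_inner F fun_eq_iff)
  have l: "lift j f = (\<lambda>z. fr z 0 0 0 (X (Psi (snd z)) * mcos j (fst z)) (Y (Psi (snd z)) * msin j (fst z)))"
    by (simp add: lift_def[abs_def] F)
  have sml: "smooth (lift j f)"
    unfolding l by (intro smooth_fr smooth_const smooth_mult smooth_Psi_snd smooth_fst sm smooth_mode)
  have inv: "lift j f (z + g) = lift j f z" if g: "g \<in> GG" for z g
  proof -
    have "\<forall>g\<in>GG. f (Psi (snd (z + g))) = f (Psi (snd z)) \<and> mcos j (fst (z + g)) = mcos j (fst z) \<and> msin j (fst (z + g)) = msin j (fst z) \<or>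
      f (Psi (snd (z + g))) = - f (Psi (snd z)) \<and> mcos j (fst (z + g)) = - mcos j (fst z) \<and> msin j (fst (z + g)) = - msin j (fst z)"
      (is "\<forall>g\<in>GG. ?P g")
      unfolding GG_cases
    proof (intro conjI impI)
      show "?P (2 * pi, 0)" by (simp add: mode_2pi)
      have "f (x + pi * real (2 * q)) = f x" for x
      proof (cases "even q")
        case True
        then have "f (x + pi * real (2 * q)) = sg (mode_l j) *\<^sub>R sg (mode_l j) *\<^sub>R f x"
          using per[of "x + pi * real q"] per[of x] by (simp add: nn_def algebra_simps)
        then show ?thesis using sg[of "mode_l j"] by auto
      next
        case False
        then show ?thesis using per[of x] by (simp add: nn_def sg_def)
      qed
      then show "?P (0, real (2 * q) * TT)" by (simp add: Psi_shift del: of_nat_mult of_nat_numeral)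
      assume q: "even q"
      then have "f (Psi (snd z) + pi * real q) = (-1) ^ mode_l j *\<^sub>R f (Psi (snd z))" using per by (simp add: nn_def sg_def)
      then show "?P (pi, real q * TT)" by (cases "even (mode_l j)") (simp_all add: Psi_shift mode_pi)
    qed
    then have "?P g" using g by blast
    then show ?thesis unfolding lift_def using fr_shift[OF g] by auto
  qed
  have "Lx (xc (lift j f)) (yc (lift j f)) z = m * xc (lift j f) z" "Ly (xc (lift j f)) (yc (lift j f)) z = m * yc (lift j f) z" for z
    unfolding Lx_product[OF s e refl] Let_def
    unfolding mode_equation(1)[OF refl refl refl refl, THEN iffD2, OF eq(1)] mode_equation(2)[OF refl refl refl refl, THEN iffD2, OF eq(2)] e
    by simp_all
  then show ?thesis using sml inv by (intro eigensectionI) (simp_all add: e, simp add: l)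
qed

text \<open>Extracting the modes with \<open>md\<close> separates different \<open>j\<close>, so
  independence has to be supplied only within each mode.\<close>

lemma count_ge:
  assumes J: "finite J" and e: "\<And>j i. j \<in> J \<Longrightarrow> i < N j \<Longrightarrow> m j i \<in> A \<and> osol nn (sg (mode_l j)) (real (mode_l j)) (m j i) (e j i)"
    and ind: "\<And>j c i. j \<in> J \<Longrightarrow> (\<And>x. (\<Sum>i<N j. c i *\<^sub>R e j i x) = 0) \<Longrightarrow> i < N j \<Longrightarrow> c i = (0 :: real)"
  shows "enat (\<Sum>j\<in>J. N j) \<le> eigenvalue_count ub GG A"
proof -
  let ?I = "SIGMA j:J. {..<N j}"
  have I: "finite ?I" using J by auto
  have "enat (card ?I) \<le> eigenvalue_count ub GG A"
  proof (rule eigenvalue_count_ge[OF I, where b = "\<lambda>(j, i). lift j (e j i)" and m = "\<lambda>(j, i). m j i"])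
    show "(case r of (j, i) \<Rightarrow> m j i) \<in> A \<and> (case r of (j, i) \<Rightarrow> lift j (e j i)) \<in> EE (case r of (j, i) \<Rightarrow> m j i)" if "r \<in> ?I" for r
      using that e lift_eigensection by auto
    fix c :: "nat \<times> nat \<Rightarrow> real" and r
    assume z: "(\<Sum>r\<in>?I. c r *\<^sub>R (case r of (j, i) \<Rightarrow> lift j (e j i))) = 0" and r: "r \<in> ?I"
    obtain j i where ji: "r = (j, i)" "j \<in> J" "i < N j" using r by auto
    have sm: "smooth (case r of (j, i) \<Rightarrow> lift j (e j i))" if "r \<in> ?I" for r
      using that by (cases r) (auto intro: eigensection(1)[OF lift_eigensection[OF conjunct2[OF e]]])
    have "(\<Sum>i<N j. c (j, i) *\<^sub>R e j i y) = 0" for y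
    proof -
      have "0 = md j 0 y" by (simp add: md_def xc_def yc_def mint_def zero_prod_def)
      also have "\<dots> = (\<Sum>r\<in>?I. c r *\<^sub>R md j (case r of (j, i) \<Rightarrow> lift j (e j i)) y)"
        unfolding z[symmetric] by (rule md_sum[OF I sm])
      also have "\<dots> = (\<Sum>k\<in>J. \<Sum>i<N k. c (k, i) *\<^sub>R (if j = k then pi else 0) *\<^sub>R e k i y)"
        using J by (subst sum.Sigma) (auto simp: md_lift split_def intro!: sum.cong)
      also have "\<dots> = (\<Sum>k\<in>J. if j = k then (\<Sum>i<N k. c (k, i) *\<^sub>R pi *\<^sub>R e k i y) else 0)"
        by (intro sum.cong) auto
      also have "\<dots> = pi *\<^sub>R (\<Sum>i<N j. c (j, i) *\<^sub>R e j i y)"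
        using J ji by (simp add: scaleR_sum_right mult.commute)
      finally show ?thesis by simp
    qed
    from ind[OF ji(2) this ji(3)] show "c r = 0" using ji by simp
  qed
  then show ?thesis using J by simp
qed

text \<open>The functionals of the finitely many relevant modes are numbered through a bijection,
  and \<open>triv\<close> disposes of all other modes.\<close>

lemma count_le:
  fixes \<Lambda> :: "nat \<Rightarrow> nat \<Rightarrow> (real \<Rightarrow> real \<times> real) \<Rightarrow> real"
  assumes J: "finite J"
    and lin: "\<And>j i (S :: (plane \<Rightarrow> R5) set) c f. j \<in> J \<Longrightarrow> i < N j \<Longrightarrow> finite S \<Longrightarrow> (\<And>X. X \<in> S \<Longrightarrow> C2D DD (f X)) \<Longrightarrow>
      \<Lambda> j i (\<lambda>x. \<Sum>X\<in>S. c X *\<^sub>R f X x) = (\<Sum>X\<in>S. c X * \<Lambda> j i (f X))"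
    and van: "\<And>j F f m x. j \<in> J \<Longrightarrow> finite F \<Longrightarrow> F \<subseteq> A \<Longrightarrow> (\<And>m. m \<in> F \<Longrightarrow> osol nn (sg (mode_l j)) (real (mode_l j)) m (f m)) \<Longrightarrow>
      (\<And>i. i < N j \<Longrightarrow> (\<Sum>m\<in>F. \<Lambda> j i (f m)) = 0) \<Longrightarrow> m \<in> F \<Longrightarrow> f m x = 0"
    and triv: "\<And>j m f x. j \<notin> J \<Longrightarrow> m \<in> A \<Longrightarrow> osol nn (sg (mode_l j)) (real (mode_l j)) m f \<Longrightarrow> f x = 0"
  shows "eigenvalue_count ub GG A \<le> enat (\<Sum>j\<in>J. N j)"
proof -
  let ?I = "SIGMA j:J. {..<N j}"
  have "finite ?I" and card: "card ?I = (\<Sum>j\<in>J. N j)" using J by auto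
  then obtain h where h: "bij_betw h {0..<card ?I} ?I" using ex_bij_betw_nat_finite by blast
  let ?M = "\<Sum>j\<in>J. N j"
  have hI: "h k \<in> ?I" if "k < ?M" for k using bij_betw_apply[OF h, of k] that unfolding card by simp
  define L where "L k X = \<Lambda> (fst (h k)) (snd (h k)) (md (fst (h k)) X)" for k X
  show ?thesis
  proof (rule eigenvalue_count_le[OF subspace_EE, where L = L])
    fix k S c l assume k: "k < ?M" and S: "finite S" "S \<subseteq> EE l"
    have sm: "smooth X" and C: "C2D DD (md j X)" if "X \<in> S" for X j
      using that S eigensection_mode[of X l j] eigensection(1)[of X l] unfolding osol_def by auto
    have "md (fst (h k)) (\<Sum>X\<in>S. c X *\<^sub>R X) = (\<lambda>y. \<Sum>X\<in>S. c X *\<^sub>R md (fst (h k)) X y)"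
      by (rule ext, rule md_sum[OF S(1) sm])
    then show "L k (\<Sum>X\<in>S. c X *\<^sub>R X) = (\<Sum>X\<in>S. c X * L k X)"
      unfolding L_def using lin[of "fst (h k)" "snd (h k)" S] hI[OF k] S C by auto
  next
    fix F X l
    assume F: "finite F" "F \<subseteq> A" and X: "\<And>l. l \<in> F \<Longrightarrow> X l \<in> EE l" and z: "\<And>k. k < ?M \<Longrightarrow> (\<Sum>l\<in>F. L k (X l)) = 0" and l: "l \<in> F"
    have "md j (X l) y = 0" for j y
    proof (cases "j \<in> J")
      case True
      show ?thesis
      proof (rule van[OF True F, of "\<lambda>l. md j (X l)"])
        fix i assume "i < N j"
        then have "(j, i) \<in> ?I" using True by auto
        then obtain k where "k < ?M" "h k = (j, i)" using h card unfolding bij_betw_def by (auto elim!: equalityE dest!: subsetD[where c = "(j, i)"])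
        then show "(\<Sum>m\<in>F. \<Lambda> j i (md j (X m))) = 0" using z[of k] by (simp add: L_def)
      qed (use X l eigensection_mode in auto)
    next
      case False
      then show ?thesis using triv[OF False _ eigensection_mode[OF X[OF l]]] F l by blast
    qed
    then show "X l = 0" by (rule eigensection_zero[OF X[OF l]])
  qed
qed

end

section \<open>The index and the nullity\<close>

locale otsuki_small_torus = otsuki_small + otsuki_torus +
  assumes ratio: "7 / 10 * real q \<le> real p" "real p < sqrt 2 / 2 * real q" and q_large: "q \<ge> 300"
begin

lemma ratio_upper: "real p \<le> 708 / 1000 * real q"
proof -
  have "sqrt 2 \<le> 1416 / 1000" by (rule real_le_lsqrt) (simp_all add: power2_eq_square)
  then have "sqrt 2 / 2 \<le> 708 / 1000" by simp
  then have "sqrt 2 / 2 * real q \<le> 708 / 1000 * real q" by (intro mult_right_mono) auto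
  then show ?thesis using ratio(2) by linarith
qed

lemma th_end: "pi / 2 < th (pi / 2)" "th (pi / 2) < pi"
proof -
  have q: "real q > 0" using q_pos by simp
  have e: "th (pi / 2) = real p / real q * pi" using th_half q by (simp add: field_simps)
  have r: "1 / 2 < real p / real q" "real p / real q < 1" using ratio(1) ratio_upper q by (simp_all add: field_simps)
  show "pi / 2 < th (pi / 2)" "th (pi / 2) < pi"
    unfolding e using mult_strict_right_mono[OF r(1), of pi] mult_strict_right_mono[OF r(2), of pi] by simp_all
qed

lemma functional_sum:
  fixes f :: "'i \<Rightarrow> real \<Rightarrow> real \<times> real"
  assumes "finite S" "\<And>X. X \<in> S \<Longrightarrow> C2D DD (f X)"
  shows "fst (\<Sum>X\<in>S. c X *\<^sub>R f X x) = (\<Sum>X\<in>S. c X * fst (f X x))"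
    and "snd (\<Sum>X\<in>S. c X *\<^sub>R f X x) = (\<Sum>X\<in>S. c X * snd (f X x))"
    and "fst (dd (\<lambda>x. \<Sum>X\<in>S. c X *\<^sub>R f X x) x) = (\<Sum>X\<in>S. c X * fst (dd (f X) x))"
    and "snd (dd (\<lambda>x. \<Sum>X\<in>S. c X *\<^sub>R f X x) x) = (\<Sum>X\<in>S. c X * snd (dd (f X) x))"
  using C2D_sum[OF assms, where c = c] by (simp_all add: fst_sum snd_sum)

lemma nullity_upper: "surface_nullity ub GG \<le> 13"
proof -
  \<comment> \<open>Three functionals for frequency 0, four for each phase of frequency 1, one for
    each phase of frequency 2: 3 + 8 + 2 = 13.\<close>
  define N :: "nat \<Rightarrow> nat" where "N = (\<lambda>j. if j = 0 then 3 else if j \<le> 2 then 4 else 1)"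
  \<comment> \<open>Cauchy data at one point. For \<open>j = 0\<close> the value of the second
    component is skipped, hence the shift to \<open>i + 1\<close>, and the point is - pi / 2 as in
    \<open>null_space_0\<close>.\<close>
  define \<Lambda> :: "nat \<Rightarrow> nat \<Rightarrow> (real \<Rightarrow> real \<times> real) \<Rightarrow> real" where
    "\<Lambda> j i f = (let x = if j = 0 then - pi / 2 else 0; k = if j = 0 \<and> i > 0 then i + 1 else i in
      if k = 0 then fst (f x) else if k = 1 then snd (f x) else if k = 2 then fst (dd f x) else snd (dd f x))" for j i f
  have "eigenvalue_count ub GG {0} \<le> enat (\<Sum>j\<in>{..4}. N j)"
  proof (rule count_le[where \<Lambda> = \<Lambda>])
    show "\<Lambda> j i (\<lambda>x. \<Sum>X\<in>S. c X *\<^sub>R f X x) = (\<Sum>X\<in>S. c X * \<Lambda> j i (f X))"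
      if "finite S" "\<And>X. X \<in> S \<Longrightarrow> C2D DD (f X)" for j i c f and S :: "(plane \<Rightarrow> R5) set"
      unfolding \<Lambda>_def Let_def by (simp only: functional_sum[OF that] split: if_splits) simp
  next
    fix j :: nat and F f m x
    assume j: "j \<in> {..4}" and F: "F \<subseteq> {0::real}" and o: "\<And>m. m \<in> F \<Longrightarrow> osol nn (sg (mode_l j)) (real (mode_l j)) m (f m)"
      and z: "\<And>i. i < N j \<Longrightarrow> (\<Sum>m\<in>F. \<Lambda> j i (f m)) = 0" and m: "m \<in> F"
    have F0: "F = {0}" "m = 0" using F m by auto
    have o0: "osol nn (sg (mode_l j)) (real (mode_l j)) 0 (f 0)" using o F0 by simp
    have z0: "\<Lambda> j i (f 0) = 0" if "i < N j" for i using z[OF that] F0 by simp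
    consider "j = 0" | "j = 1 \<or> j = 2" | "j = 3 \<or> j = 4" using j by (auto simp: atMost_def) linarith
    then have "f 0 x = 0"
    proof cases
      case 1
      have "amp\<^sup>2 \<le> (1 / 100)\<^sup>2" using amp amp_small by (intro power_mono) auto
      then have a: "amp\<^sup>2 < 1 / 2" by (simp add: power2_eq_square)
      show ?thesis
        by (rule null_space_0[OF nn(1,2) a]) (use o0 z0[of 0] z0[of 1] z0[of 2] 1 in \<open>auto simp: \<Lambda>_def N_def mode_l_def sg_even\<close>)
    next
      case 2
      have "osol nn (sg (mode_l j)) (real (mode_l j)) 0 (f 0)" by (rule o0)
      then have C: "C2D DD (f 0)" "\<And>x. qd DD (f 0) x = VV (real (mode_l j)) x (f 0 x) - (0 * ww x) *\<^sub>R f 0 x"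
        unfolding osol_def by auto
      have "f 0 0 = 0" "dd (f 0) 0 = 0"
        using z0[of 0] z0[of 1] z0[of 2] z0[of 3] 2 by (auto simp: \<Lambda>_def N_def prod_eq_iff)
      then show ?thesis by (rule osol_unique[OF nn(1,2) sg C])
    next
      case 3
      then have l: "real (mode_l j) = 2" by (auto simp: mode_l_def)
      show ?thesis
        by (rule null_space_2(2)[OF nn(1,2) sg order_refl o0[unfolded l]]) (use 3 z0[of 0] in \<open>auto simp: \<Lambda>_def N_def\<close>)
    qed
    then show "f m x = 0" using F0 by simp
  next
    fix j :: nat and m :: real and f x
    assume "j \<notin> {..4}" "m \<in> {0}" and f: "osol nn (sg (mode_l j)) (real (mode_l j)) m f"
    then have "3 \<le> mode_l j" "m \<le> 0" by (auto simp: mode_l_def)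
    then show "f x = 0" by (intro positive_modes[OF nn(1,2) sg _ _ f]) auto
  qed auto
  moreover have "(\<Sum>j\<in>{..4}. N j) = 13" by (simp add: N_def eval_nat_numeral)
  moreover have "enat 13 = 13" by (simp add: numeral_eq_enat)
  ultimately show ?thesis unfolding surface_nullity_def by simp
qed

lemma nullity_lower: "9 \<le> surface_nullity ub GG"
proof -
  define N :: "nat \<Rightarrow> nat" where "N = (\<lambda>j. if j = 0 then 3 else if j \<le> 2 then 2 else 1)"
  \<comment> \<open>A phase shift by - pi / 2 turns cosine into sine; half of it is inserted where
    the angle is doubled.\<close>
  define d :: "nat \<Rightarrow> real" where "d i = (if i = 0 then 0 else - (pi / 2))" for i
  define e0 where "e0 i x = (if i < 2 then (cc x * cos (2 * (th x + d i / 2)), 0) else (0, cc x * gg x))" for i :: nat and x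
  define e1 where "e1 i x = (SS x * cos (th x + d i), - (cc x * kk x * sin (th x + d i) + SS x * gg x * cos (th x + d i)))" for i :: nat and x
  define e2 where "e2 x = (cc x, - (cc x * gg x))" for x
  define e where "e j i = (if j = 0 then e0 i else if j \<le> 2 then e1 i else e2)" for j i :: nat
  have t: "sin (th (pi / 2)) \<noteq> 0" "cos (th (pi / 2)) \<noteq> 0"
  proof -
    show "sin (th (pi / 2)) \<noteq> 0" using sin_gt_zero[of "th (pi / 2)"] th_end pi_gt_zero by linarith
    have "cos (th (pi / 2)) < cos (pi / 2)" using th_end by (intro cos_monotone_0_pi) auto
    then show "cos (th (pi / 2)) \<noteq> 0" by simp
  qed
  have "enat (\<Sum>j\<in>{..4}. N j) \<le> eigenvalue_count ub GG {0}"
  proof (rule count_ge[where e = e and m = "\<lambda>_ _. 0"])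
    fix j i assume j: "j \<in> {..4::nat}" and i: "i < N j"
    consider "j = 0" | "j = 1 \<or> j = 2" | "j = 3 \<or> j = 4" using j by (auto simp: atMost_def) linarith
    then have "osol nn (sg (mode_l j)) (real (mode_l j)) 0 (e j i)"
    proof cases
      case 1
      then show ?thesis
        using null_solution_0_first[OF nn(1,3), of "d i / 2"] null_solution_0_second[OF nn(1)]
        by (cases "i < 2") (auto simp: e_def e0_def[abs_def] mode_l_def sg_even)
    next
      case 2
      then have l: "mode_l j = 1" by (auto simp: mode_l_def)
      show ?thesis using null_solution_1[OF nn(1,3), of "d i"] 2 unfolding l
        by (auto simp: e_def e1_def[abs_def] sg_odd)
    next
      case 3
      then have l: "mode_l j = 2" by (auto simp: mode_l_def)
      show ?thesis using null_solution_2[OF nn(1)] 3 unfolding l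
        by (auto simp: e_def e2_def[abs_def] sg_even)
    qed
    then show "0 \<in> {0::real} \<and> osol nn (sg (mode_l j)) (real (mode_l j)) 0 (e j i)" by simp
  next
    fix j i and c :: "nat \<Rightarrow> real"
    assume j: "j \<in> {..4::nat}" and z: "\<And>x. (\<Sum>i<N j. c i *\<^sub>R e j i x) = 0" and i: "i < N j"
    consider "j = 0" | "j = 1 \<or> j = 2" | "j = 3 \<or> j = 4" using j by (auto simp: atMost_def) linarith
    then show "c i = 0"
    proof cases
      case 1
      have z': "c 0 *\<^sub>R e0 0 x + c 1 *\<^sub>R e0 1 x + c 2 *\<^sub>R e0 2 x = 0" for x
        using z[of x] 1 by (simp add: N_def e_def eval_nat_numeral)
      have s: "cos (2 * th x - pi / 2) = sin (2 * th x)" for x by (simp add: cos_diff)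
      have zx: "c 0 * cos (2 * th x) + c 1 * sin (2 * th x) = 0" for x
      proof -
        have "cc x * (c 0 * cos (2 * th x) + c 1 * sin (2 * th x)) = 0"
          using arg_cong[OF z'[of x], of fst] by (simp add: e0_def d_def s algebra_simps)
        then show ?thesis by simp
      qed
      \<comment> \<open>At - pi / 2 the angle \<theta> is 0, which isolates the cosine coefficient.
        At pi / 2 it lies strictly between pi / 2 and pi, so the sine of the doubled angle is
        nonzero.\<close>
      have c0: "c 0 = 0" using zx[of "- pi / 2"] unfolding th(1) by simp
      have "sin (2 * th (pi / 2)) \<noteq> 0" using t by (simp add: sin_double)
      then have c1: "c 1 = 0" using zx[of "pi / 2"] c0 by simp
      have "gg 0 \<noteq> 0" using amp by (simp add: gg_def)
      then have "c 2 = 0" using arg_cong[OF z'[of 0], of snd] by (simp add: e0_def)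
      then show ?thesis using c0 c1 i 1 by (auto simp: N_def less_Suc_eq eval_nat_numeral)
    next
      case 2
      have z': "c 0 *\<^sub>R e1 0 x + c 1 *\<^sub>R e1 1 x = 0" for x
        using z[of x] 2 by (auto simp: N_def e_def eval_nat_numeral)
      have s: "cos (th x - pi / 2) = sin (th x)" for x by (simp add: cos_diff)
      have zx: "c 0 * (SS x * cos (th x)) + c 1 * (SS x * sin (th x)) = 0" for x
        using arg_cong[OF z'[of x], of fst] by (simp add: e1_def d_def s)
      have c0: "c 0 = 0" using zx[of "- pi / 2"] amp unfolding th(1) by (simp add: SS_def)
      then have c1: "c 1 = 0" using zx[of "pi / 2"] t amp by (simp add: SS_def)
      show ?thesis using c0 c1 i 2 by (auto simp: N_def less_Suc_eq eval_nat_numeral)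
    next
      case 3
      then show ?thesis using z[of 0] i by (auto simp: N_def e_def e2_def zero_prod_def)
    qed
  qed auto
  moreover have "(\<Sum>j\<in>{..4}. N j) = 9" by (simp add: N_def eval_nat_numeral)
  moreover have "enat 9 = 9" by (simp add: numeral_eq_enat)
  ultimately show ?thesis unfolding surface_nullity_def by simp
qed

lemma nn_large: "nn \<ge> 300" using q_large by (simp add: nn_def)

lemma pp_ratio: "7 / 10 * real nn \<le> real pp" "real pp \<le> 708 / 1000 * real nn"
  using ratio(1) ratio_upper by (auto simp: nn_def pp_def)

lemma index_upper: "surface_index ub GG \<le> enat (5 * nn + 2 * pp - 5)"
proof -
  \<comment> \<open>Slightly above the limiting frequencies: sqrt 2 and sqrt (3/2) for the first
    component, 1 and sqrt (1/2) for the second, with room for the coupling. Over the three modes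
    they add up to 6.35, below the 6.4 guaranteed by 5 + 2 p / q.\<close>
  define kX where "kX j = (if j = 0 then 142 / 100 else 124 / 100 :: real)" for j :: nat
  define kY where "kY j = (if j = 0 then 101 / 100 else 72 / 100 :: real)" for j :: nat
  define NX where "NX j = nat \<lfloor>kX j * real nn\<rfloor> + 1" for j
  define NY where "NY j = nat \<lfloor>kY j * real nn\<rfloor> + 1" for j
  have k0: "kX j \<ge> 0" "kY j \<ge> 0" for j by (simp_all add: kX_def kY_def)
  have NX: "kX j * real nn < real (NX j)" "real (NX j) \<le> kX j * real nn + 1"
    and NY: "kY j * real nn < real (NY j)" "real (NY j) \<le> kY j * real nn + 1" for j
    using k0[of j] by (simp_all add: NX_def NY_def) linarith+
  define \<Lambda> :: "nat \<Rightarrow> nat \<Rightarrow> (real \<Rightarrow> real \<times> real) \<Rightarrow> real" where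
    "\<Lambda> j i f = (if i < NX j then fst (f (pi * real nn * real i / real (NX j)))
      else snd (f (pi * real nn * real (i - NX j) / real (NY j))))" for j i f
  have "eigenvalue_count ub GG {..<0} \<le> enat (\<Sum>j\<in>{..2}. NX j + NY j)"
  proof (rule count_le[where \<Lambda> = \<Lambda>])
    show "\<Lambda> j i (\<lambda>x. \<Sum>X\<in>S. c X *\<^sub>R f X x) = (\<Sum>X\<in>S. c X * \<Lambda> j i (f X))"
      if "finite S" "\<And>X. X \<in> S \<Longrightarrow> C2D DD (f X)" for j i c f and S :: "(plane \<Rightarrow> R5) set"
      unfolding \<Lambda>_def by (simp only: functional_sum[OF that] split: if_splits) simp
  next
    fix j F f m x
    assume j: "j \<in> {..2::nat}" and F: "finite F" "F \<subseteq> {..<0::real}"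
      and o: "\<And>m. m \<in> F \<Longrightarrow> osol nn (sg (mode_l j)) (real (mode_l j)) m (f m)"
      and z: "\<And>i. i < NX j + NY j \<Longrightarrow> (\<Sum>m\<in>F. \<Lambda> j i (f m)) = 0" and m: "m \<in> F"
    have l: "0 \<le> real (mode_l j)" "real (mode_l j) \<le> 1" using j by (auto simp: mode_l_def)
    have jl: "j = 0 \<and> mode_l j = 0 \<or> j > 0 \<and> mode_l j = 1" using j by (auto simp: mode_l_def)
    show "f m x = 0"
    proof (rule vanishing_sums[OF nn(1,2) sg l k0(1)[of j] _ NX(1) k0(2)[of j] _ NY(1) F(1) _ o _ _ m])
      show "19998 / 10000 * (kX j)\<^sup>2 \<ge> 4 - (real (mode_l j))\<^sup>2 + real (mode_l j) / 35"
        "19998 / 10000 * (kY j)\<^sup>2 \<ge> 2 - (real (mode_l j))\<^sup>2 + real (mode_l j) / 35"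
        using jl by (auto simp: kX_def kY_def power2_eq_square)
      show "(\<Sum>m\<in>F. fst (f m (pi * real nn * real i / real (NX j)))) = 0" if "i < NX j" for i
        using z[of i] that by (simp add: \<Lambda>_def)
      show "(\<Sum>m\<in>F. snd (f m (pi * real nn * real i / real (NY j)))) = 0" if "i < NY j" for i
        using z[of "NX j + i"] that by (simp add: \<Lambda>_def)
    qed (use F in auto)
  next
    fix j :: nat and m :: real and f x
    assume j: "j \<notin> {..2}" and m: "m \<in> {..<0}" and f: "osol nn (sg (mode_l j)) (real (mode_l j)) m f"
    show "f x = 0"
    proof (cases "mode_l j = 2")
      case True
      then have "osol nn (sg (mode_l j)) 2 m f" using f by simp
      then show ?thesis using m by (intro null_space_2(1)[OF nn(1,2) sg]) auto
    next
      case False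
      then have "3 \<le> mode_l j" using j by (auto simp: mode_l_def)
      then show ?thesis using m by (intro positive_modes[OF nn(1,2) sg _ _ f]) auto
    qed
  qed auto
  moreover have "(\<Sum>j\<in>{..2}. NX j + NY j) \<le> 5 * nn + 2 * pp - 5"
  proof -
    have "real (\<Sum>j\<in>{..2}. NX j + NY j) = real (NX 0) + real (NY 0) + real (NX 1) + real (NY 1) + real (NX 2) + real (NY 2)"
      by (simp add: eval_nat_numeral)
    \<comment> \<open>Each of the six node counts exceeds its real value by at most 1.\<close>
    also have "\<dots> \<le> 635 / 100 * real nn + 6"
      using NX(2)[of 0] NY(2)[of 0] NX(2)[of 1] NY(2)[of 1] NX(2)[of 2] NY(2)[of 2] by (simp add: kX_def kY_def)
    also have "\<dots> \<le> 5 * real nn + 2 * real pp - 5" using pp_ratio(1) nn_large by linarith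
    finally have "real (\<Sum>j\<in>{..2}. NX j + NY j) + 5 \<le> real (5 * nn + 2 * pp)" by simp
    then show ?thesis by linarith
  qed
  ultimately show ?thesis unfolding surface_index_def by (meson enat_ord_simps(1) order_trans)
qed

lemma index_lower: "enat (3 * nn + 4 * pp - 3) \<le> surface_index ub GG"
proof -
  \<comment> \<open>Slightly below the same limiting frequencies; they add up to 6.14, above 3 + 4 *
    0.708 = 5.832.\<close>
  define kX where "kX j = (if j = 0 then 14 / 10 else 12 / 10 :: real)" for j :: nat
  define kY where "kY j = (if j = 0 then 98 / 100 else 68 / 100 :: real)" for j :: nat
  \<comment> \<open>Halved before rounding, since each frequency carries a cosine and a sine; each
    of the six counts then loses at most 2.\<close>
  define MX where "MX j = nat \<lfloor>kX j * real nn / 2\<rfloor>" for j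
  define MY where "MY j = nat \<lfloor>kY j * real nn / 2\<rfloor>" for j
  have k0: "kX j * real nn \<ge> 0" "kY j * real nn \<ge> 0" for j by (simp_all add: kX_def kY_def)
  have MX: "real (2 * MX j) \<le> kX j * real nn" "real (2 * MX j) \<ge> kX j * real nn - 2"
    and MY: "real (2 * MY j) \<le> kY j * real nn" "real (2 * MY j) \<ge> kY j * real nn - 2" for j
    using k0[of j] by (simp_all add: MX_def MY_def) linarith+
  have "\<exists>e m. (\<forall>i<2 * MX j + 2 * MY j. m i < 0 \<and> osol nn (sg (mode_l j)) (real (mode_l j)) (m i) (e i)) \<and>
    (\<forall>c. (\<forall>x. (\<Sum>i<2 * MX j + 2 * MY j. c i *\<^sub>R e i x) = 0) \<longrightarrow> (\<forall>i<2 * MX j + 2 * MY j. c i = 0))" if j: "j \<in> {..2}" for j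
  proof -
    define s :: nat where "s = (if even q then mode_l j else 0)"
    have jl: "j = 0 \<and> mode_l j = 0 \<or> j > 0 \<and> mode_l j = 1" using j by (auto simp: mode_l_def)
    have s: "s \<le> 1" "(-1) ^ s = sg (mode_l j)" using jl by (auto simp: s_def sg_def)
    have l: "0 \<le> real (mode_l j)" "real (mode_l j) \<le> 1" using jl by auto
    have "2 * (kX j)\<^sup>2 < 4 - (real (mode_l j))\<^sup>2 - 1 / 1000 - real (mode_l j) / 35"
      "2 * (kY j)\<^sup>2 < 2 - (real (mode_l j))\<^sup>2 - 1 / 1000 - real (mode_l j) / 35"
      using jl by (auto simp: kX_def kY_def power2_eq_square)
    note M = many_negative_modes[OF nn(1,2) s(1) l MX(1)[of j] this(1) MY(1)[of j] this(2), unfolded s(2)]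
    show ?thesis
    proof (rule M)
      fix e m
      assume "\<And>i. i < 2 * MX j + 2 * MY j \<Longrightarrow> osol nn (sg (mode_l j)) (real (mode_l j)) (m i) (e i)"
        "\<And>i. i < 2 * MX j + 2 * MY j \<Longrightarrow> m i < 0"
        and ind: "\<And>c i. (\<And>x. (\<Sum>i<2 * MX j + 2 * MY j. c i *\<^sub>R e i x) = 0) \<Longrightarrow> i < 2 * MX j + 2 * MY j \<Longrightarrow> c i = 0"
      moreover have "c i = 0" if "\<forall>x. (\<Sum>i<2 * MX j + 2 * MY j. c i *\<^sub>R e i x) = 0" "i < 2 * MX j + 2 * MY j" for c i
        by (rule ind[OF spec[OF that(1)] that(2)])
      ultimately show ?thesis by blast
    qed
  qed
  then have "\<forall>j\<in>{..2}. \<exists>e m. (\<forall>i<2 * MX j + 2 * MY j. m i < 0 \<and> osol nn (sg (mode_l j)) (real (mode_l j)) (m i) (e i)) \<and>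
    (\<forall>c. (\<forall>x. (\<Sum>i<2 * MX j + 2 * MY j. c i *\<^sub>R e i x) = 0) \<longrightarrow> (\<forall>i<2 * MX j + 2 * MY j. c i = 0))" by blast
  from bchoice[OF this] obtain e where "\<forall>j\<in>{..2}. \<exists>m. (\<forall>i<2 * MX j + 2 * MY j. m i < 0 \<and> osol nn (sg (mode_l j)) (real (mode_l j)) (m i) (e j i)) \<and>
    (\<forall>c. (\<forall>x. (\<Sum>i<2 * MX j + 2 * MY j. c i *\<^sub>R e j i x) = 0) \<longrightarrow> (\<forall>i<2 * MX j + 2 * MY j. c i = 0))" by blast
  from bchoice[OF this] obtain m where em: "\<And>j i. j \<in> {..2} \<Longrightarrow> i < 2 * MX j + 2 * MY j \<Longrightarrow> m j i < 0 \<and> osol nn (sg (mode_l j)) (real (mode_l j)) (m j i) (e j i)"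
    "\<And>j c i. j \<in> {..2} \<Longrightarrow> (\<And>x. (\<Sum>i<2 * MX j + 2 * MY j. c i *\<^sub>R e j i x) = 0) \<Longrightarrow> i < 2 * MX j + 2 * MY j \<Longrightarrow> c i = 0" by blast
  have "enat (\<Sum>j\<in>{..2}. 2 * MX j + 2 * MY j) \<le> eigenvalue_count ub GG {..<0}"
    by (rule count_ge[where e = e and m = m]) (use em in \<open>blast | simp\<close>)+
  moreover have "3 * nn + 4 * pp - 3 \<le> (\<Sum>j\<in>{..2}. 2 * MX j + 2 * MY j)"
  proof -
    have "real (\<Sum>j\<in>{..2}. 2 * MX j + 2 * MY j) = real (2 * MX 0) + real (2 * MY 0) + real (2 * MX 1) + real (2 * MY 1) + real (2 * MX 2) + real (2 * MY 2)"
      by (simp add: eval_nat_numeral)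
    moreover have "\<dots> \<ge> 614 / 100 * real nn - 12"
      using MX(2)[of 0] MY(2)[of 0] MX(2)[of 1] MY(2)[of 1] MX(2)[of 2] MY(2)[of 2] by (simp add: kX_def kY_def)
    moreover have "614 / 100 * real nn - 12 \<ge> 3 * real nn + 4 * real pp - 3" using pp_ratio(2) nn_large by linarith
    ultimately have "real (\<Sum>j\<in>{..2}. 2 * MX j + 2 * MY j) + 3 \<ge> real (3 * nn + 4 * pp)" by simp
    then show ?thesis by linarith
  qed
  ultimately show ?thesis unfolding surface_index_def by (meson enat_ord_simps(1) order_trans)
qed

end

text \<open>In units of pi, the bound of \<open>Xi_upper_bound\<close> lies below sqrt 2 / 2 by
  about amp^2 / (8 sqrt 2), which is nearly 9 / 1000000 at amp = 1 / 100. A smaller gap than 1 /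
  1000000 therefore excludes larger amplitudes.\<close>

lemma (in otsuki) amp_le_of_Xi:
  assumes "Xi b = r * pi" and "sqrt 2 / 2 - r < 1 / 1000000"
  shows "amp \<le> 1 / 100"
proof (rule ccontr)
  assume "\<not> amp \<le> 1 / 100"
  then have "amp\<^sup>2 \<ge> (1 / 100)\<^sup>2" by (intro power_mono) auto
  then have k: "1 + kap \<le> 19999 / 10000" by (simp add: kap(1) power2_eq_square)
  define s v where "s = sqrt (1 + kap)" and "v = 1 / (2 * s)"
  have "s \<le> 141418 / 100000" unfolding s_def by (rule real_le_lsqrt) (use k in \<open>simp_all add: power2_eq_square\<close>)
  moreover have "s > 0" using kap(2) by (simp add: s_def)
  ultimately have "v \<ge> 1 / (2 * (141418 / 100000))" unfolding v_def by (intro divide_left_mono) auto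
  then have v: "v \<ge> 353561 / 1000000" by simp
  have q: "sqrt 2 \<le> 1414214 / 1000000" by (rule real_le_lsqrt) (simp_all add: power2_eq_square)
  have "3 / (2 * sqrt 2) = 3 * sqrt 2 / 4" by (simp add: field_simps)
  then have "r * pi \<le> pi * (3 * sqrt 2 / 4 - v)" using Xi_upper_bound assms(1) by (simp only: s_def v_def)
  then have "r \<le> 3 * sqrt 2 / 4 - v" by (simp add: mult.commute)
  then show False using v q assms(2) by linarith
qed

text \<open>2 q^2 - 4 p^2 is a positive integer, hence at least 1. It is the product of a factor
  below 2 q / 1000000 and one at most 3 q, and 6 q^2 / 1000000 is less than 1 for q < 300.\<close>

lemma sqrt2_approximation:
  fixes p q :: nat
  assumes q: "q > 0" and r: "real p / real q < sqrt 2 / 2" "sqrt 2 / 2 - real p / real q < 1 / 1000000"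
  shows "q \<ge> 300"
proof (rule ccontr)
  assume "\<not> q \<ge> 300"
  then have q3: "real q < 300" by simp
  have q0: "real q > 0" using q by simp
  define x where "x = sqrt 2 * real q - 2 * real p"
  have x: "x > 0" using r(1) q0 by (simp add: x_def field_simps)
  have x2: "x < 2 * real q / 1000000" using r(2) q0 by (simp add: x_def field_simps)
  have prod: "x * (sqrt 2 * real q + 2 * real p) = 2 * (real q)\<^sup>2 - 4 * (real p)\<^sup>2"
    by (simp add: x_def algebra_simps power2_eq_square)
  have pos: "sqrt 2 * real q + 2 * real p > 0" using q0 by (simp add: add_pos_nonneg)
  have "2 * (real q)\<^sup>2 - 4 * (real p)\<^sup>2 > 0" unfolding prod[symmetric] by (rule mult_pos_pos[OF x pos])
  then have "real (2 * q\<^sup>2) > real (4 * p\<^sup>2)" by simp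
  then have "2 * q\<^sup>2 \<ge> 4 * p\<^sup>2 + 1" by linarith
  then have "real (2 * q\<^sup>2) \<ge> real (4 * p\<^sup>2 + 1)" by (simp only: of_nat_le_iff)
  then have "1 \<le> x * (sqrt 2 * real q + 2 * real p)" unfolding prod by simp
  also have "\<dots> \<le> x * (3 * real q)"
  proof -
    have "sqrt 2 \<le> 3 / 2" by (rule real_le_lsqrt) (simp_all add: power2_eq_square)
    then have "sqrt 2 * real q \<le> 3 / 2 * real q" by (intro mult_right_mono) auto
    then have "sqrt 2 * real q + 2 * real p \<le> 3 * real q" using x by (simp add: x_def)
    then show ?thesis using x by (intro mult_left_mono) auto
  qed
  also have "\<dots> \<le> (2 * real q / 1000000) * (3 * real q)" using x2 q0 by (intro mult_right_mono) auto
  also have "\<dots> \<le> (2 * 300 / 1000000) * (3 * 300)" using q3 q0 by (intro mult_mono) auto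
  also have "\<dots> < 1" by simp
  finally show False by simp
qed

theorem theorem1p1:
  shows "\<exists>\<epsilon>::real. \<epsilon> > 0 \<and>
    (\<forall>(p::nat) (q::nat) (b::real).
       p > 0 \<longrightarrow> q > 0 \<longrightarrow> coprime p q \<longrightarrow>
       1 / 2 < real p / real q \<longrightarrow> real p / real q < sqrt 2 / 2 \<longrightarrow>
       sqrt 2 / 2 - real p / real q < \<epsilon> \<longrightarrow>
       - pi / 2 < b \<longrightarrow> b < 0 \<longrightarrow> Xi b = (real p / real q) * pi \<longrightarrow>
       (let Ind = surface_index (otsuki_bipolar b) (otsuki_translations q b);
            Nul = surface_nullity (otsuki_bipolar b) (otsuki_translations q b)
        in (odd q \<longrightarrow> enat (6 * q + 8 * p - 3) \<le> Ind \<and> Ind \<le> enat (10 * q + 4 * p - 5)) \<and>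
           (even q \<longrightarrow> enat (3 * q + 4 * p - 3) \<le> Ind \<and> Ind \<le> enat (5 * q + 2 * p - 5)) \<and>
           9 \<le> Nul \<and> Nul \<le> 13))"
proof (intro exI[of _ "1 / 1000000"] conjI allI impI)
  fix p q :: nat and b :: real
  assume q: "q > 0" and cop: "coprime p q" and r: "real p / real q < sqrt 2 / 2" "sqrt 2 / 2 - real p / real q < 1 / 1000000"
    and b: "- pi / 2 < b" "b < 0" and Xi: "Xi b = (real p / real q) * pi"
  interpret O: otsuki b by (rule otsuki.intro) (rule b)+
  have "sqrt 2 \<ge> 1414 / 1000" by (rule real_le_rsqrt) (simp add: power2_eq_square)
  then have "7 / 10 \<le> real p / real q" using r(2) by linarith
  then have r1: "7 / 10 * real q \<le> real p" using q by (simp add: field_simps)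
  have r2: "real p < sqrt 2 / 2 * real q" using r(1) q by (simp add: field_simps)
  have "real q * O.th (pi / 2) = real p * pi" using Xi q unfolding O.Xi_eq by simp
  then interpret otsuki_small_torus b p q
    using O.amp_le_of_Xi[OF Xi r(2)] q cop r1 r2 sqrt2_approximation[OF q r] by unfold_locales
  show "let Ind = surface_index (otsuki_bipolar b) (otsuki_translations q b);
            Nul = surface_nullity (otsuki_bipolar b) (otsuki_translations q b)
        in (odd q \<longrightarrow> enat (6 * q + 8 * p - 3) \<le> Ind \<and> Ind \<le> enat (10 * q + 4 * p - 5)) \<and>
           (even q \<longrightarrow> enat (3 * q + 4 * p - 3) \<le> Ind \<and> Ind \<le> enat (5 * q + 2 * p - 5)) \<and>
           9 \<le> Nul \<and> Nul \<le> 13"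
    using index_lower index_upper nullity_lower nullity_upper
    by (auto simp: Let_def nn_def pp_def split: if_splits)
qed simp

end
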